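(* Let $k\ge0$ and $c>0$ be fixed, and for each $n$ let $X_n$ be a homogeneous and spatially independent random subcomplex of $\triangle_n$, with parameters $q_k,r_k$ (depending on $n$). If $n^{k+1}q_k\to\infty$ and $nr_k\sim c$ as $n\to\infty$, then for every $r\in[1,\infty)$, \[ \lim_{n\to\infty}\mathbb{E}\left[\left|\frac{\beta_k(X_n)}{n^{k+1}q_k}-\frac{h_k(c)}{(k+1)!}\right|^r\right]=0 . \]
   Context: $\triangle_n=2^{[n]}$ is the complete simplicial complex on $[n]=\{1,\dots,n\}$. A subcomplex of $\triangle_n$ is a family $Y\subset 2^{[n]}$ closed under taking subsets (so $\emptyset\in Y$); $S_n$ denotes the set of all subcomplexes. A random subcomplex of $\triangle_n$ is an $S_n$-valued random variable $X$. It is homogeneous if $X$ and $gX=\{g(\sigma):\sigma\in X\}$ have the same distribution for every permutation $g$ of $[n]$. It is spatially independent if for all $Y_1,Y_2\in S_n$, $\mathbb{P}(Y_1\cup Y_2\subset X)\,\mathbb{P}(Y_1\cap Y_2\subset X)=\mathbb{P}(Y_1\subset X)\,\mathbb{P}(Y_2\subset X)$. A $k$-simplex is a set of $k+1$ elements; $F_k(X)$ is the set of $k$-simplices of $X$, $f_k(X)=\#F_k(X)$, $\dim X$ is the largest dimension of a simplex of $X$. For a homogeneous $X$ and $k\ge-1$, $q_k=\mathbb{P}(\tau\in X)$ and $r_k=\mathbb{P}(\sigma\in X\mid \tau\in X)$ if $q_k>0$, $r_k=0$ otherwise, where $\tau\subset\sigma$ are any $k$- and $(k+1)$-simplices of $\triangle_n$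 (independent of the choice by homogeneity). For a finite simplicial complex $X$, $\beta_k(X)=\dim_{\mathbb{R}}H^k(X)$, real cohomology computed from the augmented cochain complex including $C^{-1}(X)=\mathbb{R}^{\{\emptyset\}}$ (reduced Betti numbers). For $d\in\mathbb{N}$, $c\ge0$, $t_{d,c}\in(0,1]$ is the smallest positive root of $t=\exp(-c(1-t)^d)$, and $h_k(c)=\max\{1-\frac{c}{k+2},\ t+ct(1-t)^{k+1}-\frac{c}{k+2}(1-(1-t)^{k+2})\}$ with $t=t_{k+1,c}$. Notation $a_n\sim b_n$ means $a_n/b_n\to1$. *)

theory Defs
  imports "HOL-Probability.Probability" "HOL-Library.Landau_Symbols" "HOL-Combinatorics.Permutations" "HOL-Library.Function_Algebras"
begin

definition subcomplex :: "nat \<Rightarrow> nat set set \<Rightarrow> bool" where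
  "subcomplex n Y \<longleftrightarrow> Y \<subseteq> Pow {1..n} \<and> {} \<in> Y \<and> (\<forall>\<sigma>\<in>Y. \<forall>\<tau>. \<tau> \<subseteq> \<sigma> \<longrightarrow> \<tau> \<in> Y)"

definition S :: "nat \<Rightarrow> nat set set set" where
  "S n = {Y. subcomplex n Y}"

definition random_subcomplex :: "nat \<Rightarrow> nat set set pmf \<Rightarrow> bool" where
  "random_subcomplex n X \<longleftrightarrow> set_pmf X \<subseteq> S n"

definition homogeneous :: "nat \<Rightarrow> nat set set pmf \<Rightarrow> bool" where
  "homogeneous n X \<longleftrightarrow> (\<forall>g. g permutes {1..n} \<longrightarrow> map_pmf (\<lambda>Z. (\<lambda>\<sigma>. g ` \<sigma>) ` Z) X = X)"

definition Pcont :: "nat set set pmf \<Rightarrow> nat set set \<Rightarrow> real" where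
  "Pcont X Y = measure_pmf.prob X {Z. Y \<subseteq> Z}"

definition spatially_independent :: "nat \<Rightarrow> nat set set pmf \<Rightarrow> bool" where
  "spatially_independent n X \<longleftrightarrow>
     (\<forall>Y1\<in>S n. \<forall>Y2\<in>S n. Pcont X (Y1 \<union> Y2) * Pcont X (Y1 \<inter> Y2) = Pcont X Y1 * Pcont X Y2)"

text \<open>q_k = P(tau \<in> X) for the k-simplex tau = {1..k+1}; r_k = P(sigma \<in> X | tau \<in> X)
  for the (k+1)-simplex sigma = {1..k+2} (0 if q_k = 0).  By homogeneity the choice
  of tau \<subseteq> sigma is irrelevant.\<close>
definition qk :: "nat \<Rightarrow> nat set set pmf \<Rightarrow> real" where
  "qk k X = measure_pmf.prob X {Z. {1..k+1} \<in> Z}"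

definition rk :: "nat \<Rightarrow> nat set set pmf \<Rightarrow> real" where
  "rk k X = (if qk k X > 0
     then measure_pmf.prob X {Z. {1..k+2} \<in> Z \<and> {1..k+1} \<in> Z} / qk k X else 0)"

text \<open>Real cochains of X supported on simplices with m vertices (i.e. of dimension m-1),
  viewed inside the real vector space of functions nat set \<Rightarrow> real.\<close>
definition cochains :: "nat \<Rightarrow> nat set set \<Rightarrow> (nat set \<Rightarrow> real) set" where
  "cochains m X = {f. \<forall>\<sigma>. f \<sigma> \<noteq> 0 \<longrightarrow> \<sigma> \<in> X \<and> finite \<sigma> \<and> card \<sigma> = m}"

text \<open>Coboundary from m-vertex cochains to (m+1)-vertex cochains, with the standard
  orientation induced by the order on vertices:
  (delta f)(sigma) = sum_i (-1)^i f(sigma minus its i-th vertex).\<close>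
definition coboundary :: "nat \<Rightarrow> nat set set \<Rightarrow> (nat set \<Rightarrow> real) \<Rightarrow> (nat set \<Rightarrow> real)" where
  "coboundary m X f = (\<lambda>\<sigma>. if \<sigma> \<in> X \<and> finite \<sigma> \<and> card \<sigma> = m + 1
      then (\<Sum>v\<in>\<sigma>. (-1) ^ card {u\<in>\<sigma>. u < v} * f (\<sigma> - {v})) else 0)"

abbreviation fscale :: "real \<Rightarrow> (nat set \<Rightarrow> real) \<Rightarrow> (nat set \<Rightarrow> real)" where
  "fscale r f \<equiv> (\<lambda>x. r * f x)"

text \<open>Reduced Betti number beta_k = dim H^k(X; R) of the augmented cochain complex
  (C^{-1} = R^{empty}): dim ker(delta_k) - dim im(delta_{k-1}).  Cochains of degree k live
  on simplices with k+1 vertices.\<close>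
definition betti :: "nat \<Rightarrow> nat set set \<Rightarrow> nat" where
  "betti k X = vector_space.dim fscale {f \<in> cochains (k+1) X. coboundary (k+1) X f = (\<lambda>_. 0)}
             - vector_space.dim fscale (coboundary k X ` cochains k X)"

definition tdc :: "nat \<Rightarrow> real \<Rightarrow> real" where
  "tdc d c = (LEAST t. t > 0 \<and> t = exp (- c * (1 - t) ^ d))"

definition hk :: "nat \<Rightarrow> real \<Rightarrow> real" where
  "hk k c = (let t = tdc (k+1) c in
     max (1 - c / real (k+2))
         (t + c * t * (1 - t) ^ (k+1) - c / real (k+2) * (1 - (1 - t) ^ (k+2))))"

end

theory Submission
  imports Defs
begin

text \<open>A homogeneous spatially independent complex is obtained by marking every simplex independently, with a
  probability depending on its dimension, and keeping the simplices all of whose faces are marked.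
  The dimension of the space of \<open>k\<close>-cocycles is the trace of the orthogonal projection to it, i.e. the sum
  over the \<open>k\<close>-faces of the squared norms of the projections of the unit vectors. In this regime the
  neighbourhood of a \<open>k\<close>-face looks like a Galton-Watson tree in which every face has Poisson(\<open>c\<close>) many
  further cofaces, each with \<open>k+1\<close> other faces. On such a tree the squared norm at the root obeys a recursion, and
  truncating at depth \<open>l\<close> with boundary value 1 or 0 gives upper and lower bounds that depend only on the
  truncated tree. The limiting mean is bounded above by the larger of the two values of the Bethe functional at \<open>1\<close> and
  \<open>t\<close>; the value at \<open>t\<close> is a lower bound by the recursion started from 0, and the value at \<open>1\<close> is one by the
  Euler characteristic. The Efron-Stein inequality yields concentration, the difference between the cocycle
  dimension and the Betti number is at most the number of \<open>(k-1)\<close>-faces, which is negligible, and moment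
  bounds on face counts upgrade convergence in \<open>L\<^sup>1\<close> to \<open>L\<^sup>r\<close>.\<close>

section \<open>The Bethe functional\<close>

text \<open>The obstacle is mass near zero. Values grown from boundary value 1 are always positive,
  so their probability of being positive carries no information. The Bethe functional is evaluated
  instead at \<open>p\<close>, the probability of exceeding a threshold \<theta>, and a pigeonhole
  over geometric scales finds a \<theta> with little mass just above it. The resulting
  \<open>p\<close> is uncontrolled, which does no harm because the functional is at most
  \<open>hk\<close> on all of [0,1]. From boundary value 0 the threshold is 0, and the probability
  of being positive follows an exact iteration that converges to \<open>tdc\<close>. The functional
  itself arises from the Palm formula for the Poisson cofaces together with the exchangeability of
  the \<open>k+2\<close> faces of one coface. For the occurrence of explorations a lower bound
  suffices: applied to 1 minus the value it yields the upper bound for the trace. The assumptions on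
  \<open>q_k\<close> and \<open>r_k\<close> force faces of smaller dimension to be far more numerous
  and the factor \<open>W k\<close>, the price of two further vertices being joined over a
  \<open>k\<close>-set, to vanish; this makes neighbourhoods tree-like.\<close>

definition Bethe :: "nat \<Rightarrow> real \<Rightarrow> real \<Rightarrow> real" where
  "Bethe k c p = exp (- c * (1 - p) ^ (k+1)) + c * p * (1 - p) ^ (k+1)
     - c / real (k+2) * (1 - (1 - p) ^ (k+2))"

text \<open>\<open>LEAST\<close> on the reals is meaningful only once a minimum is attained. The
  roots in [0,1] form a compact set containing 1, so a smallest one exists; it is positive because
  \<open>exp\<close> is, and roots above 1 cannot compete.\<close>

lemma tdc_props:
  assumes c: "c > 0"
  shows "0 < tdc (k+1) c" "tdc (k+1) c = exp (- c * (1 - tdc (k+1) c) ^ (k+1))"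
    "tdc (k+1) c \<le> 1" "\<And>s. 0 < s \<Longrightarrow> s = exp (- c * (1 - s) ^ (k+1)) \<Longrightarrow> tdc (k+1) c \<le> s"
proof -
  define f where "f = (\<lambda>t::real. exp (- c * (1 - t) ^ (k+1)))"
  let ?A = "{t. 0 \<le> t \<and> t \<le> 1 \<and> f t = t}"
  have fc: "continuous_on UNIV f" unfolding f_def by (intro continuous_intros)
  have "closed ?A"
    by (intro closed_Collect_conj closed_Collect_le closed_Collect_eq continuous_intros fc)
  moreover have "bounded ?A"
    by (rule bounded_subset[of "{0..1}"]) auto
  ultimately have cA: "compact ?A" by (simp add: compact_eq_bounded_closed)
  have "1 \<in> ?A" by (simp add: f_def)
  then have "?A \<noteq> {}" by (rule ex_in_conv[THEN iffD1, OF exI])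
  from compact_attains_inf[OF cA this] obtain t
    where t: "t \<in> ?A" "\<And>s. s \<in> ?A \<Longrightarrow> t \<le> s" by (elim bexE) auto
  have "f t > 0" by (simp add: f_def)
  with t(1) have tpos: "t > 0" by simp
  have least: "t \<le> s" if "s > 0 \<and> s = f s" for s
  proof (cases "s \<le> 1")
    case True
    have "f s = s" using that[THEN conjunct2] by (rule sym)
    moreover have "0 \<le> s" using that[THEN conjunct1] by linarith
    ultimately have "s \<in> ?A" using True by simp
    then show ?thesis by (rule t(2))
  next
    case False
    have "t \<le> 1" using t(1) by blast
    then show ?thesis using False by linarith
  qed
  have eq: "tdc (k+1) c = t" unfolding tdc_def f_def[symmetric]
  proof (rule Least_equality)
    show "0 < t \<and> t = exp (- c * (1 - t) ^ (k+1))" using t(1) tpos unfolding f_def mem_Collect_eq by metis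
    show "t \<le> s" if "0 < s \<and> s = exp (- c * (1 - s) ^ (k+1))" for s
      using that by (rule least[unfolded f_def])
  qed
  show "0 < tdc (k+1) c" "tdc (k+1) c \<le> 1" unfolding eq using t(1) tpos by auto
  show "tdc (k+1) c = exp (- c * (1 - tdc (k+1) c) ^ (k+1))"
    unfolding eq using t(1) unfolding f_def mem_Collect_eq by metis
  show "tdc (k+1) c \<le> s" if "0 < s" "s = exp (- c * (1 - s) ^ (k+1))" for s
    unfolding eq by (rule least[unfolded f_def]) (use that in \<open>rule conjI\<close>)
qed

lemma hk_Bethe:
  assumes "c > 0"
  shows "hk k c = max (Bethe k c 1) (Bethe k c (tdc (k+1) c))"
proof -
  define t where "t = tdc (k+1) c"
  have t: "exp (- c * (1 - t) ^ (k+1)) = t"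
    using tdc_props(2)[OF assms, of k] unfolding t_def[symmetric] by (rule sym)
  show ?thesis unfolding hk_def Let_def Bethe_def t_def[symmetric] t by simp
qed

text \<open>The factor \<open>exp (- c * (1 - p) ^ (k+1)) - p\<close> turns the fixed points of the
  recursion into critical points, so monotonicity of \<open>Bethe\<close> is a question about the
  sign of this difference.\<close>

lemma Bethe_deriv:
  "(Bethe k c has_real_derivative
     c * real (k+1) * (1 - p) ^ k * (exp (- c * (1 - p) ^ (k+1)) - p)) (at p)"
proof -
  have *: "(1-p)^(k+1) = (1-p)^k * (1-p)" by simp
  have **: "((\<lambda>p. exp (- c * (1 - p) ^ (k+1)) + c * p * (1 - p) ^ (k+1)
     - c / real (k+2) * (1 - (1 - p) ^ (k+2))) has_real_derivative
     exp (- c * (1 - p) ^ (k+1)) * (- c * (real (k+1) * (1-p)^k * (-1)))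
     + (c * (1-p)^(k+1) + c * p * (real (k+1) * (1-p)^k * (-1)))
     - c / real (k+2) * (- (real (k+2) * (1-p)^(k+1) * (-1)))) (at p)"
    by (rule derivative_eq_intros refl | simp)+
  have "c / real (k+2) * (- (real (k+2) * (1-p)^(k+1) * (-1))) = c * (1-p)^(k+1)"
    by (simp add: field_simps del: of_nat_add)
  with ** show ?thesis unfolding Bethe_def[abs_def]
    by (elim DERIV_cong) (simp add: algebra_simps)
qed

lemma Bethe_mono:
  assumes "c > 0" "a \<le> b" "b \<le> 1" "\<And>x. a < x \<Longrightarrow> x < b \<Longrightarrow> x \<le> exp (- c * (1 - x) ^ (k+1))"
  shows "Bethe k c a \<le> Bethe k c b"
proof (cases "a = b")
  case False
  then have ab: "a < b" using assms by simp
  obtain z where "z > a" "z < b" "Bethe k c b - Bethe k c a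
      = (b - a) * (c * real (k+1) * (1 - z) ^ k * (exp (- c * (1 - z) ^ (k+1)) - z))"
    using MVT2[OF ab Bethe_deriv, of k c] by blast
  moreover have "0 \<le> (b - a) * (c * real (k+1) * (1 - z) ^ k * (exp (- c * (1 - z) ^ (k+1)) - z))"
    if "z > a" "z < b"
    using assms ab that by (intro mult_nonneg_nonneg zero_le_power) auto
  ultimately show ?thesis by simp
qed simp

lemma Bethe_antimono:
  assumes "c > 0" "a \<le> b" "b \<le> 1" "\<And>x. a < x \<Longrightarrow> x < b \<Longrightarrow> x \<ge> exp (- c * (1 - x) ^ (k+1))"
  shows "Bethe k c a \<ge> Bethe k c b"
proof (cases "a = b")
  case False
  then have ab: "a < b" using assms by simp
  obtain z where z: "z > a" "z < b" "Bethe k c b - Bethe k c a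
      = (b - a) * (c * real (k+1) * (1 - z) ^ k * (exp (- c * (1 - z) ^ (k+1)) - z))"
    using MVT2[OF ab Bethe_deriv, of k c] by blast
  moreover have "0 \<le> (b - a) * (c * real (k+1) * (1 - z) ^ k * (z - exp (- c * (1 - z) ^ (k+1))))"
    using assms ab z by (intro mult_nonneg_nonneg zero_le_power) auto
  ultimately show ?thesis by (simp add: algebra_simps)
qed simp

text \<open>\<open>t < exp (- c (1-t)\<^sup>d)\<close> means \<open>- ln t / (1-t)\<^sup>d > c\<close>, and the left-hand side has
  at most one change of monotonicity because \<open>t - 1 - d t ln t\<close> is concave and vanishes at 1.\<close>
lemma exp_root_sign:
  fixes c :: real
  assumes c: "c > 0" and d: "d \<ge> 1" and t: "0 < t" "t = exp (- c * (1 - t) ^ d)"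
    and ab: "t < a" "a \<le> b" "b < 1" and a: "a < exp (- c * (1 - a) ^ d)"
  shows "b < exp (- c * (1 - b) ^ d)"
proof -
  define h where "h = (\<lambda>p::real. - ln p / (1 - p) ^ d)"
  \<comment> \<open>\<open>j\<close> is the numerator of the derivative of \<open>h\<close>; the
    denominator is positive on (0,1), so the sign of \<open>j\<close> decides where \<open>h\<close>
    is monotone.\<close>
  define j where "j = (\<lambda>p::real. p - 1 - real d * p * ln p)"
  have hc: "p < exp (- c * (1 - p) ^ d) \<longleftrightarrow> h p > c" if "0 < p" "p < 1" for p
  proof -
    have "p < exp (- c * (1 - p) ^ d) \<longleftrightarrow> ln p < - c * (1 - p) ^ d"
      using that by (metis exp_less_cancel_iff exp_ln)
    also have "\<dots> \<longleftrightarrow> h p > c" unfolding h_def using that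
      by (subst less_divide_eq) auto
    finally show ?thesis .
  qed
  have ht: "h t = c"
  proof -
    have "ln t = - c * (1 - t) ^ d" using t by (metis ln_exp)
    then show ?thesis unfolding h_def using ab by simp
  qed
  have hd: "(h has_real_derivative j p / (p * (1 - p) ^ (d+1))) (at p)" if "0 < p" "p < 1" for p
  proof -
    have "((\<lambda>p::real. - ln p / (1 - p) ^ d) has_real_derivative
        ((- (1/p)) * (1-p)^d - (- ln p) * (real d * (1-p)^(d-1) * (-1))) / ((1-p)^d * (1-p)^d)) (at p)"
      using that by (auto intro!: derivative_eq_intros simp: divide_simps)
    moreover have "((- (1/p)) * (1-p)^d - (- ln p) * (real d * (1-p)^(d-1) * (-1))) / ((1-p)^d * (1-p)^d)
       = j p / (p * (1 - p) ^ (d+1))"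
    proof -
      obtain e where e: "d = Suc e" using d by (cases d) auto
      have "(1 - p) ^ e > 0" using that by simp
      then show ?thesis using that unfolding j_def e
        by (simp add: divide_simps) (simp add: algebra_simps)
    qed
    ultimately show ?thesis unfolding h_def by simp
  qed
  have ja: "(j has_real_derivative 1 - real d * ln p - real d) (at p)" if "0 < p" for p
    unfolding j_def using that by (auto intro!: derivative_eq_intros simp: field_simps)
  have ha: "h a > c" using hc[of a] a ab t by auto
  \<comment> \<open>Since \<open>h\<close> rises from \<open>c\<close> at \<open>t\<close> to above
    \<open>c\<close> at \<open>a\<close>, its derivative, and hence \<open>j\<close>, is positive
    somewhere in between.\<close>
  have "\<exists>z. z > t \<and> z < a \<and> h a - h t = (a - t) * (j z / (z * (1 - z) ^ (d+1)))"
    using ab t by (intro MVT2 hd) auto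
  then obtain z where z: "z > t" "z < a" "h a - h t = (a - t) * (j z / (z * (1 - z) ^ (d+1)))"
    by blast
  have "(a - t) * (j z / (z * (1 - z) ^ (d+1))) > 0" using z(3) ha ht by simp
  moreover have Q: "z * (1 - z) ^ (d+1) > 0" using z ab t by simp
  moreover have "a - t > 0" using ab by simp
  ultimately have "j z / (z * (1 - z) ^ (d+1)) > 0" by (metis zero_less_mult_pos)
  then have jz: "j z > 0" using Q by (metis zero_less_divide_iff less_asym)
  \<comment> \<open>A negative value beyond \<open>z\<close> would make the slope of
    \<open>j\<close> negative before it, because \<open>j z > 0\<close>, and positive after it,
    because \<open>j 1 = 0\<close>; but this slope decreases.\<close>
  have jpos: "j p \<ge> 0" if p: "z < p" "p < 1" for p
  proof (rule ccontr)
    assume neg: "\<not> j p \<ge> 0"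
    have "\<exists>x. x > z \<and> x < p \<and> j p - j z = (p - z) * (1 - real d * ln x - real d)"
      using p z t by (intro MVT2 ja) auto
    then obtain x where x: "x > z" "x < p" "j p - j z = (p - z) * (1 - real d * ln x - real d)" by blast
    have "\<exists>y. y > p \<and> y < 1 \<and> j 1 - j p = (1 - p) * (1 - real d * ln y - real d)"
      using p z t by (intro MVT2 ja) auto
    then obtain y where y: "y > p" "y < 1" "j 1 - j p = (1 - p) * (1 - real d * ln y - real d)" by blast
    have "j 1 = 0" by (simp add: j_def)
    have "(p - z) * (1 - real d * ln x - real d) < 0" using x(3) jz neg by linarith
    then have "1 - real d * ln x - real d < 0" using p by (simp add: mult_less_0_iff)
    moreover have "(1 - p) * (1 - real d * ln y - real d) > 0" using y(3) neg \<open>j 1 = 0\<close> by linarith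
    then have "1 - real d * ln y - real d > 0" using p by (simp add: zero_less_mult_iff)
    moreover have "ln x \<le> ln y" using x y z t by simp
    then have "real d * ln x \<le> real d * ln y" by (simp add: mult_left_mono)
    ultimately show False by linarith
  qed
  have "h a \<le> h b"
  proof (cases "a = b")
    case False
    have "\<exists>x. x > a \<and> x < b \<and> h b - h a = (b - a) * (j x / (x * (1 - x) ^ (d+1)))"
      using ab t False by (intro MVT2 hd) auto
    then obtain x where x: "x > a" "x < b" "h b - h a = (b - a) * (j x / (x * (1 - x) ^ (d+1)))" by blast
    have "(b - a) * (j x / (x * (1 - x) ^ (d+1))) \<ge> 0"
      using x ab z t jpos[of x] by (intro mult_nonneg_nonneg divide_nonneg_nonneg zero_le_power) auto
    then show ?thesis using x by linarith
  qed simp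
  then show ?thesis using hc[of b] ha ab t by auto
qed

text \<open>Below \<open>t\<close> one has \<open>x \<le> exp (- c * (1 - x) ^ (k+1))\<close>, since
  a violation would give a smaller root by the intermediate value theorem; so \<open>Bethe\<close>
  increases up to \<open>t\<close>. Beyond \<open>t\<close> either the reverse inequality holds up
  to \<open>p\<close>, and \<open>Bethe\<close> has decreased since \<open>t\<close>, or the strict
  inequality holds at some \<open>a\<close>, persists up to 1 by \<open>exp_root_sign\<close>, and
  \<open>Bethe\<close> increases from \<open>p\<close> to 1.\<close>

lemma Bethe_le_hk:
  assumes c: "c > 0" and p: "0 \<le> p" "p \<le> 1"
  shows "Bethe k c p \<le> hk k c"
proof -
  define t where "t = tdc (k+1) c"
  note T = tdc_props[OF c, where k=k, folded t_def]
  have below: "x \<le> exp (- c * (1 - x) ^ (k+1))" if "0 \<le> x" "x < t" for x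
  proof (rule ccontr)
    assume neg: "\<not> ?thesis"
    have "\<exists>s. 0 \<le> s \<and> s \<le> x \<and> s - exp (- c * (1 - s) ^ (k+1)) = 0"
    proof (rule IVT')
      show "continuous_on {0..x} (\<lambda>s. s - exp (- c * (1 - s) ^ (k+1)))"
        by (intro continuous_intros)
    qed (use neg that in simp_all)
    then obtain s where s: "0 \<le> s" "s \<le> x" "s - exp (- c * (1 - s) ^ (k+1)) = 0" by metis
    have s3: "s = exp (- c * (1 - s) ^ (k+1))" using s(3) by linarith
    have "s > 0" by (subst s3) (rule exp_gt_zero)
    from T(4)[OF this s3] show False using s(2) that by linarith
  qed
  show ?thesis
  proof (cases "p \<le> t")
    case True
    have "Bethe k c p \<le> Bethe k c t"
      using below p True T by (intro Bethe_mono c) auto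
    then show ?thesis by (simp add: hk_Bethe[OF c] t_def)
  next
    case pt: False
    show ?thesis
    proof (cases "\<exists>a. t < a \<and> a \<le> p \<and> a < 1 \<and> a < exp (- c * (1 - a) ^ (k+1))")
      case True
      then obtain a where a: "t < a" "a \<le> p" "a < 1" "a < exp (- c * (1 - a) ^ (k+1))" by blast
      have "Bethe k c p \<le> Bethe k c 1"
      proof (rule Bethe_mono[OF c p(2)])
        fix x assume x: "p < x" "x < 1"
        show "x \<le> exp (- c * (1 - x) ^ (k+1))"
          using exp_root_sign[OF c _ T(1) T(2) a(1) _ x(2) a(4)] a x by simp
      qed simp
      then show ?thesis by (simp add: hk_Bethe[OF c])
    next
      case False
      have "Bethe k c p \<le> Bethe k c t"
      proof (intro Bethe_antimono c)
        fix x assume x: "t < x" "x < p"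
        then have "x < 1" using p by simp
        then show "exp (- c * (1 - x) ^ (k+1)) \<le> x" using False x by (meson less_imp_le not_le)
      qed (use pt p in auto)
      then show ?thesis by (simp add: hk_Bethe[OF c] t_def)
    qed
  qed
qed

text \<open>The map is increasing and \<open>P\<close> starts below the least root \<open>t\<close>,
  so \<open>P\<close> increases and stays below \<open>t\<close>; its limit is a positive root and
  therefore \<open>t\<close> itself. In the application \<open>P l\<close> is the probability that
  the value with boundary 0 at depth \<open>l\<close> is positive.\<close>

lemma iterate_tendsto_tdc:
  assumes c: "c > 0" and P: "P 0 = 0" "\<And>l. P (Suc l) = exp (- c * (1 - P l) ^ (k+1))"
  shows "P \<longlonglongrightarrow> tdc (k+1) c" "incseq P" "\<And>l. 0 \<le> P l \<and> P l \<le> 1"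
proof -
  define t where "t = tdc (k+1) c"
  note T = tdc_props[OF c, where k=k, folded t_def]
  have mono: "exp (- c * (1 - x) ^ (k+1)) \<le> exp (- c * (1 - y) ^ (k+1))" if "x \<le> y" "y \<le> 1" for x y
    using that c by (auto intro!: mult_left_mono power_mono simp del: power_Suc)
  have b: "0 \<le> P l \<and> P l \<le> t" for l
  proof (induction l)
    case (Suc l)
    have "P (Suc l) \<le> exp (- c * (1 - t) ^ (k+1))"
      unfolding P by (rule mono) (use Suc T(3) in auto)
    then show ?case using T(2) P(2)[of l] by (metis exp_ge_zero)
  qed (use T P in auto)
  show b2: "0 \<le> P l \<and> P l \<le> 1" for l using b[of l] T(3) by linarith
  have "P l \<le> P (Suc l)" for l
  proof (induction l)
    case (Suc l)
    then show ?case using mono[of "P l" "P (Suc l)"] b2[of "Suc l"] by (simp only: P(2)) 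
  qed (simp add: P)
  then show inc: "incseq P" by (rule incseq_SucI)
  obtain L where L: "P \<longlonglongrightarrow> L" "\<forall>l. P l \<le> L"
    using incseq_convergent[OF inc, of t] b by blast
  have "(\<lambda>l. P (Suc l)) \<longlonglongrightarrow> exp (- c * (1 - L) ^ (k+1))"
    unfolding P by (intro tendsto_intros L)
  moreover have "(\<lambda>l. P (Suc l)) \<longlonglongrightarrow> L" using L(1) by (rule LIMSEQ_Suc)
  ultimately have eq: "L = exp (- c * (1 - L) ^ (k+1))" using LIMSEQ_unique by blast
  have "L > 0" by (subst eq) simp
  then have "t \<le> L" using T(4) eq by blast
  moreover have "L \<le> t" using L(1) b by (intro LIMSEQ_le_const2) auto
  ultimately show "P \<longlonglongrightarrow> tdc (k+1) c" using L(1) by (simp add: t_def)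
qed

section \<open>Expectations of discrete distributions\<close>

abbreviation Ep :: "'a pmf \<Rightarrow> ('a \<Rightarrow> real) \<Rightarrow> real" where
  "Ep p f \<equiv> measure_pmf.expectation p f"

lemma integrable_pmf_bounded:
  fixes f :: "'a \<Rightarrow> real"
  assumes "\<And>x. x \<in> set_pmf p \<Longrightarrow> \<bar>f x\<bar> \<le> B"
  shows "integrable (measure_pmf p) f"
  by (rule measure_pmf.integrable_const_bound[where B=B]) (use assms in \<open>auto simp: AE_measure_pmf_iff\<close>)

lemma Ep_cong: "(\<And>x. x \<in> set_pmf p \<Longrightarrow> f x = g x) \<Longrightarrow> Ep p f = Ep p g"
  by (rule integral_cong_AE) (auto simp: AE_measure_pmf_iff)

lemma Ep_mono:
  fixes f g :: "'a \<Rightarrow> real"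
  assumes "\<And>x. x \<in> set_pmf p \<Longrightarrow> \<bar>f x\<bar> \<le> B" "\<And>x. x \<in> set_pmf p \<Longrightarrow> \<bar>g x\<bar> \<le> C"
    "\<And>x. x \<in> set_pmf p \<Longrightarrow> f x \<le> g x"
  shows "Ep p f \<le> Ep p g"
  by (rule integral_mono_AE)
     (use assms in \<open>auto simp: AE_measure_pmf_iff intro!: integrable_pmf_bounded\<close>)

lemma Ep_bounds:
  fixes f :: "'a \<Rightarrow> real"
  assumes "\<And>x. x \<in> set_pmf p \<Longrightarrow> a \<le> f x \<and> f x \<le> b"
  shows "a \<le> Ep p f" "Ep p f \<le> b"
proof -
  have b: "\<bar>f x\<bar> \<le> max \<bar>a\<bar> \<bar>b\<bar>" if "x \<in> set_pmf p" for x using assms[OF that] by (auto simp: max_def abs_if)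
  have "Ep p (\<lambda>_. a) \<le> Ep p f" by (rule Ep_mono[OF _ b]) (use assms in auto)
  then show "a \<le> Ep p f" by simp
  have "Ep p f \<le> Ep p (\<lambda>_. b)" by (rule Ep_mono[OF b]) (use assms in auto)
  then show "Ep p f \<le> b" by simp
qed

lemma Ep_bind:
  fixes f :: "'b \<Rightarrow> real"
  assumes "\<And>x. x \<in> set_pmf (bind_pmf p q) \<Longrightarrow> \<bar>f x\<bar> \<le> B"
  shows "Ep (bind_pmf p q) f = Ep p (\<lambda>x. Ep (q x) f)"
proof -
  \<comment> \<open>The integral over a bind is available for functions bounded everywhere, whereas
    \<open>f\<close> is bounded on the support only; hence the cut-off.\<close>
  define g where "g x = (if x \<in> set_pmf (bind_pmf p q) then f x else 0)" for x
  have B: "\<bar>g x\<bar> \<le> \<bar>B\<bar>" for x unfolding g_def using assms by force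
  have "Ep (bind_pmf p q) g = Ep p (\<lambda>x. Ep (q x) g)"
    unfolding measure_pmf_bind
    by (subst integral_bind[where K="count_space UNIV" and B'=1 and B="\<bar>B\<bar>"])
       (auto simp: B space_subprob_algebra subprob_space_measure_pmf measure_pmf_in_subprob_algebra
          measure_pmf.emeasure_space_1 measure_pmf.finite_measure_axioms)
  moreover have "Ep (bind_pmf p q) g = Ep (bind_pmf p q) f" by (rule Ep_cong) (simp add: g_def)
  moreover have "Ep p (\<lambda>x. Ep (q x) g) = Ep p (\<lambda>x. Ep (q x) f)"
    by (intro Ep_cong) (auto simp: g_def)
  ultimately show ?thesis by simp
qed

lemma Ep_pair:
  fixes f :: "'a \<times> 'b \<Rightarrow> real"
  assumes "\<And>x. x \<in> set_pmf (pair_pmf p q) \<Longrightarrow> \<bar>f x\<bar> \<le> B"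
  shows "Ep (pair_pmf p q) f = Ep p (\<lambda>x. Ep q (\<lambda>y. f (x, y)))"
  using assms unfolding pair_pmf_def
  by (subst Ep_bind) (auto simp: map_pmf_def[symmetric] Ep_bind)

lemma Ep_nat_sums:
  fixes f :: "nat \<Rightarrow> real"
  assumes "\<And>x. \<bar>f x\<bar> \<le> B"
  shows "(\<lambda>m. pmf p m * f m) sums Ep p f"
proof -
  have "integrable (measure_pmf p) f" by (rule integrable_pmf_bounded) (rule assms)
  then have "integrable (count_space UNIV) (\<lambda>m. pmf p m * f m)"
    by (simp add: measure_pmf_eq_density integrable_density)
  then have "(\<lambda>m. pmf p m * f m) sums (\<integral>m. pmf p m * f m \<partial>count_space UNIV)"
    by (rule sums_integral_count_space_nat)
  then show ?thesis by (simp add: measure_pmf_eq_density integral_density)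
qed

section \<open>Lists of independent samples and their exchangeability\<close>

lemma map_replicate_pmf: "replicate_pmf n (map_pmf f p) = map_pmf (map f) (replicate_pmf n p)"
  by (induction n) (auto simp: map_pmf_def bind_assoc_pmf bind_return_pmf)

lemma replicate_pmf_Suc_pair:
  "replicate_pmf (Suc m) Q = map_pmf (\<lambda>(as, a). a # as) (pair_pmf (replicate_pmf m Q) Q)"
  by (subst pair_commute_pmf)
     (simp add: pair_pmf_def map_pmf_def bind_assoc_pmf bind_return_pmf)

lemma set_replicate_pmfD: "as \<in> set_pmf (replicate_pmf n Q) \<Longrightarrow> length as = n \<and> set as \<subseteq> set_pmf Q"
  by (auto simp: set_replicate_pmf)

lemma Ep_replicate_Suc:
  fixes F :: "'a list \<Rightarrow> real"
  assumes "\<And>as. as \<in> set_pmf (replicate_pmf (Suc m) Q) \<Longrightarrow> \<bar>F as\<bar> \<le> B"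
  shows "Ep (replicate_pmf (Suc m) Q) F = Ep (replicate_pmf m Q) (\<lambda>as. Ep Q (\<lambda>a. F (a # as)))"
proof -
  have "Ep (replicate_pmf (Suc m) Q) F = Ep (pair_pmf (replicate_pmf m Q) Q) (\<lambda>(as, a). F (a # as))"
    by (simp add: replicate_pmf_Suc_pair case_prod_beta' del: replicate_pmf.simps)
  also have "\<dots> = Ep (replicate_pmf m Q) (\<lambda>as. Ep Q (\<lambda>a. F (a # as)))"
    by (subst Ep_pair[where B=B])
       (auto intro!: assms simp: set_replicate_pmf simp del: replicate_pmf.simps)
  finally show ?thesis .
qed

text \<open>Independent samples are exchangeable; rotations are enough here because they already
  bring any chosen entry to the front.\<close>

lemma rotate_replicate_pmf: "map_pmf (rotate i) (replicate_pmf m Q) = replicate_pmf m Q"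
proof -
  have 1: "map_pmf rotate1 (replicate_pmf m Q) = replicate_pmf m Q"
  proof (cases m)
    case (Suc n)
    have a: "replicate_pmf (Suc n) Q
        = bind_pmf (replicate_pmf n Q) (\<lambda>xs. bind_pmf Q (\<lambda>x. return_pmf (xs @ [x])))"
      using replicate_pmf_distrib[of n 1 Q]
      by (simp add: bind_assoc_pmf bind_return_pmf del: replicate_pmf.simps(2) add: replicate_pmf_1)
         (simp add: map_pmf_def bind_assoc_pmf bind_return_pmf)
    have "map_pmf rotate1 (replicate_pmf (Suc n) Q)
        = bind_pmf Q (\<lambda>x. bind_pmf (replicate_pmf n Q) (\<lambda>xs. return_pmf (xs @ [x])))"
      by (simp add: map_pmf_def bind_assoc_pmf bind_return_pmf)
    also have "\<dots> = replicate_pmf (Suc n) Q" unfolding a by (rule bind_commute_pmf)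
    finally show ?thesis unfolding Suc .
  qed simp
  show ?thesis
  proof (induction i)
    case (Suc i)
    have "map_pmf (rotate (Suc i)) (replicate_pmf m Q) = map_pmf (rotate1 \<circ> rotate i) (replicate_pmf m Q)"
      by (simp add: rotate_def)
    also have "\<dots> = replicate_pmf m Q" unfolding pmf.map_comp[symmetric] Suc 1 ..
    finally show ?case .
  qed (simp add: rotate_def pmf.map_id0 flip: id_def)
qed

text \<open>By rotation invariance every entry contributes as much as the first one, which is then
  split off. This is the counterpart of the Palm formula for a fixed number of samples.\<close>

lemma Ep_replicate_sum:
  fixes F :: "'a \<Rightarrow> real" and G :: "'a list \<Rightarrow> real"
  assumes G: "\<And>i as. G (rotate i as) = G as"
    and B: "\<And>a as. as \<in> set_pmf (replicate_pmf (Suc m) Q) \<Longrightarrow> a \<in> set as \<Longrightarrow> \<bar>F a * G as\<bar> \<le> B"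
  shows "Ep (replicate_pmf (Suc m) Q) (\<lambda>as. (\<Sum>a\<leftarrow>as. F a) * G as)
     = real (Suc m) * Ep (replicate_pmf m Q) (\<lambda>as. Ep Q (\<lambda>a. F a * G (a # as)))"
proof -
  let ?R = "replicate_pmf (Suc m) Q"
  have bd: "\<bar>F (as ! i) * G as\<bar> \<le> B" if "as \<in> set_pmf ?R" "i < Suc m" for i as
    using that by (intro B) (auto simp: set_replicate_pmf simp del: replicate_pmf.simps)
  have "Ep ?R (\<lambda>as. (\<Sum>a\<leftarrow>as. F a) * G as) = Ep ?R (\<lambda>as. \<Sum>i<Suc m. F (as ! i) * G as)"
    by (rule Ep_cong) (auto simp: set_replicate_pmf sum_list_sum_nth sum_distrib_right atLeast0LessThan
        simp del: replicate_pmf.simps sum.lessThan_Suc)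
  also have "\<dots> = (\<Sum>i<Suc m. Ep ?R (\<lambda>as. F (as ! i) * G as))"
    by (rule Bochner_Integration.integral_sum) (rule integrable_pmf_bounded, rule bd, auto)
  also have "\<dots> = (\<Sum>i<Suc m. Ep ?R (\<lambda>as. F (as ! 0) * G as))"
  proof (rule sum.cong[OF refl])
    fix i assume i: "i \<in> {..<Suc m}"
    have "Ep ?R (\<lambda>as. F (as ! 0) * G as) = Ep (map_pmf (rotate i) ?R) (\<lambda>as. F (as ! 0) * G as)"
      by (simp only: rotate_replicate_pmf)
    also have "\<dots> = Ep ?R (\<lambda>as. F (as ! i) * G as)"
      unfolding integral_map_pmf
      by (rule Ep_cong) (use i in \<open>auto simp: set_replicate_pmf nth_rotate G simp del: replicate_pmf.simps\<close>)
    finally show "Ep ?R (\<lambda>as. F (as ! i) * G as) = Ep ?R (\<lambda>as. F (as ! 0) * G as)" by simp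
  qed
  also have "\<dots> = real (Suc m) * Ep ?R (\<lambda>as. F (as ! 0) * G as)" by simp
  also have "Ep ?R (\<lambda>as. F (as ! 0) * G as) = Ep (replicate_pmf m Q) (\<lambda>as. Ep Q (\<lambda>a. F a * G (a # as)))"
    by (subst Ep_replicate_Suc[where B=B]) (use bd in auto)
  finally show ?thesis .
qed

lemma Ep_replicate_prod:
  fixes f :: "'a \<Rightarrow> real"
  assumes f: "\<And>a. a \<in> set_pmf Q \<Longrightarrow> 0 \<le> f a \<and> f a \<le> 1"
  shows "Ep (replicate_pmf m Q) (\<lambda>as. \<Prod>a\<leftarrow>as. f a) = (Ep Q f) ^ m"
proof (induction m)
  case (Suc m)
  have b: "0 \<le> (\<Prod>a\<leftarrow>as. f a) \<and> (\<Prod>a\<leftarrow>as. f a) \<le> 1" if "set as \<subseteq> set_pmf Q" for as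
    using that f by (induction as) (auto intro!: mult_le_one)
  show ?case
  proof (subst Ep_replicate_Suc[where B=1])
    show "\<bar>\<Prod>a\<leftarrow>as. f a\<bar> \<le> 1" if "as \<in> set_pmf (replicate_pmf (Suc m) Q)" for as
      using b[of as] set_replicate_pmfD[OF that] by auto
  qed (use Suc in auto)
qed simp

lemma sum_list_rotate: "sum_list (rotate i xs) = (sum_list xs :: real)"
proof -
  have "sum_list (rotate i xs) = sum_list (drop (i mod length xs) xs) + sum_list (take (i mod length xs) xs)"
    by (simp add: rotate_drop_take)
  also have "\<dots> = sum_list xs"
    by (metis add.commute append_take_drop_id sum_list_append)
  finally show ?thesis .
qed

text \<open>The effect of the cofaces of a face on the squared norm of the projection of its unit vector to the
  cocycles: \<open>Ss\<close> lists, for each coface, the sum of the values at its other faces.\<close>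
definition comb :: "real list \<Rightarrow> real" where
  "comb Ss = (if 0 \<in> set Ss then 0 else 1 / (1 + (\<Sum>s\<leftarrow>Ss. 1 / s)))"

section \<open>Poisson many independent children\<close>

definition forest :: "real \<Rightarrow> 'a pmf \<Rightarrow> 'a list pmf" where
  "forest c Q = bind_pmf (poisson_pmf c) (\<lambda>m. replicate_pmf m Q)"

lemma forest_set: "as \<in> set_pmf (forest c Q) \<Longrightarrow> set as \<subseteq> set_pmf Q"
  by (auto simp: forest_def set_replicate_pmf)

lemma forest_sums:
  fixes F :: "'a list \<Rightarrow> real"
  assumes c: "c > 0" and F: "\<And>as. set as \<subseteq> set_pmf Q \<Longrightarrow> \<bar>F as\<bar> \<le> B"
  shows "(\<lambda>m. (c ^ m / fact m * exp (- c)) * Ep (replicate_pmf m Q) F) sums Ep (forest c Q) F"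
proof -
  have "\<bar>Ep (replicate_pmf m Q) F\<bar> \<le> B" for m
  proof -
    have "- B \<le> F as \<and> F as \<le> B" if "as \<in> set_pmf (replicate_pmf m Q)" for as
      using F[of as] set_replicate_pmfD[OF that] by (auto simp: abs_le_iff)
    from Ep_bounds[of "replicate_pmf m Q" "-B" F B, OF this] show ?thesis by (auto simp: abs_le_iff)
  qed
  from Ep_nat_sums[OF this, of "poisson_pmf c"] show ?thesis
    using c unfolding forest_def
    by (subst Ep_bind[where B=B]) (auto simp: set_replicate_pmf intro!: F)
qed

text \<open>Generating functional of a Poisson process: conditioning on the number of points leaves
  the exponential series in \<open>c * Ep Q f\<close>.\<close>

lemma forest_prod:
  fixes f :: "'a \<Rightarrow> real"
  assumes c: "c > 0" and f: "\<And>a. a \<in> set_pmf Q \<Longrightarrow> 0 \<le> f a \<and> f a \<le> 1"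
  shows "Ep (forest c Q) (\<lambda>as. \<Prod>a\<leftarrow>as. f a) = exp (- c * (1 - Ep Q f))"
proof -
  have b: "0 \<le> (\<Prod>a\<leftarrow>as. f a) \<and> (\<Prod>a\<leftarrow>as. f a) \<le> 1" if "set as \<subseteq> set_pmf Q" for as
    using that f by (induction as) (auto intro!: mult_le_one)
  have "(\<lambda>m. (c ^ m / fact m * exp (- c)) * Ep (replicate_pmf m Q) (\<lambda>as. \<Prod>a\<leftarrow>as. f a)) sums
      Ep (forest c Q) (\<lambda>as. \<Prod>a\<leftarrow>as. f a)"
    by (rule forest_sums[OF c, where B=1]) (use b in auto)
  also have "(\<lambda>m. (c ^ m / fact m * exp (- c)) * Ep (replicate_pmf m Q) (\<lambda>as. \<Prod>a\<leftarrow>as. f a))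
      = (\<lambda>m. ((c * Ep Q f) ^ m /\<^sub>R fact m) * exp (- c))"
    by (subst Ep_replicate_prod) (use f in \<open>auto simp: power_mult_distrib divide_inverse\<close>)
  finally have "(\<lambda>m. ((c * Ep Q f) ^ m /\<^sub>R fact m) * exp (- c)) sums Ep (forest c Q) (\<lambda>as. \<Prod>a\<leftarrow>as. f a)" .
  moreover have "(\<lambda>m. ((c * Ep Q f) ^ m /\<^sub>R fact m) * exp (- c)) sums (exp (c * Ep Q f) * exp (- c))"
    by (intro sums_mult2 exp_converges)
  ultimately have "Ep (forest c Q) (\<lambda>as. \<Prod>a\<leftarrow>as. f a) = exp (c * Ep Q f) * exp (- c)"
    using sums_unique2 by blast
  also have "\<dots> = exp (- c * (1 - Ep Q f))" by (simp add: exp_add[symmetric] algebra_simps)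
  finally show ?thesis .
qed

text \<open>Conditioning on one of the Poisson many children (the Palm formula) leaves the law of the
  remaining ones unchanged.\<close>
lemma forest_palm:
  fixes s :: "'a \<Rightarrow> real"
  assumes c: "c > 0" and s: "\<And>a. a \<in> set_pmf Q \<Longrightarrow> g a \<Longrightarrow> 0 < s a"
  defines "x \<equiv> \<lambda>as. 1 / (1 + (\<Sum>a\<leftarrow>as. 1 / s a))"
  defines "G \<equiv> \<lambda>as. of_bool (\<forall>a\<in>set as. g a)"
  shows "Ep (forest c Q) (\<lambda>as. G as * x as)
    = Ep (forest c Q) G - c * Ep (pair_pmf (forest c Q) Q) (\<lambda>(as, a). G (a # as) * (x as / (x as + s a)))"
proof -
  \<comment> \<open>With \<open>x = 1 / (1 + y)\<close>, where \<open>y\<close> is the sum of all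
    \<open>1 / s a\<close>, one has \<open>1 - x = y * x\<close>. So \<open>h\<close> is a sum over
    the children, to which exchangeability applies.\<close>
  define h where "h = (\<lambda>as. G as * (1 - x as))"
  define u where "u = (\<lambda>(as, a). G (a # as) * (x as / (x as + s a)))"
  have sum0: "(\<Sum>a\<leftarrow>as. 1 / s a) \<ge> 0" if "set as \<subseteq> set_pmf Q" "\<forall>a\<in>set as. g a" for as
    using that s by (intro sum_list_nonneg) (auto intro!: less_imp_le)
  have x01: "0 < x as \<and> x as \<le> 1" if "set as \<subseteq> set_pmf Q" "\<forall>a\<in>set as. g a" for as
    using sum0[OF that] by (simp add: x_def)
  have hb: "\<bar>h as\<bar> \<le> 1" if "set as \<subseteq> set_pmf Q" for as
    using x01[OF that] by (auto simp: h_def G_def)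
  have Gxb: "\<bar>G as * x as\<bar> \<le> 1" if "set as \<subseteq> set_pmf Q" for as
    using x01[OF that] by (auto simp: G_def)
  have ub: "\<bar>u (as, a)\<bar> \<le> 1" if "set as \<subseteq> set_pmf Q" "a \<in> set_pmf Q" for as a
    using x01[OF that(1)] s[OF that(2)] by (auto simp: u_def G_def)
  \<comment> \<open>Adding a child replaces \<open>1 / x\<close> by \<open>1 / x + 1 / s a\<close>;
    the new value divided by \<open>s a\<close> is therefore \<open>x / (x + s a)\<close>.\<close>
  have ux: "G (a # as) * x (a # as) / s a = u (as, a)" if "set as \<subseteq> set_pmf Q" "a \<in> set_pmf Q" for as a
  proof (cases "\<forall>a'\<in>set (a # as). g a'")
    case True
    define y where "y = (\<Sum>a\<leftarrow>as. 1 / s a)"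
    have "y \<ge> 0" "s a > 0" using sum0[OF that(1)] s[OF that(2)] True by (auto simp: y_def)
    then have "(1 / (1 + (1 / s a + y))) / s a = (1 / (1 + y)) / (1 / (1 + y) + s a)"
      by (simp add: divide_simps add_pos_nonneg) (simp add: algebra_simps)
    then show ?thesis using True by (simp add: u_def x_def G_def y_def)
  qed (auto simp: u_def G_def)
  have step: "Ep (replicate_pmf (Suc m) Q) h = real (Suc m) * Ep (replicate_pmf m Q) (\<lambda>as. Ep Q (\<lambda>a. u (as, a)))" for m
  proof -
    have "Ep (replicate_pmf (Suc m) Q) h = Ep (replicate_pmf (Suc m) Q) (\<lambda>as. (\<Sum>a\<leftarrow>as. 1 / s a) * (G as * x as))"
    proof (rule Ep_cong)
      fix as assume "as \<in> set_pmf (replicate_pmf (Suc m) Q)"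
      then have sub: "set as \<subseteq> set_pmf Q" using set_replicate_pmfD by blast
      show "h as = (\<Sum>a\<leftarrow>as. 1 / s a) * (G as * x as)"
      proof (cases "\<forall>a\<in>set as. g a")
        case True
        have "1 + (\<Sum>a\<leftarrow>as. 1 / s a) > 0" using sum0[OF sub True] by linarith
        then show ?thesis using True by (simp add: h_def G_def x_def field_simps)
      qed (simp add: h_def G_def)
    qed
    also have "\<dots> = real (Suc m) * Ep (replicate_pmf m Q) (\<lambda>as. Ep Q (\<lambda>a. 1 / s a * (G (a # as) * x (a # as))))"
    proof (rule Ep_replicate_sum[where B=1])
      fix i as
      have "sum_list (map (\<lambda>a. 1 / s a) (rotate i as)) = sum_list (map (\<lambda>a. 1 / s a) as)"
        by (simp only: rotate_map[symmetric] sum_list_rotate)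
      then show "G (rotate i as) * x (rotate i as) = G as * x as"
        by (simp add: x_def G_def)
    next
      fix a as assume as: "as \<in> set_pmf (replicate_pmf (Suc m) Q)" and a: "a \<in> set as"
      have sub: "set as \<subseteq> set_pmf Q" using set_replicate_pmfD[OF as] by blast
      show "\<bar>1 / s a * (G as * x as)\<bar> \<le> 1"
      proof (cases "\<forall>a\<in>set as. g a")
        case True
        have "1 / s a \<le> (\<Sum>a\<leftarrow>as. 1 / s a)"
          using a sub s True by (intro member_le_sum_list) (auto intro!: less_imp_le)
        moreover have "0 < s a" using a sub s True by auto
        ultimately have "1 \<le> s a * (1 + (\<Sum>a\<leftarrow>as. 1 / s a))"
          by (simp add: field_simps)
        then have "1 / (s a * (1 + (\<Sum>a\<leftarrow>as. 1 / s a))) \<le> 1" "1 / (s a * (1 + (\<Sum>a\<leftarrow>as. 1 / s a))) \<ge> 0"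
          by simp_all
        then show ?thesis using True
          by (simp add: x_def G_def abs_le_iff)
      qed (auto simp: G_def)
    qed
    also have "Ep (replicate_pmf m Q) (\<lambda>as. Ep Q (\<lambda>a. 1 / s a * (G (a # as) * x (a # as))))
       = Ep (replicate_pmf m Q) (\<lambda>as. Ep Q (\<lambda>a. u (as, a)))"
      by (intro Ep_cong) (use ux set_replicate_pmfD in \<open>fastforce simp: algebra_simps\<close>)
    finally show ?thesis .
  qed
  have ub': "\<bar>Ep Q (\<lambda>a. u (as, a))\<bar> \<le> 1" if "set as \<subseteq> set_pmf Q" for as
    using Ep_bounds[of Q "-1" "\<lambda>a. u (as, a)" 1] ub[OF that] by (auto simp: abs_le_iff)
  \<comment> \<open>\<open>m + 1\<close> times the Poisson weight of \<open>m + 1\<close> is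
    \<open>c\<close> times the weight of \<open>m\<close>; this is why the remaining children keep
    their law.\<close>
  have pois: "c ^ Suc m / fact (Suc m) * exp (- c) * (real (Suc m) * z) = c * (c ^ m / fact m * exp (- c) * z)" for m z
    by (simp add: fact_Suc del: of_nat_Suc)
  have "(\<lambda>m. c * (c ^ m / fact m * exp (- c) * Ep (replicate_pmf m Q) (\<lambda>as. Ep Q (\<lambda>a. u (as, a)))))
     sums (c * Ep (forest c Q) (\<lambda>as. Ep Q (\<lambda>a. u (as, a))))"
    by (intro sums_mult forest_sums[where B=1] c ub')
  then have "(\<lambda>m. c ^ Suc m / fact (Suc m) * exp (- c) * Ep (replicate_pmf (Suc m) Q) h)
     sums (c * Ep (forest c Q) (\<lambda>as. Ep Q (\<lambda>a. u (as, a))))"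
    unfolding step pois .
  then have "(\<lambda>m. c ^ m / fact m * exp (- c) * Ep (replicate_pmf m Q) h)
     sums (c * Ep (forest c Q) (\<lambda>as. Ep Q (\<lambda>a. u (as, a))))"
    by (subst (asm) sums_Suc_iff) (simp add: h_def x_def)
  moreover have "(\<lambda>m. c ^ m / fact m * exp (- c) * Ep (replicate_pmf m Q) h) sums Ep (forest c Q) h"
    by (intro forest_sums[where B=1] c hb)
  ultimately have "Ep (forest c Q) h = c * Ep (forest c Q) (\<lambda>as. Ep Q (\<lambda>a. u (as, a)))"
    using sums_unique2 by blast
  also have "Ep (forest c Q) (\<lambda>as. Ep Q (\<lambda>a. u (as, a))) = Ep (pair_pmf (forest c Q) Q) u"
    by (subst Ep_pair[where B=1]) (use ub forest_set in fastforce)+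
  also have "Ep (forest c Q) h = Ep (forest c Q) (\<lambda>as. G as - G as * x as)"
    by (simp add: h_def algebra_simps)
  also have "\<dots> = Ep (forest c Q) G - Ep (forest c Q) (\<lambda>as. G as * x as)"
    by (rule Bochner_Integration.integral_diff; rule integrable_pmf_bounded[where B=1])
       (use forest_set Gxb in \<open>fastforce simp: G_def\<close>)+
  finally show ?thesis by (simp add: u_def)
qed

section \<open>The recursion on distributions\<close>

declare replicate_pmf.simps(2) [simp del]

definition Op :: "nat \<Rightarrow> real \<Rightarrow> real pmf \<Rightarrow> real pmf" where
  "Op k c D = map_pmf (\<lambda>bs. comb (map sum_list bs)) (forest c (replicate_pmf (k+1) D))"

text \<open>Being nonzero is tested on the entries and not on the sum of a block, since independent
  entries give the closed form \<open>1 - (1 - p) ^ m\<close>.\<close>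

definition big :: "real \<Rightarrow> real list \<Rightarrow> bool" where
  "big \<theta> b \<longleftrightarrow> (\<exists>x\<in>set b. \<theta> < x)"

lemma comb_bounds:
  assumes "\<And>s. s \<in> set Ss \<Longrightarrow> 0 \<le> s"
  shows "0 \<le> comb Ss" "comb Ss \<le> 1" "s \<in> set Ss \<Longrightarrow> comb Ss \<le> s"
proof -
  have n: "(\<Sum>s\<leftarrow>Ss. 1 / s) \<ge> 0" using assms by (intro sum_list_nonneg) auto
  then show "0 \<le> comb Ss" "comb Ss \<le> 1" by (auto simp: comb_def)
  show "comb Ss \<le> s" if s: "s \<in> set Ss"
  proof (cases "0 \<in> set Ss")
    case False
    then have "s > 0" using assms[OF s] s by (cases "s = 0") auto
    have "1 / s \<le> (\<Sum>s\<leftarrow>Ss. 1 / s)"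
      using s assms by (intro member_le_sum_list) auto
    then have "1 / s \<le> 1 + (\<Sum>s\<leftarrow>Ss. 1 / s)" by simp
    then have "1 / (1 + (\<Sum>s\<leftarrow>Ss. 1 / s)) \<le> 1 / (1 / s)"
      using \<open>s > 0\<close> n by (intro divide_left_mono mult_pos_pos) auto
    then show ?thesis using False by (simp add: comb_def)
  qed (use assms s in \<open>auto simp: comb_def\<close>)
qed

text \<open>\<open>D\<close> is the law of the values one level further down, and \<theta> the level
  up to which a value counts as zero: 0 for values grown from boundary 0, a small positive number
  for those grown from boundary 1, which never vanish.\<close>

locale unit_pmf =
  fixes D :: "real pmf" and k :: nat and c \<theta> :: real
  assumes D: "set_pmf D \<subseteq> {0..1}" and c: "c > 0" and th: "\<theta> \<ge> 0"
begin

abbreviation "Blk \<equiv> replicate_pmf (k+1) D"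

definition p :: real where "p = Ep D (\<lambda>x. of_bool (\<theta> < x))"

lemma Blk_set: "b \<in> set_pmf Blk \<Longrightarrow> length b = k+1 \<and> set b \<subseteq> {0..1}"
  using D by (auto simp: set_replicate_pmf)

lemma Blk_sum_nonneg: "b \<in> set_pmf Blk \<Longrightarrow> 0 \<le> sum_list b"
  by (rule sum_list_nonneg) (use Blk_set in force)

lemma elem_le_sum: "b \<in> set_pmf Blk \<Longrightarrow> x \<in> set b \<Longrightarrow> x \<le> sum_list b"
  by (rule member_le_sum_list) (use Blk_set in force)+

lemma big_sum: "b \<in> set_pmf Blk \<Longrightarrow> big \<theta> b \<Longrightarrow> \<theta> < sum_list b"
  using elem_le_sum by (force simp: big_def)

lemma not_big_sum: "b \<in> set_pmf Blk \<Longrightarrow> \<not> big \<theta> b \<Longrightarrow> sum_list b \<le> real (k+1) * \<theta>"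
  using sum_list_mono[of b "\<lambda>x. x" "\<lambda>_. \<theta>"] Blk_set[of b]
  by (auto simp: big_def not_less sum_list_replicate map_replicate_const algebra_simps)

lemma prod_of_bool: "(\<Prod>x\<leftarrow>xs. of_bool (P x) :: real) = of_bool (\<forall>x\<in>set xs. P x)"
  by (induction xs) auto

lemma not_big_prob: "Ep (replicate_pmf m D) (\<lambda>b. of_bool (\<not> big \<theta> b)) = (1 - p) ^ m"
proof -
  have "Ep (replicate_pmf m D) (\<lambda>b. of_bool (\<not> big \<theta> b))
      = Ep (replicate_pmf m D) (\<lambda>b. \<Prod>x\<leftarrow>b. of_bool (\<not> \<theta> < x))"
    by (simp only: prod_of_bool big_def) auto
  also have "\<dots> = Ep D (\<lambda>x. of_bool (\<not> \<theta> < x)) ^ m"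
    by (rule Ep_replicate_prod) auto
  also have "Ep D (\<lambda>x. of_bool (\<not> \<theta> < x)) = Ep D (\<lambda>x. 1 - of_bool (\<theta> < x))"
    by (intro Ep_cong) auto
  also have "\<dots> = 1 - p" unfolding p_def
    by (subst Bochner_Integration.integral_diff) (auto intro!: integrable_pmf_bounded[where B=1])
  finally show ?thesis .
qed

lemma big_prob: "Ep (replicate_pmf m D) (\<lambda>b. of_bool (big \<theta> b)) = 1 - (1 - p) ^ m"
proof -
  have "Ep (replicate_pmf m D) (\<lambda>b. of_bool (big \<theta> b)) = Ep (replicate_pmf m D) (\<lambda>b. 1 - of_bool (\<not> big \<theta> b))"
    by (intro Ep_cong) auto
  also have "\<dots> = 1 - (1 - p) ^ m" unfolding not_big_prob[symmetric]
    by (subst Bochner_Integration.integral_diff) (auto intro!: integrable_pmf_bounded[where B=1])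
  finally show ?thesis .
qed

lemma forest_big: "Ep (forest c Blk) (\<lambda>bs. of_bool (\<forall>b\<in>set bs. big \<theta> b)) = exp (- c * (1 - p) ^ (k+1))"
  using forest_prod[OF c, of Blk "\<lambda>b. of_bool (big \<theta> b)"] big_prob[of "k+1"]
  by (simp add: prod_of_bool)

lemma p01: "0 \<le> p" "p \<le> 1"
  using Ep_bounds[of D 0 "\<lambda>x. of_bool (\<theta> < x)" 1] by (auto simp: p_def)

lemma exists_prob: "Ep Blk (\<lambda>b. of_bool (\<exists>x\<in>set b. P x)) \<le> real (k+1) * Ep D (\<lambda>x. of_bool (P x))"
proof -
  have *: "of_bool (\<exists>x\<in>set b. P x) \<le> (\<Sum>x\<leftarrow>b. of_bool (P x) :: real)
      \<and> (\<Sum>x\<leftarrow>b. of_bool (P x) :: real) \<le> length b \<and> (\<Sum>x\<leftarrow>b. of_bool (P x) :: real) \<ge> 0" for b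
  proof (induction b)
    case (Cons a b)
    then show ?case by (cases "\<exists>x\<in>set b. P x") auto
  qed simp
  have "Ep Blk (\<lambda>b. of_bool (\<exists>x\<in>set b. P x)) \<le> Ep Blk (\<lambda>b. (\<Sum>x\<leftarrow>b. of_bool (P x)) * 1)"
  proof (rule Ep_mono[where B=1 and C="real (k+1)"])
    fix b assume "b \<in> set_pmf Blk"
    then have "length b = k + 1" using Blk_set by blast
    then show "\<bar>(\<Sum>x\<leftarrow>b. of_bool (P x)) * 1 :: real\<bar> \<le> real (k+1)"
      "of_bool (\<exists>x\<in>set b. P x) \<le> (\<Sum>x\<leftarrow>b. of_bool (P x)) * (1 :: real)" using *[of b] by simp_all
  qed simp
  also have "\<dots> = real (k+1) * Ep D (\<lambda>x. of_bool (P x))"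
    using Ep_replicate_sum[of "\<lambda>_. 1" k D "\<lambda>x. of_bool (P x)" 1]
    by (simp)
  finally show ?thesis .
qed

text \<open>The share of one face in the total over a coface, \<open>b\<close> listing the values of
  the other \<open>k+1\<close> faces. This is the quantity that the Palm formula leaves
  behind.\<close>

definition ratio :: "real \<times> real list \<Rightarrow> real" where
  "ratio = (\<lambda>(x, b). x / (x + sum_list b))"

lemma ratio01: "0 \<le> x \<Longrightarrow> b \<in> set_pmf Blk \<Longrightarrow> 0 \<le> ratio (x, b) \<and> ratio (x, b) \<le> 1"
  using Blk_sum_nonneg[of b] by (auto simp: ratio_def intro!: divide_le_eq_1[THEN iffD2])

lemma ratio01': "x \<in> set_pmf D \<Longrightarrow> b \<in> set_pmf Blk \<Longrightarrow> \<bar>ratio (x, b)\<bar> \<le> 1"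
  using ratio01[of x b] D by auto

text \<open>The \<open>k+2\<close> shares in a coface with independent, equally distributed values
  have the same mean, and they sum to 1 as soon as one value exceeds \<theta>, which has probability
  \<open>1 - (1 - p) ^ (k+2)\<close>. This is the origin of the last term of
  \<open>Bethe\<close>.\<close>

lemma ratio_exchange:
  "Ep (pair_pmf D Blk) (\<lambda>(x, b). of_bool (big \<theta> (x # b)) * ratio (x, b)) = (1 - (1 - p) ^ (k+2)) / real (k+2)"
proof -
  let ?G = "\<lambda>b. of_bool (big \<theta> b) / sum_list b"
  have "real (Suc (k+1)) * Ep Blk (\<lambda>b. Ep D (\<lambda>x. x * ?G (x # b)))
     = Ep (replicate_pmf (Suc (k+1)) D) (\<lambda>b. (\<Sum>x\<leftarrow>b. x) * ?G b)"
  proof (rule Ep_replicate_sum[where B=1, symmetric])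
    fix i and as :: "real list"
    show "?G (rotate i as) = ?G as" by (simp add: big_def sum_list_rotate)
  next
    fix a as assume as: "as \<in> set_pmf (replicate_pmf (Suc (k+1)) D)" and a: "a \<in> set as"
    have *: "set as \<subseteq> {0..1}" using set_replicate_pmfD[OF as] D by auto
    have "0 \<le> a" using * a by auto
    moreover have "a \<le> sum_list as" using * a by (intro member_le_sum_list) auto
    ultimately show "\<bar>a * ?G as\<bar> \<le> 1" by (auto simp: divide_simps)
  qed
  also have "\<dots> = Ep (replicate_pmf (Suc (k+1)) D) (\<lambda>b. of_bool (big \<theta> b))"
  proof (rule Ep_cong)
    fix as assume as: "as \<in> set_pmf (replicate_pmf (Suc (k+1)) D)"
    have *: "set as \<subseteq> {0..1}" using set_replicate_pmfD[OF as] D by auto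
    show "(\<Sum>x\<leftarrow>as. x) * ?G as = of_bool (big \<theta> as)"
    proof (cases "big \<theta> as")
      case True
      then obtain a where a: "a \<in> set as" "\<theta> < a" by (auto simp: big_def)
      have "a \<le> sum_list as" using * a by (intro member_le_sum_list) auto
      then show ?thesis using a th True by simp
    qed simp
  qed
  also have "\<dots> = 1 - (1 - p) ^ (k+2)" using big_prob[of "Suc (k+1)"] by simp
  finally have 1: "real (k+2) * Ep Blk (\<lambda>b. Ep D (\<lambda>x. x * ?G (x # b))) = 1 - (1 - p) ^ (k+2)" by simp
  have "Ep (pair_pmf D Blk) (\<lambda>(x, b). of_bool (big \<theta> (x # b)) * ratio (x, b))
    = Ep (pair_pmf Blk D) (\<lambda>(b, x). of_bool (big \<theta> (x # b)) * ratio (x, b))"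
    by (subst pair_commute_pmf) (simp add: case_prod_beta')
  also have "\<dots> = Ep Blk (\<lambda>b. Ep D (\<lambda>x. of_bool (big \<theta> (x # b)) * ratio (x, b)))"
  proof (subst Ep_pair[where B=1])
    fix z assume z: "z \<in> set_pmf (pair_pmf Blk D)"
    obtain x b where [simp]: "z = (b, x)" by force
    have "0 \<le> x" "b \<in> set_pmf Blk" using z D by auto
    from ratio01[OF this] show "\<bar>case z of (b, x) \<Rightarrow> of_bool (big \<theta> (x # b)) * ratio (x, b)\<bar> \<le> 1" by auto
  qed simp
  also have "\<dots> = Ep Blk (\<lambda>b. Ep D (\<lambda>x. x * ?G (x # b)))"
    by (simp add: ratio_def algebra_simps)
  finally show ?thesis using 1 by (simp add: field_simps)
qed

lemma ratio_small:
  "Ep (pair_pmf D Blk) (\<lambda>(x, b). of_bool (\<theta> < x \<and> \<not> big \<theta> b)) = p * (1 - p) ^ (k+1)"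
proof -
  have "Ep (pair_pmf D Blk) (\<lambda>(x, b). of_bool (\<theta> < x \<and> \<not> big \<theta> b))
     = Ep D (\<lambda>x. Ep Blk (\<lambda>b. of_bool (\<theta> < x) * of_bool (\<not> big \<theta> b)))"
    by (subst Ep_pair[where B=1]) (auto intro!: Ep_cong simp: of_bool_conj)
  also have "\<dots> = p * (1 - p) ^ (k+1)"
    using not_big_prob[of "k+1"] by (simp add: p_def[symmetric])
  finally show ?thesis .
qed

text \<open>Stationary version of the Palm term: the distinguished face and the entries of the block
  all have law \<open>D\<close>, so that \<open>ratio_exchange\<close> applies.\<close>

definition TD :: real where
  "TD = Ep (pair_pmf D Blk) (\<lambda>(x, b). of_bool (big \<theta> b) * ratio (x, b))"

text \<open>Passing from \<open>big \<theta> (x # b)\<close> to \<open>big \<theta> b\<close> loses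
  only the event that \<open>x\<close> alone exceeds \<theta>, where the share is at most 1.\<close>

lemma TD_lower: "TD \<ge> (1 - (1 - p) ^ (k+2)) / real (k+2) - p * (1 - p) ^ (k+1)"
proof -
  have "(1 - (1 - p) ^ (k+2)) / real (k+2) - p * (1 - p) ^ (k+1)
     = Ep (pair_pmf D Blk) (\<lambda>z. (\<lambda>(x, b). of_bool (big \<theta> (x # b)) * ratio (x, b)) z
         - (\<lambda>(x, b). of_bool (\<theta> < x \<and> \<not> big \<theta> b)) z)"
    unfolding ratio_exchange[symmetric] ratio_small[symmetric]
    by (rule Bochner_Integration.integral_diff[symmetric]; rule integrable_pmf_bounded[where B=1])
       (use ratio01' in auto)
  also have "\<dots> \<le> TD" unfolding TD_def
  proof (rule Ep_mono[where B=2 and C=1])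
    fix z assume z: "z \<in> set_pmf (pair_pmf D Blk)"
    obtain x b where [simp]: "z = (x, b)" by force
    have "0 \<le> x" "b \<in> set_pmf Blk" using z D by (auto)
    then have r: "0 \<le> ratio (x, b)" "ratio (x, b) \<le> 1" using ratio01 by auto
    show "(case z of (x, b) \<Rightarrow> of_bool (big \<theta> (x # b)) * ratio (x, b)) - (case z of (x, b) \<Rightarrow> of_bool (\<theta> < x \<and> \<not> big \<theta> b))
      \<le> (case z of (x, b) \<Rightarrow> of_bool (big \<theta> b) * ratio (x, b))"
      "\<bar>(case z of (x, b) \<Rightarrow> of_bool (big \<theta> (x # b)) * ratio (x, b)) - (case z of (x, b) \<Rightarrow> of_bool (\<theta> < x \<and> \<not> big \<theta> b))\<bar> \<le> 2"
      "\<bar>case z of (x, b) \<Rightarrow> of_bool (big \<theta> b) * ratio (x, b)\<bar> \<le> 1"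
      using r by (auto simp: big_def)
  qed
  finally show ?thesis .
qed

text \<open>For threshold 0 all other entries vanish on the lost event, so the share is exactly 1
  there and the estimate of \<open>TD_lower\<close> is sharp.\<close>

lemma TD_upper:
  assumes "\<theta> = 0"
  shows "TD \<le> (1 - (1 - p) ^ (k+2)) / real (k+2) - p * (1 - p) ^ (k+1)"
proof -
  have "TD = Ep (pair_pmf D Blk) (\<lambda>z. (\<lambda>(x, b). of_bool (big \<theta> (x # b)) * ratio (x, b)) z
         - (\<lambda>(x, b). of_bool (\<theta> < x \<and> \<not> big \<theta> b)) z)"
    unfolding TD_def
  proof (rule Ep_cong)
    fix z assume z: "z \<in> set_pmf (pair_pmf D Blk)"
    obtain x b where [simp]: "z = (x, b)" by force
    have xb: "0 \<le> x" "b \<in> set_pmf Blk" using z D by (auto)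
    have "ratio (x, b) = 1" if "\<not> big \<theta> b" "0 < x"
      using not_big_sum[OF xb(2) that(1)] Blk_sum_nonneg[OF xb(2)] assms that by (simp add: ratio_def)
    then show "(case z of (x, b) \<Rightarrow> of_bool (big \<theta> b) * ratio (x, b)) =
      (case z of (x, b) \<Rightarrow> of_bool (big \<theta> (x # b)) * ratio (x, b)) - (case z of (x, b) \<Rightarrow> of_bool (\<theta> < x \<and> \<not> big \<theta> b))"
      using assms by (auto simp: big_def)
  qed
  also have "\<dots> = (1 - (1 - p) ^ (k+2)) / real (k+2) - p * (1 - p) ^ (k+1)"
    unfolding ratio_exchange[symmetric] ratio_small[symmetric]
    by (rule Bochner_Integration.integral_diff; rule integrable_pmf_bounded[where B=1])
       (use ratio01' in auto)
  finally show ?thesis by simp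
qed

text \<open>Restricting to families in which every block is big keeps the block sums positive, as
  \<open>forest_palm\<close> requires, and puts \<open>comb\<close> into its reciprocal
  form.\<close>

lemma palm:
  defines "Bs \<equiv> \<lambda>bs. \<forall>b\<in>set bs. big \<theta> b"
  shows "Ep (forest c Blk) (\<lambda>bs. of_bool (Bs bs) * comb (map sum_list bs))
    = exp (- c * (1 - p) ^ (k+1)) - c * Ep (pair_pmf (forest c Blk) Blk)
        (\<lambda>(bs, b). of_bool (Bs (b # bs)) * ratio (comb (map sum_list bs), b))"
proof -
  have x: "comb (map sum_list bs) = 1 / (1 + (\<Sum>b\<leftarrow>bs. 1 / sum_list b))"
    if "set bs \<subseteq> set_pmf Blk" "Bs bs" for bs
  proof -
    have "0 \<notin> set (map sum_list bs)" using that big_sum th by (force simp: Bs_def)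
    then show ?thesis by (simp add: comb_def comp_def)
  qed
  have "Ep (forest c Blk) (\<lambda>bs. of_bool (Bs bs) * comb (map sum_list bs))
     = Ep (forest c Blk) (\<lambda>bs. of_bool (Bs bs) * (1 / (1 + (\<Sum>b\<leftarrow>bs. 1 / sum_list b))))"
    by (rule Ep_cong) (use x[OF forest_set] in auto)
  also have "\<dots> = exp (- c * (1 - p) ^ (k+1)) - c * Ep (pair_pmf (forest c Blk) Blk)
     (\<lambda>(bs, b). of_bool (Bs (b # bs)) * (1 / (1 + (\<Sum>b\<leftarrow>bs. 1 / sum_list b)) / (1 / (1 + (\<Sum>b\<leftarrow>bs. 1 / sum_list b)) + sum_list b)))"
    unfolding Bs_def forest_big[symmetric]
    by (rule forest_palm[OF c]) (use big_sum th in force)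
  also have "Ep (pair_pmf (forest c Blk) Blk)
     (\<lambda>(bs, b). of_bool (Bs (b # bs)) * (1 / (1 + (\<Sum>b\<leftarrow>bs. 1 / sum_list b)) / (1 / (1 + (\<Sum>b\<leftarrow>bs. 1 / sum_list b)) + sum_list b)))
     = Ep (pair_pmf (forest c Blk) Blk)
        (\<lambda>(bs, b). of_bool (Bs (b # bs)) * ratio (comb (map sum_list bs), b))"
    by (rule Ep_cong) (use x[OF forest_set] in \<open>auto simp: Bs_def ratio_def\<close>)
  finally show ?thesis .
qed


section \<open>Errors caused by mass near zero\<close>

lemma Ep_pair_snd: "Ep (pair_pmf p' q) (\<lambda>(x, y). f y) = Ep q f"
  using integral_map_pmf[of snd "pair_pmf p' q" f] by (simp add: map_snd_pair_pmf case_prod_beta')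

lemma Ep_pair_fst: "Ep (pair_pmf p' q) (\<lambda>(x, y). f x) = Ep p' f"
  using integral_map_pmf[of fst "pair_pmf p' q" f] by (simp add: map_fst_pair_pmf case_prod_beta')

text \<open>Bounds the probability that a block has an entry in the window from \<theta> to \<eta>.
  A big block whose sum is at most \<eta> has such an entry.\<close>

definition gap :: "real \<Rightarrow> real" where
  "gap \<eta> = real (k+1) * Ep D (\<lambda>x. of_bool (\<theta> < x \<and> x \<le> \<eta>))"

lemma gap_prob: "Ep Blk (\<lambda>b. of_bool (\<exists>x\<in>set b. \<theta> < x \<and> x \<le> \<eta>)) \<le> gap \<eta>"
  unfolding gap_def by (rule exists_prob)

lemma big_gap:
  assumes "b \<in> set_pmf Blk" "big \<theta> b" "sum_list b \<le> \<eta>"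
  shows "\<exists>x\<in>set b. \<theta> < x \<and> x \<le> \<eta>"
  using assms elem_le_sum[OF assms(1)] unfolding big_def by force

lemma Ep_add3:
  fixes f g h :: "'a \<Rightarrow> real"
  assumes "\<And>x. x \<in> set_pmf M \<Longrightarrow> \<bar>f x\<bar> \<le> A" "\<And>x. x \<in> set_pmf M \<Longrightarrow> \<bar>g x\<bar> \<le> B" "\<And>x. x \<in> set_pmf M \<Longrightarrow> \<bar>h x\<bar> \<le> C"
  shows "Ep M (\<lambda>x. f x + g x + h x) = Ep M f + Ep M g + Ep M h"
proof -
  have "integrable M f" "integrable M g" "integrable M h"
    by (rule integrable_pmf_bounded, erule assms)+
  then show ?thesis by (simp add: Bochner_Integration.integral_add)
qed

text \<open>Subtracting \<open>c\<close> times the value found in \<open>TD_lower\<close> from the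
  exponential in \<open>palm\<close> leaves exactly \<open>Bethe\<close>.\<close>

lemma Bethe_eq:
  "c * ((1 - (1 - p) ^ (k+2)) / real (k+2) - p * (1 - p) ^ (k+1)) = exp (- c * (1 - p) ^ (k+1)) - Bethe k c p"
proof -
  have "c * (w / K - p * u) = e - (e + c * p * u - c / K * w)" for w K u e by (simp add: algebra_simps)
  then show ?thesis unfolding Bethe_def .
qed

text \<open>As a function of \<open>x\<close>, the share \<open>x / (x + s)\<close> has slope at
  most \<open>1 / s\<close>, so for block sums above \<eta> it changes by at most the change of
  \<open>x\<close> divided by \<eta>; under the coupling this becomes a difference of means. Big
  blocks with a smaller sum have an entry in the window and are paid for by
  \<open>gap\<close>.\<close>

lemma coupling:
  assumes rel: "rel_pmf (\<lambda>x y. 0 \<le> x \<and> x \<le> y) P1 P2" and P2: "set_pmf P2 \<subseteq> {0..1}" and eta: "\<eta> > 0"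
  defines "f \<equiv> \<lambda>(x, b). of_bool (big \<theta> b) * ratio (x, b)"
  shows "Ep (pair_pmf P2 Blk) f \<le> Ep (pair_pmf P1 Blk) f + (Ep P2 (\<lambda>x. x) - Ep P1 (\<lambda>x. x)) / \<eta> + gap \<eta>"
proof -
  obtain pq where pq: "\<And>x y. (x, y) \<in> set_pmf pq \<Longrightarrow> 0 \<le> x \<and> x \<le> y" "map_pmf fst pq = P1" "map_pmf snd pq = P2"
    using rel by (cases rule: rel_pmf.cases) blast
  have y1: "y \<le> 1" if "(x, y) \<in> set_pmf pq" for x y
  proof -
    have "snd (x, y) \<in> set_pmf (map_pmf snd pq)" unfolding set_map_pmf using that by (rule imageI)
    then show ?thesis using P2 unfolding pq(3) by auto
  qed
  have f01: "0 \<le> f (x, b)" "f (x, b) \<le> 1" if "0 \<le> x" "b \<in> set_pmf Blk" for x b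
    using ratio01[OF that] by (auto simp: f_def)
  let ?M = "pair_pmf pq Blk"
  let ?g = "\<lambda>(z, b). (snd z - fst z) / \<eta>" and ?h = "\<lambda>(z, b). of_bool (\<exists>x\<in>set b. \<theta> < x \<and> x \<le> \<eta>)"
  have "Ep (pair_pmf P2 Blk) f = Ep ?M (\<lambda>(z, b). f (snd z, b))"
    unfolding pq(3)[symmetric] pair_map_pmf1 integral_map_pmf by (simp add: apfst_def map_prod_def case_prod_beta')
  also have "\<dots> \<le> Ep ?M (\<lambda>w. (\<lambda>(z, b). f (fst z, b)) w + ?g w + ?h w)"
  proof (rule Ep_mono[where B=1 and C="1 + 1 / \<eta> + 1"])
    fix w assume w: "w \<in> set_pmf ?M"
    obtain x y b where W: "w = ((x, y), b)" by (metis surj_pair)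
    have xy: "0 \<le> x" "x \<le> y" "y \<le> 1" "b \<in> set_pmf Blk"
      using w pq(1) y1 by (auto simp: W)
    have g: "0 \<le> (y - x) / \<eta>" "(y - x) / \<eta> \<le> 1 / \<eta>" using xy eta by (auto simp: divide_right_mono)
    have "f (y, b) \<le> f (x, b) + (y - x) / \<eta> + of_bool (\<exists>x\<in>set b. \<theta> < x \<and> x \<le> \<eta>)"
    proof (cases "big \<theta> b \<and> sum_list b > \<eta>")
      case True
      define s where "s = sum_list b"
      have s: "s > \<eta>" "s > 0" using True eta by (auto simp: s_def)
      have "y / (y + s) - x / (x + s) = (y - x) * (s / ((y + s) * (x + s)))"
        using xy s by (simp add: divide_simps) (simp add: algebra_simps)
      also have "\<dots> \<le> (y - x) * (1 / \<eta>)"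
      proof (intro mult_left_mono)
        have "s * \<eta> \<le> s * s" using s eta by simp
        also have "\<dots> \<le> (y + s) * (x + s)" using xy s by (intro mult_mono) auto
        finally show "s / ((y + s) * (x + s)) \<le> 1 / \<eta>" using xy s eta by (simp add: divide_simps)
      qed (use xy in auto)
      finally show ?thesis using True by (simp add: f_def ratio_def s_def)
    next
      case False
      show ?thesis
      proof (cases "big \<theta> b")
        case True
        then have "\<exists>x\<in>set b. \<theta> < x \<and> x \<le> \<eta>" using big_gap[OF xy(4)] False by auto
        then show ?thesis using f01[of y b] f01[of x b] xy g by simp
      qed (use g in \<open>simp add: f_def\<close>)
    qed
    then show "(case w of (z, b) \<Rightarrow> f (snd z, b)) \<le> (\<lambda>(z, b). f (fst z, b)) w + ?g w + ?h w" by (simp add: W)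
    show "\<bar>case w of (z, b) \<Rightarrow> f (snd z, b)\<bar> \<le> 1" using f01[of y b] xy by (simp add: W)
    show "\<bar>(\<lambda>(z, b). f (fst z, b)) w + ?g w + ?h w\<bar> \<le> 1 + 1 / \<eta> + 1"
      using f01[of x b] xy g by (auto simp: W)
  qed
  also have "\<dots> = Ep ?M (\<lambda>(z, b). f (fst z, b)) + Ep ?M ?g + Ep ?M ?h"
  proof (rule Ep_add3)
    fix w assume w: "w \<in> set_pmf ?M"
    obtain x y b where W: "w = ((x, y), b)" by (metis surj_pair)
    have xy: "0 \<le> x" "x \<le> y" "y \<le> 1" "b \<in> set_pmf Blk"
      using w pq(1) y1 by (auto simp: W)
    then show "\<bar>case w of (z, b) \<Rightarrow> f (fst z, b)\<bar> \<le> 1" using f01[of x b] by (simp add: W)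
    show "\<bar>?g w\<bar> \<le> 1 / \<eta>" using xy eta by (auto simp: W divide_right_mono)
    show "\<bar>?h w :: real\<bar> \<le> 1" by (simp add: W)
  qed
  also have "Ep ?M (\<lambda>(z, b). f (fst z, b)) = Ep (pair_pmf P1 Blk) f"
    unfolding pq(2)[symmetric] pair_map_pmf1 integral_map_pmf by (simp add: apfst_def map_prod_def case_prod_beta')
  also have "Ep ?M ?g = Ep pq (\<lambda>z. (snd z - fst z) / \<eta>)" by (rule Ep_pair_fst)
  also have "\<dots> = (Ep pq snd - Ep pq fst) / \<eta>"
  proof -
    have "integrable pq snd" "integrable pq fst"
      by (rule integrable_pmf_bounded[where B=1], use pq(1) y1 in force)+
    then show ?thesis by simp
  qed
  also have "Ep pq snd = Ep P2 (\<lambda>x. x)" unfolding pq(3)[symmetric] by simp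
  also have "Ep pq fst = Ep P1 (\<lambda>x. x)" unfolding pq(2)[symmetric] by simp
  also have "Ep ?M ?h = Ep Blk (\<lambda>b. of_bool (\<exists>x\<in>set b. \<theta> < x \<and> x \<le> \<eta>))" by (rule Ep_pair_snd)
  finally show ?thesis using gap_prob[of \<eta>] by linarith
qed

lemma comb01: "set bs \<subseteq> set_pmf Blk \<Longrightarrow> 0 \<le> comb (map sum_list bs) \<and> comb (map sum_list bs) \<le> 1"
  using comb_bounds[of "map sum_list bs"] Blk_sum_nonneg by auto

lemma Op_set: "set_pmf (Op k c D) \<subseteq> {0..1}"
  using comb01[OF forest_set] by (auto simp: Op_def)

lemma comb_small:
  assumes "set bs \<subseteq> set_pmf Blk" "b \<in> set bs" "\<not> big \<theta> b"
  shows "comb (map sum_list bs) \<le> real (k+1) * \<theta>"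
proof -
  have "comb (map sum_list bs) \<le> sum_list b"
    using assms Blk_sum_nonneg by (intro comb_bounds(3)) auto
  also have "\<dots> \<le> real (k+1) * \<theta>" by (rule not_big_sum) (use assms in auto)
  finally show ?thesis .
qed

lemma Op_pair: "Ep (pair_pmf (Op k c D) Blk) f = Ep (pair_pmf (forest c Blk) Blk) (\<lambda>(bs, b). f (comb (map sum_list bs), b))"
  unfolding Op_def pair_map_pmf1 integral_map_pmf by (simp add: apfst_def map_prod_def case_prod_beta')

text \<open>In the Palm term the distinguished value has law \<open>Op k c D\<close>, in
  \<open>TD\<close> it has law \<open>D\<close>; \<open>coupling\<close> compares the two. Families
  with a block that is not big have value at most \<open>(k+1) * \<theta>\<close>: this gives the
  additive error and, divided by a block sum above \<eta>, the error with \<theta> over \<eta>. Both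
  comparisons give up blocks with sum at most \<eta>, whence the factor 2 at
  \<open>gap\<close>.\<close>

lemma Op_upper:
  assumes rel: "rel_pmf (\<lambda>x y. 0 \<le> x \<and> x \<le> y) (Op k c D) D" and eta: "\<eta> > 0"
  shows "Ep (Op k c D) (\<lambda>x. x) \<le> Bethe k c p + real (k+1) * \<theta>
    + c * (real (k+1) * \<theta> / \<eta> + 2 * gap \<eta> + (Ep D (\<lambda>x. x) - Ep (Op k c D) (\<lambda>x. x)) / \<eta>)"
proof -
  let ?F = "forest c Blk" and ?X = "\<lambda>bs. comb (map sum_list bs)" and ?Bs = "\<lambda>bs. \<forall>b\<in>set bs. big \<theta> b"
  let ?K = "real (k+1) * \<theta>"
  have K: "?K \<ge> 0" using th by simp
  have XF: "0 \<le> ?X bs" "?X bs \<le> 1" if "bs \<in> set_pmf ?F" for bs using comb01[OF forest_set[OF that]] by auto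
  have "Ep (Op k c D) (\<lambda>x. x) = Ep ?F ?X" by (simp add: Op_def)
  also have "\<dots> \<le> Ep ?F (\<lambda>bs. of_bool (?Bs bs) * ?X bs + ?K)"
  proof (rule Ep_mono[where B=1 and C="1 + ?K"])
    fix bs assume bs: "bs \<in> set_pmf ?F"
    have "?X bs \<le> ?K" if "\<not> ?Bs bs" using comb_small[OF forest_set[OF bs]] that by auto
    then show "?X bs \<le> of_bool (?Bs bs) * ?X bs + ?K" using K by (cases "?Bs bs") auto
    show "\<bar>?X bs\<bar> \<le> 1" "\<bar>of_bool (?Bs bs) * ?X bs + ?K\<bar> \<le> 1 + ?K" using XF[OF bs] K by auto
  qed
  also have "\<dots> = Ep ?F (\<lambda>bs. of_bool (?Bs bs) * ?X bs) + ?K"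
    by (subst Bochner_Integration.integral_add)
       (use XF in \<open>auto intro!: integrable_pmf_bounded[where B=1]\<close>)
  finally have 1: "Ep (Op k c D) (\<lambda>x. x) \<le> Ep ?F (\<lambda>bs. of_bool (?Bs bs) * ?X bs) + ?K" .
  let ?M = "pair_pmf ?F Blk"
  let ?f = "\<lambda>(bs, b). of_bool (?Bs (b # bs)) * ratio (?X bs, b)"
  have "Ep (pair_pmf (Op k c D) Blk) (\<lambda>(x, b). of_bool (big \<theta> b) * ratio (x, b))
     = Ep ?M (\<lambda>(bs, b). of_bool (big \<theta> b) * ratio (?X bs, b))"
    unfolding Op_pair by (simp add: case_prod_beta')
  also have "\<dots> \<le> Ep ?M (\<lambda>w. ?f w + (\<lambda>w. ?K / \<eta>) w + (\<lambda>(bs, b). of_bool (\<exists>x\<in>set b. \<theta> < x \<and> x \<le> \<eta>)) w)"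
  proof (rule Ep_mono[where B=1 and C="1 + ?K / \<eta> + 1"])
    fix w assume w: "w \<in> set_pmf ?M"
    obtain bs b where W: "w = (bs, b)" by force
    have bs: "bs \<in> set_pmf ?F" "b \<in> set_pmf Blk" using w by (auto simp: W)
    have r: "0 \<le> ratio (?X bs, b)" "ratio (?X bs, b) \<le> 1" using ratio01[OF XF(1)[OF bs(1)] bs(2)] by auto
    have "ratio (?X bs, b) \<le> ?K / \<eta>" if "\<not> ?Bs bs" "sum_list b > \<eta>"
    proof -
      have "?X bs \<le> ?K" using comb_small[OF forest_set[OF bs(1)]] that(1) by auto
      then show ?thesis unfolding ratio_def using XF[OF bs(1)] that(2) eta K
        by (auto intro!: frac_le)
    qed
    moreover have "\<exists>x\<in>set b. \<theta> < x \<and> x \<le> \<eta>" if "big \<theta> b" "\<not> sum_list b > \<eta>"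
      using big_gap[OF bs(2) that(1)] that(2) by auto
    moreover have "?K / \<eta> \<ge> 0" using K eta by simp
    ultimately show "(case w of (bs, b) \<Rightarrow> of_bool (big \<theta> b) * ratio (?X bs, b)) \<le> ?f w + (\<lambda>w. ?K / \<eta>) w + (\<lambda>(bs, b). of_bool (\<exists>x\<in>set b. \<theta> < x \<and> x \<le> \<eta>)) w"
      using r unfolding W by (cases "?Bs bs"; cases "big \<theta> b"; cases "sum_list b > \<eta>") auto
    show "\<bar>case w of (bs, b) \<Rightarrow> of_bool (big \<theta> b) * ratio (?X bs, b)\<bar> \<le> 1" using r by (simp add: W)
    show "\<bar>?f w + (\<lambda>w. ?K / \<eta>) w + (\<lambda>(bs, b). of_bool (\<exists>x\<in>set b. \<theta> < x \<and> x \<le> \<eta>)) w\<bar> \<le> 1 + ?K / \<eta> + 1"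
      using r \<open>?K / \<eta> \<ge> 0\<close> unfolding W by auto
  qed
  also have "\<dots> = Ep ?M ?f + Ep ?M (\<lambda>w. ?K / \<eta>) + Ep ?M (\<lambda>(bs, b). of_bool (\<exists>x\<in>set b. \<theta> < x \<and> x \<le> \<eta>))"
    by (rule Ep_add3[where A=1 and B="\<bar>?K / \<eta>\<bar>" and C=1]) (use ratio01[OF XF(1)] in \<open>auto\<close>)
  also have "Ep ?M (\<lambda>(bs, b). of_bool (\<exists>x\<in>set b. \<theta> < x \<and> x \<le> \<eta>)) \<le> gap \<eta>"
    unfolding Ep_pair_snd by (rule gap_prob)
  finally have 2: "Ep (pair_pmf (Op k c D) Blk) (\<lambda>(x, b). of_bool (big \<theta> b) * ratio (x, b)) \<le> Ep ?M ?f + ?K / \<eta> + gap \<eta>"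
    by simp
  have 3: "TD \<le> Ep (pair_pmf (Op k c D) Blk) (\<lambda>(x, b). of_bool (big \<theta> b) * ratio (x, b))
      + (Ep D (\<lambda>x. x) - Ep (Op k c D) (\<lambda>x. x)) / \<eta> + gap \<eta>"
    unfolding TD_def by (rule coupling[OF rel D eta])
  have "(1 - (1 - p) ^ (k+2)) / real (k+2) - p * (1 - p) ^ (k+1) \<le> Ep ?M ?f + (?K / \<eta> + 2 * gap \<eta> + (Ep D (\<lambda>x. x) - Ep (Op k c D) (\<lambda>x. x)) / \<eta>)"
    using TD_lower 2 3 by linarith
  from mult_left_mono[OF this less_imp_le[OF c]]
  have "c * ((1 - (1 - p) ^ (k+2)) / real (k+2) - p * (1 - p) ^ (k+1)) \<le> c * Ep ?M ?f + c * (?K / \<eta> + 2 * gap \<eta> + (Ep D (\<lambda>x. x) - Ep (Op k c D) (\<lambda>x. x)) / \<eta>)"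
    by (simp only: distrib_left)
  then show ?thesis using 1 palm Bethe_eq by linarith
qed

text \<open>Families with a block that is not big can be discarded in a lower bound, and
  \<open>TD_upper\<close> keeps the Palm term below its ideal value. Only the coupling error
  remains, with the two laws in the opposite order.\<close>

lemma Op_lower:
  assumes rel: "rel_pmf (\<lambda>x y. 0 \<le> x \<and> x \<le> y) D (Op k c D)" and eta: "\<eta> > 0" and th0: "\<theta> = 0"
  shows "Ep (Op k c D) (\<lambda>x. x) \<ge> Bethe k c p
    - c * (gap \<eta> + (Ep (Op k c D) (\<lambda>x. x) - Ep D (\<lambda>x. x)) / \<eta>)"
proof -
  let ?F = "forest c Blk" and ?X = "\<lambda>bs. comb (map sum_list bs)" and ?Bs = "\<lambda>bs. \<forall>b\<in>set bs. big \<theta> b"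
  have XF: "0 \<le> ?X bs" "?X bs \<le> 1" if "bs \<in> set_pmf ?F" for bs using comb01[OF forest_set[OF that]] by auto
  have 1: "Ep (Op k c D) (\<lambda>x. x) \<ge> Ep ?F (\<lambda>bs. of_bool (?Bs bs) * ?X bs)"
    unfolding Op_def integral_map_pmf by (rule Ep_mono[where B=1 and C=1]) (use XF in \<open>auto\<close>)
  let ?M = "pair_pmf ?F Blk"
  let ?f = "\<lambda>(bs, b). of_bool (?Bs (b # bs)) * ratio (?X bs, b)"
  have "Ep ?M ?f \<le> Ep ?M (\<lambda>(bs, b). of_bool (big \<theta> b) * ratio (?X bs, b))"
    by (rule Ep_mono[where B=1 and C=1]) (use ratio01[OF XF(1)] in auto)
  also have "\<dots> = Ep (pair_pmf (Op k c D) Blk) (\<lambda>(x, b). of_bool (big \<theta> b) * ratio (x, b))"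
    unfolding Op_pair by (simp add: case_prod_beta')
  also have "\<dots> \<le> TD + (Ep (Op k c D) (\<lambda>x. x) - Ep D (\<lambda>x. x)) / \<eta> + gap \<eta>"
    unfolding TD_def by (rule coupling[OF rel Op_set eta])
  finally have "Ep ?M ?f \<le> ((1 - (1 - p) ^ (k+2)) / real (k+2) - p * (1 - p) ^ (k+1)) + (gap \<eta> + (Ep (Op k c D) (\<lambda>x. x) - Ep D (\<lambda>x. x)) / \<eta>)"
    using TD_upper[OF th0] by linarith
  from mult_left_mono[OF this less_imp_le[OF c]]
  have "c * Ep ?M ?f \<le> c * ((1 - (1 - p) ^ (k+2)) / real (k+2) - p * (1 - p) ^ (k+1)) + c * (gap \<eta> + (Ep (Op k c D) (\<lambda>x. x) - Ep D (\<lambda>x. x)) / \<eta>)"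
    by (simp only: distrib_left)
  then show ?thesis using 1 palm Bethe_eq by linarith
qed

end

section \<open>Galton-Watson trees\<close>

text \<open>A node stands for a face; each block lists the other faces of one coface leading away from the root.\<close>
datatype tree = Node (blocks: "tree list list")

primrec gw :: "nat \<Rightarrow> real \<Rightarrow> nat \<Rightarrow> tree pmf" where
  "gw k c 0 = return_pmf (Node [])"
| "gw k c (Suc l) = map_pmf Node (forest c (replicate_pmf (k+1) (gw k c l)))"

text \<open>Boundary value \<open>b = 1\<close> at depth \<open>l\<close> leaves the faces there unconstrained, \<open>b = 0\<close> forces cocycles to vanish on them.\<close>
primrec val :: "real \<Rightarrow> nat \<Rightarrow> tree \<Rightarrow> real" where
  "val b 0 T = b"
| "val b (Suc l) T = comb (map (\<lambda>ts. \<Sum>t\<leftarrow>ts. val b l t) (blocks T))"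

definition law :: "nat \<Rightarrow> real \<Rightarrow> real \<Rightarrow> nat \<Rightarrow> real pmf" where
  "law k c b l = map_pmf (val b l) (gw k c l)"

lemma law_0: "law k c b 0 = return_pmf b"
  by (simp add: law_def)

lemma law_Suc: "law k c b (Suc l) = Op k c (law k c b l)"
proof -
  have "law k c b (Suc l) = map_pmf (\<lambda>bs. comb (map sum_list (map (map (val b l)) bs)))
      (forest c (replicate_pmf (k+1) (gw k c l)))"
    by (simp add: law_def pmf.map_comp comp_def)
  also have "\<dots> = map_pmf (\<lambda>bs. comb (map sum_list bs)) (forest c (replicate_pmf (k+1) (law k c b l)))"
    unfolding law_def map_replicate_pmf forest_def map_bind_pmf pmf.map_comp
    by (simp add: comp_def)
  finally show ?thesis by (simp add: Op_def)
qed

lemma law_set: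
  assumes "0 \<le> b" "b \<le> 1" "c > 0"
  shows "set_pmf (law k c b l) \<subseteq> {0..1}"
proof (induction l)
  case (Suc l)
  interpret unit_pmf "law k c b l" k c 0 by unfold_locales (use Suc assms in auto)
  show ?case using Op_set by (simp add: law_Suc)
qed (use assms in \<open>simp add: law_0\<close>)

section \<open>Stochastic order between the laws\<close>

lemma rel_replicate_pmf:
  "rel_pmf R p q \<Longrightarrow> rel_pmf (list_all2 R) (replicate_pmf n p) (replicate_pmf n q)"
  by (induction n) (auto simp: replicate_pmf.simps intro!: rel_pmf_bindI rel_pmf_return_pmfI)

text \<open>Nonnegativity is part of the relation because \<open>comb\<close> is shown to be
  monotone for nonnegative entries. Lifted by \<open>rel_pmf\<close>, the relation expresses
  stochastic domination through a coupling.\<close>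

abbreviation nle :: "real \<Rightarrow> real \<Rightarrow> bool" where "nle \<equiv> \<lambda>x y. 0 \<le> x \<and> x \<le> y"

lemma sum_list_nle: "list_all2 nle xs ys \<Longrightarrow> nle (sum_list xs) (sum_list ys)"
  by (induction xs ys rule: list_all2_induct) auto

text \<open>A zero in the smaller list makes the smaller value 0; otherwise both lists are positive
  and the order of the reciprocals is reversed.\<close>

lemma comb_nle:
  assumes "list_all2 nle xs ys"
  shows "nle (comb xs) (comb ys)"
proof -
  have pos: "0 \<le> x" if "x \<in> set xs" for x
    using assms that by (auto simp: list_all2_conv_all_nth in_set_conv_nth)
  have posy: "0 \<le> x" if "x \<in> set ys" for x
    using assms that by (auto simp: list_all2_conv_all_nth in_set_conv_nth intro: order_trans)
  show ?thesis
  proof (cases "0 \<in> set xs")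
    case True
    then show ?thesis using comb_bounds(1)[OF posy] by (simp add: comb_def[of xs])
  next
    case False
    have xs: "0 < x" if "x \<in> set xs" for x using pos[OF that] False that by (cases "x = 0") auto
    have ys: "0 \<notin> set ys \<and> 0 \<le> (\<Sum>s\<leftarrow>ys. 1 / s) \<and> (\<Sum>s\<leftarrow>ys. 1 / s) \<le> (\<Sum>s\<leftarrow>xs. 1 / s)"
      using assms xs
    proof (induction xs ys rule: list_all2_induct)
      case (Cons x xs y ys)
      have "0 < x" "x \<le> y" using Cons by auto
      then have "1 / y \<le> 1 / x" "0 < y" by (auto intro: divide_left_mono)
      moreover have "1 / y > 0" using \<open>0 < y\<close> by simp
      ultimately show ?case using Cons by fastforce
    qed simp
    then have "1 / (1 + (\<Sum>s\<leftarrow>xs. 1 / s)) \<le> 1 / (1 + (\<Sum>s\<leftarrow>ys. 1 / s))"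
      by (intro divide_left_mono mult_pos_pos) linarith+
    then show ?thesis using False ys comb_bounds(1)[OF pos] by (simp add: comb_def)
  qed
qed

lemma Op_mono:
  assumes "rel_pmf nle P1 P2"
  shows "rel_pmf nle (Op k c P1) (Op k c P2)"
proof -
  have "rel_pmf (list_all2 (list_all2 nle)) (forest c (replicate_pmf (k+1) P1)) (forest c (replicate_pmf (k+1) P2))"
    unfolding forest_def
    by (rule rel_pmf_bindI[where R="(=)"]) (auto simp: pmf.rel_eq intro!: rel_replicate_pmf assms)
  then show ?thesis unfolding Op_def pmf.rel_map
  proof (rule pmf.rel_mono_strong)
    fix bs bs' :: "real list list" assume "list_all2 (list_all2 nle) bs bs'"
    then have "list_all2 nle (map sum_list bs) (map sum_list bs')"
      unfolding list_all2_map1 list_all2_map2 by (rule list_all2_mono) (rule sum_list_nle)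
    then show "nle (comb (map sum_list bs)) (comb (map sum_list bs'))" by (rule comb_nle)
  qed
qed

lemma rel_pmf_Ep_mono:
  assumes rel: "rel_pmf nle P1 P2" and P2: "set_pmf P2 \<subseteq> {0..1}"
    and f: "\<And>x y. 0 \<le> x \<Longrightarrow> x \<le> y \<Longrightarrow> y \<le> 1 \<Longrightarrow> f x \<le> f y" "\<And>x. 0 \<le> x \<Longrightarrow> x \<le> 1 \<Longrightarrow> \<bar>f x\<bar> \<le> 1"
  shows "Ep P1 f \<le> Ep P2 f"
proof -
  obtain pq where pq: "\<And>x y. (x, y) \<in> set_pmf pq \<Longrightarrow> 0 \<le> x \<and> x \<le> y" "map_pmf fst pq = P1" "map_pmf snd pq = P2"
    using rel by (cases rule: rel_pmf.cases) blast
  have z: "0 \<le> fst z \<and> fst z \<le> snd z \<and> snd z \<le> 1" if "z \<in> set_pmf pq" for z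
  proof -
    have "snd z \<in> set_pmf (map_pmf snd pq)" unfolding set_map_pmf using that by (rule imageI)
    then show ?thesis using P2 pq(1)[of "fst z" "snd z"] that unfolding pq(3) by auto
  qed
  show ?thesis unfolding pq(2)[symmetric] pq(3)[symmetric] integral_map_pmf
    by (rule Ep_mono[where B=1 and C=1]) (use z f in force)+
qed

text \<open>The boundary value 1 is the largest possible one, so replacing it by one more level can
  only decrease the law; monotonicity of \<open>Op\<close> carries this to every depth.\<close>

lemma law_decreasing:
  assumes "c > 0"
  shows "rel_pmf nle (law k c 1 (Suc l)) (law k c 1 l)"
proof (induction l)
  case 0
  show ?case using law_set[OF _ _ assms, of 1 k "Suc 0"] by (force simp: law_0 rel_pmf_return_pmf2)
next
  case (Suc l)
  then show ?case using Op_mono by (simp add: law_Suc)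
qed

lemma law_increasing:
  assumes "c > 0"
  shows "rel_pmf nle (law k c 0 l) (law k c 0 (Suc l))"
proof (induction l)
  case 0
  show ?case using law_set[OF _ _ assms, of 0 k "Suc 0"] by (force simp: law_0 rel_pmf_return_pmf1)
next
  case (Suc l)
  then show ?case using Op_mono by (simp add: law_Suc)
qed

text \<open>The means decrease to a limit, so for a fixed window the coupling error between
  consecutive levels vanishes. Taking \<open>\<delta> ^ Suc i\<close> and
  \<open>\<delta> ^ i\<close> as the ends of the window makes their quotient \<delta> small, and
  among \<open>K\<close> disjoint windows one has mass at most \<open>1 / K\<close>. Since
  \<open>i\<close> depends on \<open>l\<close>, the level is chosen beforehand against the smallest
  scale \<open>\<delta> ^ K\<close>.\<close>

lemma law_one_limit:
  assumes c: "c > 0" and e: "\<epsilon> > 0"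
  shows "\<exists>l. Ep (law k c 1 l) (\<lambda>x. x) \<le> hk k c + \<epsilon>"
proof -
  define m where "m l = Ep (law k c 1 l) (\<lambda>x. x)" for l
  have set: "set_pmf (law k c 1 l) \<subseteq> {0..1}" for l using law_set c by simp
  have m0: "0 \<le> m l \<and> m l \<le> 1" for l
  proof -
    have "nle x 1" if "x \<in> set_pmf (law k c 1 l)" for x using set[of l] that by force
    from Ep_bounds[of "law k c 1 l" 0 "\<lambda>x. x" 1, OF this] show ?thesis by (simp add: m_def)
  qed
  have dec: "m (Suc l) \<le> m l" for l unfolding m_def
    by (rule rel_pmf_Ep_mono[OF law_decreasing[OF c] set]) auto
  define a where "a = real (k+1)"
  have a: "a \<ge> 1" by (simp add: a_def)
  obtain \<delta> where \<delta>: "0 < \<delta>" "\<delta> < 1" "a * \<delta> \<le> \<epsilon> / 4" "c * (a * \<delta>) \<le> \<epsilon> / 4"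
  proof
    define \<delta> where "\<delta> = min (1/2) (min (\<epsilon> / 4 / a) (\<epsilon> / 4 / (c * a)))"
    show "0 < \<delta>" "\<delta> < 1" using e a c by (auto simp: \<delta>_def)
    have "\<delta> \<le> \<epsilon> / 4 / a" "\<delta> \<le> \<epsilon> / 4 / (c * a)" by (auto simp: \<delta>_def)
    then show "a * \<delta> \<le> \<epsilon> / 4" "c * (a * \<delta>) \<le> \<epsilon> / 4"
      using a c by (auto simp: pos_le_divide_eq mult.commute mult.left_commute)
  qed
  \<comment> \<open>With this many windows the gap term costs at most a quarter of \<epsilon>; each
    of the other three errors takes a quarter as well.\<close>
  obtain K :: nat where K: "K > 0" "8 * c * a / \<epsilon> \<le> real K"
    by (metis real_arch_simple less_imp_le max.cobounded1 max.cobounded2 of_nat_mono order_trans zero_less_Suc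
        le_Suc_eq max_Suc_Suc gr0I le_0_eq not_less)
  have K': "c * (2 * (a / real K)) \<le> \<epsilon> / 4" using K e by (simp add: field_simps)
  have "m \<longlonglongrightarrow> (INF l. m l)"
    by (rule LIMSEQ_decseq_INF) (use m0 dec in \<open>auto intro!: bdd_belowI2[where m=0] decseq_SucI\<close>)
  then have "(\<lambda>l. m l - m (Suc l)) \<longlonglongrightarrow> (INF l. m l) - (INF l. m l)"
    by (intro tendsto_diff LIMSEQ_Suc)
  then have "\<forall>\<^sub>F l in sequentially. m l - m (Suc l) < \<epsilon> / 4 * \<delta> ^ K / c"
    using e \<delta> c by (intro order_tendstoD) auto
  then obtain l where l: "m l - m (Suc l) < \<epsilon> / 4 * \<delta> ^ K / c"
    by (auto simp: eventually_sequentially)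
  define g where "g i = Ep (law k c 1 l) (\<lambda>x. of_bool (\<delta> ^ i < x))" for i
  have g01: "0 \<le> g i \<and> g i \<le> 1" for i
    using Ep_bounds[of "law k c 1 l" 0 "\<lambda>x. of_bool (\<delta> ^ i < x)" 1] by (auto simp: g_def)
  \<comment> \<open>The window masses telescope to \<open>g K - g 0\<close>, which is at most
    1.\<close>
  have "\<exists>i<K. g (Suc i) - g i \<le> 1 / real K"
  proof (rule ccontr)
    assume "\<not> ?thesis"
    then have "(\<Sum>i<K. 1 / real K) < (\<Sum>i<K. g (Suc i) - g i)"
      using K by (intro sum_strict_mono) auto
    also have "\<dots> = g K - g 0" by (rule sum_lessThan_telescope)
    finally show False using K g01[of K] g01[of 0] by simp
  qed
  then obtain i where i: "i < K" "g (Suc i) - g i \<le> 1 / real K" by blast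
  interpret unit_pmf "law k c 1 l" k c "\<delta> ^ Suc i"
    by unfold_locales (use set c \<delta> in auto)
  have "g (Suc i) - g i = Ep (law k c 1 l) (\<lambda>x. of_bool (\<delta> ^ Suc i < x) - of_bool (\<delta> ^ i < x))"
    unfolding g_def by (rule Bochner_Integration.integral_diff[symmetric]; rule integrable_pmf_bounded[where B=1]) auto
  also have "\<dots> = Ep (law k c 1 l) (\<lambda>x. of_bool (\<delta> ^ Suc i < x \<and> x \<le> \<delta> ^ i))"
  proof (rule Ep_cong)
    fix x
    have "\<delta> ^ Suc i \<le> \<delta> ^ i" using \<delta> by (simp add: mult_left_le_one_le)
    then show "of_bool (\<delta> ^ Suc i < x) - of_bool (\<delta> ^ i < x) = (of_bool (\<delta> ^ Suc i < x \<and> x \<le> \<delta> ^ i) :: real)" by auto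
  qed
  finally have "gap (\<delta> ^ i) \<le> a * (1 / real K)"
    unfolding gap_def a_def using i(2) by (intro mult_left_mono) auto
  then have gap: "c * (2 * gap (\<delta> ^ i)) \<le> \<epsilon> / 4"
    using K' c by (intro order_trans[OF _ K'] mult_left_mono) auto
  have r: "real (k+1) * \<delta> ^ Suc i / \<delta> ^ i = a * \<delta>" using \<delta> by (simp add: a_def)
  have "\<delta> ^ K \<le> \<delta> ^ i" using i \<delta> by (intro power_decreasing) auto
  then have "(m l - m (Suc l)) / \<delta> ^ i \<le> (m l - m (Suc l)) / \<delta> ^ K"
    using dec[of l] \<delta> by (intro divide_left_mono) auto
  also have "\<dots> \<le> (\<epsilon> / 4 * \<delta> ^ K / c) / \<delta> ^ K" using l \<delta> by (intro divide_right_mono) auto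
  also have "\<dots> = \<epsilon> / 4 / c" using \<delta> by simp
  finally have D: "c * ((m l - m (Suc l)) / \<delta> ^ i) \<le> \<epsilon> / 4" using c by (simp add: field_simps)
  have s: "real (k+1) * \<delta> ^ Suc i \<le> \<epsilon> / 4"
  proof -
    have "\<delta> ^ Suc i \<le> \<delta>" using \<delta> by (simp add: power_le_one mult_left_le)
    then show ?thesis using \<delta>(3) a unfolding a_def by (meson mult_left_mono of_nat_0_le_iff order_trans)
  qed
  have "m (Suc l) \<le> Bethe k c p + real (k+1) * \<delta> ^ Suc i
    + c * (real (k+1) * \<delta> ^ Suc i / \<delta> ^ i + 2 * gap (\<delta> ^ i) + (m l - m (Suc l)) / \<delta> ^ i)"
    using Op_upper[of "\<delta> ^ i"] law_decreasing[OF c, of k l] \<delta>(1) unfolding m_def law_Suc by simp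
  also have "\<dots> = Bethe k c p + real (k+1) * \<delta> ^ Suc i
    + (c * (a * \<delta>) + c * (2 * gap (\<delta> ^ i)) + c * ((m l - m (Suc l)) / \<delta> ^ i))"
    unfolding r by (simp only: distrib_left)
  also have "\<dots> \<le> hk k c + \<epsilon>" using Bethe_le_hk[OF c p01, of k] gap D s \<delta>(4) by linarith
  finally show ?thesis unfolding m_def by blast
qed

text \<open>A family has positive value iff each of its blocks has a positive entry, so with
  threshold 0 the probability in \<open>forest_big\<close> is that of a positive value one level
  up.\<close>

lemma law_zero_positive:
  assumes c: "c > 0"
  shows "Ep (law k c 0 (Suc l)) (\<lambda>x. of_bool (0 < x)) = exp (- c * (1 - Ep (law k c 0 l) (\<lambda>x. of_bool (0 < x))) ^ (k+1))"
proof -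
  interpret unit_pmf "law k c 0 l" k c 0
    by unfold_locales (use law_set c in auto)
  have "Ep (law k c 0 (Suc l)) (\<lambda>x. of_bool (0 < x)) = Ep (forest c Blk) (\<lambda>bs. of_bool (0 < comb (map sum_list bs)))"
    by (simp add: law_Suc Op_def)
  also have "\<dots> = Ep (forest c Blk) (\<lambda>bs. of_bool (\<forall>b\<in>set bs. big 0 b))"
  proof (rule Ep_cong)
    fix bs assume "bs \<in> set_pmf (forest c Blk)"
    then have sub: "set bs \<subseteq> set_pmf Blk" by (rule forest_set)
    have "sum_list b \<noteq> 0 \<longleftrightarrow> big 0 b" if "b \<in> set bs" for b
      using big_sum[of b] not_big_sum[of b] Blk_sum_nonneg[of b] that sub by force
    then have "0 \<notin> set (map sum_list bs) \<longleftrightarrow> (\<forall>b\<in>set bs. big 0 b)" by force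
    moreover have "0 < comb (map sum_list bs) \<longleftrightarrow> 0 \<notin> set (map sum_list bs)"
    proof -
      have "(\<Sum>s\<leftarrow>map sum_list bs. 1 / s) \<ge> 0"
        using Blk_sum_nonneg sub by (intro sum_list_nonneg) auto
      then show ?thesis by (auto simp: comb_def)
    qed
    ultimately show "of_bool (0 < comb (map sum_list bs)) = of_bool (\<forall>b\<in>set bs. big 0 b)" by simp
  qed
  also have "\<dots> = exp (- c * (1 - p) ^ (k+1))" by (rule forest_big)
  finally show ?thesis by (simp add: p_def)
qed

text \<open>With threshold 0 the functional is evaluated at \<open>P l\<close>, which tends to
  \<open>tdc\<close>. The window below \<eta> must be light at all large levels at once. It is light
  at one level \<open>L\<close> where \<open>P L\<close> is already close to the limit, and it stays
  light because \<open>H\<close> increases while \<open>P\<close> gains at most \<delta> after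
  \<open>L\<close>.\<close>

lemma law_zero_limit:
  assumes c: "c > 0" and e: "\<epsilon> > 0"
  shows "\<exists>l. Ep (law k c 0 l) (\<lambda>x. x) \<ge> Bethe k c (tdc (k+1) c) - \<epsilon>"
proof -
  define t where "t = tdc (k+1) c"
  define m where "m l = Ep (law k c 0 l) (\<lambda>x. x)" for l
  define P where "P l = Ep (law k c 0 l) (\<lambda>x. of_bool (0 < x))" for l
  have set: "set_pmf (law k c 0 l) \<subseteq> {0..1}" for l using law_set c by simp
  have m0: "0 \<le> m l \<and> m l \<le> 1" for l
  proof -
    have "nle x 1" if "x \<in> set_pmf (law k c 0 l)" for x using set[of l] that by force
    from Ep_bounds[of "law k c 0 l" 0 "\<lambda>x. x" 1, OF this] show ?thesis by (simp add: m_def)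
  qed
  have inc: "m l \<le> m (Suc l)" for l unfolding m_def
    by (rule rel_pmf_Ep_mono[OF law_increasing[OF c] set]) auto
  have P: "P \<longlonglongrightarrow> t" "incseq P" "\<And>l. 0 \<le> P l \<and> P l \<le> 1"
    using iterate_tendsto_tdc[OF c, of P k] law_zero_positive[OF c] by (simp_all add: P_def t_def law_0)
  define a where "a = real (k+1)"
  have a: "a \<ge> 1" by (simp add: a_def)
  \<comment> \<open>Chosen so that the gap term, at most \<open>c * (a * (2 * \<delta>))\<close>,
    costs half of \<epsilon>.\<close>
  define \<delta> where "\<delta> = \<epsilon> / 4 / (c * a)"
  have \<delta>: "\<delta> > 0" "c * (a * \<delta>) = \<epsilon> / 4" using e c a by (auto simp: \<delta>_def)
  have "\<forall>\<^sub>F l in sequentially. P l > t - \<delta>" using P(1) \<delta> by (intro order_tendstoD) auto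
  then obtain L where L: "P L > t - \<delta>" by (auto simp: eventually_sequentially)
  have PL: "P l - P L \<le> \<delta>" for l
    using L incseq_le[OF P(2) P(1), of l] by simp
  \<comment> \<open>These windows shrink to the empty set, so their mass under the law at the fixed
    level \<open>L\<close> tends to 0.\<close>
  define A where "A n = {x::real. 0 < x \<and> x \<le> 1 / real (Suc n)}" for n
  have "(\<lambda>n. measure_pmf.prob (law k c 0 L) (A n)) \<longlonglongrightarrow> measure_pmf.prob (law k c 0 L) (\<Inter>n. A n)"
  proof (rule measure_pmf.finite_Lim_measure_decseq)
    show "decseq A" unfolding A_def decseq_def
      by (auto intro: order_trans[OF _ divide_left_mono] simp del: of_nat_Suc)
  qed simp
  moreover have "(\<Inter>n. A n) = {}"
  proof -
    have "\<exists>n. x \<notin> A n" for x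
    proof (cases "x > 0")
      case True
      then obtain n where "1 / real (Suc n) < x" using nat_approx_posE by blast
      then show ?thesis by (auto simp: A_def intro!: exI[of _ n])
    qed (simp add: A_def)
    then show ?thesis by blast
  qed
  ultimately have "(\<lambda>n. measure_pmf.prob (law k c 0 L) (A n)) \<longlonglongrightarrow> 0" by simp
  then have "\<forall>\<^sub>F n in sequentially. measure_pmf.prob (law k c 0 L) (A n) < \<delta>"
    using \<delta> by (intro order_tendstoD) auto
  then obtain n where n: "measure_pmf.prob (law k c 0 L) (A n) < \<delta>" by (auto simp: eventually_sequentially)
  define \<eta> where "\<eta> = 1 / real (Suc n)"
  have eta: "\<eta> > 0" by (simp add: \<eta>_def)
  define H where "H l = Ep (law k c 0 l) (\<lambda>x. of_bool (\<eta> < x))" for l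
  have H: "Ep (law k c 0 l) (\<lambda>x. of_bool (0 < x \<and> x \<le> \<eta>)) = P l - H l" for l
  proof -
    have "P l - H l = Ep (law k c 0 l) (\<lambda>x. of_bool (0 < x) - of_bool (\<eta> < x))"
      unfolding P_def H_def by (rule Bochner_Integration.integral_diff[symmetric]; rule integrable_pmf_bounded[where B=1]) auto
    also have "\<dots> = Ep (law k c 0 l) (\<lambda>x. of_bool (0 < x \<and> x \<le> \<eta>))"
      by (rule Ep_cong) (use eta in auto)
    finally show ?thesis by simp
  qed
  have "H l \<le> H (Suc l)" for l unfolding H_def
    by (rule rel_pmf_Ep_mono[OF law_increasing[OF c] set]) auto
  then have "incseq H" by (rule incseq_SucI)
  have PH: "P L - H L < \<delta>"
  proof -
    have "P L - H L = Ep (law k c 0 L) (indicator (A n))"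
      unfolding H[symmetric] by (rule Ep_cong) (auto simp: A_def \<eta>_def indicator_def)
    then show ?thesis using n by simp
  qed
  have gapl: "P l - H l \<le> 2 * \<delta>" if "l \<ge> L" for l
    using PH PL[of l] incseqD[OF \<open>incseq H\<close> that] by simp
  have "m \<longlonglongrightarrow> (SUP l. m l)"
    by (rule LIMSEQ_incseq_SUP) (use m0 inc in \<open>auto intro!: bdd_aboveI2[where M=1] incseq_SucI\<close>)
  then have "(\<lambda>l. m (Suc l) - m l) \<longlonglongrightarrow> (SUP l. m l) - (SUP l. m l)"
    by (intro tendsto_diff LIMSEQ_Suc)
  then have ev1: "\<forall>\<^sub>F l in sequentially. m (Suc l) - m l < \<epsilon> / 4 * \<eta> / c"
    using e eta c by (intro order_tendstoD) auto
  have "(\<lambda>l. Bethe k c (P l)) \<longlonglongrightarrow> Bethe k c t"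
    unfolding Bethe_def by (intro tendsto_intros P)
  then have ev2: "\<forall>\<^sub>F l in sequentially. Bethe k c (P l) > Bethe k c t - \<epsilon> / 4"
    using e by (intro order_tendstoD) auto
  obtain l where l: "m (Suc l) - m l < \<epsilon> / 4 * \<eta> / c" "Bethe k c (P l) > Bethe k c t - \<epsilon> / 4" "l \<ge> L"
    using eventually_happens'[OF _ eventually_conj[OF ev1 eventually_conj[OF ev2 eventually_ge_at_top[of L]]]] by auto
  interpret unit_pmf "law k c 0 l" k c 0
    by unfold_locales (use set c in auto)
  have "gap \<eta> \<le> a * (2 * \<delta>)" unfolding gap_def a_def H using gapl[OF l(3)] by (intro mult_left_mono) auto
  then have "c * gap \<eta> \<le> c * (a * (2 * \<delta>))" using c by (intro mult_left_mono) auto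
  then have g: "c * gap \<eta> \<le> \<epsilon> / 2" using \<delta>(2) by (simp add: algebra_simps)
  have "(m (Suc l) - m l) / \<eta> \<le> (\<epsilon> / 4 * \<eta> / c) / \<eta>" using l eta by (intro divide_right_mono) auto
  also have "\<dots> = \<epsilon> / 4 / c" using eta by simp
  finally have D: "c * ((m (Suc l) - m l) / \<eta>) \<le> \<epsilon> / 4" using c by (simp add: field_simps)
  have "m (Suc l) \<ge> Bethe k c (P l) - c * (gap \<eta> + (m (Suc l) - m l) / \<eta>)"
    using Op_lower[OF _ eta] law_increasing[OF c, of k l] unfolding m_def law_Suc P_def p_def by simp
  moreover have "c * (gap \<eta> + (m (Suc l) - m l) / \<eta>) = c * gap \<eta> + c * ((m (Suc l) - m l) / \<eta>)"
    by (simp only: distrib_left)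
  ultimately have "m (Suc l) \<ge> Bethe k c t - \<epsilon>" using g D l(2) by linarith
  then show ?thesis unfolding m_def t_def by blast
qed

section \<open>Cocycles and the diagonal of the projection\<close>

interpretation fsp: vector_space fscale
  by unfold_locales (auto simp: fun_eq_iff algebra_simps)

definition ip :: "nat set set \<Rightarrow> (nat set \<Rightarrow> real) \<Rightarrow> (nat set \<Rightarrow> real) \<Rightarrow> real" where
  "ip F f g = (\<Sum>\<sigma>\<in>F. f \<sigma> * g \<sigma>)"

definition supported :: "nat set set \<Rightarrow> (nat set \<Rightarrow> real) set" where
  "supported F = {f. \<forall>\<sigma>. f \<sigma> \<noteq> 0 \<longrightarrow> \<sigma> \<in> F}"

lemma sum_fun_apply: "(\<Sum>b\<in>B. h b) x = (\<Sum>b\<in>B. h b x :: real)"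
  by (induction B rule: infinite_finite_induct) auto

lemma ip_simps:
  "ip F (f + g) h = ip F f h + ip F g h" "ip F (f - g) h = ip F f h - ip F g h"
  "ip F (\<lambda>x. r * f x) h = r * ip F f h" "ip F h (\<lambda>x. r * f x) = r * ip F h f"
  by (simp_all add: ip_def algebra_simps sum.distrib sum_subtractf sum_distrib_left)

lemma ip_sym: "ip F f g = ip F g f"
  by (simp add: ip_def mult.commute)

lemma ip_sum_left: "ip F (\<Sum>b\<in>B. h b) g = (\<Sum>b\<in>B. ip F (h b) g)"
  unfolding ip_def sum_fun_apply sum_distrib_right by (rule sum.swap)

lemma ip_nonneg: "0 \<le> ip F f f"
  by (auto simp: ip_def intro!: sum_nonneg)

lemma ip_zero_iff:
  assumes "finite F" "f \<in> supported F"
  shows "ip F f f = 0 \<longleftrightarrow> f = 0"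
  using assms by (auto simp: ip_def sum_nonneg_eq_0_iff supported_def fun_eq_iff)

lemma subspace_supported: "fsp.subspace (supported F)"
proof (rule fsp.subspaceI)
  show "x + y \<in> supported F" if "x \<in> supported F" "y \<in> supported F" for x y
    using that unfolding supported_def mem_Collect_eq plus_fun_apply by (metis add_0)
qed (auto simp: supported_def)

lemma supported_span:
  assumes "finite F"
  shows "supported F \<subseteq> fsp.span ((\<lambda>\<sigma>. indicator {\<sigma>}) ` F)"
proof
  fix f assume f: "f \<in> supported F"
  have "f = (\<Sum>\<sigma>\<in>F. fscale (f \<sigma>) (indicator {\<sigma>}))"
  proof
    fix x
    have "(\<Sum>\<sigma>\<in>F. fscale (f \<sigma>) (indicator {\<sigma>})) x = (\<Sum>\<sigma>\<in>F. if \<sigma> = x then f x else 0)"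
      unfolding sum_fun_apply by (rule sum.cong) (auto simp: indicator_def)
    also have "\<dots> = f x" using assms f by (auto simp: supported_def)
    finally show "f x = (\<Sum>\<sigma>\<in>F. fscale (f \<sigma>) (indicator {\<sigma>})) x" by simp
  qed
  also have "\<dots> \<in> fsp.span ((\<lambda>\<sigma>. indicator {\<sigma>}) ` F)"
    by (intro fsp.span_sum fsp.span_scale fsp.span_base) auto
  finally show "f \<in> fsp.span ((\<lambda>\<sigma>. indicator {\<sigma>}) ` F)" .
qed

lemma finite_basis:
  assumes "finite F" "V \<subseteq> supported F"
  obtains B where "finite B" "B \<subseteq> V" "fsp.independent B" "V \<subseteq> fsp.span B" "card B = fsp.dim V" "card B \<le> card F"
proof -
  obtain B where B: "B \<subseteq> V" "fsp.independent B" "V \<subseteq> fsp.span B" "card B = fsp.dim V"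
    using fsp.basis_exists by blast
  have "finite B \<and> card B \<le> card ((\<lambda>\<sigma>. indicator {\<sigma>} :: nat set \<Rightarrow> real) ` F)"
    by (rule fsp.independent_span_bound) (use assms B supported_span[of F] in auto)
  then have "finite B" "card B \<le> card F" using card_image_le[OF assms(1)] order_trans by auto
  then show ?thesis using B by (intro that[of B])
qed

lemma dim_le_card_supp: "finite F \<Longrightarrow> V \<subseteq> supported F \<Longrightarrow> fsp.dim V \<le> card F"
  by (erule (1) finite_basis) simp

lemma dim_mono_supp:
  assumes "finite F" "V \<subseteq> supported F" "U \<subseteq> V"
  shows "fsp.dim U \<le> fsp.dim V"
proof -
  obtain B where "finite B" "V \<subseteq> fsp.span B" "card B = fsp.dim V"
    using finite_basis[OF assms(1,2)] by metis
  then show ?thesis using assms(3) fsp.dim_le_card[of U B] by auto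
qed

definition orthonormal :: "nat set set \<Rightarrow> (nat set \<Rightarrow> real) set \<Rightarrow> bool" where
  "orthonormal F B \<longleftrightarrow> finite B \<and> (\<forall>b\<in>B. \<forall>b'\<in>B. ip F b b' = of_bool (b = b'))"

text \<open>The corrected vector \<open>a'\<close> does not vanish because \<open>a\<close> lies
  outside the span of the earlier vectors; its support in \<open>F\<close> makes its norm positive,
  so it can be normalised.\<close>

lemma gram_schmidt:
  assumes "finite F" "finite B" "fsp.independent B" "B \<subseteq> supported F"
  shows "\<exists>C. orthonormal F C \<and> fsp.span C = fsp.span B \<and> card C = card B"
  using assms(2-4)
proof (induction B rule: finite_induct)
  case empty
  then show ?case by (auto simp: orthonormal_def intro!: exI[of _ "{}"])
next
  case (insert a B)
  have indB: "fsp.independent B" using insert.prems(1) fsp.independent_mono by blast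
  then obtain C where C: "orthonormal F C" "fsp.span C = fsp.span B" "card C = card B"
    using insert by auto
  have aB: "a \<notin> fsp.span B" using insert.prems(1) insert.hyps(2) by (simp add: fsp.independent_insert)
  define s where "s = (\<Sum>b\<in>C. fscale (ip F a b) b)"
  define a' where "a' = a - s"
  have s: "s \<in> fsp.span C" unfolding s_def by (intro fsp.span_sum fsp.span_scale fsp.span_base)
  have a'n: "a' \<noteq> 0" using aB s C(2) by (auto simp: a'_def)
  have "s \<in> supported F"
    using s C(2) fsp.span_minimal[OF _ subspace_supported, of B F] insert.prems(2) by auto
  then have a's: "a' \<in> supported F"
    unfolding a'_def using insert.prems(2) fsp.subspace_diff[OF subspace_supported] by blast
  have q: "ip F a' a' > 0" using ip_zero_iff[OF assms(1) a's] a'n ip_nonneg[of F a'] by linarith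
  have ort: "ip F a' b = 0" if "b \<in> C" for b
  proof -
    have "ip F s b = (\<Sum>b'\<in>C. ip F a b' * of_bool (b' = b))"
      unfolding s_def ip_sum_left by (rule sum.cong) (use C(1) that in \<open>auto simp: ip_simps orthonormal_def\<close>)
    also have "\<dots> = (\<Sum>b'\<in>C. if b' = b then ip F a b' else 0)" by (rule sum.cong) auto
    also have "\<dots> = ip F a b" using that C(1) by (simp add: orthonormal_def)
    finally show ?thesis by (simp add: a'_def ip_simps)
  qed
  define e where "e = fscale (1 / sqrt (ip F a' a')) a'"
  have a'e: "a' = fscale (sqrt (ip F a' a')) e" using q by (simp add: e_def fun_eq_iff)
  have ee: "ip F e e = 1" unfolding e_def ip_simps using q by (simp add: divide_simps)
  have eb: "ip F e b = 0" if "b \<in> C" for b unfolding e_def ip_simps using ort[OF that] by simp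
  have be: "ip F b e = 0" if "b \<in> C" for b using eb[OF that] by (subst ip_sym)
  have en: "e \<notin> fsp.span C"
  proof
    assume "e \<in> fsp.span C"
    then have "a' \<in> fsp.span C" by (subst a'e) (rule fsp.span_scale)
    then have "a' + s \<in> fsp.span C" using s by (rule fsp.span_add)
    then show False using aB C(2) by (simp add: a'_def)
  qed
  have "fsp.span (insert e C) = fsp.span (insert a B)"
  proof
    have CB: "fsp.span C \<subseteq> fsp.span (insert a B)" unfolding C(2) by (rule fsp.span_mono) auto
    have "s \<in> fsp.span (insert a B)" using s CB by blast
    moreover have "a \<in> fsp.span (insert a B)" by (rule fsp.span_base) simp
    ultimately have "a' \<in> fsp.span (insert a B)" unfolding a'_def using fsp.span_diff by blast
    then have "e \<in> fsp.span (insert a B)" unfolding e_def by (rule fsp.span_scale)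
    then have "insert e C \<subseteq> fsp.span (insert a B)" using CB fsp.span_superset[of C] by auto
    then show "fsp.span (insert e C) \<subseteq> fsp.span (insert a B)"
      by (rule fsp.span_minimal) (rule fsp.subspace_span)
    have CB: "fsp.span C \<subseteq> fsp.span (insert e C)" by (rule fsp.span_mono) auto
    have "a' \<in> fsp.span (insert e C)"
      by (subst a'e) (intro fsp.span_scale fsp.span_base, simp)
    then have "a' + s \<in> fsp.span (insert e C)" using s CB by (intro fsp.span_add) auto
    then have "a \<in> fsp.span (insert e C)" by (simp add: a'_def)
    moreover have "B \<subseteq> fsp.span (insert e C)" using CB C(2) fsp.span_superset[of B] by auto
    ultimately have "insert a B \<subseteq> fsp.span (insert e C)" by auto
    then show "fsp.span (insert a B) \<subseteq> fsp.span (insert e C)"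
      by (rule fsp.span_minimal) (rule fsp.subspace_span)
  qed
  moreover have "e \<notin> C" using en fsp.span_base by blast
  moreover have "orthonormal F (insert e C)"
    using C(1) ee eb be \<open>e \<notin> C\<close> unfolding orthonormal_def by auto
  moreover have "finite C" using C(1) by (simp add: orthonormal_def)
  ultimately show ?case using C(3) insert.hyps by (intro exI[of _ "insert e C"]) auto
qed

text \<open>\<open>P \<sigma>\<close> is the squared norm of the orthogonal projection of the \<open>\<sigma>\<close>-th unit vector to \<open>V\<close>.\<close>
lemma projection_diagonal:
  assumes F: "finite F" and V: "fsp.subspace V" "V \<subseteq> supported F"
  shows "\<exists>P. (\<forall>\<sigma>. 0 \<le> P \<sigma>) \<and> (\<Sum>\<sigma>\<in>F. P \<sigma>) = real (fsp.dim V)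
    \<and> (\<forall>f\<in>V. \<forall>\<sigma>. (f \<sigma>)\<^sup>2 \<le> P \<sigma> * ip F f f)
    \<and> (\<forall>\<sigma> C. 0 \<le> C \<longrightarrow> (\<forall>f\<in>V. (f \<sigma>)\<^sup>2 \<le> C * ip F f f) \<longrightarrow> P \<sigma> \<le> C)"
proof -
  obtain B0 where B0: "finite B0" "B0 \<subseteq> V" "fsp.independent B0" "V \<subseteq> fsp.span B0" "card B0 = fsp.dim V"
    using finite_basis[OF F V(2)] by metis
  obtain B where B: "orthonormal F B" "fsp.span B = fsp.span B0" "card B = card B0"
    using gram_schmidt[OF F B0(1,3)] B0(2) V(2) by auto
  have span: "fsp.span B = V"
    using B0 B V fsp.span_minimal by (metis subset_antisym)
  have fin: "finite B" using B by (simp add: orthonormal_def)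
  have BV: "B \<subseteq> V" using span fsp.span_superset by blast
  \<comment> \<open>Diagonal entry of the projection in an orthonormal basis; its sum over
    \<open>F\<close> counts the basis vectors.\<close>
  define P where "P \<sigma> = (\<Sum>b\<in>B. (b \<sigma>)\<^sup>2)" for \<sigma>
  have ipc: "ip F (\<Sum>b\<in>B. fscale (u b) b) b' = u b'" if "b' \<in> B" for u b'
  proof -
    have "ip F (\<Sum>b\<in>B. fscale (u b) b) b' = (\<Sum>b\<in>B. if b = b' then u b else 0)"
      unfolding ip_sum_left by (rule sum.cong) (use B(1) that in \<open>auto simp: ip_simps orthonormal_def\<close>)
    then show ?thesis using that fin by simp
  qed
  have nrm: "ip F (\<Sum>b\<in>B. fscale (u b) b) (\<Sum>b\<in>B. fscale (u b) b) = (\<Sum>b\<in>B. (u b)\<^sup>2)" for u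
  proof -
    have "ip F (\<Sum>b\<in>B. fscale (u b) b) (\<Sum>b\<in>B. fscale (u b) b)
       = (\<Sum>b'\<in>B. ip F (fscale (u b') b') (\<Sum>b\<in>B. fscale (u b) b))"
      by (rule ip_sum_left)
    also have "\<dots> = (\<Sum>b'\<in>B. (u b')\<^sup>2)"
      by (rule sum.cong[OF refl]) (use ipc in \<open>simp add: ip_simps ip_sym[of F _ "\<Sum>b\<in>B. fscale (u b) b"] power2_eq_square\<close>)
    finally show ?thesis .
  qed
  have "(\<Sum>\<sigma>\<in>F. P \<sigma>) = (\<Sum>b\<in>B. ip F b b)"
    unfolding P_def ip_def power2_eq_square by (rule sum.swap)
  also have "\<dots> = (\<Sum>b\<in>B. 1)"
    by (rule sum.cong) (use B(1) in \<open>auto simp: orthonormal_def\<close>)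
  also have "\<dots> = real (fsp.dim V)" using B B0 by simp
  finally have 1: "(\<Sum>\<sigma>\<in>F. P \<sigma>) = real (fsp.dim V)" .
  have 2: "(f \<sigma>)\<^sup>2 \<le> P \<sigma> * ip F f f" if "f \<in> V" for f \<sigma>
  proof -
    obtain u where u: "f = (\<Sum>b\<in>B. fscale (u b) b)"
      using \<open>f \<in> V\<close> unfolding span[symmetric] fsp.span_finite[OF fin] by auto
    have "(f \<sigma>)\<^sup>2 = (\<Sum>b\<in>B. u b * b \<sigma>)\<^sup>2" unfolding u sum_fun_apply ..
    also have "\<dots> \<le> (\<Sum>b\<in>B. (u b)\<^sup>2) * (\<Sum>b\<in>B. (b \<sigma>)\<^sup>2)" by (rule Cauchy_Schwarz_ineq_sum)
    finally show ?thesis unfolding P_def u nrm by (simp add: mult.commute)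
  qed
  have 3: "P \<sigma> \<le> C" if C: "0 \<le> C" "\<forall>f\<in>V. (f \<sigma>)\<^sup>2 \<le> C * ip F f f" for \<sigma> C
  proof -
    \<comment> \<open>\<open>g\<close> is the projection of the unit vector at \<sigma>. It attains
      equality: both its value at \<sigma> and its squared norm are
      \<open>P \<sigma>\<close>.\<close>
    define g where "g = (\<Sum>b\<in>B. fscale (b \<sigma>) b)"
    have "g \<in> V" unfolding g_def span[symmetric] by (intro fsp.span_sum fsp.span_scale fsp.span_base)
    then have "(g \<sigma>)\<^sup>2 \<le> C * ip F g g" using C by blast
    moreover have "g \<sigma> = P \<sigma>" unfolding g_def sum_fun_apply P_def by (simp add: power2_eq_square)
    moreover have "ip F g g = P \<sigma>" unfolding g_def nrm P_def ..
    ultimately have "P \<sigma> * P \<sigma> \<le> C * P \<sigma>" by (simp add: power2_eq_square)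
    moreover have "0 \<le> P \<sigma>" by (auto simp: P_def intro!: sum_nonneg)
    ultimately show ?thesis using C(1) by (cases "P \<sigma> = 0") auto
  qed
  show ?thesis
    by (rule exI[of _ P]) (use 1 2 3 in \<open>auto simp: P_def intro!: sum_nonneg\<close>)
qed

lemma dim_kernel_le:
  assumes F: "finite F" and V: "fsp.subspace V" "V \<subseteq> supported F"
    and ph: "\<And>f g. \<phi> (f + g) = \<phi> f + (\<phi> g :: real)" "\<And>r f. \<phi> (fscale r f) = r * \<phi> f"
  shows "fsp.dim V \<le> fsp.dim {f \<in> V. \<phi> f = 0} + 1"
proof (cases "\<exists>v\<in>V. \<phi> v \<noteq> 0")
  case False
  then have "{f \<in> V. \<phi> f = 0} = V" by auto
  then show ?thesis by simp
next
  case True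
  then obtain v where v: "v \<in> V" "\<phi> v \<noteq> 0" by blast
  obtain B where B: "finite B" "{f \<in> V. \<phi> f = 0} \<subseteq> fsp.span B" "card B = fsp.dim {f \<in> V. \<phi> f = 0}"
  proof -
    have "{f \<in> V. \<phi> f = 0} \<subseteq> supported F" using V(2) by auto
    then show thesis by (rule finite_basis[OF F]) (rule that)
  qed
  have "V \<subseteq> fsp.span (insert v B)"
  proof
    fix f assume f: "f \<in> V"
    define g where "g = f + fscale (- \<phi> f / \<phi> v) v"
    have "g \<in> V" unfolding g_def
      by (intro fsp.subspace_add[OF V(1)] fsp.subspace_scale[OF V(1)] f v)
    moreover have "\<phi> g = 0" unfolding g_def ph using v by simp
    ultimately have "g \<in> fsp.span B" using B(2) by auto
    then have "g \<in> fsp.span (insert v B)" using fsp.span_mono[of B "insert v B"] by auto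
    moreover have "fscale (\<phi> f / \<phi> v) v \<in> fsp.span (insert v B)"
      by (intro fsp.span_scale fsp.span_base) simp
    ultimately have "g + fscale (\<phi> f / \<phi> v) v \<in> fsp.span (insert v B)" by (rule fsp.span_add)
    moreover have "g + fscale (\<phi> f / \<phi> v) v = f" by (simp add: g_def fun_eq_iff)
    ultimately show "f \<in> fsp.span (insert v B)" by simp
  qed
  then have "fsp.dim V \<le> card (insert v B)" using B by (intro fsp.dim_le_card) auto
  then show ?thesis using B card_insert_le_m1[of "Suc (card B)" B v] by (auto simp: card_insert_if split: if_splits)
qed

text \<open>Each linear condition lowers the dimension by at most one. The comparisons of cocycle
  dimensions below use it with values on faces or coboundaries on cofaces as the conditions.\<close>

lemma dim_kernels_le:
  assumes F: "finite F" and A: "finite A" and V: "fsp.subspace V" "V \<subseteq> supported F"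
    and ph: "\<And>a f g. \<phi> a (f + g) = \<phi> a f + (\<phi> a g :: real)" "\<And>a r f. \<phi> a (fscale r f) = r * \<phi> a f"
  shows "fsp.dim V \<le> fsp.dim {f \<in> V. \<forall>a\<in>A. \<phi> a f = 0} + card A"
  using A
proof (induction A rule: finite_induct)
  case (insert a A)
  let ?W = "{f \<in> V. \<forall>a\<in>A. \<phi> a f = 0}"
  have "fsp.subspace ?W"
  proof (rule fsp.subspaceI)
    have "\<phi> a 0 = 0" for a using ph(2)[of a 0 0] by (simp add: zero_fun_def)
    then show "0 \<in> ?W" using fsp.subspace_0[OF V(1)] by auto
    show "x + y \<in> ?W" if "x \<in> ?W" "y \<in> ?W" for x y
      using that fsp.subspace_add[OF V(1)] by (simp add: ph)
    show "fscale r x \<in> ?W" if "x \<in> ?W" for x r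
      using that fsp.subspace_scale[OF V(1)] by (simp add: ph)
  qed
  then have "fsp.dim ?W \<le> fsp.dim {f \<in> ?W. \<phi> a f = 0} + 1"
    using V(2) by (intro dim_kernel_le[OF F _ _ ph]) auto
  moreover have "{f \<in> ?W. \<phi> a f = 0} = {f \<in> V. \<forall>a\<in>insert a A. \<phi> a f = 0}" by auto
  ultimately show ?case using insert by simp
qed simp

section \<open>Cochains of a complex and the dimension of its cocycles\<close>

definition faces :: "nat \<Rightarrow> nat set set \<Rightarrow> nat set set" where
  "faces m X = {\<sigma>\<in>X. finite \<sigma> \<and> card \<sigma> = m}"

lemma cochains_supported: "cochains m X = supported (faces m X)"
  by (auto simp: cochains_def supported_def faces_def)

lemma coboundary_add: "coboundary m X (f + g) = coboundary m X f + coboundary m X g"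
  by (auto simp: coboundary_def fun_eq_iff algebra_simps sum.distrib)

lemma coboundary_scale: "coboundary m X (fscale r f) = fscale r (coboundary m X f)"
  by (auto simp: coboundary_def fun_eq_iff sum_distrib_left mult.left_commute)

definition cocycles :: "nat \<Rightarrow> nat set set \<Rightarrow> (nat set \<Rightarrow> real) set" where
  "cocycles k X = {f \<in> cochains (k+1) X. coboundary (k+1) X f = (\<lambda>_. 0)}"

lemma cocycles_alt:
  "cocycles k X = {f \<in> cochains (k+1) X. \<forall>a\<in>faces (k+2) X. coboundary (k+1) X f a = 0}"
  by (auto simp: cocycles_def fun_eq_iff coboundary_def faces_def)

lemma subspace_cocycles: "fsp.subspace (cocycles k X)"
proof (rule fsp.subspaceI)
  show "0 \<in> cocycles k X" by (auto simp: cocycles_def cochains_def coboundary_def)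
  show "x + y \<in> cocycles k X" if "x \<in> cocycles k X" "y \<in> cocycles k X" for x y
    using that fsp.subspace_add[OF subspace_supported]
    by (auto simp: cocycles_def cochains_supported coboundary_add)
  show "fscale r x \<in> cocycles k X" if "x \<in> cocycles k X" for x r
    using that fsp.subspace_scale[OF subspace_supported]
    by (auto simp: cocycles_def cochains_supported coboundary_scale)
qed

lemma cocycles_supported: "cocycles k X \<subseteq> supported (faces (k+1) X)"
  by (auto simp: cocycles_def cochains_supported)

definition nullity :: "nat \<Rightarrow> nat set set \<Rightarrow> nat" where
  "nullity k X = fsp.dim (cocycles k X)"

lemma finite_faces: "finite X \<Longrightarrow> finite (faces m X)"
  by (simp add: faces_def)

text \<open>The indicator of \<sigma> has norm 1 and value 1 at \<sigma>, which forces every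
  diagonal entry of the projection to be at least 1.\<close>

lemma dim_supported:
  assumes "finite F"
  shows "fsp.dim (supported F) = card F"
proof (rule antisym)
  show "fsp.dim (supported F) \<le> card F" using dim_le_card_supp[OF assms] by simp
  obtain P where P: "\<forall>\<sigma>. 0 \<le> P \<sigma>" "(\<Sum>\<sigma>\<in>F. P \<sigma>) = real (fsp.dim (supported F))"
    "\<forall>f\<in>supported F. \<forall>\<sigma>. (f \<sigma>)\<^sup>2 \<le> P \<sigma> * ip F f f"
    using projection_diagonal[OF assms subspace_supported, of F] by auto
  have "1 \<le> P \<sigma>" if "\<sigma> \<in> F" for \<sigma>
  proof -
    have i: "indicator {\<sigma>} \<in> supported F" using that by (auto simp: supported_def indicator_def)
    have "ip F (indicator {\<sigma>}) (indicator {\<sigma>}) = (\<Sum>\<tau>\<in>F. if \<tau> = \<sigma> then 1 else 0)"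
      unfolding ip_def by (rule sum.cong) (auto simp: indicator_def)
    also have "\<dots> = 1" using assms that by simp
    finally show ?thesis using P(3)[rule_format, OF i, of \<sigma>] by simp
  qed
  then have "(\<Sum>\<sigma>\<in>F. 1) \<le> (\<Sum>\<sigma>\<in>F. P \<sigma>)" by (intro sum_mono) auto
  then show "card F \<le> fsp.dim (supported F)" using P(2) by simp
qed

lemma nullity_le_faces: "finite X \<Longrightarrow> nullity k X \<le> card (faces (k+1) X)"
  unfolding nullity_def by (rule dim_le_card_supp[OF finite_faces cocycles_supported])

text \<open>Cochains are cut down to cocycles by one condition per coface. This bound supplies the
  value of \<open>Bethe\<close> at 1.\<close>

lemma faces_le_nullity:
  assumes "finite X"
  shows "card (faces (k+1) X) \<le> nullity k X + card (faces (k+2) X)"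
proof -
  let ?F = "faces (k+1) X"
  have "fsp.dim (supported ?F) \<le> fsp.dim {f \<in> supported ?F. \<forall>a\<in>faces (k+2) X. coboundary (k+1) X f a = 0} + card (faces (k+2) X)"
    by (rule dim_kernels_le[OF finite_faces finite_faces subspace_supported])
       (use assms in \<open>auto simp: coboundary_add coboundary_scale\<close>)
  then show ?thesis
    by (simp add: dim_supported finite_faces assms nullity_def cocycles_alt cochains_supported)
qed

text \<open>Cocycles of the larger complex that vanish on the new faces are cocycles of the smaller
  one. Together with \<open>nullity_le_add_cofaces\<close> this controls the effect of marking a
  single set.\<close>

lemma nullity_le_add_faces:
  assumes X: "finite X'" "X \<subseteq> X'"
  shows "nullity k X' \<le> nullity k X + card (faces (k+1) X' - faces (k+1) X)"
proof -
  let ?A = "faces (k+1) X' - faces (k+1) X"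
  have "fsp.dim (cocycles k X') \<le> fsp.dim {f \<in> cocycles k X'. \<forall>a\<in>?A. f a = 0} + card ?A"
    by (rule dim_kernels_le[OF finite_faces[OF X(1)] _ subspace_cocycles cocycles_supported])
       (use finite_faces[OF X(1)] in auto)
  also have "fsp.dim {f \<in> cocycles k X'. \<forall>a\<in>?A. f a = 0} \<le> fsp.dim (cocycles k X)"
  proof (rule dim_mono_supp[OF finite_faces[OF finite_subset[OF X(2,1)]] cocycles_supported])
    show "{f \<in> cocycles k X'. \<forall>a\<in>?A. f a = 0} \<subseteq> cocycles k X"
    proof
      fix f assume f: "f \<in> {f \<in> cocycles k X'. \<forall>a\<in>?A. f a = 0}"
      then have "f \<in> cochains (k+1) X" by (auto simp: cocycles_def cochains_supported supported_def)
      moreover have "coboundary (k+1) X f a = 0" if "a \<in> faces (k+2) X" for a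
      proof -
        have "coboundary (k+1) X f a = coboundary (k+1) X' f a"
          using that X(2) by (auto simp: coboundary_def faces_def)
        then show ?thesis using f by (simp add: cocycles_def)
      qed
      ultimately show "f \<in> cocycles k X" by (simp add: cocycles_alt)
    qed
  qed
  finally show ?thesis unfolding nullity_def by simp
qed

lemma nullity_le_add_cofaces:
  assumes X: "finite X'" "X \<subseteq> X'"
  shows "nullity k X \<le> nullity k X' + card (faces (k+2) X' - faces (k+2) X)"
proof -
  let ?A = "faces (k+2) X' - faces (k+2) X"
  have fX: "finite X" using X finite_subset by blast
  have "fsp.dim (cocycles k X) \<le> fsp.dim {f \<in> cocycles k X. \<forall>a\<in>?A. coboundary (k+1) X' f a = 0} + card ?A"
    by (rule dim_kernels_le[OF finite_faces[OF fX] _ subspace_cocycles cocycles_supported])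
       (use finite_faces[OF X(1)] in \<open>auto simp: coboundary_add coboundary_scale\<close>)
  also have "fsp.dim {f \<in> cocycles k X. \<forall>a\<in>?A. coboundary (k+1) X' f a = 0} \<le> fsp.dim (cocycles k X')"
  proof (rule dim_mono_supp[OF finite_faces[OF X(1)] cocycles_supported])
    show "{f \<in> cocycles k X. \<forall>a\<in>?A. coboundary (k+1) X' f a = 0} \<subseteq> cocycles k X'"
    proof
      fix f assume f: "f \<in> {f \<in> cocycles k X. \<forall>a\<in>?A. coboundary (k+1) X' f a = 0}"
      then have "f \<in> cochains (k+1) X'" using X(2) by (auto simp: cocycles_def cochains_def)
      moreover have "coboundary (k+1) X' f a = 0" if "a \<in> faces (k+2) X'" for a
      proof (cases "a \<in> faces (k+2) X")
        case True
        then have "coboundary (k+1) X' f a = coboundary (k+1) X f a"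
          using X(2) by (auto simp: coboundary_def faces_def)
        then show ?thesis using f by (simp add: cocycles_def)
      qed (use f that in auto)
      ultimately show "f \<in> cocycles k X'" by (simp add: cocycles_alt)
    qed
  qed
  finally show ?thesis unfolding nullity_def by simp
qed

text \<open>Indicators span the cochains, so the coboundary has rank at most the number of simplices
  with \<open>k\<close> vertices.\<close>

lemma betti_bounds:
  assumes "finite X"
  shows "betti k X \<le> nullity k X" "nullity k X \<le> betti k X + card (faces k X)"
proof -
  show "betti k X \<le> nullity k X" by (simp add: betti_def nullity_def cocycles_def)
  let ?d = "coboundary k X"
  have "?d ` cochains k X \<subseteq> fsp.span ((\<lambda>\<sigma>. ?d (indicator {\<sigma>})) ` faces k X)"
  proof
    fix g assume "g \<in> ?d ` cochains k X"
    then obtain f where f: "f \<in> cochains k X" "g = ?d f" by blast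
    define W where "W = {f. ?d f \<in> fsp.span ((\<lambda>\<sigma>. ?d (indicator {\<sigma>})) ` faces k X)}"
    have "fsp.subspace W"
    proof (rule fsp.subspaceI)
      have "?d 0 = 0" by (auto simp: coboundary_def)
      then show "0 \<in> W" by (simp add: W_def fsp.span_zero)
    qed (auto simp: W_def coboundary_add coboundary_scale intro: fsp.span_add fsp.span_scale)
    then have "fsp.span ((\<lambda>\<sigma>. indicator {\<sigma>}) ` faces k X) \<subseteq> W"
      by (intro fsp.span_minimal) (auto simp: W_def intro: fsp.span_base)
    then show "g \<in> fsp.span ((\<lambda>\<sigma>. ?d (indicator {\<sigma>})) ` faces k X)"
      using supported_span[OF finite_faces[OF assms], of k] f unfolding cochains_supported W_def by auto
  qed
  then have "fsp.dim (?d ` cochains k X) \<le> card ((\<lambda>\<sigma>. ?d (indicator {\<sigma>})) ` faces k X)"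
    by (intro fsp.dim_le_card finite_imageI finite_faces assms)
  also have "\<dots> \<le> card (faces k X)" by (rule card_image_le[OF finite_faces[OF assms]])
  finally show "nullity k X \<le> betti k X + card (faces k X)"
    by (simp add: betti_def nullity_def cocycles_def)
qed

text \<open>The last two clauses make \<open>P \<sigma>\<close> the least nonnegative constant
  \<open>C\<close> in \<open>(f \<sigma>)\<^sup>2 \<le> C * ip (faces (k+1) X) f f\<close> on the
  cocycles, so the choice is in fact unique. It is bounded above by proving such an inequality and
  below by exhibiting one cocycle.\<close>

definition pdiag :: "nat \<Rightarrow> nat set set \<Rightarrow> nat set \<Rightarrow> real" where
  "pdiag k X = (SOME P. (\<forall>\<sigma>. 0 \<le> P \<sigma>) \<and> (\<Sum>\<sigma>\<in>faces (k+1) X. P \<sigma>) = real (nullity k X)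
    \<and> (\<forall>f\<in>cocycles k X. \<forall>\<sigma>. (f \<sigma>)\<^sup>2 \<le> P \<sigma> * ip (faces (k+1) X) f f)
    \<and> (\<forall>\<sigma> C. 0 \<le> C \<longrightarrow> (\<forall>f\<in>cocycles k X. (f \<sigma>)\<^sup>2 \<le> C * ip (faces (k+1) X) f f) \<longrightarrow> P \<sigma> \<le> C))"

lemma pdiag:
  assumes "finite X"
  shows "0 \<le> pdiag k X \<sigma>" "(\<Sum>\<sigma>\<in>faces (k+1) X. pdiag k X \<sigma>) = real (nullity k X)"
    "f \<in> cocycles k X \<Longrightarrow> (f \<sigma>)\<^sup>2 \<le> pdiag k X \<sigma> * ip (faces (k+1) X) f f"
    "0 \<le> C \<Longrightarrow> (\<And>f. f \<in> cocycles k X \<Longrightarrow> (f \<sigma>)\<^sup>2 \<le> C * ip (faces (k+1) X) f f) \<Longrightarrow> pdiag k X \<sigma> \<le> C"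
proof -
  note * = someI_ex[OF projection_diagonal[OF finite_faces[OF assms, of "k+1"] subspace_cocycles[of k X]
      cocycles_supported[of k X]], folded nullity_def, folded pdiag_def]
  show "0 \<le> pdiag k X \<sigma>" "(\<Sum>\<sigma>\<in>faces (k+1) X. pdiag k X \<sigma>) = real (nullity k X)"
    using *[THEN conjunct1] *[THEN conjunct2, THEN conjunct1] by simp_all
  show "f \<in> cocycles k X \<Longrightarrow> (f \<sigma>)\<^sup>2 \<le> pdiag k X \<sigma> * ip (faces (k+1) X) f f"
    using *[THEN conjunct2, THEN conjunct2, THEN conjunct1] by simp
  show "0 \<le> C \<Longrightarrow> (\<And>f. f \<in> cocycles k X \<Longrightarrow> (f \<sigma>)\<^sup>2 \<le> C * ip (faces (k+1) X) f f) \<Longrightarrow> pdiag k X \<sigma> \<le> C"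
    using *[THEN conjunct2, THEN conjunct2, THEN conjunct2] by simp
qed

lemma pdiag_le_1:
  assumes "finite X" "\<sigma> \<in> faces (k+1) X"
  shows "pdiag k X \<sigma> \<le> 1"
proof (rule pdiag(4)[OF assms(1)])
  fix f :: "nat set \<Rightarrow> real"
  have "(f \<sigma>)\<^sup>2 \<le> (\<Sum>\<tau>\<in>faces (k+1) X. (f \<tau>)\<^sup>2)"
    by (rule member_le_sum[of \<sigma> _ "\<lambda>\<tau>. (f \<tau>)\<^sup>2"]) (use assms finite_faces in auto)
  then show "(f \<sigma>)\<^sup>2 \<le> 1 * ip (faces (k+1) X) f f" by (simp add: ip_def power2_eq_square)
qed simp

section \<open>Products over cubes\<close>

text \<open>Product of \<open>p (card \<rho>)\<close> over the sets \<open>\<rho>\<close> between a fixed set of size \<open>s\<close> and one of size \<open>s + j\<close>.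
  Below, \<open>Q j\<close> is the probability that a set with \<open>j\<close> vertices is a face, \<open>R j\<close> that it can be extended by a given
  vertex, and \<open>W j\<close> accounts for the faces containing two given new vertices.\<close>
primrec cube_prod :: "(nat \<Rightarrow> real) \<Rightarrow> nat \<Rightarrow> nat \<Rightarrow> real" where
  "cube_prod p 0 s = p s"
| "cube_prod p (Suc j) s = cube_prod p j s * cube_prod p j (Suc s)"

lemma prod_Pow_insert:
  assumes "finite A" "a \<notin> A"
  shows "(\<Prod>\<rho>\<in>Pow (insert a A). f \<rho>) = (\<Prod>\<rho>\<in>Pow A. f \<rho>) * (\<Prod>\<rho>\<in>Pow A. f (insert a \<rho>) :: real)"
proof -
  have "inj_on (insert a) (Pow A)" using assms by (auto simp: inj_on_def)
  then have "(\<Prod>\<rho>\<in>insert a ` Pow A. f \<rho>) = (\<Prod>\<rho>\<in>Pow A. f (insert a \<rho>))"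
    by (simp add: prod.reindex)
  moreover have "Pow A \<inter> insert a ` Pow A = {}" using assms by auto
  ultimately show ?thesis unfolding Pow_insert using assms
    by (subst prod.union_disjoint) auto
qed

lemma prod_Pow:
  assumes "finite A"
  shows "(\<Prod>\<rho>\<in>Pow A. p (card \<rho> + s)) = cube_prod p (card A) s"
  using assms
proof (induction A arbitrary: s rule: finite_induct)
  case (insert a A)
  have "(\<Prod>\<rho>\<in>Pow A. p (card (insert a \<rho>) + s)) = (\<Prod>\<rho>\<in>Pow A. p (card \<rho> + Suc s))"
  proof (rule prod.cong[OF refl])
    fix \<rho> assume "\<rho> \<in> Pow A"
    then have "finite \<rho>" "a \<notin> \<rho>" using insert.hyps finite_subset by auto
    then show "p (card (insert a \<rho>) + s) = p (card \<rho> + Suc s)" by simp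
  qed
  then show ?case unfolding prod_Pow_insert[OF insert.hyps(1,2)]
    by (simp only: insert.IH card_insert_disjoint[OF insert.hyps] cube_prod.simps)
qed simp

locale face_probs =
  fixes p :: "nat \<Rightarrow> real"
  assumes p01: "0 \<le> p i" "p i \<le> 1" and p0: "p 0 = 1"
begin

abbreviation "Q j \<equiv> cube_prod p j 0"
abbreviation "R j \<equiv> cube_prod p j (Suc 0)"
abbreviation "W j \<equiv> cube_prod p j (Suc (Suc 0))"

lemma cube_prod_01: "0 \<le> cube_prod p j s" "cube_prod p j s \<le> 1"
proof -
  have "0 \<le> cube_prod p j s \<and> cube_prod p j s \<le> 1"
  proof (induction j arbitrary: s)
    case (Suc j)
    then show ?case using mult_le_one[of "cube_prod p j s" "cube_prod p j (Suc s)"] by auto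
  qed (simp add: p01)
  then show "0 \<le> cube_prod p j s" "cube_prod p j s \<le> 1" by auto
qed

lemma cube_prod_antimono: "i \<le> j \<Longrightarrow> cube_prod p j s \<le> cube_prod p i s"
proof (induction j rule: dec_induct)
  case (step j)
  have "cube_prod p (Suc j) s \<le> cube_prod p j s"
    using cube_prod_01 by (simp add: mult_left_le)
  then show ?case using step by simp
qed simp

text \<open>A simplex is built one vertex at a time, the step from \<open>j\<close> to
  \<open>j+1\<close> vertices contributing \<open>R j\<close>.\<close>

lemma Q_eq_prod: "Q b = (\<Prod>j<b. R j)"
  by (induction b) (simp_all add: p0)

text \<open>\<open>R (Suc j) = R j * W j\<close>, and \<open>W\<close> decreases in
  \<open>j\<close>; so a lower bound on \<open>W k\<close> carries an upper bound for
  \<open>R k\<close> over to all smaller indices.\<close>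

lemma R_le_R: "j \<le> k \<Longrightarrow> R j * W k ^ (k - j) \<le> R k"
proof (induction j rule: inc_induct)
  case (step j)
  have "R j * W k ^ (k - j) = R j * W k * W k ^ (k - Suc j)"
    using step by (simp add: Suc_diff_Suc flip: power_Suc)
  also have "\<dots> \<le> R j * W j * W k ^ (k - Suc j)"
    using step cube_prod_01 cube_prod_antimono[of j k]
    by (intro mult_right_mono mult_left_mono) auto
  finally show ?case using step by simp
qed simp

end

text \<open>If \<open>n * R k\<close> were at most \<open>B\<close> for some large \<open>n\<close>,
  then \<open>n * R k * W k\<close>, which is close to \<open>c\<close>, would keep
  \<open>W k\<close> above a constant; by \<open>R_le_R\<close> every \<open>n * R j\<close> with
  \<open>j \<le> k\<close> would be bounded, and with them their product
  \<open>n ^ (k+1) * Q (k+1)\<close>. Hence \<open>n * R k\<close> diverges, and \<open>W k\<close>,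
  the quotient of \<open>n * R (k+1)\<close> by it, tends to 0.\<close>

lemma face_probs_asymptotics:
  fixes p :: "nat \<Rightarrow> nat \<Rightarrow> real" and k :: nat
  assumes p: "\<And>n. face_probs (p n)" and c: "c > 0"
    and N: "filterlim (\<lambda>n. real n ^ (k+1) * cube_prod (p n) (k+1) 0) at_top sequentially"
    and r: "(\<lambda>n. real n * cube_prod (p n) (k+1) 1) \<longlonglongrightarrow> c"
  shows "j \<le> k \<Longrightarrow> filterlim (\<lambda>n. real n * cube_prod (p n) j 1) at_top sequentially"
    "(\<lambda>n. cube_prod (p n) k 2) \<longlonglongrightarrow> 0"
    "1 \<le> b \<Longrightarrow> b \<le> k + 2 \<Longrightarrow> filterlim (\<lambda>n. real n ^ b * cube_prod (p n) b 0) at_top sequentially"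
proof -
  have r_ev: "\<forall>\<^sub>F n in sequentially. real n * cube_prod (p n) (k+1) 1 > c / 2"
    using r c by (intro order_tendstoD) auto
  have Rk: "filterlim (\<lambda>n. real n * cube_prod (p n) k 1) at_top sequentially"
    unfolding filterlim_at_top_gt[where c=0]
  proof (intro allI impI)
    fix B :: real assume B: "B > 0"
    \<comment> \<open>If \<open>n * R k \<le> B\<close> while \<open>n * R k * W k\<close> exceeds
      \<open>c / 2\<close>, then \<open>W k\<close> is at least this number.\<close>
    define w where "w = c / (2 * B)"
    have w: "w > 0" using B c by (simp add: w_def)
    have "\<forall>\<^sub>F n in sequentially. real n ^ (k+1) * cube_prod (p n) (k+1) 0 > (B / w ^ k) ^ (k+1)"
      using N by (simp add: filterlim_at_top_dense)
    then show "\<forall>\<^sub>F n in sequentially. B \<le> real n * cube_prod (p n) k 1"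
      using r_ev
    proof eventually_elim
      case (elim n)
      interpret face_probs "p n" by (rule p)
      show ?case
      proof (rule ccontr)
        assume "\<not> ?thesis"
        then have nR: "real n * R k \<le> B" by simp
        have "c / 2 < real n * R k * W k" using elim(2) by (simp add: mult.assoc)
        also have "\<dots> \<le> B * W k" using nR cube_prod_01 by (intro mult_right_mono) auto
        finally have "w \<le> W k" using B by (simp add: w_def field_simps)
        then have "w \<le> 1" using cube_prod_01(2)[of k "Suc (Suc 0)"] by linarith
        have nRj: "real n * R j \<le> B / w ^ k" if "j \<le> k" for j
        proof -
          have "w ^ k \<le> w ^ (k - j)" using w \<open>w \<le> 1\<close> by (intro power_decreasing) auto
          also have "\<dots> \<le> W k ^ (k - j)" using w \<open>w \<le> W k\<close> by (intro power_mono) auto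
          finally have "real n * R j * w ^ k \<le> real n * (R j * W k ^ (k - j))"
            using cube_prod_01 by (simp add: mult.assoc mult_left_mono)
          also have "\<dots> \<le> real n * R k" using R_le_R[OF that] by (intro mult_left_mono) auto
          also have "\<dots> \<le> B" by (rule nR)
          finally show ?thesis using w by (simp add: field_simps)
        qed
        have "real n ^ (k+1) * Q (k+1) = (\<Prod>j<k+1. real n * R j)"
          by (simp only: Q_eq_prod prod.distrib prod_constant card_lessThan)
        also have "\<dots> \<le> (\<Prod>j<k+1. B / w ^ k)"
        proof (rule prod_mono)
          fix j assume "j \<in> {..<k+1}"
          then show "0 \<le> real n * R j \<and> real n * R j \<le> B / w ^ k"
            using nRj[of j] cube_prod_01(1)[of j] by simp
        qed
        also have "\<dots> = (B / w ^ k) ^ (k+1)" by (simp only: prod_constant card_lessThan)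
        finally show False using elim(1) by linarith
      qed
    qed
  qed
  show Rj: "filterlim (\<lambda>n. real n * cube_prod (p n) j 1) at_top sequentially" if "j \<le> k" for j
  proof (rule filterlim_at_top_mono[OF Rk])
    show "\<forall>\<^sub>F n in sequentially. real n * cube_prod (p n) k 1 \<le> real n * cube_prod (p n) j 1"
      using face_probs.cube_prod_antimono[OF p that] by (intro always_eventually allI mult_left_mono) auto
  qed
  have "(\<lambda>n. (real n * cube_prod (p n) (k+1) 1) / (real n * cube_prod (p n) k 1)) \<longlonglongrightarrow> 0"
    by (rule real_tendsto_divide_at_top[OF r Rk])
  moreover have "\<forall>\<^sub>F n in sequentially. (real n * cube_prod (p n) (k+1) 1) / (real n * cube_prod (p n) k 1) = cube_prod (p n) k 2"
    using filterlim_at_top_dense[THEN iffD1, OF Rk, rule_format, of 0]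
    by eventually_elim (auto simp: numeral_2_eq_2 zero_less_mult_iff)
  ultimately show "(\<lambda>n. cube_prod (p n) k 2) \<longlonglongrightarrow> 0"
    by (rule Lim_transform_eventually)
  have Qb: "filterlim (\<lambda>n. real n ^ b * cube_prod (p n) b 0) at_top sequentially" if "1 \<le> b" "b \<le> k + 1" for b
    using that
  proof (induction b rule: nat_induct_at_least)
    case base
    have "(\<lambda>n. real n * cube_prod (p n) 0 1) = (\<lambda>n. real n ^ 1 * cube_prod (p n) 1 0)"
      by (simp add: face_probs.p0[OF p])
    then show ?case using Rj[of 0] by simp
  next
    case (Suc b)
    have "filterlim (\<lambda>n. (real n ^ b * cube_prod (p n) b 0) * (real n * cube_prod (p n) b 1)) at_top sequentially"
    proof (rule filterlim_at_top_mult_at_top)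
      show "filterlim (\<lambda>n. real n ^ b * cube_prod (p n) b 0) at_top sequentially" using Suc by simp
      show "filterlim (\<lambda>n. real n * cube_prod (p n) b 1) at_top sequentially" using Suc by (intro Rj) simp
    qed
    then show ?case by (simp add: algebra_simps)
  qed
  show "filterlim (\<lambda>n. real n ^ b * cube_prod (p n) b 0) at_top sequentially" if "1 \<le> b" "b \<le> k + 2" for b
  proof (cases "b = k + 2")
    case True
    have "filterlim (\<lambda>n. (real n * cube_prod (p n) (k+1) 1) * (real n ^ (k+1) * cube_prod (p n) (k+1) 0)) at_top sequentially"
      by (rule filterlim_tendsto_pos_mult_at_top[OF r c Qb]) auto
    then show ?thesis unfolding True by (simp add: algebra_simps)
  qed (use Qb that in auto)
qed

section \<open>The product structure of spatially independent complexes\<close>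

definition field :: "nat \<Rightarrow> (nat \<Rightarrow> real) \<Rightarrow> (nat set \<Rightarrow> bool) pmf" where
  "field n p = Pi_pmf (Pow {1..n}) False (\<lambda>\<sigma>. bernoulli_pmf (p (card \<sigma>)))"

definition cplx :: "nat \<Rightarrow> (nat set \<Rightarrow> bool) \<Rightarrow> nat set set" where
  "cplx n \<omega> = {\<sigma>. \<sigma> \<subseteq> {1..n} \<and> (\<forall>\<rho>\<subseteq>\<sigma>. \<omega> \<rho>)}"

lemma finite_S: "finite (S n)"
  by (rule finite_subset[of _ "Pow (Pow {1..n})"]) (auto simp: S_def subcomplex_def)

lemma S_finite: "Y \<in> S n \<Longrightarrow> finite Y"
  by (rule finite_subset[of _ "Pow {1..n}"]) (auto simp: S_def subcomplex_def)

lemma S_Pow_subset: "Y \<in> S n \<Longrightarrow> \<sigma> \<in> Y \<Longrightarrow> Pow \<sigma> \<subseteq> Y"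
  by (auto simp: S_def subcomplex_def)

lemma Pow_S: "\<sigma> \<subseteq> {1..n} \<Longrightarrow> Pow \<sigma> \<in> S n"
  by (auto simp: S_def subcomplex_def)

text \<open>\<open>Pcont\<close> adds up the point masses above \<open>Y\<close>; descending
  induction on the size of \<open>Y\<close> recovers each of them.\<close>

lemma pmf_eq_Pcont:
  assumes X: "set_pmf X \<subseteq> S n" "set_pmf X' \<subseteq> S n" and eq: "\<And>Y. Y \<in> S n \<Longrightarrow> Pcont X Y = Pcont X' Y"
  shows "X = X'"
proof (rule pmf_eqI)
  have Pc: "Pcont Z Y = pmf Z Y + (\<Sum>Y'\<in>{Y'\<in>S n. Y \<subset> Y'}. pmf Z Y')"
    if "set_pmf Z \<subseteq> S n" "Y \<in> S n" for Z Y
  proof -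
    have "Pcont Z Y = measure_pmf.prob Z {Y'\<in>S n. Y \<subseteq> Y'}" unfolding Pcont_def
      by (rule measure_pmf.finite_measure_eq_AE) (use that in \<open>auto simp: AE_measure_pmf_iff\<close>)
    also have "\<dots> = (\<Sum>Y'\<in>{Y'\<in>S n. Y \<subseteq> Y'}. pmf Z Y')"
      using finite_S by (simp add: measure_measure_pmf_finite)
    also have "{Y'\<in>S n. Y \<subseteq> Y'} = insert Y {Y'\<in>S n. Y \<subset> Y'}" using that by auto
    finally show ?thesis using finite_S by simp
  qed
  fix Y
  show "pmf X Y = pmf X' Y"
  proof (cases "Y \<in> S n")
    case True
    then show ?thesis
    proof (induction "card (Pow {1..n}) - card Y" arbitrary: Y rule: less_induct)
      case less
      have "pmf X Y' = pmf X' Y'" if Y': "Y' \<in> S n" "Y \<subset> Y'" for Y'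
      proof (rule less.hyps[OF _ Y'(1)])
        have "card Y < card Y'" using Y' S_finite psubset_card_mono by blast
        moreover have "card Y' \<le> card (Pow {1..n})"
          using Y' by (intro card_mono) (auto simp: S_def subcomplex_def)
        ultimately show "card (Pow {1..n}) - card Y' < card (Pow {1..n}) - card Y" by linarith
      qed
      then have "(\<Sum>Y'\<in>{Y'\<in>S n. Y \<subset> Y'}. pmf X Y') = (\<Sum>Y'\<in>{Y'\<in>S n. Y \<subset> Y'}. pmf X' Y')"
        by (intro sum.cong) auto
      then show ?case using Pc[OF X(1) less.prems] Pc[OF X(2) less.prems] eq[OF less.prems] by simp
    qed
  next
    case False
    then show ?thesis using X by (metis pmf_eq_0_set_pmf subsetD)
  qed
qed

lemma prob_field_open:
  assumes p: "\<And>i. 0 \<le> p i" "\<And>i. p i \<le> 1" and Y: "Y \<subseteq> Pow {1..n}"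
  shows "measure_pmf.prob (field n p) {\<omega>. \<forall>\<sigma>\<in>Y. \<omega> \<sigma>} = (\<Prod>\<sigma>\<in>Y. p (card \<sigma>))"
proof -
  let ?B = "\<lambda>\<sigma>. if \<sigma> \<in> Y then {True} else UNIV"
  have "{\<omega>. \<forall>\<sigma>\<in>Y. \<omega> \<sigma>} = Pi (Pow {1..n}) ?B" using Y by (auto simp: Pi_def split: if_splits)
  then have "measure_pmf.prob (field n p) {\<omega>. \<forall>\<sigma>\<in>Y. \<omega> \<sigma>}
     = (\<Prod>\<sigma>\<in>Pow {1..n}. measure_pmf.prob (bernoulli_pmf (p (card \<sigma>))) (?B \<sigma>))"
    unfolding field_def by (simp only: measure_Pi_pmf_Pi[OF finite_Pow_iff[THEN iffD2, OF finite_atLeastAtMost]])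
  also have "\<dots> = (\<Prod>\<sigma>\<in>Pow {1..n}. if \<sigma> \<in> Y then p (card \<sigma>) else 1)"
    by (rule prod.cong) (use p in \<open>auto simp: measure_pmf_single\<close>)
  also have "\<dots> = (\<Prod>\<sigma>\<in>Y. p (card \<sigma>))"
    using Y by (subst prod.If_cases) (auto intro!: prod.cong)
  finally show ?thesis .
qed

lemma subset_cplx:
  assumes "Y \<in> S n"
  shows "Y \<subseteq> cplx n \<omega> \<longleftrightarrow> (\<forall>\<sigma>\<in>Y. \<omega> \<sigma>)"
proof
  assume "Y \<subseteq> cplx n \<omega>"
  then show "\<forall>\<sigma>\<in>Y. \<omega> \<sigma>" unfolding cplx_def by blast
next
  assume w: "\<forall>\<sigma>\<in>Y. \<omega> \<sigma>"
  show "Y \<subseteq> cplx n \<omega>"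
  proof
    fix \<sigma> assume s: "\<sigma> \<in> Y"
    then have "\<sigma> \<subseteq> {1..n}" using assms unfolding S_def subcomplex_def by blast
    then show "\<sigma> \<in> cplx n \<omega>" using S_Pow_subset[OF assms s] w unfolding cplx_def by blast
  qed
qed

lemma cplx_S:
  assumes "\<omega> {}"
  shows "cplx n \<omega> \<in> S n"
  unfolding S_def subcomplex_def mem_Collect_eq
proof (intro conjI ballI allI impI)
  show "cplx n \<omega> \<subseteq> Pow {1..n}" unfolding cplx_def by blast
  show "{} \<in> cplx n \<omega>" using assms by (simp add: cplx_def)
  show "\<tau> \<in> cplx n \<omega>" if "\<sigma> \<in> cplx n \<omega>" "\<tau> \<subseteq> \<sigma>" for \<sigma> \<tau>
    using that unfolding cplx_def mem_Collect_eq by (meson order_trans)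
qed

lemma field_empty: "p 0 = 1 \<Longrightarrow> \<omega> \<in> set_pmf (field n p) \<Longrightarrow> \<omega> {}"
proof -
  assume p: "p 0 = 1" and w: "\<omega> \<in> set_pmf (field n p)"
  have "\<omega> {} \<in> set_pmf (bernoulli_pmf (p (card {})))"
    using w by (simp add: field_def set_Pi_pmf PiE_dflt_def) (drule spec[of _ "{}"], simp)
  then have "pmf (bernoulli_pmf 1) (\<omega> {}) \<noteq> 0" using p by (simp add: set_pmf_iff)
  then show "\<omega> {}" by (cases "\<omega> {}") auto
qed

text \<open>A bijection between two sets of equal size extends to a permutation of all vertices, and
  homogeneity makes \<open>Pcont\<close> invariant under it.\<close>

lemma homogeneous_Pcont:
  assumes X: "homogeneous n X" and st: "\<sigma> \<subseteq> {1..n}" "\<tau> \<subseteq> {1..n}" "card \<sigma> = card \<tau>"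
  shows "\<exists>g. inj g \<and> g ` \<sigma> = \<tau> \<and> (\<forall>Y. Pcont X ((\<lambda>\<sigma>. g ` \<sigma>) ` Y) = Pcont X Y)"
proof -
  have fin: "finite \<sigma>" "finite \<tau>" using st finite_subset by auto
  obtain f where f: "bij_betw f \<sigma> \<tau>" using st(3) fin finite_same_card_bij by blast
  have "card ({1..n} - \<sigma>) = card ({1..n} - \<tau>)"
    using st fin by (simp add: card_Diff_subset)
  then have "\<exists>h. bij_betw h ({1..n} - \<sigma>) ({1..n} - \<tau>)"
    by (intro finite_same_card_bij) simp_all
  then obtain h where h: "bij_betw h ({1..n} - \<sigma>) ({1..n} - \<tau>)" ..
  define g where "g x = (if x \<in> \<sigma> then f x else if x \<in> {1..n} then h x else x)" for x
  have "bij_betw g \<sigma> \<tau>" using f by (subst bij_betw_cong[of _ g f]) (auto simp: g_def)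
  moreover have "bij_betw g ({1..n} - \<sigma>) ({1..n} - \<tau>)"
    using h by (subst bij_betw_cong[of _ g h]) (auto simp: g_def)
  ultimately have "bij_betw g (\<sigma> \<union> ({1..n} - \<sigma>)) (\<tau> \<union> ({1..n} - \<tau>))"
    by (rule bij_betw_combine) auto
  moreover have "\<sigma> \<union> ({1..n} - \<sigma>) = {1..n}" "\<tau> \<union> ({1..n} - \<tau>) = {1..n}" using st by auto
  ultimately have "bij_betw g {1..n} {1..n}" by simp
  then have g: "g permutes {1..n}" by (rule bij_imp_permutes) (use st in \<open>auto simp: g_def\<close>)
  show ?thesis
  proof (intro exI conjI allI)
    show inj: "inj g" using g by (rule permutes_inj)
    show "g ` \<sigma> = \<tau>" using \<open>bij_betw g \<sigma> \<tau>\<close> by (simp add: bij_betw_def)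
    fix Y
    have eq: "map_pmf (\<lambda>Z. (\<lambda>\<sigma>. g ` \<sigma>) ` Z) X = X"
      using X[unfolded homogeneous_def, rule_format, OF g] .
    have "Pcont X ((\<lambda>\<sigma>. g ` \<sigma>) ` Y) = measure_pmf.prob (map_pmf (\<lambda>Z. (\<lambda>\<sigma>. g ` \<sigma>) ` Z) X) {Z. (\<lambda>\<sigma>. g ` \<sigma>) ` Y \<subseteq> Z}"
      unfolding eq Pcont_def ..
    also have "\<dots> = measure_pmf.prob X {Z. (\<lambda>\<sigma>. g ` \<sigma>) ` Y \<subseteq> (\<lambda>\<sigma>. g ` \<sigma>) ` Z}"
      by (simp add: measure_map_pmf vimage_def)
    also have "{Z. (\<lambda>\<sigma>. g ` \<sigma>) ` Y \<subseteq> (\<lambda>\<sigma>. g ` \<sigma>) ` Z} = {Z. Y \<subseteq> Z}"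
    proof -
      have "inj (\<lambda>\<sigma>. g ` \<sigma>)" using inj by (simp add: inj_on_def inj_image_eq_iff)
      then show ?thesis by (intro Collect_cong inj_image_subset_iff)
    qed
    finally show "Pcont X ((\<lambda>\<sigma>. g ` \<sigma>) ` Y) = Pcont X Y" unfolding Pcont_def .
  qed
qed

lemma Pcont_mono: "Y \<subseteq> Y' \<Longrightarrow> Pcont X Y' \<le> Pcont X Y"
  unfolding Pcont_def by (rule measure_pmf.finite_measure_mono) auto

text \<open>\<open>p j\<close> is the conditional probability that a set of size \<open>j\<close> is a face, given that its proper subsets are.\<close>
lemma random_subcomplex_field:
  assumes X: "random_subcomplex n X" "homogeneous n X" "spatially_independent n X"
  obtains p where "face_probs p" "X = map_pmf (cplx n) (field n p)"
proof -
  define a where "a j = Pcont X (Pow {1..j})" for j :: nat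
  define b where "b j = Pcont X (Pow {1..j} - {{1..j}})" for j :: nat
  \<comment> \<open>If \<open>b j\<close> vanishes, the proper subsets of a \<open>j\<close>-set are
    almost surely not all present, and with the default 0 both sides of the product formula vanish.
    The empty simplex is always present.\<close>
  define p where "p j = (if j = 0 then 1 else if b j > 0 then a j / b j else 0)" for j
  have b0: "0 \<le> a j" "0 \<le> b j" "a j \<le> b j" for j
    unfolding a_def b_def using Pcont_mono[of "Pow {1..j} - {{1..j}}" "Pow {1..j}" X]
    by (simp_all add: Pcont_def)
  have fp: "face_probs p"
    by unfold_locales (use b0 in \<open>auto simp: p_def divide_le_eq_1\<close>)
  have ab: "Pcont X (Pow \<sigma>) = a (card \<sigma>)" "Pcont X (Pow \<sigma> - {\<sigma>}) = b (card \<sigma>)" if sn: "\<sigma> \<subseteq> {1..n}" for \<sigma>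
  proof -
    have "card \<sigma> \<le> n" using card_mono[OF _ sn] by simp
    then have sub: "{1..card \<sigma>} \<subseteq> {1..n}" by auto
    have "card {1..card \<sigma>} = card \<sigma>" by simp
    from homogeneous_Pcont[OF X(2) sub sn this]
    obtain g where g: "inj g \<and> g ` {1..card \<sigma>} = \<sigma> \<and> (\<forall>Y. Pcont X ((\<lambda>\<sigma>. g ` \<sigma>) ` Y) = Pcont X Y)" ..
    then have g: "inj g" "g ` {1..card \<sigma>} = \<sigma>" "\<And>Y. Pcont X ((\<lambda>\<sigma>. g ` \<sigma>) ` Y) = Pcont X Y" by simp_all
    have P: "(\<lambda>\<sigma>. g ` \<sigma>) ` Pow {1..card \<sigma>} = Pow \<sigma>"
      by (rule image_Pow_surj[OF g(2)])
    have "inj (\<lambda>\<sigma>. g ` \<sigma>)" using g(1) by (simp add: inj_on_def inj_image_eq_iff)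
    then have "(\<lambda>\<sigma>. g ` \<sigma>) ` (Pow {1..card \<sigma>} - {{1..card \<sigma>}}) = Pow \<sigma> - {\<sigma>}"
      by (subst image_set_diff) (simp_all only: P image_insert image_empty g(2))
    with P show "Pcont X (Pow \<sigma>) = a (card \<sigma>)" "Pcont X (Pow \<sigma> - {\<sigma>}) = b (card \<sigma>)"
      using g(3)[of "Pow {1..card \<sigma>}"] g(3)[of "Pow {1..card \<sigma>} - {{1..card \<sigma>}}"] by (simp_all add: a_def b_def)
  qed
  have XS: "set_pmf X \<subseteq> S n" using X(1) by (simp add: random_subcomplex_def)
  have main: "Pcont X Y = (\<Prod>\<sigma>\<in>Y. p (card \<sigma>))" if "Y \<in> S n" for Y
    using that
  proof (induction "card Y" arbitrary: Y rule: less_induct)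
    case less
    have finY: "finite Y" using less.prems by (rule S_finite)
    have e: "{} \<in> Y" using less.prems by (simp add: S_def subcomplex_def)
    show ?case
    proof (cases "Y = {{}}")
      case True
      have "Pcont X Y = measure_pmf.prob X UNIV" unfolding Pcont_def
        by (rule measure_pmf.finite_measure_eq_AE)
           (use XS True in \<open>auto simp: AE_measure_pmf_iff S_def subcomplex_def\<close>)
      then show ?thesis using True by (simp add: p_def)
    next
      case False
      then have "Y - {{}} \<noteq> {}" using e by auto
      \<comment> \<open>A simplex of largest dimension is removed, so that what remains is still a
        complex.\<close>
      then have "Max (card ` (Y - {{}})) \<in> card ` (Y - {{}})" using finY by (intro Max_in) auto
      then obtain \<sigma> where "\<sigma> \<in> Y - {{}}" "Max (card ` (Y - {{}})) = card \<sigma>" by blast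
      then have \<sigma>: "\<sigma> \<in> Y - {{}}" "\<And>\<tau>. \<tau> \<in> Y - {{}} \<Longrightarrow> card \<tau> \<le> card \<sigma>"
        using finY Max_ge[of "card ` (Y - {{}})"] by auto
      have sn: "\<sigma> \<subseteq> {1..n}" using \<sigma> less.prems by (auto simp: S_def subcomplex_def)
      have fin: "finite \<sigma>" using sn finite_subset by auto
      have max: "\<tau> = \<sigma>" if "\<tau> \<in> Y" "\<sigma> \<subseteq> \<tau>" for \<tau>
      proof -
        have "finite \<tau>" using that less.prems finite_subset[of \<tau> "{1..n}"] by (auto simp: S_def subcomplex_def)
        moreover have "card \<tau> \<le> card \<sigma>" using \<sigma> that by (cases "\<tau> = {}") auto
        ultimately show ?thesis using card_seteq that(2) by metis
      qed
      have Y1: "Y - {\<sigma>} \<in> S n"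
        unfolding S_def subcomplex_def mem_Collect_eq
      proof (intro conjI ballI allI impI)
        show "Y - {\<sigma>} \<subseteq> Pow {1..n}" using less.prems by (auto simp: S_def subcomplex_def)
        show "{} \<in> Y - {\<sigma>}" using e \<sigma> by auto
        fix \<sigma>' \<tau> assume a: "\<sigma>' \<in> Y - {\<sigma>}" "\<tau> \<subseteq> \<sigma>'"
        then have "\<tau> \<in> Y" using S_Pow_subset[OF less.prems, of \<sigma>'] by auto
        moreover have "\<tau> \<noteq> \<sigma>" using max[of \<sigma>'] a by auto
        ultimately show "\<tau> \<in> Y - {\<sigma>}" by simp
      qed
      have Y2: "Pow \<sigma> \<in> S n" using sn by (rule Pow_S)
      have un: "(Y - {\<sigma>}) \<union> Pow \<sigma> = Y" using \<sigma> S_Pow_subset[OF less.prems, of \<sigma>] by auto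
      have int: "(Y - {\<sigma>}) \<inter> Pow \<sigma> = Pow \<sigma> - {\<sigma>}" using \<sigma> S_Pow_subset[OF less.prems, of \<sigma>] by auto
      \<comment> \<open>Spatial independence for \<open>Y - {\<sigma>}\<close> and the full simplex
        \<open>Pow \<sigma>\<close>, which meet in the boundary of \<sigma>.\<close>
      have rec: "Pcont X Y * b (card \<sigma>) = Pcont X (Y - {\<sigma>}) * a (card \<sigma>)"
        using X(3)[unfolded spatially_independent_def, rule_format, OF Y1 Y2]
        by (simp only: un int ab[OF sn])
      have IH: "Pcont X (Y - {\<sigma>}) = (\<Prod>\<sigma>\<in>Y - {\<sigma>}. p (card \<sigma>))"
      proof (rule less.hyps[OF _ Y1])
        show "card (Y - {\<sigma>}) < card Y" using finY \<sigma> by (intro card_Diff1_less) auto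
      qed
      have "card \<sigma> \<noteq> 0" using \<sigma> fin by auto
      have "Pcont X Y = p (card \<sigma>) * Pcont X (Y - {\<sigma>})"
      proof (cases "b (card \<sigma>) > 0")
        case True
        then show ?thesis using rec \<open>card \<sigma> \<noteq> 0\<close> by (simp add: p_def field_simps)
      next
        case False
        then have "Pcont X (Pow \<sigma> - {\<sigma>}) = 0" using b0(2)[of "card \<sigma>"] ab[OF sn] by linarith
        moreover have "Pow \<sigma> - {\<sigma>} \<subseteq> Y" using S_Pow_subset[OF less.prems, of \<sigma>] \<sigma> by auto
        ultimately have "Pcont X Y \<le> 0" using Pcont_mono[of "Pow \<sigma> - {\<sigma>}" Y X] by simp
        moreover have "0 \<le> Pcont X Y" by (simp add: Pcont_def)
        ultimately have "Pcont X Y = 0" by linarith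
        then show ?thesis using False \<open>card \<sigma> \<noteq> 0\<close> by (simp add: p_def)
      qed
      then show ?thesis unfolding IH using \<sigma> finY by (simp add: prod.remove[of Y \<sigma>])
    qed
  qed
  interpret face_probs p by (rule fp)
  have "X = map_pmf (cplx n) (field n p)"
  proof (rule pmf_eq_Pcont[OF XS])
    show "set_pmf (map_pmf (cplx n) (field n p)) \<subseteq> S n"
      using cplx_S field_empty[of p, OF p0] by auto
    fix Y assume Y: "Y \<in> S n"
    have "Pcont (map_pmf (cplx n) (field n p)) Y = measure_pmf.prob (field n p) {\<omega>. \<forall>\<sigma>\<in>Y. \<omega> \<sigma>}"
      by (simp add: Pcont_def measure_map_pmf vimage_def subset_cplx[OF Y])
    also have "\<dots> = (\<Prod>\<sigma>\<in>Y. p (card \<sigma>))"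
      by (rule prob_field_open) (use p01 Y in \<open>auto simp: S_def subcomplex_def\<close>)
    finally show "Pcont X Y = Pcont (map_pmf (cplx n) (field n p)) Y" using main[OF Y] by simp
  qed
  then show ?thesis by (rule that[OF fp])
qed

section \<open>Exact occurrence of tree-like neighbourhoods\<close>

text \<open>\<open>H\<close> collects the cofaces of a complex on the vertex set \<open>V\<close>, grown from \<open>v\<close> by gluing each new vertex
  to one existing face.\<close>
inductive ktree :: "nat \<Rightarrow> nat set \<Rightarrow> nat set \<Rightarrow> nat set set \<Rightarrow> bool" for k v where
  base: "ktree k v v {}"
| step: "ktree k v V H \<Longrightarrow> w = v \<or> (\<exists>a\<in>H. w \<subseteq> a) \<Longrightarrow> card w = k+1 \<Longrightarrow> z \<notin> V
    \<Longrightarrow> ktree k v (insert z V) (insert (insert z w) H)"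

lemma ktree_basic:
  assumes "ktree k v V H" "finite v" "card v = k+1"
  shows "finite V" "v \<subseteq> V" "finite H" "a \<in> H \<Longrightarrow> a \<subseteq> V \<and> card a = k+2" "card V = k+1 + card H"
proof -
  have "finite V \<and> v \<subseteq> V \<and> finite H \<and> (\<forall>a\<in>H. a \<subseteq> V \<and> card a = k+2) \<and> card V = k+1 + card H"
    using assms
  proof (induction rule: ktree.induct)
    case (step V H w z)
    then have IH: "finite V" "v \<subseteq> V" "finite H" "\<forall>a\<in>H. a \<subseteq> V \<and> card a = k+2" "card V = k+1 + card H" by auto
    have wV: "w \<subseteq> V" using step.hyps(2) IH by auto
    then have "finite w" "z \<notin> w" using IH(1) finite_subset step.hyps(4) by auto
    moreover have "insert z w \<notin> H" using IH(4) step.hyps(4) by auto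
    ultimately show ?case using IH wV step.hyps(3,4) by auto
  qed auto
  then show "finite V" "v \<subseteq> V" "finite H" "a \<in> H \<Longrightarrow> a \<subseteq> V \<and> card a = k+2" "card V = k+1 + card H" by auto
qed

text \<open>The newest vertex of a clique has all its neighbours in the face it was attached to.\<close>
lemma ktree_clique:
  assumes "ktree k v V H" "finite v" "card v = k+1"
    and "C \<subseteq> V" "card C = k+2" "\<And>x y. x \<in> C \<Longrightarrow> y \<in> C \<Longrightarrow> x \<noteq> y \<Longrightarrow> \<exists>\<sigma>\<in>insert v H. {x, y} \<subseteq> \<sigma>"
  shows "C \<in> H"
  using assms
proof (induction arbitrary: C rule: ktree.induct)
  case base
  then have "card C \<le> card v" by (intro card_mono) auto
  then show ?case using base by simp
next
  case (step V H w z)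
  have kb: "finite V" "v \<subseteq> V" "\<And>a. a \<in> H \<Longrightarrow> a \<subseteq> V"
    using ktree_basic[OF step.hyps(1) step.prems(1,2)] by auto
  have wV: "w \<subseteq> V" using step.hyps(2) kb by auto
  show ?case
  proof (cases "z \<in> C")
    case False
    have "C \<in> H"
    proof (rule step.IH[OF step.prems(1,2)])
      show "C \<subseteq> V" using step.prems(3) False by auto
      show "card C = k+2" by (rule step.prems(4))
      fix x y assume xy: "x \<in> C" "y \<in> C" "x \<noteq> y"
      obtain \<sigma> where s: "\<sigma> \<in> insert v (insert (insert z w) H)" "{x, y} \<subseteq> \<sigma>"
        using step.prems(5)[OF xy] by blast
      show "\<exists>\<sigma>\<in>insert v H. {x, y} \<subseteq> \<sigma>"
      proof (cases "\<sigma> = insert z w")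
        case True
        then have "{x, y} \<subseteq> w" using s(2) xy False by auto
        then show ?thesis using step.hyps(2) by auto
      qed (use s in auto)
    qed
    then show ?thesis by simp
  next
    case True
    have "C - {z} \<subseteq> w"
    proof
      fix y assume y: "y \<in> C - {z}"
      then obtain \<sigma> where s: "\<sigma> \<in> insert v (insert (insert z w) H)" "{z, y} \<subseteq> \<sigma>"
        using step.prems(5)[of z y] True by blast
      have "\<sigma> = insert z w" using s kb step.hyps(4) by auto
      then show "y \<in> w" using s(2) y by auto
    qed
    moreover have "finite w" using wV kb(1) finite_subset by auto
    moreover have "card w = card (C - {z})" using True step.prems(4) step.hyps(3) by simp
    ultimately have "C - {z} = w" using card_subset_eq by metis
    then show ?thesis using True by auto
  qed
qed

section \<open>Probability that a given neighbourhood occurs exactly\<close>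

definition skel :: "nat set \<Rightarrow> nat set set \<Rightarrow> nat set set" where
  "skel v H = (\<Union>\<sigma>\<in>insert v H. Pow \<sigma>)"

lemma finite_skel:
  assumes "ktree k v V H" "finite v" "card v = k+1"
  shows "skel v H \<subseteq> Pow V" "finite (skel v H)"
proof -
  note b = ktree_basic[OF assms]
  show "skel v H \<subseteq> Pow V" unfolding skel_def using b(2,4) by blast
  then show "finite (skel v H)" using b(1) finite_subset by blast
qed

lemma (in face_probs) prod_Pow_s:
  assumes "finite A"
  shows "(\<Prod>\<rho>\<in>Pow A. p (card \<rho>)) = Q (card A)" "(\<Prod>\<rho>\<in>Pow A. p (Suc (card \<rho>))) = R (card A)"
    "(\<Prod>\<rho>\<in>Pow A. p (Suc (Suc (card \<rho>)))) = W (card A)"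
  using prod_Pow[OF assms, of p 0] prod_Pow[OF assms, of p "Suc 0"] prod_Pow[OF assms, of p "Suc (Suc 0)"] by simp_all

lemma (in face_probs) prod_star:
  assumes "finite A" "z \<notin> A"
  shows "(\<Prod>\<sigma>\<in>insert z ` Pow A. p (card \<sigma>)) = R (card A)"
proof -
  have "inj_on (insert z) (Pow A)" using assms by (auto simp: inj_on_def)
  then have "(\<Prod>\<sigma>\<in>insert z ` Pow A. p (card \<sigma>)) = (\<Prod>\<rho>\<in>Pow A. p (card (insert z \<rho>)))"
    by (simp add: prod.reindex)
  also have "\<dots> = (\<Prod>\<rho>\<in>Pow A. p (Suc (card \<rho>)))"
  proof (rule prod.cong[OF refl])
    fix \<rho> assume "\<rho> \<in> Pow A"
    then have "finite \<rho>" "z \<notin> \<rho>" using assms finite_subset by auto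
    then show "p (card (insert z \<rho>)) = p (Suc (card \<rho>))" by simp
  qed
  finally show ?thesis using prod_Pow_s(2)[OF assms(1)] by simp
qed

lemma (in face_probs) prod_star2:
  assumes "finite A" "z \<notin> A" "y \<notin> A" "z \<noteq> y"
  shows "(\<Prod>\<sigma>\<in>(\<lambda>\<rho>. insert z (insert y \<rho>)) ` Pow A. p (card \<sigma>)) = W (card A)"
proof -
  have "inj_on (\<lambda>\<rho>. insert z (insert y \<rho>)) (Pow A)"
  proof (rule inj_onI)
    fix \<rho> \<rho>' assume "\<rho> \<in> Pow A" "\<rho>' \<in> Pow A" "insert z (insert y \<rho>) = insert z (insert y \<rho>')"
    then show "\<rho> = \<rho>'" using assms by (metis Diff_insert_absorb PowD insert_iff subsetD)
  qed
  then have "(\<Prod>\<sigma>\<in>(\<lambda>\<rho>. insert z (insert y \<rho>)) ` Pow A. p (card \<sigma>)) = (\<Prod>\<rho>\<in>Pow A. p (card (insert z (insert y \<rho>))))"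
    by (simp add: prod.reindex)
  also have "\<dots> = (\<Prod>\<rho>\<in>Pow A. p (Suc (Suc (card \<rho>))))"
  proof (rule prod.cong[OF refl])
    fix \<rho> assume "\<rho> \<in> Pow A"
    then have "finite \<rho>" "z \<notin> \<rho>" "y \<notin> \<rho>" using assms finite_subset by auto
    then show "p (card (insert z (insert y \<rho>))) = p (Suc (Suc (card \<rho>)))" using assms(4) by simp
  qed
  finally show ?thesis using prod_Pow_s(3)[OF assms(1)] by simp
qed

text \<open>Gluing \<open>z\<close> to \<open>w\<close> adds exactly the sets
  \<open>insert z \<rho>\<close> with \<open>\<rho> \<subseteq> w\<close>, which amounts to one
  factor \<open>R (k+1)\<close>.\<close>

lemma (in face_probs) prod_skel:
  assumes "ktree k v V H" "finite v" "card v = k+1"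
  shows "(\<Prod>\<sigma>\<in>skel v H. p (card \<sigma>)) = Q (k+1) * R (k+1) ^ card H"
  using assms
proof (induction rule: ktree.induct)
  case base
  then show ?case using prod_Pow_s(1)[of v] by (simp add: skel_def)
next
  case (step V H w z)
  note kb = ktree_basic[OF step.hyps(1) step.prems] and fh = finite_skel[OF step.hyps(1) step.prems]
  have wV: "w \<subseteq> V" using step.hyps(2) kb(2,4) by auto
  have fw: "finite w" "z \<notin> w" using wV kb(1) finite_subset step.hyps(4) by auto
  have "Pow w \<subseteq> skel v H" using step.hyps(2) unfolding skel_def by blast
  then have un: "skel v (insert (insert z w) H) = skel v H \<union> insert z ` Pow w"
    unfolding skel_def by (auto simp: Pow_insert)
  have disj: "skel v H \<inter> insert z ` Pow w = {}" using fh(1) step.hyps(4) by auto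
  have "insert z w \<notin> H" using kb(4) step.hyps(4) by blast
  then have "card (insert (insert z w) H) = Suc (card H)" using kb(3) by simp
  moreover have "(\<Prod>\<sigma>\<in>skel v (insert (insert z w) H). p (card \<sigma>)) = (\<Prod>\<sigma>\<in>skel v H. p (card \<sigma>)) * R (card w)"
    unfolding un prod_star[OF fw, symmetric] using fh(2) fw(1) disj by (intro prod.union_disjoint) auto
  moreover have "(\<Prod>\<sigma>\<in>skel v H. p (card \<sigma>)) = Q (k+1) * R (k+1) ^ card H" using step.IH step.prems by blast
  ultimately show ?case using step.hyps(3) by (simp only: power_Suc mult.assoc mult.left_commute mult.commute)
qed

lemma Pi_pmf_indep:
  assumes A: "finite A" "A1 \<subseteq> A" "A2 \<subseteq> A" "A1 \<inter> A2 = {}"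
    and E1: "\<And>\<omega> \<omega>'. (\<And>x. x \<in> A1 \<Longrightarrow> \<omega> x = \<omega>' x) \<Longrightarrow> E1 \<omega> \<longleftrightarrow> E1 \<omega>'"
    and E2: "\<And>\<omega> \<omega>'. (\<And>x. x \<in> A2 \<Longrightarrow> \<omega> x = \<omega>' x) \<Longrightarrow> E2 \<omega> \<longleftrightarrow> E2 \<omega>'"
  shows "measure_pmf.prob (Pi_pmf A d q) {\<omega>. E1 \<omega> \<and> E2 \<omega>}
    = measure_pmf.prob (Pi_pmf A d q) {\<omega>. E1 \<omega>} * measure_pmf.prob (Pi_pmf A d q) {\<omega>. E2 \<omega>}"
proof -
  define P1 where "P1 = Pi_pmf A1 d q"
  define P2 where "P2 = Pi_pmf (A - A1) d q"
  have fin: "finite A1" "finite (A - A1)" using A finite_subset by auto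
  have AA: "A = A1 \<union> (A - A1)" using A by auto
  have un: "Pi_pmf A d q = map_pmf (\<lambda>(f, g) x. if x \<in> A1 then f x else g x) (pair_pmf P1 P2)"
    unfolding P1_def P2_def by (subst AA, rule Pi_pmf_union) (use fin in auto)
  let ?h = "\<lambda>f g x. if x \<in> A1 then f x else g x"
  have h1: "E1 (?h f g) \<longleftrightarrow> E1 f" for f g by (rule E1) simp
  have h2: "E2 (?h f g) \<longleftrightarrow> E2 g" for f g by (rule E2) (use A in auto)
  have pr: "measure_pmf.prob M {\<omega>. E \<omega>} = Ep M (\<lambda>\<omega>. of_bool (E \<omega>))" for M :: "('a \<Rightarrow> 'b) pmf" and E
  proof -
    have "measure_pmf.prob M {\<omega>. E \<omega>} = Ep M (indicator {\<omega>. E \<omega>})" by simp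
    also have "(indicator {\<omega>. E \<omega>} :: _ \<Rightarrow> real) = (\<lambda>\<omega>. of_bool (E \<omega>))" by (auto simp: fun_eq_iff)
    finally show ?thesis .
  qed
  have gen: "Ep (Pi_pmf A d q) (\<lambda>\<omega>. of_bool (F1 \<omega> \<and> F2 \<omega>)) = Ep P1 (\<lambda>f. of_bool (F1 f)) * Ep P2 (\<lambda>g. of_bool (F2 g))"
    if F: "\<And>f g. F1 (?h f g) \<longleftrightarrow> F1 f" "\<And>f g. F2 (?h f g) \<longleftrightarrow> F2 g" for F1 F2 :: "('a \<Rightarrow> 'b) \<Rightarrow> bool"
  proof -
    have "Ep (Pi_pmf A d q) (\<lambda>\<omega>. of_bool (F1 \<omega> \<and> F2 \<omega>)) = Ep (pair_pmf P1 P2) (\<lambda>(f, g). of_bool (F1 f) * of_bool (F2 g))"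
      unfolding un integral_map_pmf by (rule Ep_cong) (simp add: case_prod_beta' F of_bool_conj)
    also have "\<dots> = Ep P1 (\<lambda>f. Ep P2 (\<lambda>g. of_bool (F1 f) * of_bool (F2 g)))"
      by (subst Ep_pair[where B=1]) auto
    also have "\<dots> = Ep P1 (\<lambda>f. of_bool (F1 f)) * Ep P2 (\<lambda>g. of_bool (F2 g))" by simp
    finally show ?thesis .
  qed
  have "Ep (Pi_pmf A d q) (\<lambda>\<omega>. of_bool (E1 \<omega>)) = Ep P1 (\<lambda>f. of_bool (E1 f))"
    using gen[of E1 "\<lambda>_. True"] h1 by simp
  moreover have "Ep (Pi_pmf A d q) (\<lambda>\<omega>. of_bool (E2 \<omega>)) = Ep P2 (\<lambda>f. of_bool (E2 f))"
    using gen[of "\<lambda>_. True" E2] h2 by simp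
  ultimately show ?thesis unfolding pr using gen[of E1 E2] h1 h2 by simp
qed

text \<open>\<open>I\<close> lists the faces all of whose cofaces must lie in \<open>H\<close>. Once
  the skeleton is present, unwanted cofaces through a vertex \<open>u\<close> outside
  \<open>V\<close> depend only on sets containing \<open>u\<close>, hence independently over
  \<open>u\<close>; this gives the \<open>n\<close>-th power. Inside \<open>V\<close> there are at
  most \<open>card I * card V\<close> unwanted cofaces, and each costs a further factor
  \<open>W k\<close>.\<close>

lemma (in face_probs) exact_prob:
  assumes kt: "ktree k v V H" "finite v" "card v = k+1" and V: "V \<subseteq> {1..n}"
    and I: "finite I" "\<And>w. w \<in> I \<Longrightarrow> card w = k+1 \<and> (w = v \<or> (\<exists>a\<in>H. w \<subseteq> a))"
    and small: "real (card I) * R (k+1) \<le> 1"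
  shows "measure_pmf.prob (field n p) {\<omega>. (\<forall>\<sigma>\<in>skel v H. \<omega> \<sigma>) \<and>
      (\<forall>w\<in>I. \<forall>u\<in>{1..n} - w. (\<forall>\<rho>\<subseteq>insert u w. \<omega> \<rho>) \<longrightarrow> insert u w \<in> H)}
    \<ge> Q (k+1) * R (k+1) ^ card H * ((1 - real (card I) * R (k+1)) ^ n - real (card I * card V) * W k)"
proof -
  note kb = ktree_basic[OF kt] and fh = finite_skel[OF kt] and ph = prod_skel[OF kt]
  let ?P = "measure_pmf.prob (field n p)"
  define B where "B \<omega> \<longleftrightarrow> (\<forall>\<sigma>\<in>skel v H. \<omega> \<sigma>)" for \<omega> :: "nat set \<Rightarrow> bool"
  \<comment> \<open>On \<open>B\<close> every subset of \<open>w\<close> is marked, so the absence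
    of the coface \<open>insert u w\<close> is expressed by sets containing \<open>u\<close> alone.
    For distinct \<open>u\<close> outside \<open>V\<close> these families of sets are
    disjoint.\<close>
  define Cu where "Cu u \<omega> \<longleftrightarrow> (\<forall>w\<in>I. \<not> (\<forall>\<rho>\<subseteq>w. \<omega> (insert u \<rho>)))" for u and \<omega> :: "nat set \<Rightarrow> bool"
  define Ku where "Ku u = insert u ` Pow V" for u
  have IV: "w \<subseteq> V" "card w = k+1" "finite w" "w \<in> skel v H" if "w \<in> I" for w
  proof -
    show "w \<subseteq> V" using I(2)[OF that] kb(2,4) by blast
    then show "finite w" using kb(1) finite_subset by blast
    show "card w = k+1" using I(2)[OF that] by blast
    show "w \<in> skel v H" using I(2)[OF that] unfolding skel_def by blast
  qed
  have hn: "skel v H \<subseteq> Pow {1..n}" using fh(1) V by blast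
  have PB: "?P {\<omega>. B \<omega>} = Q (k+1) * R (k+1) ^ card H"
    unfolding B_def prob_field_open[OF p01 hn] by (rule ph)
  have PC: "?P {\<omega>. Cu u \<omega>} \<ge> 1 - real (card I) * R (k+1)" if u: "u \<in> {1..n} - V" for u
  proof -
    let ?D = "\<lambda>w. {\<omega>. \<forall>\<sigma>\<in>insert u ` Pow w. \<omega> \<sigma>}"
    have "?P (?D w) = R (k+1)" if w: "w \<in> I" for w
    proof -
      have "insert u ` Pow w \<subseteq> Pow {1..n}" using IV(1)[OF w] V u by auto
      from prob_field_open[OF p01 this] prod_star[OF IV(3)[OF w], of u] show ?thesis
        using IV(1,2)[OF w] u by auto
    qed
    then have "(\<Sum>w\<in>I. ?P (?D w)) = real (card I) * R (k+1)" by simp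
    moreover have "?P (\<Union>w\<in>I. ?D w) \<le> (\<Sum>w\<in>I. ?P (?D w))"
      by (rule measure_pmf.finite_measure_subadditive_finite) (use I in auto)
    moreover have "?P {\<omega>. Cu u \<omega>} = 1 - ?P (\<Union>w\<in>I. ?D w)"
    proof -
      have "{\<omega>. Cu u \<omega>} = UNIV - (\<Union>w\<in>I. ?D w)" unfolding Cu_def by auto
      then show ?thesis using measure_pmf.prob_compl[of "\<Union>w\<in>I. ?D w" "field n p"] by simp
    qed
    ultimately show ?thesis by simp
  qed
  have PBC: "?P {\<omega>. B \<omega> \<and> (\<forall>u\<in>U. Cu u \<omega>)} \<ge> Q (k+1) * R (k+1) ^ card H * (1 - real (card I) * R (k+1)) ^ card U"
    if "finite U" "U \<subseteq> {1..n} - V" for U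
    using that
  proof (induction U rule: finite_induct)
    case empty
    then show ?case using PB by simp
  next
    case (insert u U)
    let ?E1 = "\<lambda>\<omega>. B \<omega> \<and> (\<forall>u\<in>U. Cu u \<omega>)"
    have "?P {\<omega>. ?E1 \<omega> \<and> Cu u \<omega>} = ?P {\<omega>. ?E1 \<omega>} * ?P {\<omega>. Cu u \<omega>}"
      unfolding field_def
    proof (rule Pi_pmf_indep[where ?A1.0 = "Pow V \<union> (\<Union>u\<in>U. Ku u)" and ?A2.0 = "Ku u"])
      show "Pow V \<union> (\<Union>u\<in>U. Ku u) \<subseteq> Pow {1..n}" "Ku u \<subseteq> Pow {1..n}"
        using V insert.prems unfolding Ku_def by auto
      show "(Pow V \<union> (\<Union>u\<in>U. Ku u)) \<inter> Ku u = {}"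
      proof -
        have "\<sigma> \<notin> Pow V \<union> (\<Union>u\<in>U. Ku u)" if s: "\<sigma> \<in> Ku u" for \<sigma>
        proof -
          have "u \<in> \<sigma>" "u \<notin> V" using s insert.prems unfolding Ku_def by auto
          moreover have "u \<notin> insert u' \<rho>" if "u' \<in> U" "\<rho> \<subseteq> V" for u' \<rho>
            using that insert.hyps(2) \<open>u \<notin> V\<close> by auto
          ultimately show ?thesis unfolding Ku_def by blast
        qed
        then show ?thesis by blast
      qed
      show "Cu u \<omega> \<longleftrightarrow> Cu u \<omega>'" if eq: "\<And>x. x \<in> Ku u \<Longrightarrow> \<omega> x = \<omega>' x" for \<omega> \<omega>'
      proof -
        have "\<omega> (insert u \<rho>) = \<omega>' (insert u \<rho>)" if "w \<in> I" "\<rho> \<subseteq> w" for w \<rho>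
          using that IV(1)[of w] by (intro eq) (auto simp: Ku_def)
        then show ?thesis unfolding Cu_def by simp
      qed
      show "?E1 \<omega> \<longleftrightarrow> ?E1 \<omega>'" if eq: "\<And>x. x \<in> Pow V \<union> (\<Union>u\<in>U. Ku u) \<Longrightarrow> \<omega> x = \<omega>' x" for \<omega> \<omega>'
      proof -
        have "\<omega> (insert u' \<rho>) = \<omega>' (insert u' \<rho>)" if "u' \<in> U" "w \<in> I" "\<rho> \<subseteq> w" for u' w \<rho>
        proof (rule eq)
          have "insert u' \<rho> \<in> Ku u'" using that IV(1)[of w] by (auto simp: Ku_def)
          then show "insert u' \<rho> \<in> Pow V \<union> (\<Union>u\<in>U. Ku u)" using that(1) by blast
        qed
        then have "(\<forall>u\<in>U. Cu u \<omega>) \<longleftrightarrow> (\<forall>u\<in>U. Cu u \<omega>')" unfolding Cu_def by simp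
        moreover have "\<omega> \<sigma> = \<omega>' \<sigma>" if "\<sigma> \<in> skel v H" for \<sigma>
          using that fh(1) by (intro eq) auto
        then have "B \<omega> \<longleftrightarrow> B \<omega>'" unfolding B_def by simp
        ultimately show ?thesis by simp
      qed
    qed simp
    also have "\<dots> \<ge> (Q (k+1) * R (k+1) ^ card H * (1 - real (card I) * R (k+1)) ^ card U) * (1 - real (card I) * R (k+1))"
      using insert PC[of u] small cube_prod_01 by (intro mult_mono) auto
    also have "{\<omega>. ?E1 \<omega> \<and> Cu u \<omega>} = {\<omega>. B \<omega> \<and> (\<forall>u\<in>insert u U. Cu u \<omega>)}" by auto
    finally show ?case using insert.hyps by (simp add: mult.assoc mult.commute mult.left_commute)
  qed
  let ?U = "{1..n} - V"
  have Upow: "(1 - real (card I) * R (k+1)) ^ n \<le> (1 - real (card I) * R (k+1)) ^ card ?U"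
  proof (rule power_decreasing)
    show "card ?U \<le> n" using card_mono[of "{1..n}" ?U] by auto
  qed (use small cube_prod_01 in auto)
  \<comment> \<open>The pairs whose coface would close up inside \<open>V\<close> without belonging
    to \<open>H\<close>.\<close>
  define J where "J = {(w, u). w \<in> I \<and> u \<in> V - w \<and> insert u w \<notin> H}"
  have J: "J \<subseteq> I \<times> V" unfolding J_def by auto
  then have fJ: "finite J" using I(1) kb(1) finite_subset by blast
  have cJ: "card J \<le> card I * card V"
    using card_mono[OF _ J] I(1) kb(1) by (simp add: card_cartesian_product)
  define D where "D = (\<lambda>(w, u). {\<omega>. B \<omega> \<and> (\<forall>\<rho>\<subseteq>insert u w. \<omega> \<rho>)})"
  have PD: "?P (D j) \<le> Q (k+1) * R (k+1) ^ card H * W k" if j: "j \<in> J" for j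
  proof -
    obtain w u where [simp]: "j = (w, u)" by force
    have wu: "w \<in> I" "u \<in> V" "u \<notin> w" "insert u w \<notin> H" using j by (auto simp: J_def)
    \<comment> \<open>By \<open>ktree_clique\<close>, a candidate outside \<open>H\<close> contains
      a pair joined by no simplex of the skeleton. As \<open>w\<close> itself lies in the skeleton,
      the pair consists of \<open>u\<close> and some \<open>y\<close> in \<open>w\<close>; the
      \<open>2 ^ k\<close> subsets of the candidate containing both are all new and contribute
      \<open>W k\<close>.\<close>
    have "\<exists>y\<in>w. \<forall>\<sigma>\<in>insert v H. \<not> {u, y} \<subseteq> \<sigma>"
    proof (rule ccontr)
      assume neg: "\<not> ?thesis"
      have "insert u w \<in> H"
      proof (rule ktree_clique[OF kt])
        show "insert u w \<subseteq> V" using IV[OF wu(1)] wu by auto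
        show "card (insert u w) = k+2" using IV[OF wu(1)] wu by simp
        fix x y assume xy: "x \<in> insert u w" "y \<in> insert u w" "x \<noteq> y"
        consider "x = u" "y \<in> w" | "y = u" "x \<in> w" | "x \<in> w" "y \<in> w" using xy by auto
        then show "\<exists>\<sigma>\<in>insert v H. {x, y} \<subseteq> \<sigma>"
        proof cases
          case 3
          then show ?thesis using I(2)[OF wu(1)] by auto
        qed (use neg in \<open>auto simp: insert_commute\<close>)
      qed
      then show False using wu by simp
    qed
    then obtain y where y: "y \<in> w" "\<And>\<sigma>. \<sigma> \<in> insert v H \<Longrightarrow> \<not> {u, y} \<subseteq> \<sigma>" by blast
    define A where "A = w - {y}"
    have A: "finite A" "u \<notin> A" "y \<notin> A" "u \<noteq> y" "card A = k"
      using IV[OF wu(1)] wu y by (auto simp: A_def)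
    let ?L = "(\<lambda>\<rho>. insert u (insert y \<rho>)) ` Pow A"
    have disj: "skel v H \<inter> ?L = {}" using y(2) unfolding skel_def by auto
    have sub: "skel v H \<union> ?L \<subseteq> Pow {1..n}"
      using hn V IV(1)[OF wu(1)] wu(2) y(1) by (auto simp: A_def)
    have "?P (D j) \<le> ?P {\<omega>. \<forall>\<sigma>\<in>skel v H \<union> ?L. \<omega> \<sigma>}"
    proof (rule measure_pmf.finite_measure_mono)
      show "D j \<subseteq> {\<omega>. \<forall>\<sigma>\<in>skel v H \<union> ?L. \<omega> \<sigma>}"
      proof
        fix \<omega> assume w: "\<omega> \<in> D j"
        have "insert u (insert y \<rho>) \<subseteq> insert u w" if "\<rho> \<subseteq> A" for \<rho> using that y by (auto simp: A_def)
        then show "\<omega> \<in> {\<omega>. \<forall>\<sigma>\<in>skel v H \<union> ?L. \<omega> \<sigma>}" using w unfolding D_def B_def by auto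
      qed
    qed simp
    also have "\<dots> = (\<Prod>\<sigma>\<in>skel v H \<union> ?L. p (card \<sigma>))" by (rule prob_field_open[OF p01 sub])
    also have "\<dots> = (\<Prod>\<sigma>\<in>skel v H. p (card \<sigma>)) * W k"
      using prod_star2[OF A(1-4)] A fh(2) disj by (subst prod.union_disjoint) auto
    finally show ?thesis using ph by simp
  qed
  have "?P (\<Union>j\<in>J. D j) \<le> (\<Sum>j\<in>J. ?P (D j))"
    by (rule measure_pmf.finite_measure_subadditive_finite) (use fJ in auto)
  also have "\<dots> \<le> real (card J) * (Q (k+1) * R (k+1) ^ card H * W k)"
    using sum_bounded_above[of J "\<lambda>j. ?P (D j)", OF PD] by simp
  also have "\<dots> \<le> real (card I * card V) * (Q (k+1) * R (k+1) ^ card H * W k)"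
    using cJ cube_prod_01 by (intro mult_right_mono mult_nonneg_nonneg zero_le_power) (auto simp del: of_nat_mult)
  finally have inner: "?P (\<Union>j\<in>J. D j) \<le> Q (k+1) * R (k+1) ^ card H * (real (card I * card V) * W k)"
    by (simp only: mult.assoc mult.left_commute)
  let ?G = "{\<omega>. B \<omega> \<and> (\<forall>u\<in>?U. Cu u \<omega>)}"
  let ?T = "{\<omega>. (\<forall>\<sigma>\<in>skel v H. \<omega> \<sigma>) \<and> (\<forall>w\<in>I. \<forall>u\<in>{1..n} - w. (\<forall>\<rho>\<subseteq>insert u w. \<omega> \<rho>) \<longrightarrow> insert u w \<in> H)}"
  have "?G \<subseteq> ?T \<union> (\<Union>j\<in>J. D j)"
  proof
    fix \<omega> assume w: "\<omega> \<in> ?G"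
    show "\<omega> \<in> ?T \<union> (\<Union>j\<in>J. D j)"
    proof (cases "\<omega> \<in> (\<Union>j\<in>J. D j)")
      case False
      have "insert u w \<in> H" if wu: "w \<in> I" "u \<in> {1..n} - w" "\<forall>\<rho>\<subseteq>insert u w. \<omega> \<rho>" for w u
      proof (cases "u \<in> V")
        case True
        show ?thesis
        proof (rule ccontr)
          assume "insert u w \<notin> H"
          then have "(w, u) \<in> J" using wu True by (simp add: J_def)
          moreover have "\<omega> \<in> D (w, u)" using w wu(3) by (simp add: D_def)
          ultimately show False using \<open>\<omega> \<notin> (\<Union>j\<in>J. D j)\<close> by blast
        qed
      next
        case False
        then have "Cu u \<omega>" using w wu(2) by blast
        moreover have "\<omega> (insert u \<rho>)" if "\<rho> \<subseteq> w" for \<rho>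
          using wu(3)[rule_format, of "insert u \<rho>"] that by auto
        ultimately show ?thesis using wu(1) unfolding Cu_def by blast
      qed
      then show ?thesis using w unfolding B_def by blast
    qed simp
  qed
  then have "?P ?G \<le> ?P (?T \<union> (\<Union>j\<in>J. D j))" by (intro measure_pmf.finite_measure_mono) auto
  also have "\<dots> \<le> ?P ?T + ?P (\<Union>j\<in>J. D j)" by (rule measure_Un_le) auto
  finally have "?P ?T \<ge> ?P ?G - ?P (\<Union>j\<in>J. D j)" by simp
  moreover have "?P ?G \<ge> Q (k+1) * R (k+1) ^ card H * (1 - real (card I) * R (k+1)) ^ n"
  proof -
    have "Q (k+1) * R (k+1) ^ card H * (1 - real (card I) * R (k+1)) ^ n
      \<le> Q (k+1) * R (k+1) ^ card H * (1 - real (card I) * R (k+1)) ^ card ?U"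
      using Upow cube_prod_01 by (intro mult_left_mono mult_nonneg_nonneg zero_le_power) auto
    then show ?thesis using PBC[of ?U] by simp
  qed
  ultimately have "?P ?T \<ge> Q (k+1) * R (k+1) ^ card H * (1 - real (card I) * R (k+1)) ^ n
     - Q (k+1) * R (k+1) ^ card H * (real (card I * card V) * W k)"
    using inner by linarith
  then show ?thesis by (simp only: right_diff_distrib)
qed

section \<open>Variance and moments\<close>

lemma Ep_bind_finite:
  fixes f :: "'b \<Rightarrow> real"
  assumes "finite (set_pmf (bind_pmf p q))"
  shows "Ep (bind_pmf p q) f = Ep p (\<lambda>x. Ep (q x) f)"
  by (rule Ep_bind[where B="\<Sum>x\<in>set_pmf (bind_pmf p q). \<bar>f x\<bar>"])
     (rule member_le_sum, use assms in auto)

lemma finite_Pi_bernoulli: "finite A \<Longrightarrow> finite (set_pmf (Pi_pmf A False (\<lambda>x. bernoulli_pmf (q x))))"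
  by (rule finite_subset[OF set_Pi_pmf_subset']) auto

lemma Ep_Pi_insert:
  fixes f :: "('a \<Rightarrow> bool) \<Rightarrow> real"
  assumes A: "finite A" "x \<notin> A" and q: "0 \<le> q x" "q x \<le> 1"
  shows "Ep (Pi_pmf (insert x A) False (\<lambda>x. bernoulli_pmf (q x))) f
    = q x * Ep (Pi_pmf A False (\<lambda>x. bernoulli_pmf (q x))) (\<lambda>\<omega>. f (fun_upd \<omega> x True))
    + (1 - q x) * Ep (Pi_pmf A False (\<lambda>x. bernoulli_pmf (q x))) (\<lambda>\<omega>. f (fun_upd \<omega> x False))"
proof -
  let ?M = "Pi_pmf A False (\<lambda>x. bernoulli_pmf (q x))"
  have ins: "Pi_pmf (insert x A) False (\<lambda>x. bernoulli_pmf (q x))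
     = bind_pmf (bernoulli_pmf (q x)) (\<lambda>y. map_pmf (\<lambda>\<omega>. (fun_upd \<omega> x y)) ?M)"
    unfolding Pi_pmf_insert'[OF A] map_pmf_def ..
  have fin: "finite (set_pmf (bind_pmf (bernoulli_pmf (q x)) (\<lambda>y. map_pmf (\<lambda>\<omega>. (fun_upd \<omega> x y)) ?M)))"
    unfolding ins[symmetric] by (rule finite_Pi_bernoulli) (use A in simp)
  show ?thesis unfolding ins Ep_bind_finite[OF fin] integral_map_pmf
    by (subst integral_bernoulli_pmf) (use q in \<open>auto simp: mult.commute\<close>)
qed

lemma Ep_square_le:
  fixes f :: "'a \<Rightarrow> real"
  assumes "finite (set_pmf M)"
  shows "(Ep M f)\<^sup>2 \<le> Ep M (\<lambda>x. (f x)\<^sup>2)"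
proof -
  define m where "m = Ep M f"
  have int: "integrable M g" for g :: "'a \<Rightarrow> real" by (rule integrable_measure_pmf_finite[OF assms])
  have "0 \<le> Ep M (\<lambda>x. (f x - m)\<^sup>2)" by (rule integral_nonneg_AE) simp
  also have "(\<lambda>x. (f x - m)\<^sup>2) = (\<lambda>x. (f x)\<^sup>2 - 2 * m * f x + m\<^sup>2)"
    by (auto simp: power2_eq_square algebra_simps)
  also have "Ep M \<dots> = Ep M (\<lambda>x. (f x)\<^sup>2) - 2 * m * m + m\<^sup>2"
    using int by (simp add: m_def)
  finally show ?thesis by (simp add: m_def power2_eq_square)
qed

text \<open>Splitting off the coordinate \<open>x\<close> decomposes the variance into the averaged
  variances of \<open>f1\<close> and \<open>f0\<close> plus \<open>c * (1 - c)\<close> times the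
  squared difference of their means, which Jensen's inequality bounds by the influence of
  \<open>x\<close>.\<close>

theorem efron_stein:
  fixes f :: "('a \<Rightarrow> bool) \<Rightarrow> real"
  assumes A: "finite A" and q: "\<And>x. 0 \<le> q x \<and> q x \<le> 1"
  defines "M \<equiv> \<lambda>A. Pi_pmf A False (\<lambda>x. bernoulli_pmf (q x))"
  shows "Ep (M A) (\<lambda>\<omega>. (f \<omega>)\<^sup>2) - (Ep (M A) f)\<^sup>2
    \<le> (\<Sum>x\<in>A. q x * (1 - q x) * Ep (M A) (\<lambda>\<omega>. (f (fun_upd \<omega> x True) - f (fun_upd \<omega> x False))\<^sup>2))"
  using A
proof (induction A arbitrary: f rule: finite_induct)
  case empty
  then show ?case by (simp add: M_def)
next
  case (insert x A)
  define f1 where "f1 \<omega> = f (fun_upd \<omega> x True)" for \<omega>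
  define f0 where "f0 \<omega> = f (fun_upd \<omega> x False)" for \<omega>
  define c where "c = q x"
  have c: "0 \<le> c" "0 \<le> 1 - c" using q[of x] by (auto simp: c_def)
  have ins: "Ep (M (insert x A)) g = c * Ep (M A) (\<lambda>\<omega>. g (fun_upd \<omega> x True)) + (1 - c) * Ep (M A) (\<lambda>\<omega>. g (fun_upd \<omega> x False))" for g
    unfolding M_def c_def by (rule Ep_Pi_insert) (use insert.hyps q in auto)
  let ?D = "\<lambda>f y. Ep (M A) (\<lambda>\<omega>. (f (fun_upd \<omega> y True) - f (fun_upd \<omega> y False))\<^sup>2)"
  have finM: "finite (set_pmf (M A))" unfolding M_def by (rule finite_Pi_bernoulli) (rule insert.hyps)
  have d: "Ep (M (insert x A)) (\<lambda>\<omega>. (f (fun_upd \<omega> y True) - f (fun_upd \<omega> y False))\<^sup>2) = c * ?D f1 y + (1 - c) * ?D f0 y"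
    if "y \<in> A" for y
  proof -
    have "y \<noteq> x" using that insert.hyps by auto
    then show ?thesis unfolding ins f1_def f0_def by (simp add: fun_upd_twist)
  qed
  have dx: "Ep (M (insert x A)) (\<lambda>\<omega>. (f (fun_upd \<omega> x True) - f (fun_upd \<omega> x False))\<^sup>2) = Ep (M A) (\<lambda>\<omega>. (f1 \<omega> - f0 \<omega>)\<^sup>2)"
    unfolding ins f1_def f0_def by (simp add: algebra_simps)
  have sq: "(Ep (M A) f1 - Ep (M A) f0)\<^sup>2 \<le> Ep (M A) (\<lambda>\<omega>. (f1 \<omega> - f0 \<omega>)\<^sup>2)"
  proof -
    have "Ep (M A) f1 - Ep (M A) f0 = Ep (M A) (\<lambda>\<omega>. f1 \<omega> - f0 \<omega>)"
      by (rule Bochner_Integration.integral_diff[symmetric]; rule integrable_measure_pmf_finite[OF finM])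
    then show ?thesis using Ep_square_le[OF finM] by simp
  qed
  define e1 e0 s1 s0 where "e1 = Ep (M A) f1" "e0 = Ep (M A) f0"
    "s1 = Ep (M A) (\<lambda>\<omega>. (f1 \<omega>)\<^sup>2)" "s0 = Ep (M A) (\<lambda>\<omega>. (f0 \<omega>)\<^sup>2)"
  have "Ep (M (insert x A)) (\<lambda>\<omega>. (f \<omega>)\<^sup>2) - (Ep (M (insert x A)) f)\<^sup>2 = c * s1 + (1 - c) * s0 - (c * e1 + (1 - c) * e0)\<^sup>2"
    unfolding ins e1_e0_s1_s0_def f1_def f0_def ..
  also have "\<dots> = c * (s1 - e1\<^sup>2) + (1 - c) * (s0 - e0\<^sup>2) + c * (1 - c) * (e1 - e0)\<^sup>2"
    by (simp add: power2_eq_square algebra_simps)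
  also have "\<dots> \<le> c * (\<Sum>y\<in>A. q y * (1 - q y) * ?D f1 y) + (1 - c) * (\<Sum>y\<in>A. q y * (1 - q y) * ?D f0 y)
      + c * (1 - c) * Ep (M A) (\<lambda>\<omega>. (f1 \<omega> - f0 \<omega>)\<^sup>2)"
    unfolding e1_e0_s1_s0_def
    by (intro add_mono mult_left_mono insert.IH sq mult_nonneg_nonneg c)
  also have "\<dots> = (\<Sum>y\<in>A. q y * (1 - q y) * (c * ?D f1 y + (1 - c) * ?D f0 y))
      + c * (1 - c) * Ep (M A) (\<lambda>\<omega>. (f1 \<omega> - f0 \<omega>)\<^sup>2)"
    unfolding sum_distrib_left sum.distrib[symmetric]
    by (simp add: algebra_simps)
  also have "\<dots> = (\<Sum>y\<in>insert x A. q y * (1 - q y) * Ep (M (insert x A)) (\<lambda>\<omega>. (f (fun_upd \<omega> y True) - f (fun_upd \<omega> y False))\<^sup>2))"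
    using insert.hyps d dx by (simp add: c_def)
  finally show ?case .
qed

text \<open>Trades a forced mark, weighted by its probability, for the event that the mark is
  present; the influence bound then speaks of the random complex itself.\<close>

lemma Ep_Pi_update:
  fixes g :: "('a \<Rightarrow> bool) \<Rightarrow> real"
  assumes A: "finite A" "x \<in> A" and q: "\<And>x. 0 \<le> q x \<and> q x \<le> 1"
  defines "M \<equiv> Pi_pmf A False (\<lambda>x. bernoulli_pmf (q x))"
  shows "q x * Ep M (\<lambda>\<omega>. g (fun_upd \<omega> x True)) = Ep M (\<lambda>\<omega>. of_bool (\<omega> x) * g \<omega>)"
proof -
  have ins: "Ep M h = q x * Ep (Pi_pmf (A - {x}) False (\<lambda>x. bernoulli_pmf (q x))) (\<lambda>\<omega>. h (fun_upd \<omega> x True))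
    + (1 - q x) * Ep (Pi_pmf (A - {x}) False (\<lambda>x. bernoulli_pmf (q x))) (\<lambda>\<omega>. h (fun_upd \<omega> x False))" for h
    using Ep_Pi_insert[of "A - {x}" x q h] A q unfolding M_def by (simp add: insert_absorb)
  show ?thesis unfolding ins by (simp add: algebra_simps)
qed

section \<open>Overlapping simplices and moments of face counts\<close>

context face_probs
begin

definition wt :: "nat set set \<Rightarrow> real" where "wt Y = (\<Prod>\<sigma>\<in>Y. p (card \<sigma>))"

lemma wt_nonneg: "0 \<le> wt Y"
  unfolding wt_def by (rule prod_nonneg) (use p01 in auto)

text \<open>The subsets of \<tau> not contained in \<open>V\<close> are new, and their weight is
  \<open>Q (card \<tau>)\<close> divided by \<open>Q (card (\<tau> \<inter> V))\<close>. The product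
  form remains valid when the divisor vanishes.\<close>

lemma wt_union:
  assumes V: "finite V" "Y \<subseteq> Pow V" and t: "finite \<tau>"
  shows "wt (Y \<union> Pow \<tau>) * Q (card (\<tau> \<inter> V)) \<le> wt Y * Q (card \<tau>)"
proof -
  define Z where "Z = {\<rho>\<in>Pow \<tau>. \<not> \<rho> \<subseteq> V}"
  have fin: "finite Y" "finite Z" using V t finite_subset unfolding Z_def by auto
  have disj: "Y \<inter> Z = {}" using V(2) by (auto simp: Z_def)
  have "Pow \<tau> = Pow (\<tau> \<inter> V) \<union> Z" "Pow (\<tau> \<inter> V) \<inter> Z = {}" by (auto simp: Z_def)
  then have q: "Q (card \<tau>) = Q (card (\<tau> \<inter> V)) * wt Z"
    unfolding prod_Pow_s(1)[OF t, symmetric] prod_Pow_s(1)[OF finite_Int, OF disjI1[OF t], symmetric] wt_def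
    using t fin by (metis finite_Int finite_Pow_iff prod.union_disjoint)
  have sub: "Y \<union> Z \<subseteq> Y \<union> Pow \<tau>" by (auto simp: Z_def)
  have fin': "finite (Y \<union> Pow \<tau>)" using fin t by simp
  have "wt (Y \<union> Pow \<tau>) \<le> wt (Y \<union> Z)"
  proof -
    have "wt (Y \<union> Pow \<tau>) = wt (Y \<union> Z) * wt ((Y \<union> Pow \<tau>) - (Y \<union> Z))"
      unfolding wt_def using prod.subset_diff[OF sub fin'] by (simp add: mult.commute)
    moreover have "wt ((Y \<union> Pow \<tau>) - (Y \<union> Z)) \<le> 1"
      unfolding wt_def by (rule prod_le_1) (use p01 in auto)
    ultimately show ?thesis using wt_nonneg[of "Y \<union> Z"] by (simp add: mult_left_le)
  qed
  also have "\<dots> = wt Y * wt Z" unfolding wt_def by (rule prod.union_disjoint) (use fin disj in auto)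
  finally have "wt (Y \<union> Pow \<tau>) * Q (card (\<tau> \<inter> V)) \<le> wt Y * wt Z * Q (card (\<tau> \<inter> V))"
    using cube_prod_01 by (intro mult_right_mono) auto
  then show ?thesis unfolding q by (simp add: mult_ac)
qed

lemma binomial_le_power: "n choose r \<le> n ^ r"
  by (cases "r \<le> n") (auto intro: binomial_le_pow simp: binomial_eq_0)

definition subs :: "nat \<Rightarrow> nat \<Rightarrow> nat set set" where
  "subs n j = {\<tau>. \<tau> \<subseteq> {1..n} \<and> card \<tau> = j}"

lemma finite_subs: "finite (subs n j)" "\<tau> \<in> subs n j \<Longrightarrow> finite \<tau>"
proof -
  have "subs n j \<subseteq> Pow {1..n}" by (auto simp: subs_def)
  then show "finite (subs n j)" by (rule finite_subset) simp
  show "finite \<tau>" if "\<tau> \<in> subs n j"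
    using that finite_subset[of \<tau> "{1..n}"] by (simp add: subs_def)
qed

lemma card_subs: "card (subs n j) = n choose j"
  using n_subsets[of "{1..n}" j] by (simp add: subs_def)

lemma card_subs_inter:
  assumes "finite V" "b \<le> j"
  shows "card {\<tau>\<in>subs n j. card (\<tau> \<inter> V) = b} \<le> 2 ^ card V * n ^ (j - b)"
proof -
  let ?A = "{\<tau>\<in>subs n j. card (\<tau> \<inter> V) = b}"
  have inj: "inj_on (\<lambda>\<tau>. (\<tau> \<inter> V, \<tau> - V)) ?A"
    by (rule inj_onI) (metis Int_Diff_Un Pair_inject)
  have "(\<lambda>\<tau>. (\<tau> \<inter> V, \<tau> - V)) ` ?A \<subseteq> Pow V \<times> subs n (j - b)"
  proof
    fix z assume "z \<in> (\<lambda>\<tau>. (\<tau> \<inter> V, \<tau> - V)) ` ?A"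
    then obtain \<tau> where t: "\<tau> \<in> ?A" "z = (\<tau> \<inter> V, \<tau> - V)" by blast
    have "finite \<tau>" using t finite_subs by blast
    then have "card (\<tau> - V) = card \<tau> - card (\<tau> \<inter> V)" by (simp add: card_Diff_subset_Int)
    then show "z \<in> Pow V \<times> subs n (j - b)" using t by (auto simp: subs_def)
  qed
  then have "card ?A \<le> card (Pow V \<times> subs n (j - b))"
    using assms finite_subs by (intro card_inj_on_le[OF inj]) auto
  also have "\<dots> = 2 ^ card V * (n choose (j - b))"
    using assms by (simp add: card_cartesian_product card_Pow card_subs)
  also have "\<dots> \<le> 2 ^ card V * n ^ (j - b)" using binomial_le_power by simp
  finally show ?thesis .
qed

text \<open>Order of magnitude of the expected number of faces with \<open>b\<close> vertices, the
  binomial coefficient being replaced by \<open>n ^ b\<close>.\<close>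

definition kap :: "nat \<Rightarrow> nat \<Rightarrow> real" where "kap n b = real n ^ b * Q b"

lemma kap_0: "kap n 0 = 1" by (simp add: kap_def p0)

text \<open>At most \<open>2 ^ card V * n ^ (j - b)\<close> simplices meet \<open>V\<close> in
  \<open>b\<close> vertices, and each multiplies the weight by at most \<open>Q j / Q b\<close>; the
  powers of \<open>n\<close> combine with these to \<open>kap n j / kap n b\<close>.\<close>

lemma sum_wt_union_le:
  assumes V: "finite V" "Y \<subseteq> Pow V" and pos: "\<And>b. b \<le> j \<Longrightarrow> kap n b > 0" and B: "B \<subseteq> {..j}"
  shows "(\<Sum>\<tau>\<in>{\<tau>\<in>subs n j. card (\<tau> \<inter> V) \<in> B}. wt (Y \<union> Pow \<tau>))
    \<le> wt Y * kap n j * 2 ^ card V * (\<Sum>b\<in>B. 1 / kap n b)"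
proof -
  have finB: "finite B" using B finite_subset by blast
  have one: "(\<Sum>\<tau>\<in>{\<tau>\<in>subs n j. card (\<tau> \<inter> V) = b}. wt (Y \<union> Pow \<tau>))
      \<le> wt Y * kap n j * 2 ^ card V * (1 / kap n b)" if b: "b \<in> B" for b
  proof -
    have bj: "b \<le> j" using b B by auto
    have n: "real n ^ b * Q b > 0" using pos[OF bj] by (simp add: kap_def)
    then have Qb: "Q b > 0" "real n ^ b > 0" using cube_prod_01[of b 0]
      by (auto simp: zero_less_mult_iff)
    let ?A = "{\<tau>\<in>subs n j. card (\<tau> \<inter> V) = b}"
    have "wt (Y \<union> Pow \<tau>) \<le> wt Y * Q j / Q b" if "\<tau> \<in> ?A" for \<tau>
      using wt_union[OF V, of \<tau>] that finite_subs(2)[of \<tau> n j] Qb by (simp add: subs_def field_simps)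
    then have "(\<Sum>\<tau>\<in>?A. wt (Y \<union> Pow \<tau>)) \<le> real (card ?A) * (wt Y * Q j / Q b)"
      by (rule sum_bounded_above)
    also have "\<dots> \<le> real (2 ^ card V * n ^ (j - b)) * (wt Y * Q j / Q b)"
      using card_subs_inter[OF V(1) bj] wt_nonneg cube_prod_01
      by (intro mult_right_mono of_nat_mono) auto
    also have "\<dots> = wt Y * kap n j * 2 ^ card V * (1 / kap n b)"
    proof -
      have "real n ^ j = real n ^ (j - b) * real n ^ b" using bj by (simp flip: power_add)
      then have e: "real n ^ (j - b) = real n ^ j / real n ^ b" using Qb(2) by (simp add: field_simps)
      show ?thesis unfolding of_nat_mult of_nat_power e kap_def by simp
    qed
    finally show ?thesis .
  qed
  have "{\<tau>\<in>subs n j. card (\<tau> \<inter> V) \<in> B} = (\<Union>b\<in>B. {\<tau>\<in>subs n j. card (\<tau> \<inter> V) = b})" by auto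
  then have "(\<Sum>\<tau>\<in>{\<tau>\<in>subs n j. card (\<tau> \<inter> V) \<in> B}. wt (Y \<union> Pow \<tau>))
     = (\<Sum>b\<in>B. \<Sum>\<tau>\<in>{\<tau>\<in>subs n j. card (\<tau> \<inter> V) = b}. wt (Y \<union> Pow \<tau>))"
    using finB finite_subs(1) by (simp only:) (intro sum.UNION_disjoint, auto)
  also have "\<dots> \<le> (\<Sum>b\<in>B. wt Y * kap n j * 2 ^ card V * (1 / kap n b))" by (rule sum_mono) (rule one)
  finally show ?thesis by (simp only: sum_distrib_left)
qed

text \<open>Relative weight of the simplices that share at least one vertex with a given bounded
  set. That it tends to 0 in the present regime is the source of concentration.\<close>

definition tail :: "nat \<Rightarrow> nat \<Rightarrow> real" where "tail n j = (\<Sum>b\<in>{1..j}. 1 / kap n b)"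

abbreviation "F n \<equiv> Ep (field n p)"

lemma finite_field: "finite (set_pmf (field n p))"
  unfolding field_def by (rule finite_Pi_bernoulli) simp

lemma int_field: "integrable (field n p) (g :: _ \<Rightarrow> real)"
  by (rule integrable_measure_pmf_finite[OF finite_field])

lemma F_open: "Y \<subseteq> Pow {1..n} \<Longrightarrow> F n (\<lambda>\<omega>. of_bool (\<forall>\<sigma>\<in>Y. \<omega> \<sigma>)) = wt Y"
proof -
  assume "Y \<subseteq> Pow {1..n}"
  from prob_field_open[OF p01 this] have "measure_pmf.prob (field n p) {\<omega>. \<forall>\<sigma>\<in>Y. \<omega> \<sigma>} = wt Y" by (simp add: wt_def)
  moreover have "F n (indicator {\<omega>. \<forall>\<sigma>\<in>Y. \<omega> \<sigma>}) = measure_pmf.prob (field n p) {\<omega>. \<forall>\<sigma>\<in>Y. \<omega> \<sigma>}" by simp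
  moreover have "(indicator {\<omega>. \<forall>\<sigma>\<in>Y. \<omega> \<sigma>} :: _ \<Rightarrow> real) = (\<lambda>\<omega>. of_bool (\<forall>\<sigma>\<in>Y. \<omega> \<sigma>))" by (auto simp: fun_eq_iff)
  ultimately show ?thesis by simp
qed

lemma F_mono: "(\<And>\<omega>. f \<omega> \<le> (g \<omega> :: real)) \<Longrightarrow> F n f \<le> F n g"
  by (rule integral_mono[OF int_field int_field])

lemma F_sum: "F n (\<lambda>\<omega>. \<Sum>i\<in>A. (f i \<omega> :: real)) = (\<Sum>i\<in>A. F n (f i))"
  by (rule Bochner_Integration.integral_sum) (rule int_field)

lemma faces_cplx: "faces j (cplx n \<omega>) = {\<tau>\<in>subs n j. \<forall>\<rho>\<in>Pow \<tau>. \<omega> \<rho>}"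
proof -
  have "finite \<tau>" if "\<tau> \<subseteq> {1..n}" for \<tau> using that finite_subset by blast
  then show ?thesis by (auto simp: faces_def cplx_def subs_def)
qed

lemma card_faces_sum: "real (card (faces j (cplx n \<omega>))) = (\<Sum>\<tau>\<in>subs n j. of_bool (\<forall>\<rho>\<in>Pow \<tau>. \<omega> \<rho>))"
  unfolding faces_cplx using finite_subs(1) by (simp add: sum.If_cases Int_def of_bool_def)

lemma F_faces: "F n (\<lambda>\<omega>. real (card (faces j (cplx n \<omega>)))) = real (n choose j) * Q j"
proof -
  have "F n (\<lambda>\<omega>. of_bool (\<forall>\<rho>\<in>Pow \<tau>. \<omega> \<rho>)) = Q j" if "\<tau> \<in> subs n j" for \<tau>
    using F_open[of "Pow \<tau>" n] prod_Pow_s(1)[of \<tau>] that finite_subs(2)[OF that] by (auto simp: subs_def wt_def)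
  then show ?thesis unfolding card_faces_sum F_sum by (simp add: card_subs)
qed

text \<open>The power is expanded one face at a time: \<open>Y\<close> collects what has already
  been chosen, on a vertex set \<open>V\<close> that grows by at most \<open>j\<close> each time.
  The summand 1 in \<open>1 + tail n j\<close> stands for faces disjoint from
  \<open>V\<close>.\<close>

lemma face_moments:
  assumes pos: "\<And>b. b \<le> j \<Longrightarrow> kap n b > 0"
  shows "finite V \<Longrightarrow> V \<subseteq> {1..n} \<Longrightarrow> Y \<subseteq> Pow V \<Longrightarrow> card V \<le> s \<Longrightarrow>
    F n (\<lambda>\<omega>. of_bool (\<forall>\<sigma>\<in>Y. \<omega> \<sigma>) * real (card (faces j (cplx n \<omega>))) ^ m)
    \<le> wt Y * (kap n j * (1 + tail n j) * 2 ^ (s + j * m)) ^ m"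
proof (induction m arbitrary: Y V s)
  case 0
  have "Y \<subseteq> Pow {1..n}" using 0 by auto
  then show ?case using F_open by simp
next
  case (Suc m)
  let ?f = "\<lambda>\<omega>. real (card (faces j (cplx n \<omega>)))"
  define a where "a = kap n j * (1 + tail n j)"
  have tail: "tail n j \<ge> 0" unfolding tail_def by (rule sum_nonneg) (use pos in \<open>auto intro: less_imp_le\<close>)
  then have a: "a \<ge> 0" unfolding a_def using pos[of j] by (intro mult_nonneg_nonneg) auto
  let ?K = "(a * 2 ^ (s + j * Suc m)) ^ m"
  have K: "?K \<ge> 0" using a by simp
  have "F n (\<lambda>\<omega>. of_bool (\<forall>\<sigma>\<in>Y. \<omega> \<sigma>) * ?f \<omega> ^ Suc m)
     = F n (\<lambda>\<omega>. \<Sum>\<tau>\<in>subs n j. of_bool (\<forall>\<sigma>\<in>Y \<union> Pow \<tau>. \<omega> \<sigma>) * ?f \<omega> ^ m)"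
  proof (rule Ep_cong)
    fix \<omega>
    have "of_bool (\<forall>\<sigma>\<in>Y. \<omega> \<sigma>) * ?f \<omega> ^ Suc m = (of_bool (\<forall>\<sigma>\<in>Y. \<omega> \<sigma>) * ?f \<omega> ^ m) * ?f \<omega>" by simp
    also have "\<dots> = (\<Sum>\<tau>\<in>subs n j. (of_bool (\<forall>\<sigma>\<in>Y. \<omega> \<sigma>) * ?f \<omega> ^ m) * of_bool (\<forall>\<rho>\<in>Pow \<tau>. \<omega> \<rho>))"
      by (subst (2) card_faces_sum) (rule sum_distrib_left)
    also have "\<dots> = (\<Sum>\<tau>\<in>subs n j. of_bool (\<forall>\<sigma>\<in>Y \<union> Pow \<tau>. \<omega> \<sigma>) * ?f \<omega> ^ m)"
      by (rule sum.cong[OF refl]) (simp add: ball_Un)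
    finally show "of_bool (\<forall>\<sigma>\<in>Y. \<omega> \<sigma>) * ?f \<omega> ^ Suc m = (\<Sum>\<tau>\<in>subs n j. of_bool (\<forall>\<sigma>\<in>Y \<union> Pow \<tau>. \<omega> \<sigma>) * ?f \<omega> ^ m)" .
  qed
  also have "\<dots> = (\<Sum>\<tau>\<in>subs n j. F n (\<lambda>\<omega>. of_bool (\<forall>\<sigma>\<in>Y \<union> Pow \<tau>. \<omega> \<sigma>) * ?f \<omega> ^ m))" by (rule F_sum)
  also have "\<dots> \<le> (\<Sum>\<tau>\<in>subs n j. wt (Y \<union> Pow \<tau>) * ?K)"
  proof (rule sum_mono)
    fix \<tau> assume t: "\<tau> \<in> subs n j"
    have ft: "finite \<tau>" using finite_subs(2)[OF t] .
    have "card (V \<union> \<tau>) \<le> card V + card \<tau>" by (rule card_Un_le)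
    then have c: "card (V \<union> \<tau>) \<le> s + j" using Suc.prems(4) t by (simp add: subs_def)
    have "F n (\<lambda>\<omega>. of_bool (\<forall>\<sigma>\<in>Y \<union> Pow \<tau>. \<omega> \<sigma>) * ?f \<omega> ^ m) \<le> wt (Y \<union> Pow \<tau>) * (kap n j * (1 + tail n j) * 2 ^ (s + j + j * m)) ^ m"
    proof (rule Suc.IH[OF _ _ _ c])
      show "finite (V \<union> \<tau>)" "V \<union> \<tau> \<subseteq> {1..n}" using Suc.prems ft t by (auto simp: subs_def)
      show "Y \<union> Pow \<tau> \<subseteq> Pow (V \<union> \<tau>)" using Suc.prems(3) by auto
    qed
    then show "F n (\<lambda>\<omega>. of_bool (\<forall>\<sigma>\<in>Y \<union> Pow \<tau>. \<omega> \<sigma>) * ?f \<omega> ^ m) \<le> wt (Y \<union> Pow \<tau>) * ?K"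
      by (simp add: a_def add.assoc)
  qed
  also have "\<dots> = (\<Sum>\<tau>\<in>subs n j. wt (Y \<union> Pow \<tau>)) * ?K" by (rule sum_distrib_right[symmetric])
  also have "(\<Sum>\<tau>\<in>subs n j. wt (Y \<union> Pow \<tau>)) = (\<Sum>\<tau>\<in>{\<tau>\<in>subs n j. card (\<tau> \<inter> V) \<in> {..j}}. wt (Y \<union> Pow \<tau>))"
  proof (rule sum.cong)
    have "card (\<tau> \<inter> V) \<le> j" if "\<tau> \<in> subs n j" for \<tau>
      using that card_mono[OF finite_subs(2)[OF that], of "\<tau> \<inter> V"] by (simp add: subs_def)
    then show "subs n j = {\<tau>\<in>subs n j. card (\<tau> \<inter> V) \<in> {..j}}" by auto
  qed simp
  also have "\<dots> * ?K \<le> (wt Y * kap n j * 2 ^ card V * (\<Sum>b\<in>{..j}. 1 / kap n b)) * ?K"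
    by (rule mult_right_mono[OF sum_wt_union_le[OF Suc.prems(1,3) pos]]) (use K in auto)
  also have "(\<Sum>b\<in>{..j}. 1 / kap n b) = 1 + tail n j"
    unfolding tail_def by (subst sum.atMost_shift) (simp add: kap_0 sum.shift_bounds_Suc_ivl sum.atLeast1_atMost_eq)
  also have "(wt Y * kap n j * 2 ^ card V * (1 + tail n j)) * ?K \<le> (wt Y * (a * 2 ^ (s + j * Suc m))) * ?K"
  proof (rule mult_right_mono[OF _ K])
    have "(2::real) ^ card V \<le> 2 ^ (s + j * Suc m)" using Suc.prems(4) by (intro power_increasing) auto
    then have "wt Y * a * 2 ^ card V \<le> wt Y * a * 2 ^ (s + j * Suc m)"
      using wt_nonneg a by (intro mult_left_mono mult_nonneg_nonneg) auto
    then show "wt Y * kap n j * 2 ^ card V * (1 + tail n j) \<le> wt Y * (a * 2 ^ (s + j * Suc m))"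
      by (simp add: a_def mult_ac)
  qed
  also have "\<dots> = wt Y * (kap n j * (1 + tail n j) * 2 ^ (s + j * Suc m)) ^ Suc m"
    by (simp add: a_def mult_ac)
  finally show ?case .
qed

lemma face_moment:
  assumes "\<And>b. b \<le> j \<Longrightarrow> kap n b > 0"
  shows "F n (\<lambda>\<omega>. real (card (faces j (cplx n \<omega>))) ^ m) \<le> (kap n j * (1 + tail n j) * 2 ^ (j * m)) ^ m"
  using face_moments[of j n "{}" "{}" 0 m] assms by (simp add: wt_def)

text \<open>The square counts pairs of faces that both contain \<sigma>. After exchanging the sums a
  pair is counted at most \<open>2 ^ j\<close> times, and only pairs with a common vertex are
  counted at all, which produces \<open>tail\<close>; another \<open>2 ^ j\<close> comes from the
  choice of the intersection.\<close>

lemma star_sum: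
  assumes pos: "\<And>b. b \<le> j \<Longrightarrow> kap n b > 0"
  shows "(\<Sum>\<sigma>\<in>Pow {1..n} - {{}}. F n (\<lambda>\<omega>. (real (card {\<tau>\<in>faces j (cplx n \<omega>). \<sigma> \<subseteq> \<tau>}))\<^sup>2))
    \<le> 4 ^ j * (kap n j)\<^sup>2 * tail n j"
proof -
  have tail: "tail n j \<ge> 0" unfolding tail_def by (rule sum_nonneg) (use pos in \<open>auto intro: less_imp_le\<close>)
  have kj: "kap n j > 0" using pos by simp
  let ?S = "subs n j" and ?P = "Pow {1..n} - {{}}"
  let ?o = "\<lambda>\<tau> \<tau>' \<omega>. of_bool (\<forall>\<rho>\<in>Pow \<tau> \<union> Pow \<tau>'. \<omega> \<rho>) :: real"
  have sq: "(real (card {\<tau>\<in>faces j (cplx n \<omega>). \<sigma> \<subseteq> \<tau>}))\<^sup>2 = (\<Sum>\<tau>\<in>?S. \<Sum>\<tau>'\<in>?S. of_bool (\<sigma> \<subseteq> \<tau> \<inter> \<tau>') * ?o \<tau> \<tau>' \<omega>)" for \<sigma> \<omega>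
  proof -
    have "real (card {\<tau>\<in>faces j (cplx n \<omega>). \<sigma> \<subseteq> \<tau>}) = (\<Sum>\<tau>\<in>?S. of_bool (\<sigma> \<subseteq> \<tau> \<and> (\<forall>\<rho>\<in>Pow \<tau>. \<omega> \<rho>)))"
      unfolding faces_cplx using finite_subs(1)
      by (simp add: sum.If_cases Int_def of_bool_def) (metis (mono_tags, lifting))
    then have "(real (card {\<tau>\<in>faces j (cplx n \<omega>). \<sigma> \<subseteq> \<tau>}))\<^sup>2 = (\<Sum>\<tau>\<in>?S. \<Sum>\<tau>'\<in>?S. of_bool (\<sigma> \<subseteq> \<tau> \<and> (\<forall>\<rho>\<in>Pow \<tau>. \<omega> \<rho>)) * of_bool (\<sigma> \<subseteq> \<tau>' \<and> (\<forall>\<rho>\<in>Pow \<tau>'. \<omega> \<rho>)))"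
      by (simp only: power2_eq_square sum_product)
    also have "\<dots> = (\<Sum>\<tau>\<in>?S. \<Sum>\<tau>'\<in>?S. of_bool (\<sigma> \<subseteq> \<tau> \<inter> \<tau>') * ?o \<tau> \<tau>' \<omega>)"
      by (intro sum.cong refl) (simp only: of_bool_conj[symmetric] ball_Un Int_subset_iff conj_ac)
    finally show ?thesis .
  qed
  have "(\<Sum>\<sigma>\<in>?P. F n (\<lambda>\<omega>. (real (card {\<tau>\<in>faces j (cplx n \<omega>). \<sigma> \<subseteq> \<tau>}))\<^sup>2))
     = (\<Sum>\<sigma>\<in>?P. \<Sum>\<tau>\<in>?S. \<Sum>\<tau>'\<in>?S. of_bool (\<sigma> \<subseteq> \<tau> \<inter> \<tau>') * F n (?o \<tau> \<tau>'))"
    unfolding sq F_sum by simp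
  also have "\<dots> = (\<Sum>\<tau>\<in>?S. \<Sum>\<tau>'\<in>?S. \<Sum>\<sigma>\<in>?P. of_bool (\<sigma> \<subseteq> \<tau> \<inter> \<tau>') * F n (?o \<tau> \<tau>'))"
    by (subst sum.swap) (intro sum.cong refl sum.swap)
  also have "\<dots> \<le> (\<Sum>\<tau>\<in>?S. \<Sum>\<tau>'\<in>?S. if card (\<tau>' \<inter> \<tau>) \<in> {1..j} then 2 ^ j * wt (Pow \<tau> \<union> Pow \<tau>') else 0)"
  proof (intro sum_mono)
    fix \<tau> \<tau>' assume t: "\<tau> \<in> ?S" "\<tau>' \<in> ?S"
    have ft: "finite \<tau>" "finite \<tau>'" using t finite_subs by auto
    have Fo: "F n (?o \<tau> \<tau>') = wt (Pow \<tau> \<union> Pow \<tau>')"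
      by (rule F_open) (use t in \<open>auto simp: subs_def\<close>)
    have "(\<Sum>\<sigma>\<in>?P. of_bool (\<sigma> \<subseteq> \<tau> \<inter> \<tau>') * F n (?o \<tau> \<tau>')) = real (card {\<sigma>\<in>?P. \<sigma> \<subseteq> \<tau> \<inter> \<tau>'}) * wt (Pow \<tau> \<union> Pow \<tau>')"
      unfolding Fo sum_distrib_right[symmetric] by (simp add: sum.If_cases Int_def of_bool_def)
    also have "\<dots> \<le> (if card (\<tau>' \<inter> \<tau>) \<in> {1..j} then 2 ^ j * wt (Pow \<tau> \<union> Pow \<tau>') else 0)"
    proof (cases "\<tau> \<inter> \<tau>' = {}")
      case True
      then have "{\<sigma>\<in>?P. \<sigma> \<subseteq> \<tau> \<inter> \<tau>'} = {}" by auto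
      then show ?thesis using True by (simp add: Int_commute)
    next
      case False
      have "card {\<sigma>\<in>?P. \<sigma> \<subseteq> \<tau> \<inter> \<tau>'} \<le> card (Pow \<tau>)" using ft by (intro card_mono) auto
      also have "\<dots> = 2 ^ j" using ft t by (simp add: card_Pow subs_def)
      finally have "real (card {\<sigma>\<in>?P. \<sigma> \<subseteq> \<tau> \<inter> \<tau>'}) \<le> 2 ^ j"
        by (metis of_nat_le_iff of_nat_numeral of_nat_power)
      moreover have "card (\<tau>' \<inter> \<tau>) \<le> j" using t card_mono[OF ft(1), of "\<tau>' \<inter> \<tau>"] by (simp add: subs_def)
      moreover have "card (\<tau>' \<inter> \<tau>) \<noteq> 0" using False ft by auto
      ultimately show ?thesis using wt_nonneg by (auto intro!: mult_right_mono)
    qed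
    finally show "(\<Sum>\<sigma>\<in>?P. of_bool (\<sigma> \<subseteq> \<tau> \<inter> \<tau>') * F n (?o \<tau> \<tau>')) \<le> (if card (\<tau>' \<inter> \<tau>) \<in> {1..j} then 2 ^ j * wt (Pow \<tau> \<union> Pow \<tau>') else 0)" .
  qed
  also have "\<dots> = (\<Sum>\<tau>\<in>?S. 2 ^ j * (\<Sum>\<tau>'\<in>{\<tau>'\<in>?S. card (\<tau>' \<inter> \<tau>) \<in> {1..j}}. wt (Pow \<tau> \<union> Pow \<tau>')))"
    unfolding sum_distrib_left by (rule sum.cong[OF refl]) (rule sum.inter_filter[OF finite_subs(1), symmetric])
  also have "\<dots> \<le> (\<Sum>\<tau>\<in>?S. 2 ^ j * (Q j * kap n j * 2 ^ j * tail n j))"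
  proof (intro sum_mono mult_left_mono)
    fix \<tau> assume t: "\<tau> \<in> ?S"
    have ft: "finite \<tau>" "card \<tau> = j" using finite_subs(2)[OF t] t by (simp_all add: subs_def)
    have "(\<Sum>\<tau>'\<in>{\<tau>'\<in>?S. card (\<tau>' \<inter> \<tau>) \<in> {1..j}}. wt (Pow \<tau> \<union> Pow \<tau>'))
      \<le> wt (Pow \<tau>) * kap n j * 2 ^ card \<tau> * (\<Sum>b\<in>{1..j}. 1 / kap n b)"
      by (rule sum_wt_union_le[OF ft(1) _ pos]) auto
    then show "(\<Sum>\<tau>'\<in>{\<tau>'\<in>?S. card (\<tau>' \<inter> \<tau>) \<in> {1..j}}. wt (Pow \<tau> \<union> Pow \<tau>')) \<le> Q j * kap n j * 2 ^ j * tail n j"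
      unfolding wt_def[of "Pow \<tau>"] prod_Pow_s(1)[OF ft(1)] tail_def ft(2) .
  qed simp
  also have "\<dots> = real (n choose j) * Q j * (4 ^ j * kap n j * tail n j)"
  proof -
    have "(2 * 2 :: real) ^ j = 2 ^ j * 2 ^ j" by (rule power_mult_distrib)
    then have four: "(4::real) ^ j = 2 ^ j * 2 ^ j" by simp
    show ?thesis unfolding sum_constant card_subs four by (simp only: mult_ac)
  qed
  also have "\<dots> \<le> kap n j * (4 ^ j * kap n j * tail n j)"
  proof (rule mult_right_mono)
    have "real (n choose j) \<le> real (n ^ j)" using binomial_le_power by (intro of_nat_mono)
    then show "real (n choose j) * Q j \<le> kap n j" unfolding kap_def
      using cube_prod_01 by (intro mult_right_mono) auto
  qed (use tail kj in simp)
  finally show ?thesis by (simp only: power2_eq_square mult_ac)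
qed

lemma finite_cplx: "finite (cplx n \<omega>)"
  by (rule finite_subset[of _ "Pow {1..n}"]) (auto simp: cplx_def)

text \<open>Marking \<sigma> only creates simplices that contain \<sigma>: new faces may raise the
  cocycle dimension, new cofaces may lower it, each kind by at most its number. Hence the influences
  are bounded by stars, with \<open>k+1\<close> and with \<open>k+2\<close> vertices.\<close>

lemma nullity_variance:
  assumes pos: "\<And>b. b \<le> k + 2 \<Longrightarrow> kap n b > 0"
  shows "F n (\<lambda>\<omega>. (real (nullity k (cplx n \<omega>)))\<^sup>2) - (F n (\<lambda>\<omega>. real (nullity k (cplx n \<omega>))))\<^sup>2
    \<le> 2 * (4 ^ (k+1) * (kap n (k+1))\<^sup>2 * tail n (k+1)) + 2 * (4 ^ (k+2) * (kap n (k+2))\<^sup>2 * tail n (k+2))"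
proof -
  let ?f = "\<lambda>\<omega>. real (nullity k (cplx n \<omega>))"
  let ?c = "\<lambda>j \<sigma> \<omega>. real (card {\<tau>\<in>faces j (cplx n \<omega>). \<sigma> \<subseteq> \<tau>})"
  let ?q = "\<lambda>\<sigma> :: nat set. p (card \<sigma>)"
  have diff: "(?f (fun_upd \<omega> \<sigma> True) - ?f (fun_upd \<omega> \<sigma> False))\<^sup>2 \<le> 2 * (?c (k+1) \<sigma> (fun_upd \<omega> \<sigma> True))\<^sup>2 + 2 * (?c (k+2) \<sigma> (fun_upd \<omega> \<sigma> True))\<^sup>2" for \<sigma> \<omega>
  proof -
    let ?X1 = "cplx n (fun_upd \<omega> \<sigma> True)" and ?X0 = "cplx n (fun_upd \<omega> \<sigma> False)"
    have sub: "?X0 \<subseteq> ?X1"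
    proof
      fix \<tau> assume t: "\<tau> \<in> ?X0"
      have "(fun_upd \<omega> \<sigma> True) \<rho>" if "\<rho> \<subseteq> \<tau>" for \<rho>
      proof -
        have "(fun_upd \<omega> \<sigma> False) \<rho>" using t that unfolding cplx_def by blast
        then show ?thesis by (cases "\<rho> = \<sigma>") simp_all
      qed
      then show "\<tau> \<in> ?X1" using t by (simp add: cplx_def)
    qed
    have new: "faces j ?X1 - faces j ?X0 \<subseteq> {\<tau>\<in>faces j ?X1. \<sigma> \<subseteq> \<tau>}" for j
    proof
      fix \<tau> assume t: "\<tau> \<in> faces j ?X1 - faces j ?X0"
      have "\<sigma> \<subseteq> \<tau>"
      proof (rule ccontr)
        assume n: "\<not> \<sigma> \<subseteq> \<tau>"
        have "(fun_upd \<omega> \<sigma> False) \<rho>" if "\<rho> \<subseteq> \<tau>" for \<rho>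
        proof -
          have "(fun_upd \<omega> \<sigma> True) \<rho>" using t that unfolding cplx_def faces_def by blast
          moreover have "\<rho> \<noteq> \<sigma>" using that n by auto
          ultimately show ?thesis by simp
        qed
        then have "\<tau> \<in> faces j ?X0" using t unfolding cplx_def faces_def by blast
        then show False using t by simp
      qed
      then show "\<tau> \<in> {\<tau>\<in>faces j ?X1. \<sigma> \<subseteq> \<tau>}" using t by simp
    qed
    have cn: "card (faces j ?X1 - faces j ?X0) \<le> card {\<tau>\<in>faces j ?X1. \<sigma> \<subseteq> \<tau>}" for j
      by (rule card_mono[OF _ new]) (use finite_faces[OF finite_cplx] in auto)
    define a where "a = ?c (k+1) \<sigma> (fun_upd \<omega> \<sigma> True)"
    define b where "b = ?c (k+2) \<sigma> (fun_upd \<omega> \<sigma> True)"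
    have "?f (fun_upd \<omega> \<sigma> True) \<le> ?f (fun_upd \<omega> \<sigma> False) + a"
      using nullity_le_add_faces[OF finite_cplx sub, of k] cn[of "k+1"] unfolding a_def by linarith
    moreover have "?f (fun_upd \<omega> \<sigma> False) \<le> ?f (fun_upd \<omega> \<sigma> True) + b"
      using nullity_le_add_cofaces[OF finite_cplx sub, of k] cn[of "k+2"] unfolding b_def by linarith
    moreover have "a \<ge> 0" "b \<ge> 0" by (auto simp: a_def b_def)
    ultimately have "\<bar>?f (fun_upd \<omega> \<sigma> True) - ?f (fun_upd \<omega> \<sigma> False)\<bar> \<le> \<bar>a + b\<bar>" by linarith
    then have "(?f (fun_upd \<omega> \<sigma> True) - ?f (fun_upd \<omega> \<sigma> False))\<^sup>2 \<le> (a + b)\<^sup>2" by (simp add: abs_le_square_iff)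
    also have "\<dots> \<le> 2 * a\<^sup>2 + 2 * b\<^sup>2"
    proof -
      have "0 \<le> (a - b)\<^sup>2" by simp
      then show ?thesis by (simp add: power2_eq_square algebra_simps)
    qed
    finally show ?thesis unfolding a_def b_def .
  qed
  have q: "0 \<le> ?q \<sigma> \<and> ?q \<sigma> \<le> 1" for \<sigma> using p01 by simp
  let ?G = "\<lambda>\<sigma> \<omega>. 2 * (?c (k+1) \<sigma> \<omega>)\<^sup>2 + 2 * (?c (k+2) \<sigma> \<omega>)\<^sup>2"
  have "F n (\<lambda>\<omega>. (?f \<omega>)\<^sup>2) - (F n ?f)\<^sup>2
    \<le> (\<Sum>\<sigma>\<in>Pow {1..n}. ?q \<sigma> * (1 - ?q \<sigma>) * F n (\<lambda>\<omega>. (?f (fun_upd \<omega> \<sigma> True) - ?f (fun_upd \<omega> \<sigma> False))\<^sup>2))"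
    unfolding field_def by (rule efron_stein[of "Pow {1..n}" ?q ?f]) (use q in auto)
  \<comment> \<open>The empty set is marked with probability 1 and has no influence; it must be left
    out because its star consists of all faces.\<close>
  also have "\<dots> = (\<Sum>\<sigma>\<in>Pow {1..n} - {{}}. ?q \<sigma> * (1 - ?q \<sigma>) * F n (\<lambda>\<omega>. (?f (fun_upd \<omega> \<sigma> True) - ?f (fun_upd \<omega> \<sigma> False))\<^sup>2))"
    by (rule sum.mono_neutral_right) (auto simp: p0)
  also have "\<dots> \<le> (\<Sum>\<sigma>\<in>Pow {1..n} - {{}}. F n (?G \<sigma>))"
  proof (rule sum_mono)
    fix \<sigma> assume s: "\<sigma> \<in> Pow {1..n} - {{}}"
    have nn: "0 \<le> F n (\<lambda>\<omega>. (?f (fun_upd \<omega> \<sigma> True) - ?f (fun_upd \<omega> \<sigma> False))\<^sup>2)"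
      by (rule integral_nonneg_AE) simp
    have "?q \<sigma> * (1 - ?q \<sigma>) * F n (\<lambda>\<omega>. (?f (fun_upd \<omega> \<sigma> True) - ?f (fun_upd \<omega> \<sigma> False))\<^sup>2)
       \<le> ?q \<sigma> * F n (\<lambda>\<omega>. (?f (fun_upd \<omega> \<sigma> True) - ?f (fun_upd \<omega> \<sigma> False))\<^sup>2)"
      using q[of \<sigma>] nn by (intro mult_right_mono) (auto simp: mult_left_le)
    also have "\<dots> \<le> ?q \<sigma> * F n (\<lambda>\<omega>. ?G \<sigma> (fun_upd \<omega> \<sigma> True))"
      using q by (intro mult_left_mono F_mono diff) auto
    also have "\<dots> = F n (\<lambda>\<omega>. of_bool (\<omega> \<sigma>) * ?G \<sigma> \<omega>)"
      unfolding field_def by (rule Ep_Pi_update[of "Pow {1..n}" \<sigma> ?q "?G \<sigma>"]) (use s q in auto)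
    also have "\<dots> \<le> F n (?G \<sigma>)" by (rule F_mono) simp
    finally show "?q \<sigma> * (1 - ?q \<sigma>) * F n (\<lambda>\<omega>. (?f (fun_upd \<omega> \<sigma> True) - ?f (fun_upd \<omega> \<sigma> False))\<^sup>2) \<le> F n (?G \<sigma>)" .
  qed
  also have "\<dots> = 2 * (\<Sum>\<sigma>\<in>Pow {1..n} - {{}}. F n (\<lambda>\<omega>. (?c (k+1) \<sigma> \<omega>)\<^sup>2))
      + 2 * (\<Sum>\<sigma>\<in>Pow {1..n} - {{}}. F n (\<lambda>\<omega>. (?c (k+2) \<sigma> \<omega>)\<^sup>2))"
    unfolding sum_distrib_left sum.distrib[symmetric]
    by (rule sum.cong[OF refl]) (simp add: Bochner_Integration.integral_add[OF int_field int_field])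
  also have "\<dots> \<le> 2 * (4 ^ (k+1) * (kap n (k+1))\<^sup>2 * tail n (k+1)) + 2 * (4 ^ (k+2) * (kap n (k+2))\<^sup>2 * tail n (k+2))"
    by (intro add_mono mult_left_mono star_sum pos) auto
  finally show ?thesis .
qed

end

section \<open>Exploration trees\<close>

text \<open>An edge \<open>(u, Ls)\<close> at the face \<open>w\<close> stands for the coface \<open>w \<union> {u}\<close>; the \<open>i\<close>-th entry of \<open>Ls\<close> belongs to
  its face opposite to the \<open>i\<close>-th smallest vertex of \<open>w\<close>.\<close>
datatype ltree = LNode (edges: "(nat \<times> ltree list) list")

abbreviation sl :: "nat set \<Rightarrow> nat list" where "sl \<equiv> sorted_list_of_set"

text \<open>A triple \<open>(u, x, L')\<close> stands for the subtree \<open>L'\<close> at the face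
  \<open>cf u x w\<close>, in which the vertex \<open>x\<close> has been traded for
  \<open>u\<close>.\<close>

definition ch :: "nat set \<Rightarrow> ltree \<Rightarrow> (nat \<times> nat \<times> ltree) set" where
  "ch w L = {(u, x, L'). \<exists>Ls. (u, Ls) \<in> set (edges L) \<and> (x, L') \<in> set (zip (sl w) Ls)}"

abbreviation cf :: "nat \<Rightarrow> nat \<Rightarrow> nat set \<Rightarrow> nat set" where "cf u x w \<equiv> insert u (w - {x})"

primrec labs :: "nat \<Rightarrow> ltree \<Rightarrow> nat list" where
  "labs 0 L = []"
| "labs (Suc l) L = concat (map (\<lambda>(u, Ls). u # concat (map (labs l) Ls)) (edges L))"

primrec shape :: "nat \<Rightarrow> ltree \<Rightarrow> tree" where
  "shape 0 L = Node []"
| "shape (Suc l) L = Node (map (\<lambda>(u, Ls). map (shape l) Ls) (edges L))"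

primrec wf_ltree :: "nat \<Rightarrow> nat \<Rightarrow> ltree \<Rightarrow> bool" where
  "wf_ltree k 0 L \<longleftrightarrow> L = LNode []"
| "wf_ltree k (Suc l) L \<longleftrightarrow> sorted_wrt (<) (map fst (edges L)) \<and>
     (\<forall>(u, Ls)\<in>set (edges L). length Ls = k + 1 \<and> (\<forall>L'\<in>set Ls. wf_ltree k l L'))"

primrec hyp :: "nat \<Rightarrow> nat set \<Rightarrow> ltree \<Rightarrow> nat set set" where
  "hyp 0 w L = {}"
| "hyp (Suc l) w L = (\<lambda>u. insert u w) ` fst ` set (edges L) \<union> (\<Union>(u, x, L')\<in>ch w L. hyp l (cf u x w) L')"

text \<open>The nodes of depth \<open>l\<close> are included if \<open>s\<close> is true.\<close>
primrec nodes :: "bool \<Rightarrow> nat \<Rightarrow> nat set \<Rightarrow> ltree \<Rightarrow> nat set set" where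
  "nodes s 0 w L = (if s then {w} else {})"
| "nodes s (Suc l) w L = insert w (\<Union>(u, x, L')\<in>ch w L. nodes s l (cf u x w) L')"

text \<open>\<open>L\<close> is the exploration of \<open>X\<close> to depth \<open>l\<close> starting from the face \<open>w\<close>, where \<open>w \<union> e\<close> is the coface
  through which \<open>w\<close> was reached.\<close>
primrec explores :: "nat set set \<Rightarrow> nat \<Rightarrow> nat set \<Rightarrow> nat set \<Rightarrow> ltree \<Rightarrow> bool" where
  "explores X 0 w e L \<longleftrightarrow> L = LNode []"
| "explores X (Suc l) w e L \<longleftrightarrow> sorted_wrt (<) (map fst (edges L)) \<and>
     fst ` set (edges L) = {u. u \<notin> w \<and> u \<notin> e \<and> insert u w \<in> X} \<and>
     (\<forall>(u, Ls)\<in>set (edges L). length Ls = card w) \<and>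
     (\<forall>(u, x, L')\<in>ch w L. explores X l (cf u x w) {x} L')"

text \<open>Distinct labels that avoid the root face say that each new vertex is really new, so that
  the explored part has no cycles.\<close>

definition good :: "nat \<Rightarrow> nat \<Rightarrow> nat set \<Rightarrow> ltree \<Rightarrow> bool" where
  "good k l w L \<longleftrightarrow> wf_ltree k l L \<and> distinct (labs l L) \<and> w \<inter> set (labs l L) = {} \<and> finite w \<and> card w = k + 1"

section \<open>Distinct labels keep subtrees apart\<close>

lemma concat_disjoint:
  assumes "distinct (concat (map g xs))" "i < length xs" "j < length xs" "i \<noteq> j"
  shows "set (g (xs ! i)) \<inter> set (g (xs ! j)) = {}"
  using assms
proof (induction xs arbitrary: i j)
  case (Cons x xs)
  have d: "set (g x) \<inter> set (g y) = {}" if "y \<in> set xs" for y using Cons.prems(1) that by auto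
  show ?case
  proof (cases i)
    case 0
    then obtain j' where "j = Suc j'" using Cons.prems by (cases j) auto
    then show ?thesis using 0 d[of "xs ! j'"] Cons.prems by simp
  next
    case (Suc i')
    show ?thesis
    proof (cases j)
      case 0
      then show ?thesis using Suc d[of "xs ! i'"] Cons.prems by auto
    next
      case (Suc j')
      then show ?thesis using \<open>i = Suc i'\<close> Cons.IH[of i' j'] Cons.prems by simp
    qed
  qed
qed simp

lemma distinct_concat_mem: "distinct (concat (map g xs)) \<Longrightarrow> x \<in> set xs \<Longrightarrow> distinct (g x)"
  by (induction xs) auto

lemma set_labs_Suc:
  "set (labs (Suc l) L) = (\<Union>(u, Ls)\<in>set (edges L). set (u # concat (map (labs l) Ls)))"
  by auto

lemma finite_ch: "finite (ch w L)"
proof -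
  have "ch w L \<subseteq> (\<Union>(u, Ls)\<in>set (edges L). (\<lambda>(x, L'). (u, x, L')) ` set (zip (sl w) Ls))"
    unfolding ch_def by force
  then show ?thesis by (rule finite_subset) auto
qed

lemma ch_facts:
  assumes g: "good k (Suc l) w L" and c: "(u, x, L') \<in> ch w L"
  shows "x \<in> w" "u \<notin> w" "u \<in> fst ` set (edges L)" "u \<in> set (labs (Suc l) L)"
    "set (labs l L') \<subseteq> set (labs (Suc l) L)" "u \<notin> set (labs l L')" "good k l (cf u x w) L'"
proof -
  obtain Ls where Ls: "(u, Ls) \<in> set (edges L)" "(x, L') \<in> set (zip (sl w) Ls)" using c unfolding ch_def by blast
  have fw: "finite w" using g by (simp add: good_def)
  show x: "x \<in> w" using set_zip_leftD[OF Ls(2)] fw by simp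
  have L': "L' \<in> set Ls" using Ls(2) by (rule set_zip_rightD)
  let ?f = "\<lambda>(u, Ls). u # concat (map (labs l) Ls)"
  have dc: "distinct (concat (map ?f (edges L)))" using g by (simp add: good_def)
  have df: "distinct (u # concat (map (labs l) Ls))" using distinct_concat_mem[OF dc Ls(1)] by simp
  have sub: "set (u # concat (map (labs l) Ls)) \<subseteq> set (labs (Suc l) L)"
    unfolding set_labs_Suc using UN_upper[OF Ls(1), of "\<lambda>(u, Ls). set (u # concat (map (labs l) Ls))"] by (simp only: case_prod_conv)
  show u: "u \<in> set (labs (Suc l) L)" using sub by auto
  show "u \<in> fst ` set (edges L)" using imageI[OF Ls(1), of fst] by simp
  show uw: "u \<notin> w" using u g unfolding good_def by blast
  show L'sub: "set (labs l L') \<subseteq> set (labs (Suc l) L)" using sub L' by auto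
  show uL': "u \<notin> set (labs l L')" using df L' by auto
  have "distinct (labs l L')" using df distinct_concat_mem[of "labs l" Ls L'] L' by simp
  moreover have "wf_ltree k l L'" using g Ls(1) L' unfolding good_def wf_ltree.simps by blast
  moreover have "cf u x w \<inter> set (labs l L') = {}" using uL' L'sub g unfolding good_def by blast
  moreover have "card (cf u x w) = k + 1"
  proof -
    have "card (cf u x w) = Suc (card (w - {x}))" using uw fw by simp
    then show ?thesis using x fw g card_Suc_Diff1[OF fw x] unfolding good_def by simp
  qed
  ultimately show "good k l (cf u x w) L'" using fw unfolding good_def by simp
qed

text \<open>Labels belonging to different edges, or to different entries of one edge, occupy
  different segments of the label list, which is distinct.\<close>

lemma ch_separate:
  assumes g: "good k (Suc l) w L" and c: "(u, x, L') \<in> ch w L" "(u2, x2, L2) \<in> ch w L"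
  shows "u = u2 \<Longrightarrow> x = x2 \<Longrightarrow> L' = L2" "(u, x) \<noteq> (u2, x2) \<Longrightarrow> set (labs l L') \<inter> set (labs l L2) = {}"
    "u \<notin> set (labs l L2)"
proof -
  obtain Ls where Ls: "(u, Ls) \<in> set (edges L)" "(x, L') \<in> set (zip (sl w) Ls)" using c unfolding ch_def by blast
  obtain Ls2 where Ls2: "(u2, Ls2) \<in> set (edges L)" "(x2, L2) \<in> set (zip (sl w) Ls2)" using c unfolding ch_def by blast
  have fw: "finite w" using g by (simp add: good_def)
  let ?f = "\<lambda>(u, Ls). u # concat (map (labs l) Ls)"
  have dc: "distinct (concat (map ?f (edges L)))" using g by (simp add: good_def)
  obtain i where i: "i < length (edges L)" "edges L ! i = (u, Ls)" using Ls(1) by (metis in_set_conv_nth)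
  obtain j where j: "j < length (edges L)" "edges L ! j = (u2, Ls2)" using Ls2(1) by (metis in_set_conv_nth)
  obtain a where a: "a < length (sl w)" "a < length Ls" "x = sl w ! a" "L' = Ls ! a" using Ls(2) unfolding set_zip by auto
  obtain b where b: "b < length (sl w)" "b < length Ls2" "x2 = sl w ! b" "L2 = Ls2 ! b" using Ls2(2) unfolding set_zip by auto
  have disj: "set (?f (u, Ls)) \<inter> set (?f (u2, Ls2)) = {}" if "i \<noteq> j"
    using concat_disjoint[OF dc i(1) j(1) that] unfolding i(2) j(2) .
  have ij: "i = j" if "u = u2" using disj that by auto
  have df: "distinct (u # concat (map (labs l) Ls))" using distinct_concat_mem[OF dc Ls(1)] by simp
  show "L' = L2" if "u = u2" "x = x2"
  proof -
    have "Ls = Ls2" using ij[OF that(1)] i(2) j(2) by simp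
    moreover have "a = b" using that(2) a b distinct_sorted_list_of_set[of w] by (simp add: nth_eq_iff_index_eq)
    ultimately show ?thesis using a b by simp
  qed
  show "set (labs l L') \<inter> set (labs l L2) = {}" if ne: "(u, x) \<noteq> (u2, x2)"
  proof (cases "i = j")
    case True
    then have eq: "u = u2" "Ls = Ls2" using i(2) j(2) by simp_all
    then have "a \<noteq> b" using ne a b by auto
    then show ?thesis using concat_disjoint[of "labs l" Ls a b] df a b eq by simp
  next
    case False
    have "set (labs l L') \<subseteq> set (?f (u, Ls))" "set (labs l L2) \<subseteq> set (?f (u2, Ls2))" using a b by auto
    then show ?thesis using disj[OF False] by blast
  qed
  show "u \<notin> set (labs l L2)"
  proof (cases "i = j")
    case True
    then have "L2 \<in> set Ls" using i(2) j(2) b by auto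
    then show ?thesis using df by auto
  next
    case False
    have "set (labs l L2) \<subseteq> set (?f (u2, Ls2))" using b by auto
    then show ?thesis using disj[OF False] by auto
  qed
qed

lemma edge_labels:
  assumes "good k (Suc l) w L" "u \<in> fst ` set (edges L)"
  shows "u \<in> set (labs (Suc l) L)" "u \<notin> w"
proof -
  obtain Ls where Ls: "(u, Ls) \<in> set (edges L)" using assms(2) by auto
  show "u \<in> set (labs (Suc l) L)" unfolding set_labs_Suc
    using UN_upper[OF Ls, of "\<lambda>(u, Ls). set (u # concat (map (labs l) Ls))"] by auto
  then show "u \<notin> w" using assms(1) unfolding good_def by blast
qed

lemma edge_label_not_child:
  assumes g: "good k (Suc l) w L" and u: "u \<in> fst ` set (edges L)" and c: "(u2, x2, L2) \<in> ch w L"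
  shows "u \<notin> set (labs l L2)"
proof -
  obtain Ls where Ls: "(u, Ls) \<in> set (edges L)" using u by force
  have w: "finite w" "card w = k + 1" using g by (simp_all add: good_def)
  have "length Ls = k + 1" using g Ls unfolding good_def wf_ltree.simps by blast
  then have "0 < length (zip (sl w) Ls)" using w by simp
  then have "zip (sl w) Ls ! 0 \<in> set (zip (sl w) Ls)" by (rule nth_mem)
  then have "(u, fst (zip (sl w) Ls ! 0), snd (zip (sl w) Ls ! 0)) \<in> ch w L" using Ls unfolding ch_def by auto
  then show ?thesis using ch_separate(3)[OF g _ c] by blast
qed

text \<open>The first property is the key one: every node other than the root contains a label, so
  the root alone consists of old vertices.\<close>

lemma node_facts:
  assumes "good k l w L" "\<sigma> \<in> nodes s l w L"
  shows "\<sigma> = w \<or> \<sigma> \<inter> set (labs l L) \<noteq> {}" "\<sigma> \<subseteq> w \<union> set (labs l L)" "card \<sigma> = k + 1" "finite \<sigma>"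
    "\<sigma> = w \<or> (\<exists>a\<in>hyp l w L. \<sigma> \<subseteq> a)"
proof -
  have "(\<sigma> = w \<or> \<sigma> \<inter> set (labs l L) \<noteq> {}) \<and> \<sigma> \<subseteq> w \<union> set (labs l L) \<and> card \<sigma> = k + 1 \<and> finite \<sigma>
     \<and> (\<sigma> = w \<or> (\<exists>a\<in>hyp l w L. \<sigma> \<subseteq> a))"
    using assms
  proof (induction l arbitrary: w L)
    case 0
    then show ?case by (auto simp: good_def split: if_splits)
  next
    case (Suc l)
    show ?case
    proof (cases "\<sigma> = w")
      case True
      then show ?thesis using Suc.prems(1) by (simp add: good_def)
    next
      case False
      then obtain u x L' where c: "(u, x, L') \<in> ch w L" "\<sigma> \<in> nodes s l (cf u x w) L'" using Suc.prems(2) by auto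
      note cc = ch_facts[OF Suc.prems(1) c(1)]
      note IH = Suc.IH[OF cc(7) c(2)]
      have h1: "insert u w \<in> hyp (Suc l) w L" using cc(3) by simp
      have h2: "hyp l (cf u x w) L' \<subseteq> hyp (Suc l) w L" using c(1) by auto
      have "\<exists>a\<in>hyp (Suc l) w L. \<sigma> \<subseteq> a"
      proof (cases "\<sigma> = cf u x w")
        case True
        then have "\<sigma> \<subseteq> insert u w" by auto
        then show ?thesis using h1 by (rule rev_bexI[rotated])
      next
        case False
        then obtain a where "a \<in> hyp l (cf u x w) L'" "\<sigma> \<subseteq> a" using IH by auto
        then show ?thesis using subsetD[OF h2] by (intro rev_bexI[of a]) auto
      qed
      moreover have "\<sigma> \<inter> set (labs (Suc l) L) \<noteq> {}"
      proof (cases "\<sigma> = cf u x w")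
        case True
        then have "u \<in> \<sigma> \<inter> set (labs (Suc l) L)" using cc(4) by simp
        then show ?thesis by (rule ex_in_conv[THEN iffD1, OF exI])
      next
        case False
        then have "\<sigma> \<inter> set (labs l L') \<noteq> {}" using IH by simp
        then show ?thesis using Int_mono[OF order_refl cc(5), of \<sigma>] by blast
      qed
      moreover have "\<sigma> \<subseteq> w \<union> set (labs (Suc l) L)"
      proof
        fix y assume "y \<in> \<sigma>"
        then have "y \<in> cf u x w \<or> y \<in> set (labs l L')" using IH by auto
        then show "y \<in> w \<union> set (labs (Suc l) L)" using cc(4) subsetD[OF cc(5)] by (auto simp del: labs.simps)
      qed
      ultimately show ?thesis using IH by (simp del: labs.simps hyp.simps)
    qed
  qed
  then show "\<sigma> = w \<or> \<sigma> \<inter> set (labs l L) \<noteq> {}" "\<sigma> \<subseteq> w \<union> set (labs l L)" "card \<sigma> = k + 1" "finite \<sigma>"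
    "\<sigma> = w \<or> (\<exists>a\<in>hyp l w L. \<sigma> \<subseteq> a)" by blast+
qed

lemma finite_nodes: "finite (nodes s l w L)"
  by (induction l arbitrary: w L) (auto simp: finite_ch)

lemma hyp_facts:
  assumes "good k l w L" "a \<in> hyp l w L"
  shows "a \<subseteq> w \<union> set (labs l L)" "\<exists>\<sigma>\<in>nodes False l w L. \<exists>u\<in>set (labs l L). a = insert u \<sigma>"
proof -
  have "a \<subseteq> w \<union> set (labs l L) \<and> (\<exists>\<sigma>\<in>nodes False l w L. \<exists>u\<in>set (labs l L). a = insert u \<sigma>)"
    using assms
  proof (induction l arbitrary: w L)
    case (Suc l)
    consider u where "u \<in> fst ` set (edges L)" "a = insert u w" | u x L' where "(u, x, L') \<in> ch w L" "a \<in> hyp l (cf u x w) L'"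
      using Suc.prems(2) by auto
    then show ?case
    proof cases
      case 1
      have "w \<in> nodes False (Suc l) w L" by simp
      then show ?thesis using edge_labels(1)[OF Suc.prems(1) 1(1)] 1(2) by blast
    next
      case 2
      note cc = ch_facts[OF Suc.prems(1) 2(1)]
      note IH = Suc.IH[OF cc(7) 2(2)]
      have n: "nodes False l (cf u x w) L' \<subseteq> nodes False (Suc l) w L" using 2(1) by auto
      obtain \<sigma> u' where s: "\<sigma> \<in> nodes False l (cf u x w) L'" "u' \<in> set (labs l L')" "a = insert u' \<sigma>"
        using IH by auto
      have "a \<subseteq> w \<union> set (labs (Suc l) L)"
      proof
        fix y assume "y \<in> a"
        then have "y \<in> cf u x w \<or> y \<in> set (labs l L')" using IH by auto
        then show "y \<in> w \<union> set (labs (Suc l) L)" using cc(4) subsetD[OF cc(5)] by (auto simp del: labs.simps)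
      qed
      then show ?thesis using subsetD[OF n s(1)] subsetD[OF cc(5) s(2)] s(3) by blast
    qed
  qed simp
  then show "a \<subseteq> w \<union> set (labs l L)" "\<exists>\<sigma>\<in>nodes False l w L. \<exists>u\<in>set (labs l L). a = insert u \<sigma>" by blast+
qed

text \<open>A node common to two subtrees contains no label of either, because the two label sets
  are disjoint and each avoids the root of the other subtree. It would then be the root of both, but
  \<open>cf u x w\<close> determines \<open>u\<close> and \<open>x\<close>.\<close>

lemma child_nodes_disjoint:
  assumes g: "good k (Suc l) w L" and c: "(u, x, L') \<in> ch w L" "(u2, x2, L2) \<in> ch w L" and ne: "(u, x) \<noteq> (u2, x2)"
    and s: "\<sigma> \<in> nodes s l (cf u x w) L'" "\<sigma> \<in> nodes s l (cf u2 x2 w) L2"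
  shows False
proof -
  note a = ch_facts[OF g c(1)] and b = ch_facts[OF g c(2)]
  note na = node_facts[OF a(7) s(1)] and nb = node_facts[OF b(7) s(2)]
  have wl: "w \<inter> set (labs (Suc l) L) = {}" using g unfolding good_def by blast
  have dis: "set (labs l L') \<inter> set (labs l L2) = {}" by (rule ch_separate(2)[OF g c ne])
  have u2L: "u2 \<notin> set (labs l L')" "u \<notin> set (labs l L2)"
    using ch_separate(3)[OF g c(2,1)] ch_separate(3)[OF g c] by auto
  have "\<sigma> \<inter> set (labs l L') = {}" using nb(2) dis u2L wl a(5) by blast
  then have t1: "\<sigma> = cf u x w" using na(1) by blast
  have "\<sigma> \<inter> set (labs l L2) = {}" using na(2) dis u2L wl b(5) by blast
  then have t2: "\<sigma> = cf u2 x2 w" using nb(1) by blast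
  have "u = u2" using t1 t2 a(2) by blast
  then have "x \<noteq> x2" using ne by simp
  then have "x \<in> cf u2 x2 w" using a(1) by blast
  then have "x \<in> \<sigma>" unfolding t2 .
  then have "x \<in> cf u x w" unfolding t1 .
  then show False using a(1,2) by blast
qed

lemma root_not_child:
  assumes g: "good k (Suc l) w L" and c: "(u, x, L') \<in> ch w L" and s: "w \<in> nodes s l (cf u x w) L'"
  shows False
proof -
  note a = ch_facts[OF g c]
  have wl: "w \<inter> set (labs (Suc l) L) = {}" using g unfolding good_def by blast
  have "w \<inter> set (labs l L') = {}" using wl a(5) by blast
  then have "w = cf u x w" using node_facts(1)[OF a(7) s] by blast
  then show False using a(2) by blast
qed

text \<open>Sorted edges and the fixed order of the entries make the exploration canonical. So for a
  given root the events belonging to different trees exclude each other, which lets their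
  probabilities be added.\<close>

lemma explores_unique:
  "finite w \<Longrightarrow> explores X l w e L \<Longrightarrow> explores X l w e L' \<Longrightarrow> L = L'"
proof (induction l arbitrary: w e L L')
  case (Suc l)
  have fst_eq: "map fst (edges L) = map fst (edges L')"
    using Suc.prems(2,3) by (intro strict_sorted_equal) auto
  then have len: "length (edges L) = length (edges L')" by (metis length_map)
  have "edges L = edges L'"
  proof (rule nth_equalityI[OF len])
    fix i assume i: "i < length (edges L)"
    obtain u Ls where u: "edges L ! i = (u, Ls)" by force
    obtain u' Ls' where u': "edges L' ! i = (u', Ls')" by force
    have "u = u'" using fst_eq i len u u' by (metis fst_conv nth_map)
    have m: "(u, Ls) \<in> set (edges L)" "(u, Ls') \<in> set (edges L')" using i len u u' \<open>u = u'\<close> by (metis nth_mem)+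
    have ll: "length Ls = card w" "length Ls' = card w" using Suc.prems(2,3) m unfolding explores.simps by blast+
    have "Ls = Ls'"
    proof (rule nth_equalityI)
      fix j assume j: "j < length Ls"
      define x where "x = sl w ! j"
      have "(x, Ls ! j) \<in> set (zip (sl w) Ls)" "(x, Ls' ! j) \<in> set (zip (sl w) Ls')"
        unfolding set_zip x_def using j ll Suc.prems(1) by auto
      then have "(u, x, Ls ! j) \<in> ch w L" "(u, x, Ls' ! j) \<in> ch w L'" using m unfolding ch_def by blast+
      then have "explores X l (cf u x w) {x} (Ls ! j)" "explores X l (cf u x w) {x} (Ls' ! j)"
        using Suc.prems(2,3) unfolding explores.simps by blast+
      then show "Ls ! j = Ls' ! j" using Suc.IH[of "cf u x w"] Suc.prems(1) by blast
    qed (use ll in simp)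
    then show "edges L ! i = edges L' ! i" using u u' \<open>u = u'\<close> by simp
  qed
  then show ?case by (rule ltree.expand)
qed simp

text \<open>An inner node lists all its cofaces except the one leading to it, and that one is listed
  by its parent: for a child it is \<open>insert x (cf u x w) = insert u w\<close>. The only
  exception left is the coface through which the root was entered.\<close>

lemma explores_edges:
  assumes "explores X l w e L" "good k l w L" "\<sigma> \<in> nodes False l w L" "a \<in> X" "\<sigma> \<subseteq> a" "card a = k + 2"
  shows "a = w \<union> e \<and> e \<noteq> {} \<or> a \<in> hyp l w L \<or> (\<exists>y\<in>e. a = insert y w)"
  using assms
proof (induction l arbitrary: w e L)
  case (Suc l)
  have ins: "\<exists>u. u \<notin> \<sigma> \<and> a = insert u \<sigma>"
  proof -
    have f: "finite a" using Suc.prems(6) by (metis card.infinite add_is_0 zero_neq_numeral)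
    have "card \<sigma> = k + 1" "finite \<sigma>" using node_facts[OF Suc.prems(2,3)] by auto
    then have "card (a - \<sigma>) = 1" using Suc.prems(5,6) by (simp add: card_Diff_subset)
    then obtain u where "a - \<sigma> = {u}" by (metis card_1_singletonE)
    then show ?thesis using Suc.prems(5) by (intro exI[of _ u]) blast
  qed
  show ?case
  proof (cases "\<sigma> = w")
    case True
    then obtain u where u: "u \<notin> w" "a = insert u w" using ins by blast
    show ?thesis
    proof (cases "u \<in> e")
      case False
      then have "u \<in> fst ` set (edges L)" using u Suc.prems(1,4) by simp
      then show ?thesis using u(2) by simp
    qed (use u in blast)
  next
    case False
    then obtain u x L' where c: "(u, x, L') \<in> ch w L" "\<sigma> \<in> nodes False l (cf u x w) L'" using Suc.prems(3) by auto
    note cc = ch_facts[OF Suc.prems(2) c(1)]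
    have "explores X l (cf u x w) {x} L'" using Suc.prems(1) c(1) unfolding explores.simps by blast
    from Suc.IH[OF this cc(7) c(2) Suc.prems(4-6)] have "a = insert u w \<or> a \<in> hyp l (cf u x w) L'"
      using cc(1) by blast
    moreover have "insert u w \<in> hyp (Suc l) w L" using cc(3) by simp
    moreover have "hyp l (cf u x w) L' \<subseteq> hyp (Suc l) w L" using c(1) by auto
    ultimately show ?thesis by blast
  qed
qed simp

section \<open>Local bounds on the diagonal\<close>

definition vsign :: "nat set \<Rightarrow> nat \<Rightarrow> real" where "vsign a v = (-1) ^ card {u\<in>a. u < v}"

text \<open>The coboundary formula without reference to a complex, so that one function can be
  tested on cofaces in any part of the tree.\<close>

definition bd :: "(nat set \<Rightarrow> real) \<Rightarrow> nat set \<Rightarrow> real" where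
  "bd f a = (\<Sum>v\<in>a. vsign a v * f (a - {v}))"

lemma vsign_sq: "vsign a v * vsign a v = 1" "\<bar>vsign a v\<bar> = 1"
  by (simp_all add: vsign_def power_mult_distrib[symmetric] power_abs)

lemma bd_insert:
  assumes "finite w" "u \<notin> w"
  shows "bd f (insert u w) = vsign (insert u w) u * f w + (\<Sum>x\<in>w. vsign (insert u w) x * f (cf u x w))"
proof -
  have "insert u w - {u} = w" using assms by auto
  moreover have "insert u w - {x} = cf u x w" if "x \<in> w" for x using assms that by auto
  ultimately show ?thesis unfolding bd_def using assms by simp
qed

definition bsum :: "real \<Rightarrow> nat \<Rightarrow> ltree list \<Rightarrow> real" where
  "bsum b l Ls = (\<Sum>L'\<leftarrow>Ls. val b l (shape l L'))"

definition echild :: "nat set \<Rightarrow> nat \<times> ltree list \<Rightarrow> (nat \<times> nat \<times> ltree) set" where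
  "echild w e = (\<lambda>(x, L'). (fst e, x, L')) ` set (zip (sl w) (snd e))"

lemma val_shape_Suc: "val b (Suc l) (shape (Suc l) L) = comb (map (\<lambda>e. bsum b l (snd e)) (edges L))"
proof -
  have "map (\<lambda>ts. \<Sum>t\<leftarrow>ts. val b l t) (map (\<lambda>(u, Ls). map (shape l) Ls) (edges L)) = map (\<lambda>e. bsum b l (snd e)) (edges L)"
    by (simp add: bsum_def comp_def case_prod_beta')
  then show ?thesis by (simp only: val.simps shape.simps tree.sel)
qed

lemma ch_echild: "ch w L = (\<Union>e\<in>set (edges L). echild w e)"
  unfolding ch_def echild_def by force

lemma good_edges:
  assumes "good k (Suc l) w L"
  shows "distinct (edges L)" "distinct (map fst (edges L))" "finite w" "card w = k + 1"
    "e \<in> set (edges L) \<Longrightarrow> length (snd e) = k + 1"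
proof -
  have "sorted_wrt (<) (map fst (edges L))" using assms by (simp add: good_def)
  then show d: "distinct (map fst (edges L))" by (simp add: strict_sorted_iff)
  then show "distinct (edges L)" by (simp add: distinct_map)
  show "finite w" "card w = k + 1" using assms by (auto simp: good_def)
  show "e \<in> set (edges L) \<Longrightarrow> length (snd e) = k + 1" using assms unfolding good_def wf_ltree.simps by force
qed

lemma sum_ch:
  fixes F :: "nat \<times> nat \<times> ltree \<Rightarrow> real"
  assumes "good k (Suc l) w L"
  shows "(\<Sum>c\<in>ch w L. F c) = (\<Sum>e\<in>set (edges L). \<Sum>c\<in>echild w e. F c)"
  unfolding ch_echild
proof (rule sum.UNION_disjoint)
  show "\<forall>e\<in>set (edges L). \<forall>e'\<in>set (edges L). e \<noteq> e' \<longrightarrow> echild w e \<inter> echild w e' = {}"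
  proof (intro ballI impI)
    fix e e' assume e: "e \<in> set (edges L)" "e' \<in> set (edges L)" "e \<noteq> e'"
    have "fst e \<noteq> fst e'" using good_edges(2)[OF assms] e unfolding distinct_map inj_on_def by blast
    then show "echild w e \<inter> echild w e' = {}" unfolding echild_def by auto
  qed
qed (auto simp: echild_def)

lemma sum_echild:
  fixes F :: "nat \<times> nat \<times> ltree \<Rightarrow> real"
  shows "(\<Sum>c\<in>echild w e. F c) = (\<Sum>(x, L')\<in>set (zip (sl w) (snd e)). F (fst e, x, L'))"
  unfolding echild_def by (subst sum.reindex) (auto simp: inj_on_def case_prod_beta')

lemma sum_echild_val:
  assumes w: "finite w" "length (snd e) = card w"
  shows "(\<Sum>(u, x, L')\<in>echild w e. val b l (shape l L')) = bsum b l (snd e)"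
proof -
  let ?z = "zip (sl w) (snd e)"
  have d: "distinct ?z" by (simp add: distinct_zipI1)
  have "bsum b l (snd e) = (\<Sum>L'\<leftarrow>map snd ?z. val b l (shape l L'))"
    using w by (simp add: bsum_def map_snd_zip)
  also have "\<dots> = (\<Sum>z\<leftarrow>?z. val b l (shape l (snd z)))" by (simp add: comp_def)
  also have "\<dots> = (\<Sum>z\<in>set ?z. val b l (shape l (snd z)))" by (rule sum_list_distinct_conv_sum_set[OF d])
  finally show ?thesis unfolding sum_echild by (simp add: case_prod_beta')
qed

lemma sum_echild_fst:
  fixes h :: "nat \<Rightarrow> real"
  assumes w: "finite w" "length (snd e) = card w"
  shows "(\<Sum>(u, x, L')\<in>echild w e. h x) = (\<Sum>x\<in>w. h x)"
proof -
  let ?z = "zip (sl w) (snd e)"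
  have d: "distinct ?z" by (simp add: distinct_zipI1)
  have "(\<Sum>x\<in>w. h x) = (\<Sum>x\<leftarrow>sl w. h x)"
    using w by (subst sum_list_distinct_conv_sum_set) auto
  also have "sl w = map fst ?z" using w by (simp add: map_fst_zip)
  also have "(\<Sum>x\<leftarrow>map fst ?z. h x) = (\<Sum>z\<leftarrow>?z. h (fst z))" by (simp add: comp_def)
  also have "\<dots> = (\<Sum>z\<in>set ?z. h (fst z))" by (rule sum_list_distinct_conv_sum_set[OF d])
  finally show ?thesis unfolding sum_echild by (simp add: case_prod_beta')
qed

lemma val_nonneg:
  assumes "0 \<le> b" "b \<le> 1"
  shows "0 \<le> val b l T \<and> val b l T \<le> 1"
proof (induction l arbitrary: T)
  case (Suc l)
  have "0 \<le> s" if "s \<in> set (map (\<lambda>ts. \<Sum>t\<leftarrow>ts. val b l t) (blocks T))" for s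
    using that Suc by (auto intro!: sum_list_nonneg)
  then show ?case using comb_bounds[of "map (\<lambda>ts. \<Sum>t\<leftarrow>ts. val b l t) (blocks T)"] by simp
qed (use assms in simp)

lemma bsum_nonneg: "0 \<le> b \<Longrightarrow> b \<le> 1 \<Longrightarrow> 0 \<le> bsum b l Ls"
  unfolding bsum_def by (rule sum_list_nonneg) (use val_nonneg in auto)

text \<open>The subtrees have disjoint node sets that avoid the root, so squared norms split over
  the children.\<close>

lemma sum_nodes:
  fixes F :: "nat set \<Rightarrow> real"
  assumes g: "good k (Suc l) w L"
  shows "(\<Sum>\<sigma>\<in>nodes s (Suc l) w L. F \<sigma>) = F w + (\<Sum>(u, x, L')\<in>ch w L. \<Sum>\<sigma>\<in>nodes s l (cf u x w) L'. F \<sigma>)"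
proof -
  let ?N = "\<lambda>(u, x, L'). nodes s l (cf u x w) L'"
  have "w \<notin> (\<Union>c\<in>ch w L. ?N c)" using root_not_child[OF g] by auto
  then have "(\<Sum>\<sigma>\<in>nodes s (Suc l) w L. F \<sigma>) = F w + (\<Sum>\<sigma>\<in>(\<Union>c\<in>ch w L. ?N c). F \<sigma>)"
    by (simp add: finite_ch finite_nodes case_prod_beta')
  also have "(\<Sum>\<sigma>\<in>(\<Union>c\<in>ch w L. ?N c). F \<sigma>) = (\<Sum>c\<in>ch w L. \<Sum>\<sigma>\<in>?N c. F \<sigma>)"
  proof (rule sum.UNION_disjoint)
    show "\<forall>c\<in>ch w L. \<forall>c'\<in>ch w L. c \<noteq> c' \<longrightarrow> ?N c \<inter> ?N c' = {}"
    proof (intro ballI impI)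
      fix c c' assume c: "c \<in> ch w L" "c' \<in> ch w L" "c \<noteq> c'"
      obtain u x L' where [simp]: "c = (u, x, L')" using prod_cases3 by blast
      obtain u2 x2 L2 where [simp]: "c' = (u2, x2, L2)" using prod_cases3 by blast
      have "(u, x) \<noteq> (u2, x2)" using ch_separate(1)[OF g, of u x L' u2 x2 L2] c by auto
      then show "?N c \<inter> ?N c' = {}" using child_nodes_disjoint[OF g, of u x L' u2 x2 L2] c by auto
    qed
  qed (auto simp: finite_ch finite_nodes)
  finally show ?thesis by (simp add: case_prod_beta')
qed

text \<open>With boundary value 1 no block sum vanishes, blocks being nonempty, so
  \<open>comb\<close> takes its reciprocal form at every node.\<close>

lemma val_one_pos:
  "wf_ltree k l L \<Longrightarrow> val 1 l (shape l L) > 0"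
proof (induction l arbitrary: L)
  case (Suc l)
  have pos: "bsum 1 l (snd e) > 0" if "e \<in> set (edges L)" for e
  proof -
    have e: "length (snd e) = k + 1" "\<forall>L'\<in>set (snd e). wf_ltree k l L'"
      using Suc.prems that unfolding wf_ltree.simps by force+
    then obtain L' where L': "L' \<in> set (snd e)" by (cases "snd e") auto
    have "val 1 l (shape l L') \<le> bsum 1 l (snd e)"
      unfolding bsum_def using L' val_nonneg[of 1] by (intro member_le_sum_list) auto
    then show ?thesis using Suc.IH[of L'] e(2) L' by force
  qed
  have "(\<Sum>s\<leftarrow>map (\<lambda>e. bsum 1 l (snd e)) (edges L). 1 / s) \<ge> 0"
    using bsum_nonneg[of 1 l] by (intro sum_list_nonneg) auto
  moreover have "0 \<notin> set (map (\<lambda>e. bsum 1 l (snd e)) (edges L))" using pos by force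
  ultimately show ?case unfolding val_shape_Suc comb_def by simp
qed simp

lemma val_inverse:
  assumes g: "good k (Suc l) w L" and b: "0 \<le> b" "b \<le> 1" and nz: "\<And>e. e \<in> set (edges L) \<Longrightarrow> bsum b l (snd e) > 0"
  shows "val b (Suc l) (shape (Suc l) L) = 1 / (1 + (\<Sum>e\<in>set (edges L). 1 / bsum b l (snd e)))"
proof -
  have "0 \<notin> set (map (\<lambda>e. bsum b l (snd e)) (edges L))" using nz by force
  then have "val b (Suc l) (shape (Suc l) L) = 1 / (1 + (\<Sum>e\<leftarrow>edges L. 1 / bsum b l (snd e)))"
    unfolding val_shape_Suc comb_def by (simp add: comp_def)
  then show ?thesis by (simp only: sum_list_distinct_conv_sum_set[OF good_edges(1)[OF g]])
qed

text \<open>The cocycle equation at a coface bounds the root value by the sum of absolute values on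
  its other faces. By induction and Cauchy-Schwarz, the squared root value divided by the block sum
  is at most the squared norm on the subtrees of that coface. Adding this over the cofaces, together
  with the root itself, gives the factor \<open>1 + t\<close>, the reciprocal of the value.\<close>

lemma tree_upper:
  assumes "explores X l w e L" "good k l w L" "\<And>a. a \<in> X \<Longrightarrow> finite a \<Longrightarrow> card a = k + 2 \<Longrightarrow> bd f a = 0"
  shows "(f w)\<^sup>2 \<le> val 1 l (shape l L) * (\<Sum>\<sigma>\<in>nodes True l w L. (f \<sigma>)\<^sup>2)"
  using assms(1,2)
proof (induction l arbitrary: w e L)
  case (Suc l)
  note g = Suc.prems(2)
  note ge = good_edges[OF g]
  define N where "N = (\<lambda>(u, x, L'). \<Sum>\<sigma>\<in>nodes True l (cf u x w) L'. (f \<sigma>)\<^sup>2)"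
  define V where "V = (\<lambda>(u :: nat, x :: nat, L'). val 1 l (shape l L'))"
  have IH: "(f (cf u x w))\<^sup>2 \<le> V (u, x, L') * N (u, x, L')" if "(u, x, L') \<in> ch w L" for u x L'
  proof -
    have "explores X l (cf u x w) {x} L'" using Suc.prems(1) that unfolding explores.simps by blast
    from Suc.IH[OF this ch_facts(7)[OF g that]] show ?thesis by (simp add: N_def V_def)
  qed
  have edge: "(f w)\<^sup>2 / bsum 1 l (snd ed) \<le> (\<Sum>c\<in>echild w ed. N c)" and pos: "bsum 1 l (snd ed) > 0"
    if ed: "ed \<in> set (edges L)" for ed
  proof -
    define u where "u = fst ed"
    have len: "length (snd ed) = card w" using ge(4,5) ed by simp
    have ec: "echild w ed \<subseteq> ch w L" using ed unfolding ch_echild by blast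
    have eu: "fst c = u" if "c \<in> echild w ed" for c using that unfolding echild_def u_def by auto
    have uw: "u \<in> fst ` set (edges L)" "u \<notin> w"
      using edge_labels(2)[OF g, of u] ed unfolding u_def by auto
    then have "insert u w \<in> X" using Suc.prems(1) by auto
    then have "bd f (insert u w) = 0" using ge(3,4) uw by (intro assms(3)) auto
    then have eq: "vsign (insert u w) u * f w = - (\<Sum>x\<in>w. vsign (insert u w) x * f (cf u x w))"
      unfolding bd_insert[OF ge(3) uw(2)] by linarith
    have "\<bar>f w\<bar> = \<bar>vsign (insert u w) u * f w\<bar>" by (simp add: abs_mult vsign_sq)
    also have "\<dots> \<le> (\<Sum>x\<in>w. \<bar>f (cf u x w)\<bar>)"
      unfolding eq abs_minus_cancel by (rule order_trans[OF sum_abs]) (simp add: abs_mult vsign_sq)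
    also have "\<dots> = (\<Sum>(u', x, L')\<in>echild w ed. \<bar>f (cf u x w)\<bar>)"
      by (rule sum_echild_fst[OF ge(3) len, symmetric])
    also have "\<dots> \<le> (\<Sum>c\<in>echild w ed. sqrt (V c) * sqrt (N c))"
    proof (rule sum_mono)
      fix c assume c: "c \<in> echild w ed"
      obtain u' x L' where C: "c = (u', x, L')" using prod_cases3 by blast
      have "u' = u" using eu[OF c] by (simp add: C)
      then have "(f (cf u x w))\<^sup>2 \<le> V c * N c" using IH[of u x L'] ec c by (auto simp: C)
      then have "sqrt ((f (cf u x w))\<^sup>2) \<le> sqrt (V c * N c)" by (rule real_sqrt_le_mono)
      then show "(case c of (u', x, L') \<Rightarrow> \<bar>f (cf u x w)\<bar>) \<le> sqrt (V c) * sqrt (N c)"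
        by (simp add: C real_sqrt_mult)
    qed
    finally have "\<bar>f w\<bar>\<^sup>2 \<le> (\<Sum>c\<in>echild w ed. sqrt (V c) * sqrt (N c))\<^sup>2" by (intro power_mono) auto
    also have "\<dots> \<le> (\<Sum>c\<in>echild w ed. (sqrt (V c))\<^sup>2) * (\<Sum>c\<in>echild w ed. (sqrt (N c))\<^sup>2)"
      by (rule Cauchy_Schwarz_ineq_sum)
    also have "(\<Sum>c\<in>echild w ed. (sqrt (V c))\<^sup>2) = bsum 1 l (snd ed)"
    proof -
      have "(\<Sum>c\<in>echild w ed. (sqrt (V c))\<^sup>2) = (\<Sum>c\<in>echild w ed. V c)"
        by (rule sum.cong) (use val_nonneg[of 1] in \<open>auto simp: V_def\<close>)
      then show ?thesis unfolding V_def using sum_echild_val[OF ge(3) len] by simp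
    qed
    also have "(\<Sum>c\<in>echild w ed. (sqrt (N c))\<^sup>2) = (\<Sum>c\<in>echild w ed. N c)"
      by (rule sum.cong) (auto simp: N_def intro!: sum_nonneg)
    finally have main: "(f w)\<^sup>2 \<le> bsum 1 l (snd ed) * (\<Sum>c\<in>echild w ed. N c)" by simp
    have "wf_ltree k l L'" if "L' \<in> set (snd ed)" for L'
      using g ed that unfolding good_def wf_ltree.simps by force
    moreover obtain L' where L': "L' \<in> set (snd ed)" using ge(5)[OF ed] by (cases "snd ed") auto
    moreover have "val 1 l (shape l L') \<le> bsum 1 l (snd ed)"
      unfolding bsum_def using L' val_nonneg[of 1] by (intro member_le_sum_list) auto
    ultimately show pos: "bsum 1 l (snd ed) > 0" using val_one_pos[of k l L'] by fastforce
    show "(f w)\<^sup>2 / bsum 1 l (snd ed) \<le> (\<Sum>c\<in>echild w ed. N c)"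
      using main pos by (simp add: pos_divide_le_eq mult.commute)
  qed
  define t where "t = (\<Sum>e\<in>set (edges L). 1 / bsum 1 l (snd e))"
  have t: "t \<ge> 0" unfolding t_def by (rule sum_nonneg) (use pos in \<open>auto intro: less_imp_le\<close>)
  have "(f w)\<^sup>2 * (1 + t) = (f w)\<^sup>2 + (\<Sum>e\<in>set (edges L). (f w)\<^sup>2 / bsum 1 l (snd e))"
    by (simp add: t_def distrib_left sum_distrib_left)
  also have "\<dots> \<le> (f w)\<^sup>2 + (\<Sum>e\<in>set (edges L). \<Sum>c\<in>echild w e. N c)"
    by (intro add_left_mono sum_mono edge)
  also have "\<dots> = (\<Sum>\<sigma>\<in>nodes True (Suc l) w L. (f \<sigma>)\<^sup>2)"
    unfolding sum_nodes[OF g] sum_ch[OF g, symmetric] N_def ..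
  finally have "(f w)\<^sup>2 \<le> (\<Sum>\<sigma>\<in>nodes True (Suc l) w L. (f \<sigma>)\<^sup>2) / (1 + t)"
    using t by (simp add: pos_le_divide_eq)
  moreover have "val 1 (Suc l) (shape (Suc l) L) = 1 / (1 + t)"
    unfolding t_def by (rule val_inverse[OF g]) (use pos in auto)
  ultimately show ?case by (simp only: times_divide_eq_left mult_1_left)
qed simp

lemma bd_nonzero:
  assumes "bd f a \<noteq> 0"
  shows "\<exists>v\<in>a. f (a - {v}) \<noteq> 0"
  using assms unfolding bd_def by (metis (no_types, lifting) mult_zero_right sum.neutral)

text \<open>An extremal function is built explicitly: it is 1 at the root, each coface passes the
  value on to its other faces in proportion to their own values, and it vanishes at depth
  \<open>l\<close>. The coface given by \<open>e\<close> is exempted because its equation is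
  arranged one level up.\<close>

lemma tree_lower:
  assumes "explores X l w e L" "good k l w L" "card e \<le> 1" "e \<inter> (w \<union> set (labs l L)) = {}"
    "val 0 l (shape l L) > 0"
  shows "\<exists>f. f w = 1 \<and> (\<forall>\<sigma>. f \<sigma> \<noteq> 0 \<longrightarrow> \<sigma> \<in> nodes False l w L)
    \<and> (\<Sum>\<sigma>\<in>nodes False l w L. (f \<sigma>)\<^sup>2) \<le> 1 / val 0 l (shape l L)
    \<and> (\<forall>a\<in>X. card a = k + 2 \<longrightarrow> (\<forall>y\<in>e. a \<noteq> insert y w) \<longrightarrow> bd f a = 0)"
  using assms
proof (induction l arbitrary: w e L)
  case (Suc l)
  note g = Suc.prems(2)
  note ge = good_edges[OF g]
  define V where "V = (\<lambda>(u :: nat, x :: nat, L'). val 0 l (shape l L'))"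
  define N where "N = (\<lambda>(u, x, L'). nodes False l (cf u x w) L')"
  define S where "S u = (\<Sum>c\<in>{c\<in>ch w L. fst c = u}. V c)" for u
  have wl: "w \<inter> set (labs (Suc l) L) = {}" using g unfolding good_def by blast
  have V0: "0 \<le> V c" for c using val_nonneg[of 0] by (simp add: V_def case_prod_beta')
  have fst_echild: "fst c = fst ed" if "c \<in> echild w ed" for c ed using that by (auto simp: echild_def)
  have Se: "{c\<in>ch w L. fst c = fst ed} = echild w ed" if ed: "ed \<in> set (edges L)" for ed
  proof (intro equalityI subsetI)
    fix c assume "c \<in> {c\<in>ch w L. fst c = fst ed}"
    then obtain ed' where ed': "ed' \<in> set (edges L)" "c \<in> echild w ed'" "fst c = fst ed" unfolding ch_echild by blast
    then have "fst ed' = fst ed" using fst_echild by metis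
    then have "ed' = ed" using ge(2) ed ed'(1) unfolding distinct_map inj_on_def by blast
    then show "c \<in> echild w ed" using ed'(2) by simp
  next
    fix c assume c: "c \<in> echild w ed"
    then show "c \<in> {c\<in>ch w L. fst c = fst ed}" using fst_echild[OF c] ed unfolding ch_echild by blast
  qed
  have Sb: "S (fst ed) = bsum 0 l (snd ed)" if "ed \<in> set (edges L)" for ed
    unfolding S_def Se[OF that] V_def using sum_echild_val[OF ge(3), of ed 0 l] ge(4,5) that by simp
  have Spos: "bsum 0 l (snd ed) > 0" if ed: "ed \<in> set (edges L)" for ed
  proof -
    have "0 \<notin> set (map (\<lambda>e. bsum 0 l (snd e)) (edges L))"
      using Suc.prems(5) unfolding val_shape_Suc comb_def by (auto split: if_splits)
    then have "bsum 0 l (snd ed) \<noteq> 0" using ed by force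
    then show ?thesis using bsum_nonneg[of 0 l "snd ed"] by simp
  qed
  define R where "R = (\<lambda>(u, x, L') h. h (cf u x w) = (1::real) \<and> (\<forall>\<sigma>. h \<sigma> \<noteq> 0 \<longrightarrow> \<sigma> \<in> N (u, x, L'))
    \<and> (\<Sum>\<sigma>\<in>N (u, x, L'). (h \<sigma>)\<^sup>2) \<le> 1 / V (u, x, L')
    \<and> (\<forall>a\<in>X. card a = k + 2 \<longrightarrow> a \<noteq> insert u w \<longrightarrow> bd h a = 0))"
  \<comment> \<open>For a child of value 0 any \<open>h\<close> will do, since it receives weight 0
    in \<open>t\<close>.\<close>
  have ex: "\<exists>h. V c > 0 \<longrightarrow> R c h" if c: "c \<in> ch w L" for c
  proof (cases "V c > 0")
    case True
    obtain u x L' where C: "c = (u, x, L')" using prod_cases3 by blast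
    have c': "(u, x, L') \<in> ch w L" using c C by simp
    note cc = ch_facts[OF g c']
    have ex: "explores X l (cf u x w) {x} L'" using Suc.prems(1) c' unfolding explores.simps by blast
    have x1: "{x} \<inter> (cf u x w \<union> set (labs l L')) = {}" using cc(1,2,5) wl by blast
    have ins: "insert x (cf u x w) = insert u w" using cc(1) by auto
    from Suc.IH[OF ex cc(7) _ x1] True
    obtain h where "h (cf u x w) = 1" "\<forall>\<sigma>. h \<sigma> \<noteq> 0 \<longrightarrow> \<sigma> \<in> nodes False l (cf u x w) L'"
      "(\<Sum>\<sigma>\<in>nodes False l (cf u x w) L'. (h \<sigma>)\<^sup>2) \<le> 1 / val 0 l (shape l L')"
      "\<forall>a\<in>X. card a = k + 2 \<longrightarrow> (\<forall>y\<in>{x}. a \<noteq> insert y (cf u x w)) \<longrightarrow> bd h a = 0"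
      by (auto simp: V_def C)
    then show ?thesis using ins by (intro exI[of _ h]) (simp add: R_def C N_def V_def)
  qed simp
  then obtain H where H: "\<And>c. c \<in> ch w L \<Longrightarrow> V c > 0 \<Longrightarrow> R c (H c)" by metis
  \<comment> \<open>The signs make the contributions at the coface cancel that of the root. Among
    weights of sum 1 over the faces of positive value, \<open>V / S\<close> minimises the sum of the
    squared weights divided by \<open>V\<close>; the minimum \<open>1 / S\<close> is the term in the
    recursion for the value.\<close>
  define t where "t = (\<lambda>(u, x, L'). - vsign (insert u w) u * vsign (insert u w) x * V (u, x, L') / S u)"
  define f where "f \<sigma> = (if \<sigma> = w then 1 else \<Sum>c\<in>ch w L. t c * H c \<sigma>)" for \<sigma>
  have supp: "t c * H c \<sigma> = 0" if "c \<in> ch w L" "\<sigma> \<notin> N c" for c \<sigma>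
  proof (cases "V c > 0")
    case True
    then show ?thesis using H[OF that(1)] that(2) by (auto simp: R_def case_prod_beta')
  next
    case False
    then have "V c = 0" using V0[of c] by simp
    then show ?thesis by (simp add: t_def case_prod_beta')
  qed
  have Ndisj: "N c \<inter> N c' = {}" if c: "c \<in> ch w L" "c' \<in> ch w L" "c \<noteq> c'" for c c'
  proof -
    obtain u x L' where [simp]: "c = (u, x, L')" using prod_cases3 by blast
    obtain u2 x2 L2 where [simp]: "c' = (u2, x2, L2)" using prod_cases3 by blast
    have "(u, x) \<noteq> (u2, x2)" using ch_separate(1)[OF g, of u x L' u2 x2 L2] c by auto
    then show ?thesis using child_nodes_disjoint[OF g, of u x L' u2 x2 L2] c by (auto simp: N_def)
  qed
  have wN: "w \<notin> N c" if "c \<in> ch w L" for c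
    using root_not_child[OF g] that by (auto simp: N_def)
  have fN: "f \<sigma> = t c * H c \<sigma>" if c: "c \<in> ch w L" "\<sigma> \<in> N c" for c \<sigma>
  proof -
    have "(\<Sum>c'\<in>ch w L. t c' * H c' \<sigma>) = (\<Sum>c'\<in>{c}. t c' * H c' \<sigma>)"
    proof (rule sum.mono_neutral_right[OF finite_ch])
      show "\<forall>c'\<in>ch w L - {c}. t c' * H c' \<sigma> = 0" using supp Ndisj[of c] c by blast
    qed (use c in simp)
    then show ?thesis using wN[OF c(1)] c(2) by (auto simp: f_def)
  qed
  have fout: "f \<sigma> = 0" if "\<sigma> \<noteq> w" "\<And>c. c \<in> ch w L \<Longrightarrow> \<sigma> \<notin> N c" for \<sigma>
  proof -
    have "(\<Sum>c\<in>ch w L. t c * H c \<sigma>) = 0" by (rule sum.neutral) (use that(2) supp in blast)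
    then show ?thesis using that(1) by (simp add: f_def)
  qed
  have nodes_N: "nodes False (Suc l) w L = insert w (\<Union>c\<in>ch w L. N c)" by (simp add: N_def case_prod_beta')
  have f_supp: "\<sigma> \<in> nodes False (Suc l) w L" if "f \<sigma> \<noteq> 0" for \<sigma>
    using fout[of \<sigma>] that unfolding nodes_N by blast
  have childN: "f (cf u x w) = t (u, x, L')" if c: "(u, x, L') \<in> ch w L" for u x L'
  proof (cases "V (u, x, L') > 0")
    case True
    then have R: "R (u, x, L') (H (u, x, L'))" using H[OF c] by simp
    then have h: "H (u, x, L') (cf u x w) = 1" by (simp add: R_def)
    then have "cf u x w \<in> N (u, x, L')" using R by (simp add: R_def)
    then show ?thesis using fN[OF c] h by simp
  next
    case False
    then have t0: "t (u, x, L') = 0" using V0[of "(u, x, L')"] by (simp add: t_def)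
    note cc = ch_facts[OF g c]
    have "cf u x w \<notin> N (u2, x2, L2)" if c2: "(u2, x2, L2) \<in> ch w L" "(u2, x2, L2) \<noteq> (u, x, L')" for u2 x2 L2
    proof
      assume m: "cf u x w \<in> N (u2, x2, L2)"
      note c2f = ch_facts[OF g c2(1)]
      have n: "cf u x w \<in> nodes False l (cf u2 x2 w) L2" using m by (simp add: N_def)
      have ne: "(u, x) \<noteq> (u2, x2)" using ch_separate(1)[OF g c c2(1)] c2(2) by auto
      have "u \<notin> set (labs l L2)" by (rule ch_separate(3)[OF g c c2(1)])
      then have "cf u x w \<inter> set (labs l L2) = {}" using wl c2f(5) by blast
      then have eq: "cf u x w = cf u2 x2 w" using node_facts(1)[OF c2f(7) n] by blast
      then have "u = u2" using cc(2) by blast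
      then have "x \<noteq> x2" using ne by simp
      then have "x \<in> cf u2 x2 w" using cc(1) by blast
      then have "x \<in> cf u x w" unfolding eq .
      then show False using cc(1,2) by blast
    qed
    moreover have "f (cf u x w) = 0" if "cf u x w \<in> N (u, x, L')" using fN[OF c that] t0 by simp
    moreover have "cf u x w \<noteq> w" using cc(2) by blast
    ultimately have "f (cf u x w) = 0"
      using fout[of "cf u x w"] by (metis prod_cases3)
    then show ?thesis using t0 by simp
  qed
  have norm: "(\<Sum>\<sigma>\<in>nodes False (Suc l) w L. (f \<sigma>)\<^sup>2) \<le> 1 / val 0 (Suc l) (shape (Suc l) L)"
  proof -
    have each: "(\<Sum>\<sigma>\<in>N c. (f \<sigma>)\<^sup>2) \<le> V c / (S (fst c))\<^sup>2" if c: "c \<in> ch w L" for c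
    proof -
      have "(\<Sum>\<sigma>\<in>N c. (f \<sigma>)\<^sup>2) = (\<Sum>\<sigma>\<in>N c. (t c)\<^sup>2 * (H c \<sigma>)\<^sup>2)"
        by (rule sum.cong) (use fN[OF c] in \<open>auto simp: power_mult_distrib\<close>)
      also have "\<dots> = (t c)\<^sup>2 * (\<Sum>\<sigma>\<in>N c. (H c \<sigma>)\<^sup>2)" by (rule sum_distrib_left[symmetric])
      also have "(t c)\<^sup>2 = (V c)\<^sup>2 / (S (fst c))\<^sup>2"
        using vsign_sq(1) by (simp add: t_def case_prod_beta' power2_eq_square mult_ac)
      also have "(V c)\<^sup>2 / (S (fst c))\<^sup>2 * (\<Sum>\<sigma>\<in>N c. (H c \<sigma>)\<^sup>2) \<le> V c / (S (fst c))\<^sup>2"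
      proof (cases "V c > 0")
        case True
        then have "(\<Sum>\<sigma>\<in>N c. (H c \<sigma>)\<^sup>2) \<le> 1 / V c" using H[OF c] by (simp add: R_def case_prod_beta')
        then have "(V c)\<^sup>2 / (S (fst c))\<^sup>2 * (\<Sum>\<sigma>\<in>N c. (H c \<sigma>)\<^sup>2) \<le> (V c)\<^sup>2 / (S (fst c))\<^sup>2 * (1 / V c)"
          by (intro mult_left_mono) auto
        also have "\<dots> = V c / (S (fst c))\<^sup>2" using True by (simp add: power2_eq_square)
        finally show ?thesis .
      next
        case False
        then have "V c = 0" using V0[of c] by simp
        then show ?thesis by simp
      qed
      finally show ?thesis .
    qed
    have "(\<Sum>\<sigma>\<in>nodes False (Suc l) w L. (f \<sigma>)\<^sup>2) = (f w)\<^sup>2 + (\<Sum>c\<in>ch w L. \<Sum>\<sigma>\<in>N c. (f \<sigma>)\<^sup>2)"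
      unfolding sum_nodes[OF g] by (simp add: N_def case_prod_beta')
    also have "\<dots> \<le> 1 + (\<Sum>c\<in>ch w L. V c / (S (fst c))\<^sup>2)"
      using each by (intro add_mono sum_mono) (auto simp: f_def)
    also have "(\<Sum>c\<in>ch w L. V c / (S (fst c))\<^sup>2) = (\<Sum>ed\<in>set (edges L). \<Sum>c\<in>echild w ed. V c / (S (fst c))\<^sup>2)"
      by (rule sum_ch[OF g])
    also have "\<dots> = (\<Sum>ed\<in>set (edges L). 1 / bsum 0 l (snd ed))"
    proof (rule sum.cong[OF refl])
      fix ed assume ed: "ed \<in> set (edges L)"
      have "(\<Sum>c\<in>echild w ed. V c / (S (fst c))\<^sup>2) = (\<Sum>c\<in>echild w ed. V c / (S (fst ed))\<^sup>2)"
        by (rule sum.cong) (auto simp: echild_def)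
      also have "\<dots> = S (fst ed) / (S (fst ed))\<^sup>2"
        unfolding sum_divide_distrib[symmetric] S_def Se[OF ed] ..
      also have "\<dots> = 1 / bsum 0 l (snd ed)" using Spos[OF ed] by (simp add: Sb[OF ed] power2_eq_square)
      finally show "(\<Sum>c\<in>echild w ed. V c / (S (fst c))\<^sup>2) = 1 / bsum 0 l (snd ed)" .
    qed
    finally show ?thesis using val_inverse[OF g, of 0] Spos by simp
  qed
  have bdf: "bd f a = 0" if a: "a \<in> X" "card a = k + 2" "\<forall>y\<in>e. a \<noteq> insert y w" for a
  proof (cases "\<exists>u\<in>fst ` set (edges L). a = insert u w")
    case True
    then obtain ed where ed: "ed \<in> set (edges L)" "a = insert (fst ed) w" by auto
    define u where "u = fst ed"
    have u: "u \<in> fst ` set (edges L)" "u \<notin> w" using edge_labels(2)[OF g, of u] ed(1) by (auto simp: u_def)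
    have len: "length (snd ed) = card w" using ge(4,5) ed by simp
    have eu: "c = (u, fst (snd c), snd (snd c))" "c \<in> ch w L" if "c \<in> echild w ed" for c
      using that ed(1) unfolding ch_echild by (auto simp: echild_def u_def)
    have "(\<Sum>x\<in>w. vsign (insert u w) x * f (cf u x w)) = (\<Sum>(u', x, L')\<in>echild w ed. vsign (insert u w) x * f (cf u x w))"
      by (rule sum_echild_fst[OF ge(3) len, symmetric])
    also have "\<dots> = (\<Sum>c\<in>echild w ed. - vsign (insert u w) u * (V c / S u))"
    proof (rule sum.cong[OF refl])
      fix c assume c: "c \<in> echild w ed"
      define x where "x = fst (snd c)"
      define L' where "L' = snd (snd c)"
      have C: "c = (u, x, L')" using eu[OF c] by (simp add: x_def L'_def)
      have "f (cf u x w) = t (u, x, L')" using eu(2)[OF c] by (intro childN) (simp add: C)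
      also have "\<dots> = - vsign (insert u w) u * vsign (insert u w) x * (V c / S u)" by (simp add: t_def C)
      finally have "vsign (insert u w) x * f (cf u x w) = - (vsign (insert u w) x * vsign (insert u w) x) * vsign (insert u w) u * (V c / S u)"
        by (simp only: mult_minus_left mult_minus_right mult_ac)
      then show "(case c of (u', x, L') \<Rightarrow> vsign (insert u w) x * f (cf u x w)) = - vsign (insert u w) u * (V c / S u)"
        unfolding vsign_sq by (simp add: C)
    qed
    also have "\<dots> = - vsign (insert u w) u * (S u / S u)"
      unfolding sum_distrib_left[symmetric] sum_divide_distrib[symmetric] S_def u_def Se[OF ed(1)] ..
    also have "S u / S u = 1" using Spos[OF ed(1)] Sb[OF ed(1)] by (simp add: u_def)
    finally show ?thesis unfolding ed(2) u_def[symmetric] bd_insert[OF ge(3) u(2)] by (simp add: f_def)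
  next
    case notroot: False
    show ?thesis
    proof (rule ccontr)
      assume nz: "bd f a \<noteq> 0"
      then obtain v where v: "v \<in> a" "f (a - {v}) \<noteq> 0" using bd_nonzero by blast
      have n: "a - {v} \<in> nodes False (Suc l) w L" using f_supp[OF v(2)] .
      have fa: "finite a" using a(2) by (metis card.infinite add_is_0 zero_neq_numeral)
      from explores_edges[OF Suc.prems(1) g n a(1) _ a(2)]
      have "a = w \<union> e \<and> e \<noteq> {} \<or> a \<in> hyp (Suc l) w L" using a(3) by blast
      moreover have "\<not> (a = w \<union> e \<and> e \<noteq> {})"
      proof
        assume as: "a = w \<union> e \<and> e \<noteq> {}"
        then have "finite e" using fa by auto
        then have "card e = 1" using as Suc.prems(3) card_0_eq[of e] by (cases "card e") auto
        then obtain y where "e = {y}" by (metis card_1_singletonE)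
        then show False using a(3) as by auto
      qed
      ultimately have "a \<in> hyp (Suc l) w L" by blast
      then obtain u x L' where c: "(u, x, L') \<in> ch w L" "a \<in> hyp l (cf u x w) L'" using notroot by auto
      note cc = ch_facts[OF g c(1)]
      obtain \<sigma> u' where s: "\<sigma> \<in> nodes False l (cf u x w) L'" "u' \<in> set (labs l L')" "a = insert u' \<sigma>"
        using hyp_facts(2)[OF cc(7) c(2)] by blast
      have u'w: "u' \<notin> w" "u' \<notin> set (labs l L2)" "u' \<noteq> u2"
        if c2: "(u2, x2, L2) \<in> ch w L" "(u2, x2, L2) \<noteq> (u, x, L')" for u2 x2 L2
      proof -
        show "u' \<notin> w" using wl cc(5) s(2) by blast
        have "(u, x) \<noteq> (u2, x2)" using ch_separate(1)[OF g c(1) c2(1)] c2(2) by auto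
        then show "u' \<notin> set (labs l L2)" using ch_separate(2)[OF g c(1) c2(1)] s(2) by blast
        show "u' \<noteq> u2" using ch_separate(3)[OF g c2(1) c(1)] s(2) by blast
      qed
      have u'nw: "u' \<notin> w" using wl cc(5) s(2) by blast
      \<comment> \<open>A coface inside one subtree sees only that subtree: it contains a label
        \<open>u'\<close> that occurs neither in \<open>w\<close> nor in the other subtrees, and
        removing \<open>u'\<close> leaves a node of the subtree itself.\<close>
      have fac: "f (a - {v}) = t (u, x, L') * H (u, x, L') (a - {v})" if "v \<in> a" for v
      proof (cases "a - {v} \<in> N (u, x, L')")
        case True
        then show ?thesis using fN[OF c(1)] by simp
      next
        case False
        have u'm: "u' \<in> a - {v}"
        proof (rule ccontr)
          assume "u' \<notin> a - {v}"
          then have "v = u'" using s(3) by blast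
          have "u' \<notin> \<sigma>"
          proof
            assume "u' \<in> \<sigma>"
            then have "a = \<sigma>" using s(3) by blast
            then show False using node_facts(3)[OF cc(7) s(1)] a(2) by simp
          qed
          then have "a - {v} = \<sigma>" using s(3) \<open>v = u'\<close> by blast
          then show False using False s(1) by (simp add: N_def)
        qed
        have "a - {v} \<notin> N c'" if c': "c' \<in> ch w L" for c'
        proof (cases "c' = (u, x, L')")
          case neq: False
          obtain u2 x2 L2 where C: "c' = (u2, x2, L2)" using prod_cases3 by blast
          have c2: "(u2, x2, L2) \<in> ch w L" "(u2, x2, L2) \<noteq> (u, x, L')" using c' neq C by auto
          have "u' \<notin> cf u2 x2 w \<union> set (labs l L2)" using u'w[OF c2] by blast
          then show ?thesis using node_facts(2)[OF ch_facts(7)[OF g c2(1)]] u'm unfolding C N_def by blast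
        qed (use False in simp)
        moreover have "a - {v} \<noteq> w" using u'm u'nw by blast
        ultimately have "f (a - {v}) = 0" by (intro fout)
        moreover have "t (u, x, L') * H (u, x, L') (a - {v}) = 0" using supp[OF c(1) False] .
        ultimately show ?thesis by simp
      qed
      have "bd f a = (\<Sum>v\<in>a. t (u, x, L') * (vsign a v * H (u, x, L') (a - {v})))"
        unfolding bd_def by (rule sum.cong[OF refl]) (simp add: fac)
      also have "\<dots> = t (u, x, L') * bd (H (u, x, L')) a" unfolding bd_def by (rule sum_distrib_left[symmetric])
      also have "\<dots> = 0"
      proof (cases "V (u, x, L') > 0")
        case True
        have "a \<noteq> insert u w" using notroot cc(3) by blast
        then have "bd (H (u, x, L')) a = 0" using H[OF c(1) True] a unfolding R_def by simp
        then show ?thesis by simp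
      next
        case False
        then have "t (u, x, L') = 0" using V0[of "(u, x, L')"] by (simp add: t_def)
        then show ?thesis by simp
      qed
      finally show False using nz by simp
    qed
  qed
  have "f w = 1" by (simp add: f_def)
  then show ?case using f_supp norm bdf by (intro exI[of _ f]) blast
qed simp

section \<open>Occurrence of a given exploration\<close>

text \<open>Distinct new labels allow the cofaces to be glued one at a time. \<open>Z\<close>
  attaches the subtrees along one edge, \<open>E\<close> runs through the edges, each time on top of
  the part built so far.\<close>

lemma ktree_hyp:
  "ktree k v V H \<Longrightarrow> good k l w L \<Longrightarrow> w = v \<or> (\<exists>a\<in>H. w \<subseteq> a) \<Longrightarrow> set (labs l L) \<inter> V = {}
    \<Longrightarrow> ktree k v (V \<union> set (labs l L)) (H \<union> hyp l w L)"
proof (induction l arbitrary: V H w L)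
  case (Suc l)
  note g = Suc.prems(2)
  let ?f = "\<lambda>(u, Ls). u # concat (map (labs l) Ls)"
  let ?h = "\<lambda>(u, x, L'). hyp l (cf u x w) L'"
  have cw: "card w = k + 1" using g by (simp add: good_def)
  have Z: "ktree k v (V1 \<union> set (concat (map (\<lambda>z. labs l (snd z)) zs))) (H1 \<union> (\<Union>z\<in>set zs. ?h (u, z)))"
    if "ktree k v V1 H1" "insert u w \<in> H1" "\<And>z. z \<in> set zs \<Longrightarrow> (u, z) \<in> ch w L"
      "distinct (concat (map (\<lambda>z. labs l (snd z)) zs))" "set (concat (map (\<lambda>z. labs l (snd z)) zs)) \<inter> V1 = {}"
    for u zs V1 H1
    using that
  proof (induction zs arbitrary: V1 H1)
    case (Cons z zs)
    obtain x L' where z: "z = (x, L')" by force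
    have c: "(u, x, L') \<in> ch w L" using Cons.prems(3)[of z] z by simp
    have "ktree k v (V1 \<union> set (labs l L')) (H1 \<union> hyp l (cf u x w) L')"
    proof (rule Suc.IH[OF Cons.prems(1) ch_facts(7)[OF g c]])
      have "cf u x w \<subseteq> insert u w" by auto
      then show "cf u x w = v \<or> (\<exists>a\<in>H1. cf u x w \<subseteq> a)" using Cons.prems(2) by blast
      show "set (labs l L') \<inter> V1 = {}" using Cons.prems(5) z by auto
    qed
    then have "ktree k v ((V1 \<union> set (labs l L')) \<union> set (concat (map (\<lambda>z. labs l (snd z)) zs)))
       ((H1 \<union> hyp l (cf u x w) L') \<union> (\<Union>z\<in>set zs. ?h (u, z)))"
    proof (rule Cons.IH)
      show "insert u w \<in> H1 \<union> hyp l (cf u x w) L'" using Cons.prems(2) by simp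
      show "(u, z') \<in> ch w L" if "z' \<in> set zs" for z' using Cons.prems(3)[of z'] that by simp
      show "distinct (concat (map (\<lambda>z. labs l (snd z)) zs))" using Cons.prems(4) by simp
      have "set (labs l L') \<inter> set (concat (map (\<lambda>z. labs l (snd z)) zs)) = {}" using Cons.prems(4) by (simp add: z)
      then show "set (concat (map (\<lambda>z. labs l (snd z)) zs)) \<inter> (V1 \<union> set (labs l L')) = {}" using Cons.prems(5) by auto
    qed
    then show ?case using z by (simp add: Un_assoc)
  qed simp
  have E: "ktree k v (V1 \<union> set (concat (map ?f es))) (H1 \<union> (\<Union>e\<in>set es. insert (insert (fst e) w) (\<Union>c\<in>echild w e. ?h c)))"
    if "ktree k v V1 H1" "w = v \<or> (\<exists>a\<in>H1. w \<subseteq> a)" "set es \<subseteq> set (edges L)"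
      "distinct (concat (map ?f es))" "set (concat (map ?f es)) \<inter> V1 = {}" for es V1 H1
    using that
  proof (induction es arbitrary: V1 H1)
    case (Cons e es)
    obtain u Ls where e: "e = (u, Ls)" by force
    have eL: "(u, Ls) \<in> set (edges L)" using Cons.prems(3) e by simp
    have len: "length Ls = length (sl w)" using good_edges(4,5)[OF g] eL by fastforce
    let ?z = "zip (sl w) Ls"
    have lz: "concat (map (\<lambda>z. labs l (snd z)) ?z) = concat (map (labs l) Ls)"
    proof -
      have "map (\<lambda>z. labs l (snd z)) ?z = map (labs l) (map snd ?z)" by simp
      then show ?thesis using len by (simp only: map_snd_zip)
    qed
    have fe: "?f e = u # concat (map (labs l) Ls)" by (simp add: e)
    have d: "distinct (u # concat (map (labs l) Ls))" "distinct (concat (map ?f es))"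
      "set (u # concat (map (labs l) Ls)) \<inter> set (concat (map ?f es)) = {}"
      using Cons.prems(4) unfolding list.map(2) concat.simps(2) fe distinct_append by blast+
    have dV: "set (u # concat (map (labs l) Ls)) \<inter> V1 = {}" "set (concat (map ?f es)) \<inter> V1 = {}"
      using Cons.prems(5) unfolding list.map(2) concat.simps(2) fe set_append by blast+
    have "ktree k v (insert u V1) (insert (insert u w) H1)"
      using dV(1) by (intro ktree.step[OF Cons.prems(1,2) cw]) auto
    then have "ktree k v (insert u V1 \<union> set (concat (map (\<lambda>z. labs l (snd z)) ?z))) (insert (insert u w) H1 \<union> (\<Union>z\<in>set ?z. ?h (u, z)))"
    proof (rule Z)
      show "(u, z) \<in> ch w L" if "z \<in> set ?z" for z using that eL unfolding ch_def by (cases z) auto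
    qed (use d(1) dV(1) in \<open>auto simp: lz\<close>)
    then have 1: "ktree k v (V1 \<union> set (?f e)) (H1 \<union> insert (insert (fst e) w) (\<Union>c\<in>echild w e. ?h c))"
    proof -
      have "(\<Union>z\<in>set ?z. ?h (u, z)) = (\<Union>c\<in>echild w e. ?h c)" unfolding echild_def e by force
      then have "insert (insert u w) H1 \<union> (\<Union>z\<in>set ?z. ?h (u, z)) = H1 \<union> insert (insert (fst e) w) (\<Union>c\<in>echild w e. ?h c)"
        using e by simp
      moreover have "insert u V1 \<union> set (concat (map (\<lambda>z. labs l (snd z)) ?z)) = V1 \<union> set (?f e)" unfolding lz fe by simp
      ultimately show ?thesis using \<open>ktree k v (insert u V1 \<union> _) _\<close> by simp
    qed
    have "ktree k v ((V1 \<union> set (?f e)) \<union> set (concat (map ?f es)))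
       ((H1 \<union> insert (insert (fst e) w) (\<Union>c\<in>echild w e. ?h c)) \<union> (\<Union>e\<in>set es. insert (insert (fst e) w) (\<Union>c\<in>echild w e. ?h c)))"
    proof (rule Cons.IH[OF 1])
      show "w = v \<or> (\<exists>a\<in>H1 \<union> insert (insert (fst e) w) (\<Union>c\<in>echild w e. ?h c). w \<subseteq> a)" using Cons.prems(2) by blast
      show "set es \<subseteq> set (edges L)" using Cons.prems(3) by simp
      show "distinct (concat (map ?f es))" by (rule d(2))
      show "set (concat (map ?f es)) \<inter> (V1 \<union> set (?f e)) = {}" using d(3) dV(2) unfolding fe by blast
    qed
    moreover have "(V1 \<union> set (?f e)) \<union> set (concat (map ?f es)) = V1 \<union> set (concat (map ?f (e # es)))" by (simp add: Un_assoc)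
    moreover have "(H1 \<union> insert (insert (fst e) w) (\<Union>c\<in>echild w e. ?h c)) \<union> (\<Union>e\<in>set es. insert (insert (fst e) w) (\<Union>c\<in>echild w e. ?h c))
      = H1 \<union> (\<Union>e\<in>set (e # es). insert (insert (fst e) w) (\<Union>c\<in>echild w e. ?h c))" by (simp add: Un_assoc)
    ultimately show ?case by metis
  qed simp
  have dist: "distinct (concat (map ?f (edges L)))" using g by (simp add: good_def)
  have lab: "set (concat (map ?f (edges L))) \<inter> V = {}" using Suc.prems(4) unfolding labs.simps .
  have "ktree k v (V \<union> set (concat (map ?f (edges L)))) (H \<union> (\<Union>e\<in>set (edges L). insert (insert (fst e) w) (\<Union>c\<in>echild w e. ?h c)))"
    by (rule E[OF Suc.prems(1,3) subset_refl dist lab])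
  moreover have "(\<Union>e\<in>set (edges L). insert (insert (fst e) w) (\<Union>c\<in>echild w e. ?h c)) = hyp (Suc l) w L"
    unfolding hyp.simps ch_echild by auto
  ultimately show ?case unfolding labs.simps by (simp only:)
qed simp

text \<open>\<open>H\<close> is the coface set of the whole tree while \<open>L\<close> runs through
  its subtrees. The last hypothesis says that the rest of \<open>H\<close> avoids the labels of the
  subtree and contains its root face only in the coface leading to it. So the edges listed at a node
  are exactly the cofaces found there.\<close>

lemma explores_sufficient:
  assumes HX: "H \<subseteq> X" and I: "\<And>\<sigma> u. \<sigma> \<in> I \<Longrightarrow> u \<notin> \<sigma> \<Longrightarrow> insert u \<sigma> \<in> X \<Longrightarrow> insert u \<sigma> \<in> H"
  shows "good k l w L \<Longrightarrow> hyp l w L \<subseteq> H \<Longrightarrow> nodes False l w L \<subseteq> I \<Longrightarrow> e \<inter> (w \<union> set (labs l L)) = {} \<Longrightarrow>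
    (\<And>a. a \<in> H - hyp l w L \<Longrightarrow> a \<inter> set (labs l L) = {} \<and> (w \<subseteq> a \<longrightarrow> (\<exists>y\<in>e. a = insert y w))) \<Longrightarrow> explores X l w e L"
proof (induction l arbitrary: w e L)
  case 0
  then show ?case by (simp add: good_def)
next
  case (Suc l)
  note g = Suc.prems(1)
  note ge = good_edges[OF g]
  have wl: "w \<inter> set (labs (Suc l) L) = {}" using g unfolding good_def by blast
  have not_child: False if c: "(u, x, L') \<in> ch w L" "a \<in> hyp l (cf u x w) L'" "w \<subseteq> a" for u x L' a
  proof -
    note cc = ch_facts[OF g c(1)]
    have "a \<subseteq> cf u x w \<union> set (labs l L')" by (rule hyp_facts(1)[OF cc(7) c(2)])
    moreover have "x \<notin> cf u x w" using cc(1,2) by blast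
    moreover have "x \<notin> set (labs l L')" using cc(1,5) wl by blast
    ultimately show False using c(3) cc(1) by blast
  qed
  have set_eq: "fst ` set (edges L) = {u. u \<notin> w \<and> u \<notin> e \<and> insert u w \<in> X}"
  proof (intro equalityI subsetI)
    fix u assume u: "u \<in> fst ` set (edges L)"
    note el = edge_labels[OF g u]
    have "insert u w \<in> hyp (Suc l) w L" using u by simp
    then have "insert u w \<in> X" using Suc.prems(2) HX by blast
    moreover have "u \<notin> e" using el(1) Suc.prems(4) by blast
    ultimately show "u \<in> {u. u \<notin> w \<and> u \<notin> e \<and> insert u w \<in> X}" using el(2) by simp
  next
    fix u assume u: "u \<in> {u. u \<notin> w \<and> u \<notin> e \<and> insert u w \<in> X}"
    have "w \<in> I" using Suc.prems(3) by simp
    then have uH: "insert u w \<in> H" using I u by blast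
    show "u \<in> fst ` set (edges L)"
    proof (cases "insert u w \<in> hyp (Suc l) w L")
      case True
      then consider u' where "u' \<in> fst ` set (edges L)" "insert u w = insert u' w"
        | u' x L' where "(u', x, L') \<in> ch w L" "insert u w \<in> hyp l (cf u' x w) L'" by auto
      then show ?thesis
      proof cases
        case 1
        then have "u = u'" using u edge_labels(2)[OF g 1(1)] by blast
        then show ?thesis using 1 by simp
      next
        case 2
        then show ?thesis using not_child[OF 2] by blast
      qed
    next
      case False
      then obtain y where y: "y \<in> e" "insert u w = insert y w" using Suc.prems(5)[of "insert u w"] uH by blast
      then have "u \<in> insert y w" by blast
      then have "u = y" using u by blast
      then show ?thesis using u y(1) by blast
    qed
  qed
  have child: "explores X l (cf u x w) {x} L'" if c: "(u, x, L') \<in> ch w L" for u x L'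
  proof -
    note cc = ch_facts[OF g c]
    show ?thesis
    proof (rule Suc.IH[OF cc(7)])
      have "hyp l (cf u x w) L' \<subseteq> hyp (Suc l) w L" using c by auto
      then show "hyp l (cf u x w) L' \<subseteq> H" using Suc.prems(2) by blast
      have "nodes False l (cf u x w) L' \<subseteq> nodes False (Suc l) w L" using c by auto
      then show "nodes False l (cf u x w) L' \<subseteq> I" using Suc.prems(3) by blast
      show "{x} \<inter> (cf u x w \<union> set (labs l L')) = {}" using cc(1,2,5) wl by blast
      fix a assume a: "a \<in> H - hyp l (cf u x w) L'"
      have "a \<in> hyp (Suc l) w L \<Longrightarrow> a \<in> (\<lambda>u. insert u w) ` fst ` set (edges L) \<or> (\<exists>z\<in>ch w L. a \<in> (\<lambda>(u, x, L'). hyp l (cf u x w) L') z)"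
        unfolding hyp.simps by (elim UnE UN_E) blast+
      \<comment> \<open>A coface outside this subtree lies outside the tree at \<open>w\<close>, is
        an edge at \<open>w\<close>, or belongs to the subtree of some child, necessarily another
        one.\<close>
      then consider "a \<in> H - hyp (Suc l) w L" | "a \<in> (\<lambda>u. insert u w) ` fst ` set (edges L)"
        | z where "z \<in> ch w L" "a \<in> (\<lambda>(u, x, L'). hyp l (cf u x w) L') z"
        using a by (cases "a \<in> hyp (Suc l) w L") blast+
      then consider "a \<in> H - hyp (Suc l) w L" | u2 where "u2 \<in> fst ` set (edges L)" "a = insert u2 w"
        | u2 x2 L2 where "(u2, x2, L2) \<in> ch w L" "a \<in> hyp l (cf u2 x2 w) L2"
        by cases (blast, blast, metis (no_types, lifting) prod_cases3 case_prod_conv)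
      then show "a \<inter> set (labs l L') = {} \<and> (cf u x w \<subseteq> a \<longrightarrow> (\<exists>y\<in>{x}. a = insert y (cf u x w)))"
      proof cases
        case 1
        then have "a \<inter> set (labs (Suc l) L) = {}" using Suc.prems(5) by blast
        then show ?thesis using cc(4,5) by blast
      next
        case 2
        have "u2 \<notin> set (labs l L')" by (rule edge_label_not_child[OF g 2(1) c])
        then have "a \<inter> set (labs l L') = {}" using 2(2) wl cc(5) by blast
        moreover have "a = insert x (cf u x w)" if "cf u x w \<subseteq> a"
        proof -
          have "u = u2" using that 2(2) cc(2) by blast
          then show ?thesis using 2(2) cc(1) by blast
        qed
        ultimately show ?thesis by blast
      next
        case 3
        note c2 = ch_facts[OF g 3(1)]
        have asub: "a \<subseteq> cf u2 x2 w \<union> set (labs l L2)" by (rule hyp_facts(1)[OF c2(7) 3(2)])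
        have ne: "(u, x) \<noteq> (u2, x2)"
        proof
          assume "(u, x) = (u2, x2)"
          then show False using ch_separate(1)[OF g c 3(1)] 3(2) a by auto
        qed
        have "set (labs l L') \<inter> set (labs l L2) = {}" by (rule ch_separate(2)[OF g c 3(1) ne])
        moreover have "u2 \<notin> set (labs l L')" by (rule ch_separate(3)[OF g 3(1) c])
        ultimately have "a \<inter> set (labs l L') = {}" using asub wl cc(5) by blast
        moreover have "\<not> cf u x w \<subseteq> a"
        proof
          assume sub: "cf u x w \<subseteq> a"
          have "u \<notin> set (labs l L2)" by (rule ch_separate(3)[OF g c 3(1)])
          then have "u = u2" using sub asub cc(2) by blast
          then have "x2 \<in> cf u x w" using ne c2(1) by blast
          then have "x2 \<in> cf u2 x2 w \<union> set (labs l L2)" using sub asub by blast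
          moreover have "x2 \<notin> cf u2 x2 w" using c2(1,2) by blast
          moreover have "x2 \<notin> set (labs l L2)" using c2(1,5) wl by blast
          ultimately show False by blast
        qed
        ultimately show ?thesis by blast
      qed
    qed
  qed
  have "sorted_wrt (<) (map fst (edges L))" using g by (simp add: good_def)
  moreover have "\<forall>(u, Ls)\<in>set (edges L). length Ls = card w" using ge(4,5) by fastforce
  ultimately show ?case unfolding explores.simps using set_eq child by blast
qed

section \<open>Counting labelled trees\<close>

primrec edge_count :: "nat \<Rightarrow> tree \<Rightarrow> nat" where
  "edge_count 0 T = 0"
| "edge_count (Suc l) T = length (blocks T) + (\<Sum>ts\<leftarrow>blocks T. \<Sum>t\<leftarrow>ts. edge_count l t)"

primrec inner_count :: "nat \<Rightarrow> tree \<Rightarrow> nat" where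
  "inner_count 0 T = 0"
| "inner_count (Suc l) T = Suc (\<Sum>ts\<leftarrow>blocks T. \<Sum>t\<leftarrow>ts. inner_count l t)"

text \<open>A lower bound for the number of labelings when every node can choose among
  \<open>M\<close> free labels. A node chooses a set, not a sequence, because edges are sorted by
  label.\<close>

primrec labeling_count :: "nat \<Rightarrow> nat \<Rightarrow> tree \<Rightarrow> nat" where
  "labeling_count M 0 T = 1"
| "labeling_count M (Suc l) T = (M choose length (blocks T)) * (\<Prod>ts\<leftarrow>blocks T. \<Prod>t\<leftarrow>ts. labeling_count M l t)"

text \<open>The limit of \<open>labeling_count\<close> times one edge probability per edge; with a
  further factor \<open>exp (- c)\<close> per inner node it becomes the Galton-Watson
  weight.\<close>

primrec labeling_limit :: "real \<Rightarrow> nat \<Rightarrow> tree \<Rightarrow> real" where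
  "labeling_limit c 0 T = 1"
| "labeling_limit c (Suc l) T = c ^ length (blocks T) / fact (length (blocks T)) * (\<Prod>ts\<leftarrow>blocks T. \<Prod>t\<leftarrow>ts. labeling_limit c l t)"

primrec wf_tree :: "nat \<Rightarrow> nat \<Rightarrow> tree \<Rightarrow> bool" where
  "wf_tree k 0 T \<longleftrightarrow> T = Node []"
| "wf_tree k (Suc l) T \<longleftrightarrow> (\<forall>ts\<in>set (blocks T). length ts = k + 1 \<and> (\<forall>t\<in>set ts. wf_tree k l t))"

lemma length_labs: "length (labs l L) = edge_count l (shape l L)"
proof (induction l arbitrary: L)
  case (Suc l)
  have *: "length (concat (map (\<lambda>(u, Ls). u # concat (map (labs l) Ls)) es))
      = length es + (\<Sum>ts\<leftarrow>map (\<lambda>(u, Ls). map (shape l) Ls) es. \<Sum>t\<leftarrow>ts. edge_count l t)" for es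
  proof (induction es)
    case (Cons e es)
    have "length (concat (map (labs l) Ls)) = (\<Sum>t\<leftarrow>map (shape l) Ls. edge_count l t)" for Ls
      by (induction Ls) (simp_all add: Suc.IH)
    then show ?case using Cons by (cases e) simp
  qed simp
  show ?case using *[of "edges L"] by simp
qed simp

lemma sum_echild_snd:
  assumes w: "finite w" "length (snd e) = card w"
  shows "(\<Sum>(u, x, L')\<in>echild w e. h L') = (\<Sum>L'\<leftarrow>snd e. h L' :: real)"
proof -
  let ?z = "zip (sl w) (snd e)"
  have d: "distinct ?z" by (simp add: distinct_zipI1)
  have "(\<Sum>L'\<leftarrow>snd e. h L') = (\<Sum>L'\<leftarrow>map snd ?z. h L')"
    using w by (simp add: map_snd_zip)
  also have "\<dots> = (\<Sum>z\<leftarrow>?z. h (snd z))" by (simp add: comp_def)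
  also have "\<dots> = (\<Sum>z\<in>set ?z. h (snd z))" by (rule sum_list_distinct_conv_sum_set[OF d])
  finally show ?thesis unfolding sum_echild by (simp add: case_prod_beta')
qed

lemma card_nodes:
  "good k l w L \<Longrightarrow> real (card (nodes False l w L)) \<le> real (inner_count l (shape l L))"
proof (induction l arbitrary: w L)
  case (Suc l)
  note g = Suc.prems
  let ?N = "\<lambda>(u, x, L'). nodes False l (cf u x w) L'"
  have "real (card (nodes False (Suc l) w L)) = (\<Sum>\<sigma>\<in>nodes False (Suc l) w L. 1)" by simp
  also have "\<dots> = 1 + (\<Sum>(u, x, L')\<in>ch w L. \<Sum>\<sigma>\<in>nodes False l (cf u x w) L'. 1)" by (rule sum_nodes[OF g])
  also have "\<dots> \<le> 1 + (\<Sum>(u, x, L')\<in>ch w L. real (inner_count l (shape l L')))"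
  proof (intro add_left_mono sum_mono)
    fix c assume c: "c \<in> ch w L"
    obtain u x L' where C: "c = (u, x, L')" using prod_cases3 by blast
    show "(case c of (u, x, L') \<Rightarrow> \<Sum>\<sigma>\<in>nodes False l (cf u x w) L'. 1) \<le> (case c of (u, x, L') \<Rightarrow> real (inner_count l (shape l L')))"
      using Suc.IH[OF ch_facts(7)[OF g, of u x L']] c by (simp add: C)
  qed
  also have "(\<Sum>(u, x, L')\<in>ch w L. real (inner_count l (shape l L'))) = (\<Sum>e\<in>set (edges L). \<Sum>(u, x, L')\<in>echild w e. real (inner_count l (shape l L')))"
    by (rule sum_ch[OF g])
  also have "\<dots> = (\<Sum>e\<in>set (edges L). \<Sum>L'\<leftarrow>snd e. real (inner_count l (shape l L')))"
    by (rule sum.cong[OF refl], rule sum_echild_snd) (use good_edges[OF g] in auto)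
  also have "\<dots> = (\<Sum>e\<leftarrow>edges L. \<Sum>L'\<leftarrow>snd e. real (inner_count l (shape l L')))"
    by (rule sum_list_distinct_conv_sum_set[OF good_edges(1)[OF g], symmetric])
  also have "1 + \<dots> = real (inner_count (Suc l) (shape (Suc l) L))"
  proof -
    have in1: "(\<Sum>L'\<leftarrow>Ls. real (inner_count l (shape l L'))) = real (\<Sum>t\<leftarrow>map (shape l) Ls. inner_count l t)" for Ls
      by (induction Ls) auto
    have "(\<Sum>e\<leftarrow>es. \<Sum>L'\<leftarrow>snd e. real (inner_count l (shape l L'))) = real (\<Sum>ts\<leftarrow>map (\<lambda>(u, Ls). map (shape l) Ls) es. \<Sum>t\<leftarrow>ts. inner_count l t)"
      for es :: "(nat \<times> ltree list) list"
    proof (induction es)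
      case (Cons e es)
      then show ?case using in1[of "snd e"] by (cases e) simp
    qed simp
    from this[of "edges L"] show ?thesis by simp
  qed
  finally show ?case .
qed simp

text \<open>Entries are labelled one after another, each avoiding the labels used before. The
  required supply of \<open>M\<close> plus all labels guarantees that at each turn \<open>M\<close>
  labels remain beyond the need of that entry.\<close>

lemma list_labelings:
  fixes lab :: "'y \<Rightarrow> nat list"
  assumes base: "\<And>t V. t \<in> set ts \<Longrightarrow> finite V \<Longrightarrow> card ({1..n} - V) \<ge> M + s t \<Longrightarrow>
    \<exists>A. finite A \<and> card A \<ge> c t \<and> (\<forall>y\<in>A. Rel t y \<and> distinct (lab y) \<and> set (lab y) \<inter> V = {} \<and> set (lab y) \<subseteq> {1..n} \<and> length (lab y) = s t)"
  shows "finite V \<Longrightarrow> card ({1..n} - V) \<ge> M + (\<Sum>t\<leftarrow>ts. s t) \<Longrightarrow>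
    \<exists>A. finite A \<and> card A \<ge> (\<Prod>t\<leftarrow>ts. c t) \<and> (\<forall>ys\<in>A. list_all2 Rel ts ys \<and> distinct (concat (map lab ys))
      \<and> set (concat (map lab ys)) \<inter> V = {} \<and> set (concat (map lab ys)) \<subseteq> {1..n} \<and> length (concat (map lab ys)) = (\<Sum>t\<leftarrow>ts. s t))"
  using base
proof (induction ts arbitrary: V)
  case Nil
  then show ?case by (intro exI[of _ "{[]}"]) auto
next
  case (Cons t ts)
  have "card ({1..n} - V) \<ge> M + s t" using Cons.prems(2) by simp
  from Cons.prems(3)[OF _ Cons.prems(1) this] obtain A1 where A1: "finite A1" "card A1 \<ge> c t"
    "\<And>y. y \<in> A1 \<Longrightarrow> Rel t y \<and> distinct (lab y) \<and> set (lab y) \<inter> V = {} \<and> set (lab y) \<subseteq> {1..n} \<and> length (lab y) = s t"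
    by auto
  let ?P = "\<lambda>V ys. list_all2 Rel ts ys \<and> distinct (concat (map lab ys)) \<and> set (concat (map lab ys)) \<inter> V = {}
    \<and> set (concat (map lab ys)) \<subseteq> {1..n} \<and> length (concat (map lab ys)) = (\<Sum>t\<leftarrow>ts. s t)"
  have "\<exists>A. finite A \<and> card A \<ge> (\<Prod>t\<leftarrow>ts. c t) \<and> (\<forall>ys\<in>A. ?P (V \<union> set (lab y)) ys)" if y: "y \<in> A1" for y
  proof (rule Cons.IH)
    show "finite (V \<union> set (lab y))" using Cons.prems(1) by simp
    have "{1..n} - (V \<union> set (lab y)) = ({1..n} - V) - set (lab y)" by auto
    then have "card ({1..n} - (V \<union> set (lab y))) \<ge> card ({1..n} - V) - card (set (lab y))"
      using diff_card_le_card_Diff[of "set (lab y)" "{1..n} - V"] by simp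
    moreover have "card (set (lab y)) \<le> s t" using A1(3)[OF y] card_length[of "lab y"] by simp
    ultimately show "M + (\<Sum>t\<leftarrow>ts. s t) \<le> card ({1..n} - (V \<union> set (lab y)))" using Cons.prems(2) by simp
  qed (use Cons.prems(3) in auto)
  then obtain A2 where A2: "\<And>y. y \<in> A1 \<Longrightarrow> finite (A2 y) \<and> card (A2 y) \<ge> (\<Prod>t\<leftarrow>ts. c t) \<and> (\<forall>ys\<in>A2 y. ?P (V \<union> set (lab y)) ys)"
    by metis
  define A where "A = (\<lambda>(y, ys). y # ys) ` Sigma A1 A2"
  have "finite A" unfolding A_def using A1(1) A2 by auto
  moreover have "card A \<ge> (\<Prod>t\<leftarrow>t # ts. c t)"
  proof -
    have "inj_on (\<lambda>(y, ys). y # ys) (Sigma A1 A2)" by (auto simp: inj_on_def)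
    then have cA: "card A = card (Sigma A1 A2)" unfolding A_def by (rule card_image)
    have "c t * (\<Prod>t\<leftarrow>ts. c t) \<le> card A1 * (\<Prod>t\<leftarrow>ts. c t)" using A1(2) by (intro mult_right_mono) auto
    also have "\<dots> = (\<Sum>y\<in>A1. \<Prod>t\<leftarrow>ts. c t)" by simp
    also have "\<dots> \<le> (\<Sum>y\<in>A1. card (A2 y))" using A2 by (intro sum_mono) auto
    also have "\<dots> = card A" unfolding cA using A1(1) A2 by simp
    finally show ?thesis by simp
  qed
  moreover have "list_all2 Rel (t # ts) zs \<and> distinct (concat (map lab zs)) \<and> set (concat (map lab zs)) \<inter> V = {}
    \<and> set (concat (map lab zs)) \<subseteq> {1..n} \<and> length (concat (map lab zs)) = (\<Sum>t\<leftarrow>t # ts. s t)" if z: "zs \<in> A" for zs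
  proof -
    obtain y ys where y: "zs = y # ys" "y \<in> A1" "ys \<in> A2 y" using z unfolding A_def by auto
    have p: "?P (V \<union> set (lab y)) ys" using A2[OF y(2)] y(3) by blast
    have sc: "set (concat (map lab zs)) = set (lab y) \<union> set (concat (map lab ys))" by (simp add: y(1))
    have "set (lab y) \<inter> set (concat (map lab ys)) = {}" using p by blast
    then have "distinct (concat (map lab zs))" using p A1(3)[OF y(2)] unfolding y(1) list.map(2) concat.simps(2) distinct_append by blast
    moreover have "set (concat (map lab zs)) \<inter> V = {}" using p A1(3)[OF y(2)] unfolding sc by blast
    moreover have "set (concat (map lab zs)) \<subseteq> {1..n}" using p A1(3)[OF y(2)] unfolding sc by blast
    ultimately show ?thesis using p A1(3)[OF y(2)] by (simp add: y(1))
  qed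
  ultimately show ?case by blast
qed

lemma zip_concat:
  assumes "length us = length Ys"
  shows "set (concat (map (\<lambda>(u, Y). u # h Y) (zip us Ys))) = set us \<union> set (concat (map h Ys))"
    "distinct us \<Longrightarrow> distinct (concat (map h Ys)) \<Longrightarrow> set us \<inter> set (concat (map h Ys)) = {} \<Longrightarrow>
      distinct (concat (map (\<lambda>(u, Y). u # h Y) (zip us Ys)))"
proof -
  have 1: "set (concat (map (\<lambda>(u, Y). u # h Y) (zip us Ys))) = set us \<union> set (concat (map h Ys))"
    if "length us = length Ys" for us and Ys :: "'b list"
    using that by (induction us Ys rule: list_induct2) auto
  show "set (concat (map (\<lambda>(u, Y). u # h Y) (zip us Ys))) = set us \<union> set (concat (map h Ys))" by (rule 1[OF assms])
  show "distinct us \<Longrightarrow> distinct (concat (map h Ys)) \<Longrightarrow> set us \<inter> set (concat (map h Ys)) = {} \<Longrightarrow>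
      distinct (concat (map (\<lambda>(u, Y). u # h Y) (zip us Ys)))"
    using assms
  proof (induction us Ys rule: list_induct2)
    case (Cons u us Y Ys)
    have "set (concat (map (\<lambda>(u, Y). u # h Y) (zip us Ys))) = set us \<union> set (concat (map h Ys))"
      by (rule 1[OF Cons.hyps(1)])
    moreover have "distinct (concat (map (\<lambda>(u, Y). u # h Y) (zip us Ys)))" using Cons by auto
    moreover have "(insert u (set (h Y))) \<inter> (set us \<union> set (concat (map h Ys))) = {}"
      using Cons.prems by auto
    moreover have "distinct (u # h Y)" using Cons.prems by auto
    ultimately show ?case
      unfolding zip_Cons_Cons list.map(2) case_prod_conv concat.simps(2) distinct_append by simp
  qed simp
qed

text \<open>At the root an \<open>m\<close>-subset of a fixed set of \<open>M\<close> free labels is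
  chosen and handed out in increasing order. The blocks, and the trees inside them, are then
  labelled by two applications of \<open>list_labelings\<close>.\<close>

lemma count_labelings:
  "wf_tree k l T \<Longrightarrow> finite V \<Longrightarrow> card ({1..n} - V) \<ge> M + edge_count l T \<Longrightarrow>
    \<exists>A. finite A \<and> card A \<ge> labeling_count M l T \<and> (\<forall>L\<in>A. (shape l L = T \<and> wf_ltree k l L) \<and> distinct (labs l L)
      \<and> set (labs l L) \<inter> V = {} \<and> set (labs l L) \<subseteq> {1..n} \<and> length (labs l L) = edge_count l T)"
proof (induction l arbitrary: T V)
  case 0
  then show ?case by (intro exI[of _ "{LNode []}"]) simp
next
  case (Suc l)
  define m where "m = length (blocks T)"
  let ?Rel = "\<lambda>t L. shape l L = t \<and> wf_ltree k l L"
  let ?s = "\<lambda>ts. \<Sum>t\<leftarrow>ts. edge_count l t"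
  let ?lab = "\<lambda>Ls. concat (map (labs l) Ls)"
  obtain P0 where P0: "P0 \<subseteq> {1..n} - V" "card P0 = M"
    using obtain_subset_with_card_n[of M "{1..n} - V"] Suc.prems(3) by auto
  have fP0: "finite P0" using P0(1) finite_subset by blast
  define Us where "Us = {U. U \<subseteq> P0 \<and> card U = m}"
  have finUs: "finite Us" unfolding Us_def using fP0 by simp
  have cUs: "card Us = M choose m" unfolding Us_def using n_subsets[OF fP0] P0(2) by simp
  have U: "finite U" "U \<subseteq> {1..n}" "U \<inter> V = {}" "card U = m" if "U \<in> Us" for U
    using that P0 fP0 finite_subset unfolding Us_def by blast+
  have block: "\<exists>A. finite A \<and> card A \<ge> (\<Prod>t\<leftarrow>ts. labeling_count M l t) \<and> (\<forall>Ls\<in>A. list_all2 ?Rel ts Ls \<and> distinct (?lab Ls)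
      \<and> set (?lab Ls) \<inter> V' = {} \<and> set (?lab Ls) \<subseteq> {1..n} \<and> length (?lab Ls) = ?s ts)"
    if ts: "ts \<in> set (blocks T)" and V': "finite V'" "card ({1..n} - V') \<ge> M + ?s ts" for ts V'
  proof (rule list_labelings[OF _ V'])
    fix t V'' assume "t \<in> set ts" and V'': "finite V''" "card ({1..n} - V'') \<ge> M + edge_count l t"
    then have "wf_tree k l t" using Suc.prems(1) ts by simp
    from Suc.IH[OF this V''] show "\<exists>A. finite A \<and> card A \<ge> labeling_count M l t \<and> (\<forall>L\<in>A. ?Rel t L \<and> distinct (labs l L)
      \<and> set (labs l L) \<inter> V'' = {} \<and> set (labs l L) \<subseteq> {1..n} \<and> length (labs l L) = edge_count l t)" .
  qed
  let ?P = "\<lambda>V Lss. list_all2 (list_all2 ?Rel) (blocks T) Lss \<and> distinct (concat (map ?lab Lss)) \<and> set (concat (map ?lab Lss)) \<inter> V = {}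
    \<and> set (concat (map ?lab Lss)) \<subseteq> {1..n} \<and> length (concat (map ?lab Lss)) = (\<Sum>ts\<leftarrow>blocks T. ?s ts)"
  let ?R = "\<lambda>U A. finite A \<and> card A \<ge> (\<Prod>ts\<leftarrow>blocks T. \<Prod>t\<leftarrow>ts. labeling_count M l t) \<and> (\<forall>Lss\<in>A. ?P (V \<union> U) Lss)"
  have ex: "\<exists>A. ?R U A" if "U \<in> Us" for U
  proof (rule list_labelings[OF block])
    show "finite (V \<union> U)" using Suc.prems(2) U[OF that] by simp
    have "{1..n} - (V \<union> U) = ({1..n} - V) - U" by auto
    then have "card ({1..n} - (V \<union> U)) \<ge> card ({1..n} - V) - m"
      using diff_card_le_card_Diff[of U "{1..n} - V"] U[OF that] by simp
    then show "M + (\<Sum>ts\<leftarrow>blocks T. ?s ts) \<le> card ({1..n} - (V \<union> U))" using Suc.prems(3) by (simp add: m_def)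
  qed
  from bchoice[of Us ?R] ex obtain A2 where "\<forall>U\<in>Us. ?R U (A2 U)" by blast
  then have A2: "?R U (A2 U)" if "U \<in> Us" for U using that by (rule bspec)
  define A where "A = (\<lambda>(U, Lss). LNode (zip (sl U) Lss)) ` Sigma Us A2"
  have lenU: "length Lss = m" "length (sl U) = m" if "U \<in> Us" "Lss \<in> A2 U" for U Lss
  proof -
    have "list_all2 (list_all2 ?Rel) (blocks T) Lss" using A2[OF that(1)] that(2) by blast
    then show "length Lss = m" unfolding m_def by (simp add: list_all2_lengthD)
    show "length (sl U) = m" using U[OF that(1)] by simp
  qed
  have "finite A" unfolding A_def using finUs A2 by auto
  moreover have "card A \<ge> labeling_count M (Suc l) T"
  proof -
    have "inj_on (\<lambda>(U, Lss). LNode (zip (sl U) Lss)) (Sigma Us A2)"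
    proof (rule inj_onI)
      fix a b assume a: "a \<in> Sigma Us A2" and b: "b \<in> Sigma Us A2"
        and eq: "(\<lambda>(U, Lss). LNode (zip (sl U) Lss)) a = (\<lambda>(U, Lss). LNode (zip (sl U) Lss)) b"
      obtain U Lss where [simp]: "a = (U, Lss)" by force
      obtain U' Lss' where [simp]: "b = (U', Lss')" by force
      have z: "zip (sl U) Lss = zip (sl U') Lss'" using eq by simp
      have l1: "length (sl U) = length Lss" "length (sl U') = length Lss'" using lenU[of U Lss] lenU[of U' Lss'] a b by auto
      have "sl U = sl U'" using arg_cong[OF z, of "map fst"] l1 by simp
      then have "set (sl U) = set (sl U')" by simp
      then have "U = U'" using U(1)[of U] U(1)[of U'] a b by simp
      moreover have "Lss = Lss'" using arg_cong[OF z, of "map snd"] l1 by simp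
      ultimately show "a = b" by simp
    qed
    then have "card A = card (Sigma Us A2)" unfolding A_def by (rule card_image)
    also have "\<dots> = (\<Sum>U\<in>Us. card (A2 U))" using finUs A2 by simp
    also have "\<dots> \<ge> (\<Sum>U\<in>Us. \<Prod>ts\<leftarrow>blocks T. \<Prod>t\<leftarrow>ts. labeling_count M l t)" using A2 by (intro sum_mono) auto
    also have "(\<Sum>U\<in>Us. \<Prod>ts\<leftarrow>blocks T. \<Prod>t\<leftarrow>ts. labeling_count M l t) = labeling_count M (Suc l) T" using cUs by (simp add: m_def)
    finally show ?thesis .
  qed
  moreover have "(shape (Suc l) L = T \<and> wf_ltree k (Suc l) L) \<and> distinct (labs (Suc l) L)
      \<and> set (labs (Suc l) L) \<inter> V = {} \<and> set (labs (Suc l) L) \<subseteq> {1..n} \<and> length (labs (Suc l) L) = edge_count (Suc l) T" if L: "L \<in> A" for L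
  proof -
    obtain U' Lss where UL: "U' \<in> Us" "Lss \<in> A2 U'" "L = LNode (zip (sl U') Lss)" using L unfolding A_def by auto
    note u = U[OF UL(1)] and len = lenU[OF UL(1,2)]
    have ed: "edges L = zip (sl U') Lss" using UL(3) by simp
    have P: "?P (V \<union> U') Lss" using A2[OF UL(1)] UL(2) by blast
    have nth: "list_all2 ?Rel (blocks T ! i) (Lss ! i)" if "i < m" for i
      using P that unfolding m_def by (simp add: list_all2_conv_all_nth)
    have "shape (Suc l) L = T"
    proof -
      have "map (\<lambda>(u, Ls). map (shape l) Ls) (zip (sl U') Lss) = blocks T"
      proof (rule nth_equalityI)
        fix i assume "i < length (map (\<lambda>(u, Ls). map (shape l) Ls) (zip (sl U') Lss))"
        then have i: "i < m" using len by simp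
        have "map (shape l) (Lss ! i) = blocks T ! i"
          using nth[OF i] by (intro nth_equalityI) (auto simp: list_all2_conv_all_nth)
        then show "map (\<lambda>(u, Ls). map (shape l) Ls) (zip (sl U') Lss) ! i = blocks T ! i" using i len by simp
      qed (use len in \<open>simp add: m_def\<close>)
      then show ?thesis by (simp add: ed)
    qed
    moreover have "wf_ltree k (Suc l) L"
    proof -
      have "map fst (edges L) = sl U'" using len by (simp add: ed)
      moreover have "sorted_wrt (<) (sl U')" by (simp add: strict_sorted_iff)
      moreover have "length Ls = k + 1 \<and> (\<forall>L'\<in>set Ls. wf_ltree k l L')" if "(v, Ls) \<in> set (edges L)" for v Ls
      proof -
        have "Ls \<in> set Lss" using that unfolding ed by (rule set_zip_rightD)
        then obtain i where i: "i < m" "Ls = Lss ! i" using len by (metis in_set_conv_nth)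
        have "length (blocks T ! i) = k + 1" using Suc.prems(1) i by (simp add: m_def)
        then show ?thesis using nth[OF i(1)] i(2) by (auto simp: list_all2_conv_all_nth in_set_conv_nth)
      qed
      ultimately show ?thesis by auto
    qed
    moreover have ss: "set (labs (Suc l) L) = U' \<union> set (concat (map ?lab Lss))"
      using zip_concat(1)[of "sl U'" Lss ?lab] len u by (simp add: ed)
    moreover have "distinct (labs (Suc l) L)"
    proof -
      have "set (concat (map ?lab Lss)) \<inter> (V \<union> U') = {}" "distinct (concat (map ?lab Lss))" using P by blast+
      moreover have "set (sl U') = U'" using u(1) by simp
      ultimately have "set (sl U') \<inter> set (concat (map ?lab Lss)) = {}" by blast
      then have "distinct (concat (map (\<lambda>(u, Y). u # ?lab Y) (zip (sl U') Lss)))"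
        using len \<open>distinct (concat (map ?lab Lss))\<close> by (intro zip_concat(2)) simp_all
      then show ?thesis by (simp only: labs.simps ed)
    qed
    moreover have "set (labs (Suc l) L) \<inter> V = {}" "set (labs (Suc l) L) \<subseteq> {1..n}" using u P unfolding ss by blast+
    ultimately show ?thesis using length_labs[of "Suc l" L] by (simp only: simp_thms)
  qed
  ultimately show ?case by blast
qed

section \<open>Probability of a given Galton-Watson tree\<close>

lemma pmf_replicate: "pmf (replicate_pmf n Q) xs = (if length xs = n then (\<Prod>x\<leftarrow>xs. pmf Q x) else 0)"
proof (induction n arbitrary: xs)
  case 0
  then show ?case by (simp add: pmf_return)
next
  case (Suc n)
  show ?case
  proof (cases xs)
    case Nil
    have "[] \<notin> set_pmf (replicate_pmf (Suc n) Q)" using set_replicate_pmfD by fastforce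
    then show ?thesis using Nil by (simp add: pmf_eq_0_set_pmf)
  next
    case (Cons y ys)
    have "pmf (replicate_pmf (Suc n) Q) xs = pmf (map_pmf (\<lambda>(as, a). a # as) (pair_pmf (replicate_pmf n Q) Q)) ((\<lambda>(as, a). a # as) (ys, y))"
      unfolding replicate_pmf_Suc_pair Cons by simp
    also have "\<dots> = pmf (pair_pmf (replicate_pmf n Q) Q) (ys, y)"
      by (rule pmf_map_inj') (auto simp: inj_def)
    also have "\<dots> = pmf (replicate_pmf n Q) ys * pmf Q y" by (rule pmf_pair)
    finally show ?thesis using Suc.IH Cons by simp
  qed
qed

lemma pmf_forest:
  assumes "c > 0"
  shows "pmf (forest c Q) bs = c ^ length bs / fact (length bs) * exp (- c) * (\<Prod>b\<leftarrow>bs. pmf Q b)"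
proof -
  have "pmf (forest c Q) bs = Ep (poisson_pmf c) (\<lambda>m. pmf (replicate_pmf m Q) bs)"
    unfolding forest_def by (rule pmf_bind)
  also have "\<dots> = (\<Sum>m\<in>{length bs}. pmf (poisson_pmf c) m *\<^sub>R pmf (replicate_pmf m Q) bs)"
    by (rule integral_measure_pmf) (auto simp: pmf_replicate split: if_splits)
  finally show ?thesis using assms by (simp add: pmf_replicate)
qed

lemma prod_list_mult_exp:
  "(\<Prod>t\<leftarrow>ts. f t * exp (- c * real (g t))) = (\<Prod>t\<leftarrow>ts. f t :: real) * exp (- c * real (\<Sum>t\<leftarrow>ts. g t))"
proof (induction ts)
  case (Cons t ts)
  have "exp (- c * real (g t + (\<Sum>t\<leftarrow>ts. g t))) = exp (- c * real (g t)) * exp (- c * real (\<Sum>t\<leftarrow>ts. g t))"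
    by (simp add: exp_add[symmetric] algebra_simps)
  then show ?case using Cons by simp
qed simp

lemma prod_list_mult_power:
  "(\<Prod>t\<leftarrow>ts. f t * r ^ g t) = (\<Prod>t\<leftarrow>ts. f t :: real) * r ^ (\<Sum>t\<leftarrow>ts. g t)"
  by (induction ts) (simp_all add: power_add)

lemma prod_list_cong: "(\<And>t. t \<in> set ts \<Longrightarrow> f t = (g t :: real)) \<Longrightarrow> (\<Prod>t\<leftarrow>ts. f t) = (\<Prod>t\<leftarrow>ts. g t)"
  by (induction ts) auto

text \<open>Every inner node contributes the Poisson weight of its number of blocks; the factors
  \<open>exp (- c)\<close> are collected by \<open>inner_count\<close>.\<close>

lemma pmf_gw:
  assumes c: "c > 0"
  shows "wf_tree k l T \<Longrightarrow> pmf (gw k c l) T = labeling_limit c l T * exp (- c * real (inner_count l T))"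
proof (induction l arbitrary: T)
  case (Suc l)
  obtain bs where T: "T = Node bs" by (cases T)
  have "pmf (gw k c (Suc l)) T = pmf (forest c (replicate_pmf (k+1) (gw k c l))) bs"
    unfolding gw.simps T by (rule pmf_map_inj') (auto simp: inj_def)
  also have "\<dots> = c ^ length bs / fact (length bs) * exp (- c) * (\<Prod>ts\<leftarrow>bs. pmf (replicate_pmf (k+1) (gw k c l)) ts)"
    by (rule pmf_forest[OF c])
  also have "(\<Prod>ts\<leftarrow>bs. pmf (replicate_pmf (k+1) (gw k c l)) ts) = (\<Prod>ts\<leftarrow>bs. (\<Prod>t\<leftarrow>ts. labeling_limit c l t) * exp (- c * real (\<Sum>t\<leftarrow>ts. inner_count l t)))"
  proof (rule prod_list_cong)
    fix ts assume ts: "ts \<in> set bs"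
    then have "length ts = k + 1" "\<And>t. t \<in> set ts \<Longrightarrow> wf_tree k l t" using Suc.prems by (auto simp: T)
    then have "pmf (replicate_pmf (k+1) (gw k c l)) ts = (\<Prod>t\<leftarrow>ts. labeling_limit c l t * exp (- c * real (inner_count l t)))"
      unfolding pmf_replicate using Suc.IH by (simp cong: prod_list_cong)
    then show "pmf (replicate_pmf (k+1) (gw k c l)) ts = (\<Prod>t\<leftarrow>ts. labeling_limit c l t) * exp (- c * real (\<Sum>t\<leftarrow>ts. inner_count l t))"
      by (simp only: prod_list_mult_exp)
  qed
  also have "\<dots> = (\<Prod>ts\<leftarrow>bs. \<Prod>t\<leftarrow>ts. labeling_limit c l t) * exp (- c * real (\<Sum>ts\<leftarrow>bs. \<Sum>t\<leftarrow>ts. inner_count l t))"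
    by (rule prod_list_mult_exp)
  also have "c ^ length bs / fact (length bs) * exp (- c) * \<dots> = labeling_limit c (Suc l) T * exp (- c * real (inner_count (Suc l) T))"
  proof -
    have "exp (- c * real (inner_count (Suc l) T)) = exp (- c) * exp (- c * real (\<Sum>ts\<leftarrow>bs. \<Sum>t\<leftarrow>ts. inner_count l t))"
      by (simp add: T exp_add[symmetric] algebra_simps)
    then show ?thesis by (simp add: T)
  qed
  finally show ?case .
qed simp

lemma set_gw: "T \<in> set_pmf (gw k c l) \<Longrightarrow> wf_tree k l T"
proof (induction l arbitrary: T)
  case (Suc l)
  then obtain bs where bs: "T = Node bs" "bs \<in> set_pmf (forest c (replicate_pmf (k+1) (gw k c l)))" by auto
  show ?case unfolding wf_tree.simps
  proof (intro ballI conjI)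
    fix ts assume "ts \<in> set (blocks T)"
    then have "ts \<in> set_pmf (replicate_pmf (k+1) (gw k c l))" using forest_set[OF bs(2)] bs(1) by auto
    from set_replicate_pmfD[OF this] show "length ts = k + 1" "\<And>t. t \<in> set ts \<Longrightarrow> wf_tree k l t" using Suc.IH by auto
  qed
qed simp

lemma tendsto_prod_list:
  fixes f :: "'a \<Rightarrow> nat \<Rightarrow> real"
  assumes "\<And>t. t \<in> set ts \<Longrightarrow> (\<lambda>n. f t n) \<longlonglongrightarrow> g t"
  shows "(\<lambda>n. \<Prod>t\<leftarrow>ts. f t n) \<longlonglongrightarrow> (\<Prod>t\<leftarrow>ts. g t)"
  using assms by (induction ts) (auto intro!: tendsto_mult)

text \<open>The powers of \<open>r n\<close> are distributed over the falling factorial, in which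
  \<open>n * r n\<close> tends to \<open>c\<close> and the shifts by \<open>K\<close> and
  \<open>i\<close> disappear because \<open>r n\<close> tends to 0.\<close>

lemma binomial_tendsto:
  fixes r :: "nat \<Rightarrow> real"
  assumes r: "(\<lambda>n. real n * r n) \<longlonglongrightarrow> c"
  shows "(\<lambda>n. real (n - K choose m) * r n ^ m) \<longlonglongrightarrow> c ^ m / fact m"
proof -
  have r0: "r \<longlonglongrightarrow> 0"
  proof -
    have "(\<lambda>n. (real n * r n) * (1 / real n)) \<longlonglongrightarrow> c * 0" by (intro tendsto_mult r lim_1_over_n)
    moreover have "\<forall>\<^sub>F n in sequentially. (real n * r n) * (1 / real n) = r n"
      using eventually_gt_at_top[of 0] by eventually_elim simp
    ultimately have "r \<longlonglongrightarrow> c * 0" by (rule Lim_transform_eventually)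
    then show ?thesis by simp
  qed
  have "(\<lambda>n. (\<Prod>i\<in>{0..<m}. (real n * r n - real K * r n - real i * r n)) / fact m) \<longlonglongrightarrow> (\<Prod>i\<in>{0..<m}. (c - real K * 0 - real i * 0)) / fact m"
    by (intro tendsto_intros r r0) simp
  moreover have "\<forall>\<^sub>F n in sequentially. (\<Prod>i\<in>{0..<m}. (real n * r n - real K * r n - real i * r n)) / fact m = real (n - K choose m) * r n ^ m"
    using eventually_ge_at_top[of K]
  proof eventually_elim
    case (elim n)
    have "real (n - K choose m) = (\<Prod>i\<in>{0..<m}. real (n - K) - real i) / fact m"
      by (simp add: binomial_gbinomial gbinomial_prod_rev)
    then have "real (n - K choose m) * r n ^ m = ((\<Prod>i\<in>{0..<m}. real (n - K) - real i) * (\<Prod>i\<in>{0..<m}. r n)) / fact m" by simp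
    also have "(\<Prod>i\<in>{0..<m}. real (n - K) - real i) * (\<Prod>i\<in>{0..<m}. r n) = (\<Prod>i\<in>{0..<m}. (real n * r n - real K * r n - real i * r n))"
      unfolding prod.distrib[symmetric] using elim by (intro prod.cong) (auto simp: of_nat_diff algebra_simps)
    finally show ?case by simp
  qed
  ultimately show ?thesis by (simp add: Lim_transform_eventually)
qed

lemma labeling_count_tendsto:
  fixes r :: "nat \<Rightarrow> real"
  assumes r: "(\<lambda>n. real n * r n) \<longlonglongrightarrow> c"
  shows "(\<lambda>n. real (labeling_count (n - K) l T) * r n ^ edge_count l T) \<longlonglongrightarrow> labeling_limit c l T"
proof (induction l arbitrary: T)
  case (Suc l)
  have prod_of_nat: "real (\<Prod>t\<leftarrow>ts. f t) = (\<Prod>t\<leftarrow>ts. real (f t))" for f :: "'z \<Rightarrow> nat" and ts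
    by (induction ts) auto
  have eq: "real (labeling_count (n - K) (Suc l) T) * r n ^ edge_count (Suc l) T
     = (real (n - K choose length (blocks T)) * r n ^ length (blocks T))
       * (\<Prod>ts\<leftarrow>blocks T. \<Prod>t\<leftarrow>ts. real (labeling_count (n - K) l t) * r n ^ edge_count l t)" for n
    unfolding prod_list_mult_power by (simp add: prod_of_nat power_add)
  show ?case unfolding eq labeling_limit.simps
    by (intro tendsto_mult binomial_tendsto r tendsto_prod_list Suc.IH)
qed simp

section \<open>Expected local statistics\<close>

lemma explores_hyp: "explores X l w e L \<Longrightarrow> hyp l w L \<subseteq> X"
proof (induction l arbitrary: w e L)
  case (Suc l)
  have "insert u w \<in> X" if "u \<in> fst ` set (edges L)" for u using Suc.prems that unfolding explores.simps by blast
  moreover have "hyp l (cf u x w) L' \<subseteq> X" if "(u, x, L') \<in> ch w L" for u x L'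
  proof -
    have "explores X l (cf u x w) {x} L'" using Suc.prems that unfolding explores.simps by blast
    then show ?thesis by (rule Suc.IH)
  qed
  ultimately show ?case unfolding hyp.simps by (intro Un_least UN_least) (blast, simp add: case_prod_beta')
qed simp

lemma explores_nodes:
  assumes "explores X l w e L" "good k l w L" "w \<in> X" "\<And>\<sigma> \<tau>. \<sigma> \<in> X \<Longrightarrow> \<tau> \<subseteq> \<sigma> \<Longrightarrow> \<tau> \<in> X"
  shows "nodes s l w L \<subseteq> faces (k+1) X"
proof
  fix \<sigma> assume s: "\<sigma> \<in> nodes s l w L"
  note nf = node_facts[OF assms(2) s]
  have "\<sigma> \<in> X" using nf(5) assms(3,4) explores_hyp[OF assms(1)] by blast
  then show "\<sigma> \<in> faces (k+1) X" using nf(3,4) by (simp add: faces_def)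
qed

lemma coboundary_bd: "a \<in> faces (m+1) X \<Longrightarrow> coboundary m X f a = bd f a"
  by (simp add: coboundary_def faces_def bd_def vsign_def)

text \<open>The inequality of \<open>tree_upper\<close> passes from the explored nodes to the full
  norm, which is larger, and \<open>pdiag\<close> is the least constant of this kind.\<close>

lemma pdiag_le_val:
  assumes X: "finite X" "v \<in> X" "\<And>\<sigma> \<tau>. \<sigma> \<in> X \<Longrightarrow> \<tau> \<subseteq> \<sigma> \<Longrightarrow> \<tau> \<in> X"
    and L: "explores X l v {} L" "good k l v L"
  shows "pdiag k X v \<le> val 1 l (shape l L)"
proof (rule pdiag(4)[OF X(1)])
  show v0: "0 \<le> val 1 l (shape l L)" using val_nonneg[of 1 l "shape l L"] by simp
  fix f assume f: "f \<in> cocycles k X"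
  have "bd f a = 0" if "a \<in> X" "finite a" "card a = k + 2" for a
  proof -
    have a: "a \<in> faces (k+2) X" using that by (simp add: faces_def)
    then have "coboundary (k+1) X f a = bd f a" using coboundary_bd[of a "k+1"] by simp
    then show ?thesis using f a unfolding cocycles_alt by simp
  qed
  then have "(f v)\<^sup>2 \<le> val 1 l (shape l L) * (\<Sum>\<sigma>\<in>nodes True l v L. (f \<sigma>)\<^sup>2)"
    by (rule tree_upper[OF L])
  also have "\<dots> \<le> val 1 l (shape l L) * (\<Sum>\<sigma>\<in>faces (k+1) X. (f \<sigma>)\<^sup>2)"
    using explores_nodes[OF L X(2,3)] finite_faces[OF X(1)] v0
    by (intro mult_left_mono sum_mono2) auto
  finally show "(f v)\<^sup>2 \<le> val 1 l (shape l L) * ip (faces (k+1) X) f f"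
    by (simp add: ip_def power2_eq_square)
qed

text \<open>The function from \<open>tree_lower\<close> is a cocycle of the whole complex with value
  1 at \<open>v\<close>, and any such cocycle bounds the diagonal from below by the reciprocal of
  its squared norm.\<close>

lemma val_le_pdiag:
  assumes X: "finite X" "v \<in> X" "\<And>\<sigma> \<tau>. \<sigma> \<in> X \<Longrightarrow> \<tau> \<subseteq> \<sigma> \<Longrightarrow> \<tau> \<in> X"
    and L: "explores X l v {} L" "good k l v L"
  shows "val 0 l (shape l L) \<le> pdiag k X v"
proof (cases "val 0 l (shape l L) > 0")
  case True
  let ?N = "nodes False l v L"
  from tree_lower[OF L _ _ True] obtain f where f: "f v = 1" "\<And>\<sigma>. f \<sigma> \<noteq> 0 \<Longrightarrow> \<sigma> \<in> ?N"
    "(\<Sum>\<sigma>\<in>?N. (f \<sigma>)\<^sup>2) \<le> 1 / val 0 l (shape l L)" "\<And>a. a \<in> X \<Longrightarrow> card a = k + 2 \<Longrightarrow> bd f a = 0"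
    by auto
  have sub: "?N \<subseteq> faces (k+1) X" by (rule explores_nodes[OF L X(2,3)])
  have "f \<in> cocycles k X"
  proof -
    have "coboundary (k+1) X f a = 0" if a: "a \<in> faces (k+2) X" for a
      using coboundary_bd[of a "k+1" X f] f(4)[of a] a by (simp add: faces_def)
    then show ?thesis unfolding cocycles_alt cochains_supported supported_def using f(2) sub by blast
  qed
  from pdiag(3)[OF X(1) this, of v] have "1 \<le> pdiag k X v * ip (faces (k+1) X) f f" using f(1) by simp
  also have "ip (faces (k+1) X) f f = (\<Sum>\<sigma>\<in>?N. (f \<sigma>)\<^sup>2)"
    unfolding ip_def power2_eq_square by (rule sum.mono_neutral_right) (use sub f(2) finite_faces[OF X(1)] in auto)
  also have "pdiag k X v * \<dots> \<le> pdiag k X v * (1 / val 0 l (shape l L))"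
    using f(3) pdiag(1)[OF X(1)] by (rule mult_left_mono)
  finally show ?thesis using True by (simp add: field_simps)
next
  case False
  then show ?thesis using pdiag(1)[OF X(1), of k v] by linarith
qed

context face_probs
begin

text \<open>\<open>exact_prob\<close> is applied with the inner nodes in the role of
  \<open>I\<close>, as these are the faces whose cofaces the exploration lists completely. The bound
  depends on the shape only, so that all labelings of a shape share it.\<close>

lemma prob_explores:
  assumes v: "v \<in> subs n (k+1)" and g: "good k l v L" and lab: "set (labs l L) \<subseteq> {1..n}"
    and T: "shape l L = T" and small: "real (inner_count l T) * R (k+1) \<le> 1"
  shows "measure_pmf.prob (field n p) {\<omega>. v \<in> cplx n \<omega> \<and> explores (cplx n \<omega>) l v {} L}
    \<ge> Q (k+1) * R (k+1) ^ edge_count l T * ((1 - real (inner_count l T) * R (k+1)) ^ n - real (inner_count l T * (k + 1 + edge_count l T)) * W k)"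
proof -
  let ?V = "v \<union> set (labs l L)" and ?H = "hyp l v L" and ?I = "nodes False l v L"
  have vn: "finite v" "card v = k+1" "v \<subseteq> {1..n}" using v finite_subs(2)[OF v] by (auto simp: subs_def)
  have dl: "distinct (labs l L)" "v \<inter> set (labs l L) = {}" using g by (auto simp: good_def)
  have "set (labs l L) \<inter> v = {}" using dl(2) by blast
  from ktree_hyp[OF ktree.base g _ this] have kt: "ktree k v ?V ?H" by simp
  have Vn: "?V \<subseteq> {1..n}" using vn(3) lab by blast
  have cV: "card ?V = k + 1 + edge_count l T"
    using card_Un_disjoint[OF vn(1) _ dl(2)] vn(2) distinct_card[OF dl(1)] length_labs[of l L] T by simp
  have cH: "card ?H = edge_count l T" using ktree_basic(5)[OF kt vn(1,2)] cV by simp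
  have cI: "real (card ?I) \<le> real (inner_count l T)" using card_nodes[OF g] T by simp
  have R01: "0 \<le> R (k+1)" "R (k+1) \<le> 1" and Q0: "0 \<le> Q (k+1)" and W0: "0 \<le> W k"
    by (rule cube_prod_01)+
  have cIR: "real (card ?I) * R (k+1) \<le> real (inner_count l T) * R (k+1)" using cI R01(1) by (rule mult_right_mono)
  have Icond: "card w = k+1 \<and> (w = v \<or> (\<exists>a\<in>?H. w \<subseteq> a))" if "w \<in> ?I" for w
    using node_facts[OF g that] by blast
  have finI: "finite ?I" by (rule finite_nodes)
  have "Q (k+1) * R (k+1) ^ edge_count l T * ((1 - real (inner_count l T) * R (k+1)) ^ n - real (inner_count l T * (k + 1 + edge_count l T)) * W k)
    \<le> Q (k+1) * R (k+1) ^ card ?H * ((1 - real (card ?I) * R (k+1)) ^ n - real (card ?I * card ?V) * W k)"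
  proof -
    have "(1 - real (inner_count l T) * R (k+1)) ^ n \<le> (1 - real (card ?I) * R (k+1)) ^ n"
      using cIR small by (intro power_mono) auto
    moreover have "real (card ?I * card ?V) * W k \<le> real (inner_count l T * (k + 1 + edge_count l T)) * W k"
    proof (rule mult_right_mono[OF _ W0])
      have "card ?I \<le> inner_count l T" using cI by simp
      then show "real (card ?I * card ?V) \<le> real (inner_count l T * (k + 1 + edge_count l T))"
        unfolding cV of_nat_le_iff by (rule mult_le_mono1)
    qed
    ultimately show ?thesis using Q0 R01 unfolding cH by (intro mult_left_mono) auto
  qed
  also have "\<dots> \<le> measure_pmf.prob (field n p) {\<omega>. (\<forall>\<sigma>\<in>skel v ?H. \<omega> \<sigma>) \<and> (\<forall>w\<in>?I. \<forall>u\<in>{1..n}-w. (\<forall>\<rho>\<subseteq>insert u w. \<omega> \<rho>) \<longrightarrow> insert u w \<in> ?H)}"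
    by (rule exact_prob[OF kt vn(1,2) Vn finI Icond]) (use cIR small in linarith)+
  also have "\<dots> \<le> measure_pmf.prob (field n p) {\<omega>. v \<in> cplx n \<omega> \<and> explores (cplx n \<omega>) l v {} L}"
  proof (rule measure_pmf.finite_measure_mono)
    show "{\<omega>. (\<forall>\<sigma>\<in>skel v ?H. \<omega> \<sigma>) \<and> (\<forall>w\<in>?I. \<forall>u\<in>{1..n}-w. (\<forall>\<rho>\<subseteq>insert u w. \<omega> \<rho>) \<longrightarrow> insert u w \<in> ?H)}
      \<subseteq> {\<omega>. v \<in> cplx n \<omega> \<and> explores (cplx n \<omega>) l v {} L}"
    proof (intro subsetI CollectI conjI)
      fix \<omega> assume "\<omega> \<in> {\<omega>. (\<forall>\<sigma>\<in>skel v ?H. \<omega> \<sigma>) \<and> (\<forall>w\<in>?I. \<forall>u\<in>{1..n}-w. (\<forall>\<rho>\<subseteq>insert u w. \<omega> \<rho>) \<longrightarrow> insert u w \<in> ?H)}"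
      then have o: "\<And>\<sigma>. \<sigma> \<in> skel v ?H \<Longrightarrow> \<omega> \<sigma>"
        "\<And>w u. w \<in> ?I \<Longrightarrow> u \<in> {1..n} - w \<Longrightarrow> (\<forall>\<rho>\<subseteq>insert u w. \<omega> \<rho>) \<Longrightarrow> insert u w \<in> ?H" by blast+
      have sk: "\<omega> \<rho>" if "\<rho> \<subseteq> \<sigma>" "\<sigma> \<in> insert v ?H" for \<rho> \<sigma>
        using that by (intro o(1)) (auto simp: skel_def)
      then show "v \<in> cplx n \<omega>" using vn(3) unfolding cplx_def by blast
      have HX: "?H \<subseteq> cplx n \<omega>"
      proof
        fix a assume a: "a \<in> ?H"
        then have "a \<subseteq> {1..n}" using ktree_basic(4)[OF kt vn(1,2)] Vn by blast
        then show "a \<in> cplx n \<omega>" using sk a unfolding cplx_def by blast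
      qed
      show "explores (cplx n \<omega>) l v {} L"
      proof (rule explores_sufficient[OF HX, of ?I])
        fix \<sigma> u assume s: "\<sigma> \<in> ?I" "u \<notin> \<sigma>" "insert u \<sigma> \<in> cplx n \<omega>"
        then show "insert u \<sigma> \<in> ?H" by (intro o(2)[OF s(1)]) (auto simp: cplx_def)
      qed (use g in auto)
    qed
  qed simp
  finally show ?thesis .
qed

lemma F_of_bool: "F n (\<lambda>\<omega>. of_bool (P \<omega>)) = measure_pmf.prob (field n p) {\<omega>. P \<omega>}"
proof -
  have "(\<lambda>\<omega>. of_bool (P \<omega>) :: real) = indicator {\<omega>. P \<omega>}" by (auto simp: fun_eq_iff)
  then show ?thesis by simp
qed

text \<open>Faces whose exploration is not among the listed labelings are given up, which is where
  the nonnegativity of \<open>g\<close> enters. By \<open>explores_unique\<close> at most one of the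
  indicators belonging to a root is 1, so their weighted sum stays below \<open>g\<close>.\<close>

lemma exploration_lower_bound:
  assumes TT: "finite TT" "\<And>T. T \<in> TT \<Longrightarrow> wf_tree k l T \<and> edge_count l T \<le> K \<and> inner_count l T \<le> K"
    and K: "real K * R (k+1) \<le> 1" "k + 1 + K \<le> n"
    and \<phi>: "\<And>T. 0 \<le> (\<phi> T :: real)"
    and g0: "\<And>\<omega> v. v \<in> faces (k+1) (cplx n \<omega>) \<Longrightarrow> 0 \<le> (g (cplx n \<omega>) v :: real)"
    and g: "\<And>\<omega> v L. v \<in> faces (k+1) (cplx n \<omega>) \<Longrightarrow> explores (cplx n \<omega>) l v {} L \<Longrightarrow> good k l v L \<Longrightarrow>
      \<phi> (shape l L) \<le> g (cplx n \<omega>) v"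
  shows "F n (\<lambda>\<omega>. \<Sum>v\<in>faces (k+1) (cplx n \<omega>). g (cplx n \<omega>) v) \<ge> real (n choose (k+1)) * (\<Sum>T\<in>TT. \<phi> T *
    (real (labeling_count (n - (k+1+K)) l T) * (Q (k+1) * R (k+1) ^ edge_count l T *
      ((1 - real (inner_count l T) * R (k+1)) ^ n - real (inner_count l T * (k + 1 + edge_count l T)) * W k))))"
proof -
  let ?low = "\<lambda>T. Q (k+1) * R (k+1) ^ edge_count l T * ((1 - real (inner_count l T) * R (k+1)) ^ n - real (inner_count l T * (k + 1 + edge_count l T)) * W k)"
  let ?M = "n - (k+1+K)"
  let ?ok = "\<lambda>v T L. shape l L = T \<and> good k l v L \<and> set (labs l L) \<subseteq> {1..n}"
  let ?P = "\<lambda>v T A. finite A \<and> card A = labeling_count ?M l T \<and> (\<forall>L\<in>A. ?ok v T L)"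
  have ex: "\<exists>A. ?P v T A" if v: "v \<in> subs n (k+1)" and T: "T \<in> TT" for v T
  proof -
    have vn: "finite v" "card v = k+1" "v \<subseteq> {1..n}" using v finite_subs(2)[OF v] by (auto simp: subs_def)
    have "card ({1..n} - v) = n - (k+1)" using vn by (simp add: card_Diff_subset)
    then have "card ({1..n} - v) \<ge> ?M + edge_count l T" using TT(2)[OF T] K(2) by linarith
    from count_labelings[OF conjunct1[OF TT(2)[OF T]] vn(1) this] obtain A where A: "finite A" "card A \<ge> labeling_count ?M l T"
      "\<forall>L\<in>A. (shape l L = T \<and> wf_ltree k l L) \<and> distinct (labs l L) \<and> set (labs l L) \<inter> v = {}
        \<and> set (labs l L) \<subseteq> {1..n} \<and> length (labs l L) = edge_count l T" by blast
    \<comment> \<open>The set is trimmed to the exact number because the lower bound common to all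
      labelings may be negative, in which case additional labelings would spoil the
      estimate.\<close>
    from obtain_subset_with_card_n[OF A(2)] obtain B where B: "B \<subseteq> A" "card B = labeling_count ?M l T" "finite B"
      using A(1) finite_subset by metis
    have "\<forall>L\<in>B. ?ok v T L" using A(3) B(1) vn unfolding good_def by blast
    then show ?thesis using B(2,3) by blast
  qed
  have "\<exists>A. \<forall>T\<in>TT. ?P v T (A T)" if v: "v \<in> subs n (k+1)" for v
    by (rule bchoice[of TT "?P v"]) (intro ballI ex[OF v])
  then have "\<forall>v\<in>subs n (k+1). \<exists>A. \<forall>T\<in>TT. ?P v T (A T)" by (rule ballI)
  from bchoice[OF this] obtain A where A0: "\<forall>v\<in>subs n (k+1). \<forall>T\<in>TT. ?P v T (A v T)" by (rule exE)
  have A: "?P v T (A v T)" if "v \<in> subs n (k+1)" "T \<in> TT" for v T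
    by (rule bspec[OF bspec[OF A0 that(1)] that(2)])
  let ?e = "\<lambda>v L \<omega>. of_bool (v \<in> cplx n \<omega> \<and> explores (cplx n \<omega>) l v {} L) :: real"
  have "real (n choose (k+1)) * (\<Sum>T\<in>TT. \<phi> T * (real (labeling_count ?M l T) * ?low T))
    = (\<Sum>v\<in>subs n (k+1). \<Sum>T\<in>TT. \<phi> T * (\<Sum>L\<in>A v T. ?low T))"
    using A by (simp add: card_subs)
  also have "\<dots> \<le> (\<Sum>v\<in>subs n (k+1). \<Sum>T\<in>TT. \<phi> T * (\<Sum>L\<in>A v T. F n (?e v L)))"
  proof (intro sum_mono mult_left_mono \<phi>)
    fix v T L assume v: "v \<in> subs n (k+1)" and T: "T \<in> TT" and L: "L \<in> A v T"
    have ok: "?ok v T L" using A[OF v T] L by blast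
    have "real (inner_count l T) * R (k+1) \<le> real K * R (k+1)"
      using TT(2)[OF T] by (intro mult_right_mono cube_prod_01) simp
    then have "real (inner_count l T) * R (k+1) \<le> 1" using K(1) by linarith
    then show "?low T \<le> F n (?e v L)" unfolding F_of_bool using ok by (intro prob_explores[OF v]) auto
  qed
  also have "\<dots> = F n (\<lambda>\<omega>. \<Sum>v\<in>subs n (k+1). \<Sum>T\<in>TT. \<phi> T * (\<Sum>L\<in>A v T. ?e v L \<omega>))"
    by (simp only: F_sum Bochner_Integration.integral_mult_right_zero)
  also have "\<dots> \<le> F n (\<lambda>\<omega>. \<Sum>v\<in>faces (k+1) (cplx n \<omega>). g (cplx n \<omega>) v)"
  proof (rule F_mono)
    fix \<omega>
    let ?X = "cplx n \<omega>"
    have fsub: "faces (k+1) ?X \<subseteq> subs n (k+1)" unfolding faces_cplx by blast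
    have one: "(\<Sum>T\<in>TT. \<phi> T * (\<Sum>L\<in>A v T. ?e v L \<omega>)) \<le> (if v \<in> faces (k+1) ?X then g ?X v else 0)"
      if v: "v \<in> subs n (k+1)" for v
    proof (cases "v \<in> faces (k+1) ?X \<and> (\<exists>T\<in>TT. \<exists>L\<in>A v T. explores ?X l v {} L)")
      case True
      then obtain T0 L0 where T0: "T0 \<in> TT" "L0 \<in> A v T0" "explores ?X l v {} L0" by blast
      have ok0: "?ok v T0 L0" using A[OF v T0(1)] T0(2) by blast
      have fv: "finite v" using finite_subs(2)[OF v] .
      have eq: "T = T0 \<and> L = L0" if "T \<in> TT" "L \<in> A v T" "explores ?X l v {} L" for T L
      proof -
        have "L = L0" by (rule explores_unique[OF fv that(3) T0(3)])
        moreover have "shape l L = T" using A[OF v that(1)] that(2) by blast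
        ultimately show ?thesis using ok0 by blast
      qed
      have e0: "?e v L \<omega> = (if T = T0 \<and> L = L0 then 1 else 0)" if "T \<in> TT" "L \<in> A v T" for T L
      proof (cases "T = T0 \<and> L = L0")
        case TL: True
        have "v \<in> ?X" using True by (simp add: faces_def)
        then show ?thesis using TL T0(3) by (simp only: simp_thms if_True of_bool_eq)
      next
        case TL: False
        then have "\<not> explores ?X l v {} L" using eq[OF that] by (rule contrapos_nn)
        then show ?thesis using TL by (simp only: simp_thms if_False of_bool_eq)
      qed
      have "(\<Sum>L\<in>A v T. ?e v L \<omega>) = (if T = T0 then 1 else 0)" if T: "T \<in> TT" for T
      proof -
        have "(\<Sum>L\<in>A v T. ?e v L \<omega>) = (\<Sum>L\<in>A v T. if L = L0 then if T = T0 then 1 else 0 else 0)"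
          by (rule sum.cong[OF refl]) (simp only: e0[OF T] if_if_eq_conj conj_commute)
        also have "\<dots> = (if L0 \<in> A v T then if T = T0 then 1 else 0 else 0)" using A[OF v T] by (simp add: sum.delta)
        finally show ?thesis using T0(2) by auto
      qed
      then have "(\<Sum>T\<in>TT. \<phi> T * (\<Sum>L\<in>A v T. ?e v L \<omega>)) = (\<Sum>T\<in>TT. if T = T0 then \<phi> T else 0)"
        by (intro sum.cong[OF refl]) auto
      also have "\<dots> = \<phi> T0" using TT(1) T0(1) by (simp add: sum.delta)
      also have "\<dots> \<le> g ?X v" using g[OF conjunct1[OF True] T0(3) conjunct1[OF conjunct2[OF ok0]]] ok0 by (simp only:)
      finally show ?thesis using True by simp
    next
      case False
      have mem: "v \<in> faces (k+1) ?X" if "v \<in> ?X" using that v finite_subs(2)[OF v] by (simp add: faces_def subs_def)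
      have "(\<Sum>T\<in>TT. \<phi> T * (\<Sum>L\<in>A v T. ?e v L \<omega>)) = 0"
      proof (intro sum.neutral ballI)
        fix T assume T: "T \<in> TT"
        have "\<not> (v \<in> ?X \<and> explores ?X l v {} L)" if "L \<in> A v T" for L using False mem T that by blast
        then have "(\<Sum>L\<in>A v T. ?e v L \<omega>) = 0" by (intro sum.neutral ballI) (simp only: of_bool_eq)
        then show "\<phi> T * (\<Sum>L\<in>A v T. ?e v L \<omega>) = 0" by (simp only: mult_zero_right)
      qed
      then show ?thesis using g0 by simp
    qed
    have "(\<Sum>v\<in>subs n (k+1). \<Sum>T\<in>TT. \<phi> T * (\<Sum>L\<in>A v T. ?e v L \<omega>))
      \<le> (\<Sum>v\<in>subs n (k+1). if v \<in> faces (k+1) ?X then g ?X v else 0)" by (intro sum_mono one)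
    also have "\<dots> = (\<Sum>v\<in>faces (k+1) ?X. g ?X v)"
      using fsub finite_subs(1) by (simp add: sum.If_cases Int_absorb1)
    finally show "(\<Sum>v\<in>subs n (k+1). \<Sum>T\<in>TT. \<phi> T * (\<Sum>L\<in>A v T. ?e v L \<omega>)) \<le> (\<Sum>v\<in>faces (k+1) ?X. g ?X v)" .
  qed
  finally show ?thesis .
qed

end

section \<open>The first moment\<close>

lemma tendsto_0_of_mult_nat:
  fixes a :: "nat \<Rightarrow> real"
  assumes a: "(\<lambda>n. real n * a n) \<longlonglongrightarrow> x"
  shows "a \<longlonglongrightarrow> 0"
proof -
  have "(\<lambda>n. real n * a n * inverse (real n)) \<longlonglongrightarrow> x * 0"
    by (intro tendsto_mult a LIMSEQ_inverse_real_of_nat[THEN LIMSEQ_imp_Suc])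
  then have "(\<lambda>n. real n * a n * inverse (real n)) \<longlonglongrightarrow> 0" by (simp only: mult_zero_right)
  moreover have "\<forall>\<^sub>F n in sequentially. real n * a n * inverse (real n) = a n"
    using eventually_gt_at_top[of 0] by eventually_elim simp
  ultimately show ?thesis by (rule Lim_transform_eventually)
qed

text \<open>Both bounds come from \<open>1 + x \<le> exp x\<close>, once at \<open>a n\<close> and
  once at \<open>- (a n / (1 + a n))\<close>.\<close>

lemma power_exp_limit:
  fixes a :: "nat \<Rightarrow> real"
  assumes a: "(\<lambda>n. real n * a n) \<longlonglongrightarrow> x"
  shows "(\<lambda>n. (1 + a n) ^ n) \<longlonglongrightarrow> exp x"
proof (rule tendsto_sandwich)
  have a0: "a \<longlonglongrightarrow> 0" by (rule tendsto_0_of_mult_nat[OF a])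
  have ev: "\<forall>\<^sub>F n in sequentially. -1 < a n" by (rule order_tendstoD(1)[OF a0]) simp
  show "\<forall>\<^sub>F n in sequentially. (1 + a n) ^ n \<le> exp (real n * a n)"
    using ev
  proof eventually_elim
    case (elim n)
    have "(1 + a n) ^ n \<le> exp (a n) ^ n" using elim exp_ge_add_one_self[of "a n"] by (intro power_mono) auto
    then show ?case by (simp add: exp_of_nat_mult)
  qed
  show "\<forall>\<^sub>F n in sequentially. exp (real n * a n * (1 / (1 + a n))) \<le> (1 + a n) ^ n"
    using ev
  proof eventually_elim
    case (elim n)
    have "1 + - (a n / (1 + a n)) \<le> exp (- (a n / (1 + a n)))" by (rule exp_ge_add_one_self)
    moreover have "1 + - (a n / (1 + a n)) = 1 / (1 + a n)" using elim by (simp add: field_simps)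
    ultimately have "exp (a n / (1 + a n)) \<le> 1 + a n" using elim by (simp add: exp_minus field_simps)
    then have "exp (a n / (1 + a n)) ^ n \<le> (1 + a n) ^ n" by (intro power_mono) auto
    then show ?case by (simp add: exp_of_nat_mult[symmetric])
  qed
  have "(\<lambda>n. exp (real n * a n * (1 / (1 + a n)))) \<longlonglongrightarrow> exp (x * (1 / (1 + 0)))"
    by (intro tendsto_intros a a0) simp
  then show "(\<lambda>n. exp (real n * a n * (1 / (1 + a n)))) \<longlonglongrightarrow> exp x" by simp
  show "(\<lambda>n. exp (real n * a n)) \<longlonglongrightarrow> exp x" by (intro tendsto_intros a)
qed

text \<open>The expectation is an absolutely convergent sum, so finitely many atoms carry it up to
  \<epsilon>; keeping them in the support makes the trees among them well formed.\<close>

lemma pmf_finite_approx: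
  fixes \<phi> :: "'a \<Rightarrow> real"
  assumes \<phi>: "\<And>x. \<bar>\<phi> x\<bar> \<le> 1" and e: "\<epsilon> > 0"
  shows "\<exists>A. finite A \<and> A \<subseteq> set_pmf M \<and> (\<Sum>x\<in>A. \<phi> x * pmf M x) > Ep M \<phi> - \<epsilon>"
proof -
  let ?f = "\<lambda>x. pmf M x * \<phi> x"
  have abs: "Infinite_Set_Sum.abs_summable_on ?f UNIV"
    by (rule Infinite_Set_Sum.abs_summable_on_comparison_test[OF pmf_abs_summable[of M UNIV]])
       (use \<phi> in \<open>auto simp: abs_mult intro: mult_left_le\<close>)
  have "?f summable_on UNIV"
    by (rule Infinite_Sum.abs_summable_summable) (rule iffD2[OF abs_summable_equivalent abs])
  then have "(sum ?f \<longlongrightarrow> Ep M \<phi>) (finite_subsets_at_top UNIV)"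
    using infsum_tendsto unfolding pmf_expectation_eq_infsetsum infsetsum_infsum[OF abs] by blast
  then have "\<forall>\<^sub>F A in finite_subsets_at_top UNIV. sum ?f A > Ep M \<phi> - \<epsilon>"
    by (rule order_tendstoD) (use e in simp)
  then obtain A where A: "finite A" "sum ?f A > Ep M \<phi> - \<epsilon>"
    unfolding eventually_finite_subsets_at_top by blast
  have "sum ?f A = (\<Sum>x\<in>A \<inter> set_pmf M. \<phi> x * pmf M x)"
    by (rule sum.mono_neutral_cong_right) (use A(1) in \<open>auto simp: set_pmf_iff\<close>)
  then show ?thesis using A by (intro exI[of _ "A \<inter> set_pmf M"]) auto
qed

lemma binomial_power_tendsto: "(\<lambda>n. real (n choose m) / real n ^ m) \<longlonglongrightarrow> 1 / fact m"
proof -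
  have "(\<lambda>n. real n * (1 / real n)) \<longlonglongrightarrow> 1"
  proof (rule tendsto_eventually)
    show "\<forall>\<^sub>F n in sequentially. real n * (1 / real n) = 1" using eventually_gt_at_top[of 0] by eventually_elim simp
  qed
  from binomial_tendsto[OF this, of 0 m] show ?thesis by (simp add: power_divide)
qed

locale sparse_regime =
  fixes p :: "nat \<Rightarrow> nat \<Rightarrow> real" and k :: nat and c :: real
  assumes fp: "\<And>n. face_probs (p n)" and c: "c > 0"
    and N_top: "filterlim (\<lambda>n. real n ^ (k+1) * cube_prod (p n) (k+1) 0) at_top sequentially"
    and r_lim: "(\<lambda>n. real n * cube_prod (p n) (k+1) (Suc 0)) \<longlonglongrightarrow> c"
begin

abbreviation "E n \<equiv> Ep (field n (p n))"
abbreviation "N n \<equiv> real n ^ (k+1) * cube_prod (p n) (k+1) 0"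
abbreviation "r n \<equiv> cube_prod (p n) (k+1) (Suc 0)"

lemmas asymptotics = face_probs_asymptotics[OF fp c N_top r_lim[folded One_nat_def]]

lemma r_0: "r \<longlonglongrightarrow> 0"
  by (rule tendsto_0_of_mult_nat[OF r_lim])

lemma N_pos: "\<forall>\<^sub>F n in sequentially. N n > 0"
  using N_top by (simp only: filterlim_at_top_dense)

text \<open>For each shape the number of labelings times \<open>r n\<close> per edge tends to
  \<open>labeling_limit\<close>, and the absence of further cofaces contributes
  \<open>exp (- c)\<close> per inner node; together they are the Galton-Watson weight. Cutting down
  to finitely many shapes costs \<epsilon>.\<close>

lemma eventually_lower_bound:
  assumes \<phi>: "\<And>T. 0 \<le> \<phi> T \<and> \<phi> T \<le> (1 :: real)" and e: "\<epsilon> > 0"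
    and g0: "\<And>n \<omega> v. v \<in> faces (k+1) (cplx n \<omega>) \<Longrightarrow> 0 \<le> (g (cplx n \<omega>) v :: real)"
    and g: "\<And>n \<omega> v L. v \<in> faces (k+1) (cplx n \<omega>) \<Longrightarrow> explores (cplx n \<omega>) l v {} L \<Longrightarrow> good k l v L \<Longrightarrow>
      \<phi> (shape l L) \<le> g (cplx n \<omega>) v"
  shows "\<forall>\<^sub>F n in sequentially.
    (Ep (gw k c l) \<phi> - \<epsilon>) / fact (k+1) < E n (\<lambda>\<omega>. \<Sum>v\<in>faces (k+1) (cplx n \<omega>). g (cplx n \<omega>) v) / N n"
proof -
  have "\<bar>\<phi> T\<bar> \<le> 1" for T using \<phi>[of T] by simp
  then have "\<exists>TT. finite TT \<and> TT \<subseteq> set_pmf (gw k c l) \<and> (\<Sum>T\<in>TT. \<phi> T * pmf (gw k c l) T) > Ep (gw k c l) \<phi> - \<epsilon>"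
    using e by (rule pmf_finite_approx)
  then obtain TT where
    TT: "finite TT" "TT \<subseteq> set_pmf (gw k c l)" "(\<Sum>T\<in>TT. \<phi> T * pmf (gw k c l) T) > Ep (gw k c l) \<phi> - \<epsilon>" by blast
  have wf: "wf_tree k l T" if "T \<in> TT" for T by (rule set_gw[OF subsetD[OF TT(2) that]])
  define K where "K = (\<Sum>T\<in>TT. edge_count l T + inner_count l T)"
  have K: "edge_count l T \<le> K \<and> inner_count l T \<le> K" if "T \<in> TT" for T
  proof -
    have "edge_count l T + inner_count l T \<le> K" unfolding K_def by (rule member_le_sum[OF that _ TT(1)]) simp
    then show ?thesis by simp
  qed
  let ?w = "\<lambda>n T. (1 - real (inner_count l T) * r n) ^ n - real (inner_count l T * (k + 1 + edge_count l T)) * cube_prod (p n) k (Suc (Suc 0))"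
  let ?t = "\<lambda>n. real (n choose (k+1)) / real n ^ (k+1) * (\<Sum>T\<in>TT. \<phi> T * (real (labeling_count (n - (k+1+K)) l T) * r n ^ edge_count l T * ?w n T))"
  have wlim: "(\<lambda>n. ?w n T) \<longlonglongrightarrow> exp (- c * real (inner_count l T)) - real (inner_count l T * (k + 1 + edge_count l T)) * 0" for T
  proof (intro tendsto_diff tendsto_mult tendsto_const)
    have "(\<lambda>n. - real (inner_count l T) * (real n * r n)) \<longlonglongrightarrow> - real (inner_count l T) * c"
      by (intro tendsto_mult tendsto_const r_lim)
    then have "(\<lambda>n. real n * (- real (inner_count l T) * r n)) \<longlonglongrightarrow> - c * real (inner_count l T)" by (simp add: mult_ac)
    from power_exp_limit[OF this] show "(\<lambda>n. (1 - real (inner_count l T) * r n) ^ n) \<longlonglongrightarrow> exp (- c * real (inner_count l T))" by simp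
    show "(\<lambda>n. cube_prod (p n) k (Suc (Suc 0))) \<longlonglongrightarrow> 0" using asymptotics(2) by (simp add: numeral_2_eq_2)
  qed
  have "?t \<longlonglongrightarrow> 1 / fact (k+1) * (\<Sum>T\<in>TT. \<phi> T * (labeling_limit c l T * (exp (- c * real (inner_count l T)) - real (inner_count l T * (k + 1 + edge_count l T)) * 0)))"
    by (intro tendsto_mult binomial_power_tendsto tendsto_sum tendsto_const labeling_count_tendsto r_lim wlim)
  also have "1 / fact (k+1) * (\<Sum>T\<in>TT. \<phi> T * (labeling_limit c l T * (exp (- c * real (inner_count l T)) - real (inner_count l T * (k + 1 + edge_count l T)) * 0)))
    = (\<Sum>T\<in>TT. \<phi> T * pmf (gw k c l) T) / fact (k+1)"
    using pmf_gw[OF c wf] by simp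
  finally have t: "?t \<longlonglongrightarrow> (\<Sum>T\<in>TT. \<phi> T * pmf (gw k c l) T) / fact (k+1)" .
  have "(Ep (gw k c l) \<phi> - \<epsilon>) / fact (k+1) < (\<Sum>T\<in>TT. \<phi> T * pmf (gw k c l) T) / fact (k+1)"
    using TT(3) by (intro divide_strict_right_mono) auto
  from order_tendstoD(1)[OF t this] have 1: "\<forall>\<^sub>F n in sequentially. (Ep (gw k c l) \<phi> - \<epsilon>) / fact (k+1) < ?t n" .
  have "(\<lambda>n. real K * r n) \<longlonglongrightarrow> real K * 0" by (intro tendsto_mult tendsto_const r_0)
  then have 2: "\<forall>\<^sub>F n in sequentially. real K * r n < 1" by (rule order_tendstoD) simp
  show ?thesis
    using 1 2 N_pos eventually_ge_at_top[of "k + 1 + K"]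
  proof eventually_elim
    case (elim n)
    have le: "real (n choose (k+1)) * (\<Sum>T\<in>TT. \<phi> T *
      (real (labeling_count (n - (k+1+K)) l T) * (cube_prod (p n) (k+1) 0 * r n ^ edge_count l T * ?w n T)))
      \<le> E n (\<lambda>\<omega>. \<Sum>v\<in>faces (k+1) (cplx n \<omega>). g (cplx n \<omega>) v)"
      using elim(2,4) \<phi> wf K
      by (intro face_probs.exploration_lower_bound[OF fp TT(1)] g0 g) (blast | linarith)+
    have "real (n choose (k+1)) * (\<Sum>T\<in>TT. \<phi> T *
      (real (labeling_count (n - (k+1+K)) l T) * (cube_prod (p n) (k+1) 0 * r n ^ edge_count l T * ?w n T))) = ?t n * N n"
      using elim(3,4) by (simp add: sum_distrib_left sum_distrib_right mult_ac)
    then have "?t n * N n \<le> E n (\<lambda>\<omega>. \<Sum>v\<in>faces (k+1) (cplx n \<omega>). g (cplx n \<omega>) v)" using le by linarith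
    then have "?t n \<le> E n (\<lambda>\<omega>. \<Sum>v\<in>faces (k+1) (cplx n \<omega>). g (cplx n \<omega>) v) / N n"
      using elim(3) by (simp only: pos_le_divide_eq)
    then show ?case using elim(1) by linarith
  qed
qed

lemma cplx_down: "\<sigma> \<in> cplx n \<omega> \<Longrightarrow> \<tau> \<subseteq> \<sigma> \<Longrightarrow> \<tau> \<in> cplx n \<omega>"
  unfolding cplx_def by blast

lemma int_E: "integrable (field n (p n)) (f :: _ \<Rightarrow> real)"
  by (rule face_probs.int_field[OF fp])

lemma E_faces: "E n (\<lambda>\<omega>. real (card (faces j (cplx n \<omega>)))) = real (n choose j) * cube_prod (p n) j 0"
  by (rule face_probs.F_faces[OF fp])

lemma E_faces_limit: "(\<lambda>n. E n (\<lambda>\<omega>. real (card (faces (k+1) (cplx n \<omega>)))) / N n) \<longlonglongrightarrow> 1 / fact (k+1)"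
proof -
  have "\<forall>\<^sub>F n in sequentially. real (n choose (k+1)) / real n ^ (k+1) = E n (\<lambda>\<omega>. real (card (faces (k+1) (cplx n \<omega>)))) / N n"
    using N_pos
  proof eventually_elim
    case (elim n)
    then have "cube_prod (p n) (k+1) 0 \<noteq> 0" by auto
    then show ?case unfolding E_faces by (simp only: mult_divide_mult_cancel_right simp_thms)
  qed
  then show ?thesis by (rule Lim_transform_eventually[OF binomial_power_tendsto])
qed

lemma E_cofaces_limit: "(\<lambda>n. E n (\<lambda>\<omega>. real (card (faces (k+2) (cplx n \<omega>)))) / N n) \<longlonglongrightarrow> c / fact (k+2)"
proof -
  have "(\<lambda>n. real (n choose (k+2)) / real n ^ (k+2) * (real n * r n)) \<longlonglongrightarrow> 1 / fact (k+2) * c"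
    by (intro tendsto_mult binomial_power_tendsto r_lim)
  moreover have "\<forall>\<^sub>F n in sequentially. real (n choose (k+2)) / real n ^ (k+2) * (real n * r n)
    = E n (\<lambda>\<omega>. real (card (faces (k+2) (cplx n \<omega>)))) / N n"
    using N_pos eventually_gt_at_top[of 0]
  proof eventually_elim
    case (elim n)
    have "cube_prod (p n) (k+2) 0 = cube_prod (p n) (k+1) 0 * r n" by simp
    moreover have "cube_prod (p n) (k+1) 0 \<noteq> 0" using elim(1) by auto
    ultimately show ?case using elim(2) unfolding E_faces by (simp add: field_simps del: cube_prod.simps)
  qed
  ultimately have "(\<lambda>n. E n (\<lambda>\<omega>. real (card (faces (k+2) (cplx n \<omega>)))) / N n) \<longlonglongrightarrow> 1 / fact (k+2) * c"
    by (rule Lim_transform_eventually)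
  then show ?thesis by (simp only: times_divide_eq_left mult_1)
qed

abbreviation "Z n \<omega> \<equiv> real (nullity k (cplx n \<omega>))"

lemma nullity_limit: "(\<lambda>n. E n (Z n) / N n) \<longlonglongrightarrow> hk k c / fact (k+1)"
proof (rule order_tendstoI)
  note fc = face_probs.finite_cplx[OF fp]
  note vb = val_nonneg
  have gwE: "Ep (law k c b l) (\<lambda>x. x) = Ep (gw k c l) (val b l)" for b l by (simp add: law_def)
  {
    fix y assume y: "y < hk k c / fact (k+1)"
    then have yh: "y * fact (k+1) < max (Bethe k c 1) (Bethe k c (tdc (k+1) c))"
      unfolding hk_Bethe[OF c] pos_less_divide_eq[OF fact_gt_zero] .
    show "\<forall>\<^sub>F n in sequentially. y < E n (Z n) / N n"
    \<comment> \<open>The maximum exceeds the bound through one of its two terms, each with its own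
      proof: face counts for \<open>p = 1\<close>, explorations with boundary 0 for the least
      root.\<close>
    proof (cases "y * fact (k+1) < Bethe k c 1")
      case True
      have B1: "Bethe k c 1 / fact (k+1) = 1 / fact (k+1) - c / fact (k+2)"
        by (simp add: Bethe_def diff_divide_distrib mult.commute)
      have "y < Bethe k c 1 / fact (k+1)" using True unfolding pos_less_divide_eq[OF fact_gt_zero] .
      moreover have "(\<lambda>n. E n (\<lambda>\<omega>. real (card (faces (k+1) (cplx n \<omega>)))) / N n
          - E n (\<lambda>\<omega>. real (card (faces (k+2) (cplx n \<omega>)))) / N n) \<longlonglongrightarrow> 1 / fact (k+1) - c / fact (k+2)"
        by (intro tendsto_diff E_faces_limit E_cofaces_limit)
      ultimately have "\<forall>\<^sub>F n in sequentially. y < E n (\<lambda>\<omega>. real (card (faces (k+1) (cplx n \<omega>)))) / N n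
          - E n (\<lambda>\<omega>. real (card (faces (k+2) (cplx n \<omega>)))) / N n"
        unfolding B1 by (intro order_tendstoD)
      then show ?thesis using N_pos
      proof eventually_elim
        case (elim n)
        have "E n (\<lambda>\<omega>. real (card (faces (k+1) (cplx n \<omega>)))) - E n (\<lambda>\<omega>. real (card (faces (k+2) (cplx n \<omega>))))
          = E n (\<lambda>\<omega>. real (card (faces (k+1) (cplx n \<omega>))) - real (card (faces (k+2) (cplx n \<omega>))))"
          by (rule Bochner_Integration.integral_diff[OF int_E int_E, symmetric])
        also have "\<dots> \<le> E n (Z n)"
        proof (rule face_probs.F_mono[OF fp])
          show "real (card (faces (k+1) (cplx n \<omega>))) - real (card (faces (k+2) (cplx n \<omega>))) \<le> Z n \<omega>" for \<omega>
            using faces_le_nullity[OF fc, of k n \<omega>] by linarith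
        qed
        finally have "(E n (\<lambda>\<omega>. real (card (faces (k+1) (cplx n \<omega>)))) - E n (\<lambda>\<omega>. real (card (faces (k+2) (cplx n \<omega>))))) / N n \<le> E n (Z n) / N n"
          using elim(2) by (intro divide_right_mono) linarith+
        then show ?case using elim(1) unfolding diff_divide_distrib by linarith
      qed
    next
      case False
      define \<epsilon> where "\<epsilon> = (Bethe k c (tdc (k+1) c) - y * fact (k+1)) / 2"
      have e: "\<epsilon> > 0" using False yh by (simp add: \<epsilon>_def)
      obtain l where l: "Ep (law k c 0 l) (\<lambda>x. x) \<ge> Bethe k c (tdc (k+1) c) - \<epsilon>" using law_zero_limit[OF c e] by blast
      have "y * fact (k+1) \<le> Ep (gw k c l) (val 0 l) - \<epsilon>"
        using l unfolding gwE \<epsilon>_def by (simp add: field_simps)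
      then have y2: "y \<le> (Ep (gw k c l) (val 0 l) - \<epsilon>) / fact (k+1)" unfolding pos_le_divide_eq[OF fact_gt_zero] .
      have "\<forall>\<^sub>F n in sequentially. (Ep (gw k c l) (val 0 l) - \<epsilon>) / fact (k+1)
        < E n (\<lambda>\<omega>. \<Sum>v\<in>faces (k+1) (cplx n \<omega>). pdiag k (cplx n \<omega>) v) / N n"
      proof (rule eventually_lower_bound[OF _ e])
        show "0 \<le> val 0 l T \<and> val 0 l T \<le> 1" for T by (rule vb) simp_all
        show "0 \<le> pdiag k (cplx n \<omega>) v" for n \<omega> v by (rule pdiag(1)[OF fc])
        show "val 0 l (shape l L) \<le> pdiag k (cplx n \<omega>) v"
          if "v \<in> faces (k+1) (cplx n \<omega>)" "explores (cplx n \<omega>) l v {} L" "good k l v L" for n \<omega> v L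
          using that by (intro val_le_pdiag[OF fc _ cplx_down]) (auto simp: faces_def)
      qed
      then show ?thesis
      proof eventually_elim
        case (elim n)
        then show ?case using y2 by (simp add: pdiag(2)[OF fc, simplified])
      qed
    qed
  next
    fix y assume y: "hk k c / fact (k+1) < y"
    \<comment> \<open>One third each for \<open>law_one_limit\<close>, the exploration bound and the
      face count.\<close>
    define \<epsilon> where "\<epsilon> = (y * fact (k+1) - hk k c) / 3"
    have e: "\<epsilon> > 0" using y unfolding pos_divide_less_eq[OF fact_gt_zero] \<epsilon>_def by simp
    obtain l where l: "Ep (law k c 1 l) (\<lambda>x. x) \<le> hk k c + \<epsilon>" using law_one_limit[OF c e] by blast
    \<comment> \<open>The exploration bound is applied to the complement of the diagonal, which is
      nonnegative as the diagonal is at most 1; subtraction from the face count turns it into an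
      upper bound.\<close>
    let ?\<phi> = "\<lambda>T. 1 - val 1 l T"
    have Ev: "Ep (gw k c l) ?\<phi> = 1 - Ep (gw k c l) (val 1 l)"
    proof -
      have "integrable (gw k c l) (val 1 l)"
        by (rule integrable_pmf_bounded[where B=1]) (use vb[of 1 l] in auto)
      then show ?thesis by simp
    qed
    have "\<forall>\<^sub>F n in sequentially. (Ep (gw k c l) ?\<phi> - \<epsilon>) / fact (k+1)
        < E n (\<lambda>\<omega>. \<Sum>v\<in>faces (k+1) (cplx n \<omega>). 1 - pdiag k (cplx n \<omega>) v) / N n"
    proof (rule eventually_lower_bound[OF _ e])
      show "0 \<le> ?\<phi> T \<and> ?\<phi> T \<le> 1" for T using vb[of 1 l T] by simp
      show "0 \<le> 1 - pdiag k (cplx n \<omega>) v" if "v \<in> faces (k+1) (cplx n \<omega>)" for n \<omega> v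
        using pdiag_le_1[OF fc that] by simp
      show "?\<phi> (shape l L) \<le> 1 - pdiag k (cplx n \<omega>) v"
        if "v \<in> faces (k+1) (cplx n \<omega>)" "explores (cplx n \<omega>) l v {} L" "good k l v L" for n \<omega> v L
      proof -
        have "v \<in> cplx n \<omega>" using that(1) by (simp add: faces_def)
        from pdiag_le_val[OF fc this cplx_down that(2,3)] show ?thesis by simp
      qed
    qed
    moreover have "1 / fact (k+1) < 1 / fact (k+1) + \<epsilon> / fact (k+1)" using e by simp
    from order_tendstoD(2)[OF E_faces_limit this]
    have "\<forall>\<^sub>F n in sequentially. E n (\<lambda>\<omega>. real (card (faces (k+1) (cplx n \<omega>)))) / N n < 1 / fact (k+1) + \<epsilon> / fact (k+1)" .
    ultimately show "\<forall>\<^sub>F n in sequentially. E n (Z n) / N n < y"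
    proof eventually_elim
      case (elim n)
      have "(\<Sum>v\<in>faces (k+1) (cplx n \<omega>). 1 - pdiag k (cplx n \<omega>) v) = real (card (faces (k+1) (cplx n \<omega>))) - Z n \<omega>" for \<omega>
        using pdiag(2)[OF fc, of k n \<omega>] by (simp add: sum_subtractf)
      then have "E n (\<lambda>\<omega>. \<Sum>v\<in>faces (k+1) (cplx n \<omega>). 1 - pdiag k (cplx n \<omega>) v)
        = E n (\<lambda>\<omega>. real (card (faces (k+1) (cplx n \<omega>)))) - E n (Z n)"
        using Bochner_Integration.integral_diff[OF int_E int_E] by simp
      then have "(Ep (gw k c l) ?\<phi> - \<epsilon>) / fact (k+1) < E n (\<lambda>\<omega>. real (card (faces (k+1) (cplx n \<omega>)))) / N n - E n (Z n) / N n"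
        using elim(1) by (simp only: diff_divide_distrib)
      then have "E n (Z n) / N n < 1 / fact (k+1) + \<epsilon> / fact (k+1) - (Ep (gw k c l) ?\<phi> - \<epsilon>) / fact (k+1)"
        using elim(2) by linarith
      also have "\<dots> = (Ep (gw k c l) (val 1 l) + 2 * \<epsilon>) / fact (k+1)" unfolding Ev by (simp add: add_divide_distrib diff_divide_distrib)
      also have "\<dots> \<le> (hk k c + 3 * \<epsilon>) / fact (k+1)" using l unfolding gwE by (intro divide_right_mono) auto
      also have "hk k c + 3 * \<epsilon> = y * fact (k+1)"
      proof -
        have "a + 3 * ((b - a) / 3) = b" for a b :: real by (simp add: diff_divide_distrib right_diff_distrib)
        then show ?thesis unfolding \<epsilon>_def .
      qed
      also have "y * fact (k+1) / fact (k+1) = y" by (rule nonzero_mult_div_cancel_right[OF fact_nonzero])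
      finally show ?case .
    qed
  }
qed

end

section \<open>Convergence in mean\<close>

lemma add_power_le:
  fixes a b :: real
  assumes "0 \<le> a" "0 \<le> b"
  shows "(a + b) ^ m \<le> 2 ^ m * (a ^ m + b ^ m)"
proof -
  have "(a + b) ^ m \<le> (2 * max a b) ^ m" using assms by (intro power_mono) auto
  also have "\<dots> = 2 ^ m * max a b ^ m" by (rule power_mult_distrib)
  also have "\<dots> \<le> 2 ^ m * (a ^ m + b ^ m)" using assms by (intro mult_left_mono) (auto simp: max_def)
  finally show ?thesis .
qed

text \<open>For \<open>t = s powr (q - 1)\<close> the inequality
  \<open>t \<le> 1 / d + d * t\<^sup>2\<close> is multiplied by \<open>s\<close>; its last term
  becomes \<open>s powr (2 * q - 1)\<close>, which an integer power controls. So a small first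
  moment and bounded higher moments give a small \<open>q\<close>-th moment.\<close>

lemma powr_interpolate:
  fixes s d q :: real
  assumes s: "0 \<le> s" and d: "d > 0" and q: "q \<ge> 1" and m: "2 * q - 1 \<le> real m"
  shows "s powr q \<le> s / d + d * (1 + s ^ m)"
proof (cases "s = 0")
  case False
  define t where "t = s powr (q - 1)"
  have t0: "t \<ge> 0" by (simp add: t_def)
  have t: "t \<le> 1 / d + d * t\<^sup>2"
  proof (cases "t \<le> 1 / d")
    case True
    then show ?thesis using d by (simp add: add_increasing2)
  next
    case False
    then have "1 \<le> d * t" using d by (simp add: field_simps)
    then have "1 * t \<le> d * t * t" using t0 by (rule mult_right_mono)
    moreover have "1 / d \<ge> 0" using d by simp
    ultimately show ?thesis by (simp only: power2_eq_square mult.assoc mult_1)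
  qed
  have st: "s * t = s powr q" using s False by (simp add: t_def powr_mult_base)
  have "s * t\<^sup>2 = s powr (2 * q - 1)"
    using s False by (simp add: t_def power2_eq_square powr_add[symmetric] powr_mult_base)
  also have "\<dots> \<le> 1 + s ^ m"
  proof (cases "s \<le> 1")
    case True
    then have "s powr (2 * q - 1) \<le> 1" using s q by (intro powr_le1) auto
    then show ?thesis using s by (simp add: add_increasing2)
  next
    case False
    then have "s powr (2 * q - 1) \<le> s powr real m" using m by (intro powr_mono) auto
    then show ?thesis using False by (simp add: powr_realpow)
  qed
  finally have st2: "d * (s * t\<^sup>2) \<le> d * (1 + s ^ m)" using d by (intro mult_left_mono) auto
  have "s * t \<le> s * (1 / d + d * t\<^sup>2)" using t s by (rule mult_left_mono)
  then show ?thesis using st st2 by (simp add: algebra_simps)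
qed (use d in simp)

section \<open>Concentration and moments of the Betti number\<close>

context sparse_regime
begin

abbreviation "fmean n b \<equiv> face_probs.kap (p n) n b"
abbreviation "fmean_tail n j \<equiv> face_probs.tail (p n) n j"

lemma fmean_eq: "fmean n b = real n ^ b * cube_prod (p n) b 0"
  by (rule face_probs.kap_def[OF fp])

lemma fmean_top: "1 \<le> b \<Longrightarrow> b \<le> k + 2 \<Longrightarrow> filterlim (\<lambda>n. fmean n b) at_top sequentially"
  unfolding fmean_eq by (rule asymptotics(3))

lemma fmean_pos: "\<forall>\<^sub>F n in sequentially. \<forall>b\<in>{..k+2}. fmean n b > 0"
proof (rule eventually_ball_finite)
  show "\<forall>b\<in>{..k+2}. \<forall>\<^sub>F n in sequentially. fmean n b > 0"
  proof
    fix b assume b: "b \<in> {..k+2}"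
    show "\<forall>\<^sub>F n in sequentially. fmean n b > 0"
    proof (cases "b = 0")
      case True
      then show ?thesis by (simp add: face_probs.kap_0[OF fp])
    next
      case False
      then have "filterlim (\<lambda>n. fmean n b) at_top sequentially" using b by (intro fmean_top) auto
      then show ?thesis by (simp only: filterlim_at_top_dense)
    qed
  qed
qed simp

lemma fmean_tail_0:
  assumes "j \<le> k + 2"
  shows "(\<lambda>n. fmean_tail n j) \<longlonglongrightarrow> 0"
proof -
  have "(\<lambda>n. 1 / fmean n b) \<longlonglongrightarrow> 0" if "b \<in> {1..j}" for b
    using that assms by (intro tendsto_divide_0[OF tendsto_const] filterlim_at_top_imp_at_infinity fmean_top) auto
  then have "(\<lambda>n. \<Sum>b\<in>{1..j}. 1 / fmean n b) \<longlonglongrightarrow> (\<Sum>b\<in>{1..j}. 0)" by (rule tendsto_sum)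
  then show ?thesis unfolding face_probs.tail_def[OF fp] by simp
qed

lemma E_mono: "(\<And>\<omega>. f \<omega> \<le> (g \<omega> :: real)) \<Longrightarrow> E n f \<le> E n g"
  by (rule face_probs.F_mono[OF fp])

lemma E_add: "E n (\<lambda>\<omega>. f \<omega> + (g \<omega> :: real)) = E n f + E n g"
  by (rule Bochner_Integration.integral_add[OF int_E int_E])

text \<open>After division by the square of \<open>N n\<close> only multiples of
  \<open>fmean_tail\<close> remain, because \<open>fmean n (k+2)\<close> is \<open>N n\<close> times
  the convergent factor \<open>n * r n\<close>.\<close>

lemma variance_limit:
  "(\<lambda>n. E n (\<lambda>\<omega>. (Z n \<omega> / N n - E n (Z n) / N n)\<^sup>2)) \<longlonglongrightarrow> 0"
proof (rule tendsto_sandwich[where f="\<lambda>_. 0"])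
  let ?b = "\<lambda>n. 2 * (4 ^ (k+1) * fmean_tail n (k+1)) + 2 * (4 ^ (k+2) * (real n * r n)\<^sup>2 * fmean_tail n (k+2))"
  have "?b \<longlonglongrightarrow> 2 * (4 ^ (k+1) * 0) + 2 * (4 ^ (k+2) * c\<^sup>2 * 0)"
    by (intro tendsto_intros fmean_tail_0 r_lim) simp_all
  then show "?b \<longlonglongrightarrow> 0" by simp
  show "\<forall>\<^sub>F n in sequentially. 0 \<le> E n (\<lambda>\<omega>. (Z n \<omega> / N n - E n (Z n) / N n)\<^sup>2)"
    by (intro always_eventually allI integral_nonneg_AE) simp
  show "\<forall>\<^sub>F n in sequentially. E n (\<lambda>\<omega>. (Z n \<omega> / N n - E n (Z n) / N n)\<^sup>2) \<le> ?b n"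
    using fmean_pos N_pos
  proof eventually_elim
    case (elim n)
    define a where "a = N n"
    have a: "a > 0" using elim(2) by (simp only: a_def)
    have k1: "fmean n (k+1) = a" by (simp only: fmean_eq a_def)
    have k2: "fmean n (k+2) = a * (real n * r n)" by (simp add: fmean_eq a_def)
    define m where "m = E n (Z n)"
    have "(Z n \<omega> / a - m / a)\<^sup>2 = ((Z n \<omega>)\<^sup>2 + (- 2 * m) * Z n \<omega> + m\<^sup>2) / a\<^sup>2" for \<omega>
      by (simp add: diff_divide_distrib[symmetric] power_divide power2_eq_square algebra_simps)
    then have "E n (\<lambda>\<omega>. (Z n \<omega> / a - m / a)\<^sup>2) = E n (\<lambda>\<omega>. (Z n \<omega>)\<^sup>2 + (- 2 * m) * Z n \<omega> + m\<^sup>2) / a\<^sup>2"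
      by simp
    also have "E n (\<lambda>\<omega>. (Z n \<omega>)\<^sup>2 + (- 2 * m) * Z n \<omega> + m\<^sup>2) = E n (\<lambda>\<omega>. (Z n \<omega>)\<^sup>2) + (- 2 * m) * m + m\<^sup>2"
      unfolding E_add by (simp add: m_def)
    also have "E n (\<lambda>\<omega>. (Z n \<omega>)\<^sup>2) + (- 2 * m) * m + m\<^sup>2 = E n (\<lambda>\<omega>. (Z n \<omega>)\<^sup>2) - m\<^sup>2" by (simp add: power2_eq_square)
    finally have eq: "E n (\<lambda>\<omega>. (Z n \<omega> / a - m / a)\<^sup>2) = (E n (\<lambda>\<omega>. (Z n \<omega>)\<^sup>2) - m\<^sup>2) / a\<^sup>2" .
    have nv: "E n (\<lambda>\<omega>. (Z n \<omega>)\<^sup>2) - (E n (Z n))\<^sup>2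
      \<le> 2 * (4 ^ (k+1) * (fmean n (k+1))\<^sup>2 * fmean_tail n (k+1)) + 2 * (4 ^ (k+2) * (fmean n (k+2))\<^sup>2 * fmean_tail n (k+2))"
      by (rule face_probs.nullity_variance[OF fp]) (use elim(1) in blast)
    have le: "E n (\<lambda>\<omega>. (Z n \<omega>)\<^sup>2) - m\<^sup>2 \<le> 2 * (4 ^ (k+1) * a\<^sup>2 * fmean_tail n (k+1)) + 2 * (4 ^ (k+2) * (a * (real n * r n))\<^sup>2 * fmean_tail n (k+2))"
      using nv unfolding k1 k2 m_def .
    have "E n (\<lambda>\<omega>. (Z n \<omega> / a - m / a)\<^sup>2)
      \<le> (2 * (4 ^ (k+1) * a\<^sup>2 * fmean_tail n (k+1)) + 2 * (4 ^ (k+2) * (a * (real n * r n))\<^sup>2 * fmean_tail n (k+2))) / a\<^sup>2"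
      unfolding eq by (rule divide_right_mono[OF le]) simp
    also have "\<dots> = a\<^sup>2 * ?b n / a\<^sup>2" unfolding power_mult_distrib by (simp only: distrib_left mult_ac)
    also have "\<dots> = ?b n" using a by simp
    finally show ?case unfolding m_def a_def .
  qed
qed simp

lemma E_abs_le_sqrt: "E n (\<lambda>\<omega>. \<bar>f \<omega>\<bar>) \<le> sqrt (E n (\<lambda>\<omega>. (f \<omega>)\<^sup>2))"
  using Ep_square_le[OF face_probs.finite_field[OF fp], of n, where f="\<lambda>\<omega>. \<bar>f \<omega>\<bar>"] by (intro real_le_rsqrt) simp

text \<open>One more vertex multiplies the order of magnitude by \<open>n * R k\<close>, which
  diverges.\<close>

lemma lower_faces_limit: "(\<lambda>n. E n (\<lambda>\<omega>. real (card (faces k (cplx n \<omega>)))) / N n) \<longlonglongrightarrow> 0"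
proof (rule tendsto_sandwich[where f="\<lambda>_. 0"])
  show "(\<lambda>n. 1 / (real n * cube_prod (p n) k 1)) \<longlonglongrightarrow> 0"
    by (intro tendsto_divide_0[OF tendsto_const] filterlim_at_top_imp_at_infinity asymptotics(1)) simp
  show "\<forall>\<^sub>F n in sequentially. 0 \<le> E n (\<lambda>\<omega>. real (card (faces k (cplx n \<omega>)))) / N n"
    using N_pos by eventually_elim (intro divide_nonneg_pos integral_nonneg_AE, simp_all)
  show "\<forall>\<^sub>F n in sequentially. E n (\<lambda>\<omega>. real (card (faces k (cplx n \<omega>)))) / N n \<le> 1 / (real n * cube_prod (p n) k 1)"
    using fmean_pos N_pos
  proof eventually_elim
    case (elim n)
    have kpos: "fmean n k > 0" using elim(1) by simp
    have N: "N n = fmean n k * (real n * cube_prod (p n) k 1)" by (simp add: fmean_eq)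
    have "n choose k \<le> n ^ k" by (rule face_probs.binomial_le_power[OF fp])
    then have "E n (\<lambda>\<omega>. real (card (faces k (cplx n \<omega>)))) \<le> fmean n k"
      unfolding E_faces fmean_eq using face_probs.cube_prod_01(1)[OF fp]
      by (intro mult_right_mono) (simp_all flip: of_nat_power)
    then have "E n (\<lambda>\<omega>. real (card (faces k (cplx n \<omega>)))) / N n \<le> fmean n k / N n"
      using elim(2) by (intro divide_right_mono) linarith+
    also have "\<dots> = 1 / (real n * cube_prod (p n) k 1)" unfolding N using kpos by simp
    finally show ?case .
  qed
qed simp

abbreviation "h \<equiv> hk k c / fact (k+1)"
abbreviation "Y n \<omega> \<equiv> real (betti k (cplx n \<omega>)) / N n - h"

lemma betti_L1: "(\<lambda>n. E n (\<lambda>\<omega>. \<bar>Y n \<omega>\<bar>)) \<longlonglongrightarrow> 0"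
proof (rule tendsto_sandwich[where f="\<lambda>_. 0"])
  let ?m = "\<lambda>n. E n (Z n) / N n"
  let ?b = "\<lambda>n. sqrt (E n (\<lambda>\<omega>. (Z n \<omega> / N n - ?m n)\<^sup>2)) + \<bar>?m n - h\<bar> + E n (\<lambda>\<omega>. real (card (faces k (cplx n \<omega>)))) / N n"
  have "?b \<longlonglongrightarrow> sqrt 0 + \<bar>h - h\<bar> + 0"
    by (intro tendsto_intros variance_limit nullity_limit lower_faces_limit)
  then show "?b \<longlonglongrightarrow> 0" by simp
  show "\<forall>\<^sub>F n in sequentially. 0 \<le> E n (\<lambda>\<omega>. \<bar>Y n \<omega>\<bar>)"
    by (intro always_eventually allI integral_nonneg_AE) simp
  show "\<forall>\<^sub>F n in sequentially. E n (\<lambda>\<omega>. \<bar>Y n \<omega>\<bar>) \<le> ?b n"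
    using N_pos
  proof eventually_elim
    case (elim n)
    have "\<bar>Y n \<omega>\<bar> \<le> \<bar>Z n \<omega> / N n - ?m n\<bar> + (\<bar>?m n - h\<bar> + real (card (faces k (cplx n \<omega>))) / N n)" for \<omega>
    proof -
      note bb = betti_bounds[OF face_probs.finite_cplx[OF fp], of k n \<omega>]
      have "\<bar>real (betti k (cplx n \<omega>)) - Z n \<omega>\<bar> \<le> real (card (faces k (cplx n \<omega>)))" using bb by linarith
      then have "\<bar>real (betti k (cplx n \<omega>)) - Z n \<omega>\<bar> / N n \<le> real (card (faces k (cplx n \<omega>))) / N n"
        using elim by (intro divide_right_mono) linarith+
      moreover have "\<bar>real (betti k (cplx n \<omega>)) - Z n \<omega>\<bar> / N n = \<bar>real (betti k (cplx n \<omega>)) / N n - Z n \<omega> / N n\<bar>"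
        using elim by (simp only: abs_divide diff_divide_distrib[symmetric] abs_of_pos)
      ultimately show ?thesis by linarith
    qed
    then have "E n (\<lambda>\<omega>. \<bar>Y n \<omega>\<bar>) \<le> E n (\<lambda>\<omega>. \<bar>Z n \<omega> / N n - ?m n\<bar> + (\<bar>?m n - h\<bar> + real (card (faces k (cplx n \<omega>))) / N n))"
      by (rule E_mono)
    also have "\<dots> = E n (\<lambda>\<omega>. \<bar>Z n \<omega> / N n - ?m n\<bar>) + (\<bar>?m n - h\<bar> + E n (\<lambda>\<omega>. real (card (faces k (cplx n \<omega>)))) / N n)"
      unfolding E_add by simp
    also have "\<dots> \<le> ?b n" using E_abs_le_sqrt[of n "\<lambda>\<omega>. Z n \<omega> / N n - ?m n"] by linarith
    finally show ?case .
  qed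
qed simp

text \<open>The Betti number is at most the face count, whose moments are controlled on the scale
  \<open>N n\<close>; once \<open>fmean_tail\<close> is below 1, the factor \<open>1 + tail\<close>
  is at most 2.\<close>

lemma betti_moments: "\<exists>C. \<forall>\<^sub>F n in sequentially. E n (\<lambda>\<omega>. \<bar>Y n \<omega>\<bar> ^ m) \<le> C"
proof -
  let ?C = "2 ^ m * ((2 * 2 ^ ((k+1) * m)) ^ m + \<bar>h\<bar> ^ m)"
  have "\<forall>\<^sub>F n in sequentially. fmean_tail n (k+1) < 1" by (rule order_tendstoD[OF fmean_tail_0]) simp_all
  then have "\<forall>\<^sub>F n in sequentially. E n (\<lambda>\<omega>. \<bar>Y n \<omega>\<bar> ^ m) \<le> ?C"
    using fmean_pos N_pos
  proof eventually_elim
    case (elim n)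
    let ?f = "\<lambda>\<omega>. real (card (faces (k+1) (cplx n \<omega>)))"
    have "\<bar>Y n \<omega>\<bar> ^ m \<le> 2 ^ m * (?f \<omega> ^ m / N n ^ m + \<bar>h\<bar> ^ m)" for \<omega>
    proof -
      note fc = face_probs.finite_cplx[OF fp, of n \<omega>]
      have "real (betti k (cplx n \<omega>)) \<le> ?f \<omega>" using betti_bounds(1)[OF fc, of k] nullity_le_faces[OF fc, of k] by linarith
      then have "real (betti k (cplx n \<omega>)) / N n \<le> ?f \<omega> / N n" using elim(3) by (intro divide_right_mono) linarith+
      moreover have "0 \<le> real (betti k (cplx n \<omega>)) / N n" using elim(3) by (intro divide_nonneg_pos) linarith+
      ultimately have "\<bar>Y n \<omega>\<bar> \<le> ?f \<omega> / N n + \<bar>h\<bar>" by linarith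
      then have "\<bar>Y n \<omega>\<bar> ^ m \<le> (?f \<omega> / N n + \<bar>h\<bar>) ^ m" by (intro power_mono) auto
      also have "\<dots> \<le> 2 ^ m * ((?f \<omega> / N n) ^ m + \<bar>h\<bar> ^ m)"
        using elim(3) by (intro add_power_le divide_nonneg_pos) auto
      finally show ?thesis by (simp only: power_divide)
    qed
    then have "E n (\<lambda>\<omega>. \<bar>Y n \<omega>\<bar> ^ m) \<le> E n (\<lambda>\<omega>. 2 ^ m * (?f \<omega> ^ m / N n ^ m + \<bar>h\<bar> ^ m))" by (rule E_mono)
    also have "\<dots> = 2 ^ m * (E n (\<lambda>\<omega>. ?f \<omega> ^ m) / N n ^ m + \<bar>h\<bar> ^ m)"
      unfolding Bochner_Integration.integral_mult_right_zero E_add by simp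
    finally have *: "E n (\<lambda>\<omega>. \<bar>Y n \<omega>\<bar> ^ m) \<le> 2 ^ m * (E n (\<lambda>\<omega>. ?f \<omega> ^ m) / N n ^ m + \<bar>h\<bar> ^ m)" .
    have "E n (\<lambda>\<omega>. ?f \<omega> ^ m) \<le> (fmean n (k+1) * (1 + fmean_tail n (k+1)) * 2 ^ ((k+1) * m)) ^ m"
      by (rule face_probs.face_moment[OF fp]) (use elim(2) in auto)
    also have "\<dots> \<le> (N n * 2 * 2 ^ ((k+1) * m)) ^ m"
    proof (rule power_mono)
      have t0: "0 \<le> fmean_tail n (k+1)"
        unfolding face_probs.tail_def[OF fp] by (rule sum_nonneg) (use elim(2) in \<open>auto intro: less_imp_le\<close>)
      have kN: "fmean n (k+1) = N n" by (rule fmean_eq)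
      show "fmean n (k+1) * (1 + fmean_tail n (k+1)) * 2 ^ ((k+1) * m) \<le> N n * 2 * 2 ^ ((k+1) * m)"
        unfolding kN using elim(1,3) by (intro mult_right_mono mult_left_mono) auto
      show "0 \<le> fmean n (k+1) * (1 + fmean_tail n (k+1)) * 2 ^ ((k+1) * m)"
        unfolding kN by (intro mult_nonneg_nonneg[OF mult_nonneg_nonneg] less_imp_le[OF elim(3)] add_nonneg_nonneg t0) simp_all
    qed
    finally have "E n (\<lambda>\<omega>. ?f \<omega> ^ m) / N n ^ m \<le> (N n * 2 * 2 ^ ((k+1) * m)) ^ m / N n ^ m"
      by (rule divide_right_mono) (use elim(3) in \<open>intro zero_le_power less_imp_le\<close>)
    also have "\<dots> = (2 * 2 ^ ((k+1) * m)) ^ m"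
    proof -
      have "b * 2 * x / b = 2 * x" if "b > 0" for b x :: real using that by simp
      then show ?thesis unfolding power_divide[symmetric] using elim(3) by (simp only:)
    qed
    finally have "2 ^ m * (E n (\<lambda>\<omega>. ?f \<omega> ^ m) / N n ^ m + \<bar>h\<bar> ^ m) \<le> ?C"
      by (intro mult_left_mono add_right_mono) simp_all
    then show ?case using * by (rule order_trans[rotated])
  qed
  then show ?thesis by blast
qed

lemma betti_Lr:
  assumes q: "q \<ge> 1"
  shows "(\<lambda>n. E n (\<lambda>\<omega>. \<bar>Y n \<omega>\<bar> powr q)) \<longlonglongrightarrow> 0"
proof (rule order_tendstoI)
  show "\<forall>\<^sub>F n in sequentially. a < E n (\<lambda>\<omega>. \<bar>Y n \<omega>\<bar> powr q)" if "a < 0" for a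
  proof (intro always_eventually allI)
    fix n
    have "0 \<le> E n (\<lambda>\<omega>. \<bar>Y n \<omega>\<bar> powr q)" by (rule integral_nonneg_AE) simp
    then show "a < E n (\<lambda>\<omega>. \<bar>Y n \<omega>\<bar> powr q)" using that by linarith
  qed
  fix a :: real assume a: "0 < a"
  obtain m :: nat where m: "2 * q - 1 \<le> real m" using real_arch_simple by blast
  obtain C where C: "\<forall>\<^sub>F n in sequentially. E n (\<lambda>\<omega>. \<bar>Y n \<omega>\<bar> ^ m) \<le> C" using betti_moments by blast
  \<comment> \<open>The moment term then costs half of \<open>a\<close>; the first moment divided by
    the now fixed \<open>d\<close> costs less than the other half for large
    \<open>n\<close>.\<close>
  define d where "d = a / (2 * (1 + \<bar>C\<bar>))"
  have d: "d > 0" using a by (simp add: d_def add_pos_nonneg)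
  have "\<forall>\<^sub>F n in sequentially. E n (\<lambda>\<omega>. \<bar>Y n \<omega>\<bar>) < d * (a / 2)"
    by (rule order_tendstoD[OF betti_L1]) (use a d in simp)
  then show "\<forall>\<^sub>F n in sequentially. E n (\<lambda>\<omega>. \<bar>Y n \<omega>\<bar> powr q) < a"
    using C
  proof eventually_elim
    case (elim n)
    have "E n (\<lambda>\<omega>. \<bar>Y n \<omega>\<bar> powr q) \<le> E n (\<lambda>\<omega>. \<bar>Y n \<omega>\<bar> / d + d * (1 + \<bar>Y n \<omega>\<bar> ^ m))"
      by (intro E_mono powr_interpolate d q m) simp
    also have "\<dots> = E n (\<lambda>\<omega>. \<bar>Y n \<omega>\<bar>) / d + d * (1 + E n (\<lambda>\<omega>. \<bar>Y n \<omega>\<bar> ^ m))"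
      unfolding E_add Bochner_Integration.integral_mult_right_zero by simp
    also have "\<dots> < a / 2 + d * (1 + \<bar>C\<bar>)"
    proof (rule add_less_le_mono)
      show "E n (\<lambda>\<omega>. \<bar>Y n \<omega>\<bar>) / d < a / 2" using elim(1) d by (simp only: pos_divide_less_eq mult.commute)
      show "d * (1 + E n (\<lambda>\<omega>. \<bar>Y n \<omega>\<bar> ^ m)) \<le> d * (1 + \<bar>C\<bar>)" using elim(2) d by (intro mult_left_mono) linarith+
    qed
    also have "d * (1 + \<bar>C\<bar>) = a / 2"
    proof -
      have "1 + \<bar>C\<bar> \<noteq> 0" by linarith
      then show ?thesis unfolding d_def by (simp add: field_simps)
    qed
    finally show ?case by simp
  qed
qed

end

section \<open>Transfer to the given random complexes\<close>

lemma (in face_probs) prob_simplex: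
  assumes "j \<le> n"
  shows "measure_pmf.prob (map_pmf (cplx n) (field n p)) {Z. {1..j} \<in> Z} = Q j"
proof -
  have sub: "{1..j} \<subseteq> {1..n}" using assms by auto
  have "measure_pmf.prob (map_pmf (cplx n) (field n p)) {Z. {1..j} \<in> Z} = measure_pmf.prob (field n p) {\<omega>. \<forall>\<rho>\<in>Pow {1..j}. \<omega> \<rho>}"
    unfolding measure_map_pmf vimage_def cplx_def using sub by (intro arg_cong[where f="measure_pmf.prob _"]) blast
  also have "\<dots> = wt (Pow {1..j})" unfolding F_of_bool[symmetric] using sub by (intro F_open) blast
  also have "\<dots> = Q j" using prod_Pow_s(1)[of "{1..j}"] by (simp add: wt_def)
  finally show ?thesis .
qed

text \<open>For smaller \<open>n\<close> the simplex \<open>{1..k+2}\<close> is not on the vertex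
  set. Positivity of \<open>Q (k+1)\<close> excludes the default value in \<open>rk\<close>.\<close>

lemma (in face_probs) qk_rk:
  assumes "k + 2 \<le> n"
  defines "X \<equiv> map_pmf (cplx n) (field n p)"
  shows "qk k X = Q (k+1)" "Q (k+1) > 0 \<Longrightarrow> rk k X = R (k+1)"
proof -
  show q: "qk k X = Q (k+1)" unfolding qk_def X_def by (rule prob_simplex) (use assms(1) in simp)
  have "measure_pmf.prob X {Z. {1..k+2} \<in> Z \<and> {1..k+1} \<in> Z} = measure_pmf.prob X {Z. {1..k+2} \<in> Z}"
  proof -
    have "{1..k+1} \<in> cplx n \<omega>" if "{1..k+2} \<in> cplx n \<omega>" for \<omega>
    proof -
      have "{1..k+1} \<subseteq> {1..k+2}" by auto
      then show ?thesis using that unfolding cplx_def by blast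
    qed
    then show ?thesis unfolding X_def measure_map_pmf vimage_def
      by (intro arg_cong[where f="measure_pmf.prob _"]) blast
  qed
  also have "\<dots> = Q (k+2)" unfolding X_def by (rule prob_simplex[OF assms(1)])
  also have "\<dots> = Q (k+1) * R (k+1)" by simp
  finally show "rk k X = R (k+1)" if "Q (k+1) > 0" using that unfolding rk_def q by (simp del: cube_prod.simps)
qed

theorem theorem5p1:
  fixes k :: nat and c :: real and X :: "nat \<Rightarrow> nat set set pmf"
  assumes "c > 0"
    and "\<And>n. random_subcomplex n (X n)"
    and "\<And>n. homogeneous n (X n)"
    and "\<And>n. spatially_independent n (X n)"
    and "filterlim (\<lambda>n. real n ^ (k+1) * qk k (X n)) at_top sequentially"
    and "(\<lambda>n. real n * rk k (X n)) \<sim>[sequentially] (\<lambda>n. c)"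
  shows "\<forall>r::real. r \<ge> 1 \<longrightarrow>
    (\<lambda>n. measure_pmf.expectation (X n)
       (\<lambda>Z. \<bar>real (betti k Z) / (real n ^ (k+1) * qk k (X n)) - hk k c / fact (k+1)\<bar> powr r))
    \<longlonglongrightarrow> 0"
proof (intro allI impI)
  fix q :: real assume q: "q \<ge> 1"
  have "\<exists>p. face_probs p \<and> X n = map_pmf (cplx n) (field n p)" for n
    using random_subcomplex_field[OF assms(2-4)] by metis
  then obtain p where p: "\<And>n. face_probs (p n)" "\<And>n. X n = map_pmf (cplx n) (field n (p n))" by metis
  have qk: "\<forall>\<^sub>F n in sequentially. qk k (X n) = cube_prod (p n) (k+1) 0"
    using eventually_ge_at_top[of "k+2"]
  proof eventually_elim
    case (elim n)
    then show ?case unfolding p(2) by (rule face_probs.qk_rk(1)[OF p(1)])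
  qed
  then have "\<forall>\<^sub>F n in sequentially. real n ^ (k+1) * qk k (X n) = real n ^ (k+1) * cube_prod (p n) (k+1) 0"
    by eventually_elim (simp only:)
  from iffD1[OF filterlim_cong[OF refl refl this] assms(5)]
  have N: "filterlim (\<lambda>n. real n ^ (k+1) * cube_prod (p n) (k+1) 0) at_top sequentially" .
  then have "\<forall>\<^sub>F n in sequentially. real n ^ (k+1) * cube_prod (p n) (k+1) 0 > 0" by (simp only: filterlim_at_top_dense)
  then have "\<forall>\<^sub>F n in sequentially. real n * rk k (X n) = real n * cube_prod (p n) (k+1) (Suc 0)"
    using eventually_ge_at_top[of "k+2"]
  proof eventually_elim
    case (elim n)
    have "cube_prod (p n) (k+1) 0 \<ge> 0" by (rule face_probs.cube_prod_01(1)[OF p(1)])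
    moreover have "cube_prod (p n) (k+1) 0 \<noteq> 0" using elim(1) by auto
    ultimately have "rk k (X n) = cube_prod (p n) (k+1) (Suc 0)"
      unfolding p(2) by (intro face_probs.qk_rk(2)[OF p(1) elim(2)]) linarith
    then show ?case by (simp only:)
  qed
  moreover have "(\<lambda>n. real n * rk k (X n)) \<longlonglongrightarrow> c"
    using tendsto_asymp_equiv_cong[OF assms(6)] by simp
  ultimately have r: "(\<lambda>n. real n * cube_prod (p n) (k+1) (Suc 0)) \<longlonglongrightarrow> c"
    by (rule Lim_transform_eventually[rotated])
  interpret sparse_regime p k c
    by (rule sparse_regime.intro) (rule p(1) assms(1) N r)+
  have "\<forall>\<^sub>F n in sequentially. E n (\<lambda>\<omega>. \<bar>Y n \<omega>\<bar> powr q) = measure_pmf.expectation (X n)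
      (\<lambda>Z. \<bar>real (betti k Z) / (real n ^ (k+1) * qk k (X n)) - hk k c / fact (k+1)\<bar> powr q)"
    using qk
  proof eventually_elim
    case (elim n)
    show ?case unfolding elim unfolding p(2) integral_map_pmf ..
  qed
  then show "(\<lambda>n. measure_pmf.expectation (X n)
      (\<lambda>Z. \<bar>real (betti k Z) / (real n ^ (k+1) * qk k (X n)) - hk k c / fact (k+1)\<bar> powr q)) \<longlonglongrightarrow> 0"
    by (rule Lim_transform_eventually[OF betti_Lr[OF q]])
qed

end
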